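(* Let $V:[0,T]\times L^2_\mu(\mathbb{R}^d)\to\mathcal{V}^{\mathrm{as}}(D)$ be continuous in time and satisfy, for constants $C_V,L_V>0$, $$\sup_{t\in[0,T]}\sup_{r\in L^2_\mu(\mathbb{R}^d)}\sup_{x\in\mathbb{R}^d}\int_{\mathbb{R}^d\setminus\{x\}}|V_t[r](x,x')|^2\,d\mu(x')\le C_V$$ and, for all $t\in[0,T]$ and all $g,\tilde g\in L^2_\mu(\mathbb{R}^d)$, $$\sup_{x\in\mathbb{R}^d}\int_{\mathbb{R}^d\setminus\{x\}}|V_t[g](x,x')-V_t[\tilde g](x,x')|^2\,d\mu(x')\le L_V\|g-\tilde g\|^2_{L^2_\mu(\mathbb{R}^d)} .$$ Let $(r,\eta)$ be the solution of the Euler Co-NCL system. Then, for every initial condition $\nu\in\mathcal{P}_2^\mu(\mathbb{R}\times\mathbb{R}^d)$ with disintegration $\nu=\int_{\mathbb{R}^d}\nu_x\,d\mu(x)$, there exists a unique solution $\sigma\in C([0,T],\mathcal{P}_2^\mu(\mathbb{R}\times\mathbb{R}^d))$ of the graph continuity equation with initial condition $\nu$, and it is given by $\sigma_t=\int_{\mathbb{R}^d}\sigma_{t,x}\,d\mu(x)$, where $\sigma_{t,x}=f_x[\sigma,r,\eta](t,\cdot)_\#\nu_x$ for $\mu$-a.e. $x\in\mathbb{R}^d$.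
   Context: Fix $T>0$, $d\ge1$ and a Borel probability measure $\mu$ on $\mathbb{R}^d$ with finite second moment. Let $D:=\{(x,y)\in\mathbb{R}^d\times\mathbb{R}^d: x\ne y\}$; $C_b(D)$ is the space of bounded continuous real functions on $D$ with the supremum norm; $\mathcal{V}^{\mathrm{as}}(D):=\{v:D\to\mathbb{R}: v(x,y)=-v(y,x)\}$. A function $h$ on $D$ is symmetric if $h(x,y)=h(y,x)$. A measurable $\Phi:\mathbb{R}^3\to\mathbb{R}$ is an admissible flux interpolation if: (i) $\Phi(0,0;v)=\Phi(a,b;0)=0$; (ii) for some $L_\Phi>0$ and all real $a,b,c,d,v,w$: $|\Phi(a,b;w)-\Phi(a,b;v)|\le L_\Phi(|a|+|b|)|w-v|$ and $|\Phi(a,b;v)-\Phi(c,d;v)|\le L_\Phi(|a-c|+|b-d|)|v|$; (iii) $\Phi(\alpha a,\alpha b;w)=\alpha\Phi(a,b;w)$ for all $\alpha>0$. It is jointly antisymmetric if $\Phi(a,b;-v)=-\Phi(b,a;v)$. Standing data: $\Phi$ is a jointly antisymmetric admissible flux interpolation; $(r_0,\eta_0)\in L^2_\mu(\mathbb{R}^d)\times C_b(D)$ with $\eta_0$ symmetric; $\omega:[0,T]\times L^2_\mu(\mathbb{R}^d)\times D\to\mathbb{R}$ is such that $\omega_t[r](\cdot,\cdot)$ is continuous and symmetric on $D$, $t\mapsto\omega_t$ is in $L^1([0,T])$, $|\omega_t[r](x,y)-\omega_t[\tilde r](x,y)|\le L_\omega\|r-\tilde r\|_{L^2_\mu}$ and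 $|\omega_t[r](x,y)|\le C_\omega$ uniformly in $t$, $(x,y)$, $r,\tilde r$. Along a curve $t\mapsto r_t$, $V_t[r]$ and $\omega_t[r]$ mean $V_t[r_t]$ and $\omega_t[r_t]$. $V,\omega$ are understood to be measurable so that all integrals make sense. "$V$ continuous in time" means $t\mapsto V_t[r](x,y)$ is continuous. The solution $(r,\eta)$ of the Euler Co-NCL system is the pair $r\in AC([0,T],L^2_\mu(\mathbb{R}^d))$, $\eta\in AC([0,T],C_b(D))$ (absolutely continuous curves), unique under these assumptions, such that for $\mu$-a.e. $x$, all $t\in[0,T]$, all $(x,y)\in D$, $$r_t(x)=r_0(x)-\int_0^t\int_{\mathbb{R}^d\setminus\{x\}}\Phi(r_s(x),r_s(y);V_s[r](x,y))\eta_s(x,y)\,d\mu(y)\,ds,\quad \eta_t(x,y)=\eta_0(x,y)+\int_0^t(\omega_s[r](x,y)-\eta_s(x,y))\,ds,$$ with time-integrable integrands. $\mathcal{P}_2^\mu(\mathbb{R}\times\mathbb{R}^d)$ is the set of Borel probability measures on $\mathbb{R}\times\mathbb{R}^d$ with finite second moment and marginal $\mu$ on $\mathbb{R}^d$. For $\nu$ in it, $\nu=\int\nu_x\,d\mu(x)$ is its disintegration with respect to $\mu$, $\nu_x\in\mathcal{P}(\mathbb{R})$. It carries the (complete) metric $L^2_\mu d_2(\nu^1,\nu^2)=\left(\int_{\mathbb{R}^d}d_2^2(\nu^1_x,\nu^2_x)\,d\mu(x)\right)^{1/2}$, $d_2$ the 2-Wasserstein distance on $\mathbb{R}$; continuity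 of curves is with respect to it. For a curve $\sigma$ put $$\mathcal{X}[\sigma,r,\eta](t,\xi,x):=-\int_{\mathbb{R}\times(\mathbb{R}^d\setminus\{x\})}\Phi(\xi,\xi';V_t[r](x,x'))\eta_t(x,x')\,d\sigma_t(\xi',x').$$ For $\mu$-a.e. $x$, the flow map $f_x[\sigma,r,\eta](t,u)$, $u\in\mathbb{R}$, is the solution of $\frac{d}{dt}f_x(t,u)=\mathcal{X}[\sigma,r,\eta](t,f_x(t,u),x)$, $f_x(0,u)=u$. The graph continuity equation is $\partial_t\sigma+\partial_\xi(\sigma\,\mathcal{X}[\sigma,r,\eta])=0$. A curve $\sigma$ is a solution with initial datum $\sigma_0$ if for every $\varphi\in C_c^1([0,T]\times\mathbb{R}\times\mathbb{R}^d)$ $$\int_0^T\!\!\int\partial_t\varphi\,d\sigma_t\,dt+\int\varphi(0,\cdot)\,d\sigma_0-\int\varphi(T,\cdot)\,d\sigma_T=\int_0^T\!\!\int_{\mathbb{R}\times\mathbb{R}^d}\int_{\mathbb{R}\times(\mathbb{R}^d\setminus\{x\})}\partial_\xi\varphi(t,\xi,x)\,\Phi(\xi,\xi';V_t[r](x,x'))\eta_t(x,x')\,d\sigma_t(\xi',x')\,d\sigma_t(\xi,x)\,dt .$$ *)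

theory Defs
  imports "HOL-Probability.Probability"
begin

text \<open>
  Elements of $L^2_\mu$ are represented by square integrable Borel functions; maps defined on $L^2_\mu$
  must therefore be invariant under \<open>\<mu>\<close>-a.e. equality (this is part of \<open>velocity_field\<close> below; for
  \<open>\<omega>\<close> it follows from the Lipschitz bound).  Functions on the off-diagonal set, and curves
  on $[0,T]$, are total functions of which only the values on these sets are used.
\<close>

definition L2 :: "'a::euclidean_space measure \<Rightarrow> ('a \<Rightarrow> real) set" where
  "L2 \<mu> = {g \<in> borel_measurable borel. integrable \<mu> (\<lambda>x. (g x)\<^sup>2)}"

definition L2_dist :: "'a::euclidean_space measure \<Rightarrow> ('a \<Rightarrow> real) \<Rightarrow> ('a \<Rightarrow> real) \<Rightarrow> real" where
  "L2_dist \<mu> g h = sqrt (LINT x|\<mu>. (g x - h x)\<^sup>2)"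

definition offdiag :: "('a \<times> 'a) set" where
  "offdiag = {(x, y). x \<noteq> y}"

definition Cb_offdiag :: "('a::euclidean_space \<times> 'a \<Rightarrow> real) set" where
  "Cb_offdiag = {h. continuous_on offdiag h \<and> bounded (h ` offdiag)}"

definition Cb_dist :: "('a::euclidean_space \<times> 'a \<Rightarrow> real) \<Rightarrow> ('a \<times> 'a \<Rightarrow> real) \<Rightarrow> real" where
  "Cb_dist h k = (SUP p\<in>offdiag. \<bar>h p - k p\<bar>)"

definition symmetric_offdiag :: "('a \<times> 'a \<Rightarrow> real) \<Rightarrow> bool" where
  "symmetric_offdiag h \<longleftrightarrow> (\<forall>(x, y)\<in>offdiag. h (x, y) = h (y, x))"

definition antisymmetric_offdiag :: "('a \<times> 'a \<Rightarrow> real) \<Rightarrow> bool" where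
  "antisymmetric_offdiag v \<longleftrightarrow> (\<forall>(x, y)\<in>offdiag. v (x, y) = - v (y, x))"

definition cont_curve :: "real \<Rightarrow> 'b set \<Rightarrow> ('b \<Rightarrow> 'b \<Rightarrow> real) \<Rightarrow> (real \<Rightarrow> 'b) \<Rightarrow> bool" where
  "cont_curve T X dst c \<longleftrightarrow>
     (\<forall>t\<in>{0..T}. c t \<in> X) \<and>
     (\<forall>t\<in>{0..T}. ((\<lambda>s. dst (c s) (c t)) \<longlongrightarrow> 0) (at t within {0..T}))"

text \<open>Absolute continuity in the metric sense: the increments are dominated by the integral of some
  $m \in L^1(0,T)$.\<close>

definition ac_curve :: "real \<Rightarrow> 'b set \<Rightarrow> ('b \<Rightarrow> 'b \<Rightarrow> real) \<Rightarrow> (real \<Rightarrow> 'b) \<Rightarrow> bool" where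
  "ac_curve T X dst c \<longleftrightarrow>
     (\<forall>t\<in>{0..T}. c t \<in> X) \<and>
     (\<exists>m. set_integrable lborel {0..T} m \<and>
        (\<forall>s t. 0 \<le> s \<longrightarrow> s \<le> t \<longrightarrow> t \<le> T \<longrightarrow> dst (c s) (c t) \<le> (LINT \<tau>:{s..t}|lborel. m \<tau>)))"

definition admissible_flux :: "(real \<Rightarrow> real \<Rightarrow> real \<Rightarrow> real) \<Rightarrow> bool" where
  "admissible_flux \<Phi> \<longleftrightarrow>
     (\<lambda>(a, b, v). \<Phi> a b v) \<in> borel_measurable borel \<and>
     (\<forall>a b v. \<Phi> 0 0 v = 0 \<and> \<Phi> a b 0 = 0) \<and>
     (\<exists>L>0. \<forall>a b c d v w.
        \<bar>\<Phi> a b w - \<Phi> a b v\<bar> \<le> L * (\<bar>a\<bar> + \<bar>b\<bar>) * \<bar>w - v\<bar> \<and>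
        \<bar>\<Phi> a b v - \<Phi> c d v\<bar> \<le> L * (\<bar>a - c\<bar> + \<bar>b - d\<bar>) * \<bar>v\<bar>) \<and>
     (\<forall>\<alpha> a b w. \<alpha> > 0 \<longrightarrow> \<Phi> (\<alpha> * a) (\<alpha> * b) w = \<alpha> * \<Phi> a b w)"

definition jointly_antisymmetric :: "(real \<Rightarrow> real \<Rightarrow> real \<Rightarrow> real) \<Rightarrow> bool" where
  "jointly_antisymmetric \<Phi> \<longleftrightarrow> (\<forall>a b v. \<Phi> a b (- v) = - \<Phi> b a v)"

text \<open>Measurability of a map on $[0,T] \times L^2_\mu \times D$, in the form in which the integrals
  along curves need it: it follows from joint Borel measurability, by composition with
  $(t,x,y) \mapsto (t, \varrho_t, x, y)$.\<close>

definition measurable_along_curves ::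
  "real \<Rightarrow> 'a::euclidean_space measure \<Rightarrow> (real \<Rightarrow> ('a \<Rightarrow> real) \<Rightarrow> 'a \<times> 'a \<Rightarrow> real) \<Rightarrow> bool" where
  "measurable_along_curves T \<mu> F \<longleftrightarrow>
     (\<forall>\<rho>. cont_curve T (L2 \<mu>) (L2_dist \<mu>) \<rho> \<longrightarrow>
        (\<lambda>(t, p). F t (\<rho> t) p) \<in> borel_measurable (restrict_space borel ({0..T} \<times> offdiag)))"

definition velocity_field ::
  "real \<Rightarrow> 'a::euclidean_space measure \<Rightarrow> (real \<Rightarrow> ('a \<Rightarrow> real) \<Rightarrow> 'a \<times> 'a \<Rightarrow> real) \<Rightarrow> bool" where
  "velocity_field T \<mu> V \<longleftrightarrow>
     (\<forall>t\<in>{0..T}. \<forall>g\<in>L2 \<mu>. antisymmetric_offdiag (V t g)) \<and>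
     (\<forall>t\<in>{0..T}. \<forall>g\<in>L2 \<mu>. \<forall>h\<in>L2 \<mu>. (AE x in \<mu>. g x = h x) \<longrightarrow> (\<forall>p\<in>offdiag. V t g p = V t h p)) \<and>
     measurable_along_curves T \<mu> V"

definition weight_source ::
  "real \<Rightarrow> 'a::euclidean_space measure \<Rightarrow> (real \<Rightarrow> ('a \<Rightarrow> real) \<Rightarrow> 'a \<times> 'a \<Rightarrow> real) \<Rightarrow> bool" where
  "weight_source T \<mu> \<omega> \<longleftrightarrow>
     (\<forall>t\<in>{0..T}. \<forall>g\<in>L2 \<mu>. continuous_on offdiag (\<omega> t g) \<and> symmetric_offdiag (\<omega> t g)) \<and>
     (\<forall>g\<in>L2 \<mu>. \<forall>p\<in>offdiag. set_integrable lborel {0..T} (\<lambda>t. \<omega> t g p)) \<and>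
     (\<exists>L. \<forall>t\<in>{0..T}. \<forall>g\<in>L2 \<mu>. \<forall>h\<in>L2 \<mu>. \<forall>p\<in>offdiag. \<bar>\<omega> t g p - \<omega> t h p\<bar> \<le> L * L2_dist \<mu> g h) \<and>
     (\<exists>C. \<forall>t\<in>{0..T}. \<forall>g\<in>L2 \<mu>. \<forall>p\<in>offdiag. \<bar>\<omega> t g p\<bar> \<le> C) \<and>
     measurable_along_curves T \<mu> \<omega>"

definition co_NCL_flux ::
  "(real \<Rightarrow> real \<Rightarrow> real \<Rightarrow> real) \<Rightarrow> 'a::euclidean_space measure \<Rightarrow>
   (real \<Rightarrow> ('a \<Rightarrow> real) \<Rightarrow> 'a \<times> 'a \<Rightarrow> real) \<Rightarrow> (real \<Rightarrow> 'a \<Rightarrow> real) \<Rightarrow> (real \<Rightarrow> 'a \<times> 'a \<Rightarrow> real) \<Rightarrow>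
   real \<Rightarrow> 'a \<Rightarrow> real" where
  "co_NCL_flux \<Phi> \<mu> V r \<eta> s x =
     (LINT y:- {x}|\<mu>. \<Phi> (r s x) (r s y) (V s (r s) (x, y)) * \<eta> s (x, y))"

definition co_NCL_solution ::
  "real \<Rightarrow> 'a::euclidean_space measure \<Rightarrow> (real \<Rightarrow> real \<Rightarrow> real \<Rightarrow> real) \<Rightarrow>
   (real \<Rightarrow> ('a \<Rightarrow> real) \<Rightarrow> 'a \<times> 'a \<Rightarrow> real) \<Rightarrow> (real \<Rightarrow> ('a \<Rightarrow> real) \<Rightarrow> 'a \<times> 'a \<Rightarrow> real) \<Rightarrow>
   ('a \<Rightarrow> real) \<Rightarrow> ('a \<times> 'a \<Rightarrow> real) \<Rightarrow> (real \<Rightarrow> 'a \<Rightarrow> real) \<Rightarrow> (real \<Rightarrow> 'a \<times> 'a \<Rightarrow> real) \<Rightarrow> bool" where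
  "co_NCL_solution T \<mu> \<Phi> V \<omega> r\<^sub>0 \<eta>\<^sub>0 r \<eta> \<longleftrightarrow>
     ac_curve T (L2 \<mu>) (L2_dist \<mu>) r \<and>
     ac_curve T Cb_offdiag Cb_dist \<eta> \<and>
     (AE x in \<mu>.
        set_integrable lborel {0..T} (\<lambda>s. co_NCL_flux \<Phi> \<mu> V r \<eta> s x) \<and>
        (\<forall>t\<in>{0..T}. r t x = r\<^sub>0 x - (LINT s:{0..t}|lborel. co_NCL_flux \<Phi> \<mu> V r \<eta> s x))) \<and>
     (\<forall>p\<in>offdiag.
        set_integrable lborel {0..T} (\<lambda>s. \<omega> s (r s) p - \<eta> s p) \<and>
        (\<forall>t\<in>{0..T}. \<eta> t p = \<eta>\<^sub>0 p + (LINT s:{0..t}|lborel. (\<omega> s (r s) p - \<eta> s p))))"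

definition P2 :: "'a::euclidean_space measure \<Rightarrow> (real \<times> 'a) measure set" where
  "P2 \<mu> = {\<nu>. prob_space \<nu> \<and> sets \<nu> = sets borel \<and> integrable \<nu> (\<lambda>p. (norm p)\<^sup>2) \<and>
              distr \<nu> borel snd = \<mu>}"

definition is_disintegration ::
  "'a::euclidean_space measure \<Rightarrow> (real \<times> 'a) measure \<Rightarrow> ('a \<Rightarrow> real measure) \<Rightarrow> bool" where
  "is_disintegration \<mu> \<nu> \<kappa> \<longleftrightarrow>
     \<kappa> \<in> borel \<rightarrow>\<^sub>M prob_algebra borel \<and>
     (\<forall>A\<in>sets borel. emeasure \<nu> A = (\<integral>\<^sup>+x. emeasure (\<kappa> x) {\<xi>. (\<xi>, x) \<in> A} \<partial>\<mu>))"

text \<open>Disintegrations with respect to \<open>\<mu>\<close> are unique up to \<open>\<mu>\<close>-null sets, so the choice below does not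
  affect \<open>L2d2\<close>.\<close>

definition disintegration ::
  "'a::euclidean_space measure \<Rightarrow> (real \<times> 'a) measure \<Rightarrow> 'a \<Rightarrow> real measure" where
  "disintegration \<mu> \<nu> = (SOME \<kappa>. is_disintegration \<mu> \<nu> \<kappa>)"

definition couplings :: "real measure \<Rightarrow> real measure \<Rightarrow> (real \<times> real) measure set" where
  "couplings \<alpha> \<beta> = {\<pi>. prob_space \<pi> \<and> sets \<pi> = sets borel \<and>
                       distr \<pi> borel fst = \<alpha> \<and> distr \<pi> borel snd = \<beta>}"

text \<open>The square $d_2^2$ of the 2-Wasserstein distance, possibly infinite.\<close>

definition d2_sq :: "real measure \<Rightarrow> real measure \<Rightarrow> ennreal" where
  "d2_sq \<alpha> \<beta> = (INF \<pi>\<in>couplings \<alpha> \<beta>. \<integral>\<^sup>+(\<xi>, \<zeta>). ennreal ((\<xi> - \<zeta>)\<^sup>2) \<partial>\<pi>)"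

text \<open>On \<open>P2 \<mu>\<close> the integral is finite, so \<open>enn2real\<close> loses nothing there.\<close>

definition L2d2 :: "'a::euclidean_space measure \<Rightarrow> (real \<times> 'a) measure \<Rightarrow> (real \<times> 'a) measure \<Rightarrow> real" where
  "L2d2 \<mu> \<nu>1 \<nu>2 =
     sqrt (enn2real (\<integral>\<^sup>+x. d2_sq (disintegration \<mu> \<nu>1 x) (disintegration \<mu> \<nu>2 x) \<partial>\<mu>))"

text \<open>The field $\mathcal{X}[\sigma,r,\eta](t,\xi,x)$.\<close>

definition graph_velocity ::
  "(real \<Rightarrow> real \<Rightarrow> real \<Rightarrow> real) \<Rightarrow> (real \<Rightarrow> ('a \<Rightarrow> real) \<Rightarrow> 'a \<times> 'a \<Rightarrow> real) \<Rightarrow>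
   (real \<Rightarrow> (real \<times> 'a::euclidean_space) measure) \<Rightarrow> (real \<Rightarrow> 'a \<Rightarrow> real) \<Rightarrow> (real \<Rightarrow> 'a \<times> 'a \<Rightarrow> real) \<Rightarrow>
   real \<Rightarrow> real \<Rightarrow> 'a \<Rightarrow> real" where
  "graph_velocity \<Phi> V \<sigma> r \<eta> t \<xi> x =
     - (LINT q:UNIV \<times> - {x}|\<sigma> t. \<Phi> \<xi> (fst q) (V t (r t) (x, snd q)) * \<eta> t (x, snd q))"

definition ode_solution :: "real \<Rightarrow> (real \<Rightarrow> real \<Rightarrow> real) \<Rightarrow> real \<Rightarrow> (real \<Rightarrow> real) \<Rightarrow> bool" where
  "ode_solution T F u g \<longleftrightarrow>
     g 0 = u \<and> (\<forall>t\<in>{0..T}. (g has_real_derivative F t (g t)) (at t within {0..T}))"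

text \<open>\<open>f t u\<close> is \<^emph>\<open>the\<close> solution started at \<open>u\<close>: uniqueness on $[0,T]$ is part of the definition.\<close>

definition is_flow_map :: "real \<Rightarrow> (real \<Rightarrow> real \<Rightarrow> real) \<Rightarrow> (real \<Rightarrow> real \<Rightarrow> real) \<Rightarrow> bool" where
  "is_flow_map T F f \<longleftrightarrow>
     (\<forall>u. ode_solution T F u (\<lambda>t. f t u) \<and>
          (\<forall>g. ode_solution T F u g \<longrightarrow> (\<forall>t\<in>{0..T}. g t = f t u)))"

text \<open>\<open>\<phi>\<close> is of class $C^1_c$ on $[0,T] \times \mathbb{R} \times \mathbb{R}^d$ with total derivative
  \<open>\<phi>'\<close>, one-sided in time at the end points; \<open>\<phi>\<close> need not vanish at times 0 and \<open>T\<close>.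
  The partial derivatives in \<open>t\<close> and \<open>\<xi>\<close> are the values of \<open>\<phi>'\<close> at \<open>(1, 0, 0)\<close> and \<open>(0, 1, 0)\<close>.\<close>

definition C1c_test ::
  "real \<Rightarrow> (real \<times> real \<times> 'a::euclidean_space \<Rightarrow> real) \<Rightarrow>
   (real \<times> real \<times> 'a \<Rightarrow> (real \<times> real \<times> 'a) \<Rightarrow>\<^sub>L real) \<Rightarrow> bool" where
  "C1c_test T \<phi> \<phi>' \<longleftrightarrow>
     compact (closure {p \<in> {0..T} \<times> UNIV. \<phi> p \<noteq> 0}) \<and>
     (\<forall>p\<in>{0..T} \<times> UNIV. (\<phi> has_derivative blinfun_apply (\<phi>' p)) (at p within {0..T} \<times> UNIV)) \<and>
     continuous_on ({0..T} \<times> UNIV) \<phi>'"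

definition graph_CE_solution ::
  "real \<Rightarrow> (real \<Rightarrow> real \<Rightarrow> real \<Rightarrow> real) \<Rightarrow> (real \<Rightarrow> ('a \<Rightarrow> real) \<Rightarrow> 'a \<times> 'a \<Rightarrow> real) \<Rightarrow>
   (real \<Rightarrow> 'a \<Rightarrow> real) \<Rightarrow> (real \<Rightarrow> 'a \<times> 'a \<Rightarrow> real) \<Rightarrow>
   (real \<times> 'a::euclidean_space) measure \<Rightarrow> (real \<Rightarrow> (real \<times> 'a) measure) \<Rightarrow> bool" where
  "graph_CE_solution T \<Phi> V r \<eta> \<sigma>\<^sub>0 \<sigma> \<longleftrightarrow>
     \<sigma> 0 = \<sigma>\<^sub>0 \<and>
     (\<forall>\<phi> \<phi>'. C1c_test T \<phi> \<phi>' \<longrightarrow>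
        (LINT t:{0..T}|lborel. LINT p|\<sigma> t. blinfun_apply (\<phi>' (t, p)) (1, 0, 0))
          + (LINT p|\<sigma>\<^sub>0. \<phi> (0, p)) - (LINT p|\<sigma> T. \<phi> (T, p))
        = (LINT t:{0..T}|lborel. LINT p|\<sigma> t. (LINT q:UNIV \<times> - {snd p}|\<sigma> t.
             blinfun_apply (\<phi>' (t, p)) (0, 1, 0) *
             \<Phi> (fst p) (fst q) (V t (r t) (snd p, snd q)) * \<eta> t (snd p, snd q))))"

end

theory Submission
  imports Defs
begin

text \<open>
  For fixed \<open>x\<close> the equation is a scalar transport equation whose velocity is Lipschitz in \<open>\<xi>\<close> and depends on
  the curve only through integrals of a kernel that is Lipschitz in \<open>\<xi>'\<close>, with a Lipschitz constant
  \<open>k t x\<close> in $L^2_\mu$.  Picard iteration on characteristics started from $\nu$ gives a flow whose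
  push-forward \<open>\<sigma>\<close> of $\nu$ solves the equation.

  For uniqueness let \<open>\<rho>\<close> be another solution.  Product test functions and a monotone class argument
  give the equation for \<open>\<rho>\<close> tested with every \<open>\<xi>\<close>-primitive of a bounded Borel function, so that no
  regularity in \<open>x\<close> is needed.  A function \<open>\<psi>\<close> at time \<open>t\<close>, carried back along the flow of \<open>\<sigma>\<close> and
  mollified in \<open>\<xi>\<close>, is then an admissible test function; it bounds the difference of the integrals of
  \<open>\<psi>\<close> against \<open>\<rho> t\<close> and \<open>\<sigma> t\<close> by the time integral of the difference of the velocities.  With the
  kernel as \<open>\<psi>\<close> this is a Gronwall inequality for the velocities, so they agree, and then so do the curves.
\<close>

section \<open>Disintegrations and the fibrewise Wasserstein metric\<close>

text \<open>\<open>\<rho>\<close> comes without characteristics of its own; obtaining them would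
  take a superposition principle. Duality avoids this: test functions are carried by the flow of
  \<open>\<sigma>\<close>, which exists by construction, and the two velocities meet only in their
  difference, which is bounded uniformly in \<xi> and x. A transported function is deficient in
  three ways, and each shapes a part of the proof. It is only measurable in x, like the field, so
  the weak equation has to be extended beyond smooth tests. It is only Lipschitz in \<xi>, and its
  derivative may be missing at points charged by \<open>\<rho>\<close>; a one-sided average has the
  difference quotient as its derivative, at the price of a commutator of size \<epsilon> that the
  Lipschitz velocity controls. Finally it is not differentiated in time: increments over a partition
  are summed, with errors quadratic in the step. The Lipschitz constant of the kernel is unbounded
  in x, while test functions have to be bounded; truncation is harmless because the estimate sees
  this constant only through its integral, which is at most C.\<close>

lemma disintegration_kernel:
  assumes "is_disintegration \<mu> N \<kappa>"
  shows "\<kappa> \<in> borel \<rightarrow>\<^sub>M prob_algebra borel" "\<kappa> \<in> borel \<rightarrow>\<^sub>M subprob_algebra borel"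
    "prob_space (\<kappa> x)" "sets (\<kappa> x) = sets borel"
proof -
  show 1: "\<kappa> \<in> borel \<rightarrow>\<^sub>M prob_algebra borel" using assms by (simp add: is_disintegration_def)
  then show "\<kappa> \<in> borel \<rightarrow>\<^sub>M subprob_algebra borel" by (rule measurable_prob_algebraD)
  from measurable_space[OF 1, of x] show "prob_space (\<kappa> x)" "sets (\<kappa> x) = sets borel"
    by (auto simp: space_prob_algebra)
qed

lemma Times_in_borel:
  fixes A :: "'a::second_countable_topology set" and B :: "'b::second_countable_topology set"
  assumes "A \<in> sets borel" "B \<in> sets borel"
  shows "A \<times> B \<in> sets borel"
  using pair_measureI[OF assms] by (simp only: borel_prod)

lemma is_disintegration_bind:
  fixes \<mu> :: "'a::euclidean_space measure"
  assumes k: "\<kappa> \<in> borel \<rightarrow>\<^sub>M prob_algebra borel" and \<mu>: "sets \<mu> = sets borel"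
  defines "N \<equiv> \<mu> \<bind> (\<lambda>x. distr (\<kappa> x) borel (\<lambda>\<xi>. (\<xi>, x)))"
  shows "is_disintegration \<mu> N \<kappa>" "sets N = sets borel"
proof -
  have s: "sets (\<kappa> x) = sets borel" for x
    using measurable_space[OF k, of x] by (auto simp: space_prob_algebra)
  have pm: "(\<lambda>(x::'a, \<xi>::real). (\<xi>, x)) \<in> borel \<Otimes>\<^sub>M borel \<rightarrow>\<^sub>M (borel :: (real \<times> 'a) measure)"
    unfolding borel_prod[symmetric] by measurable
  have "(\<lambda>x. distr (\<kappa> x) borel (\<lambda>\<xi>. (\<xi>, x))) \<in> borel \<rightarrow>\<^sub>M subprob_algebra borel"
    by (rule measurable_distr2[OF _ measurable_prob_algebraD[OF k]]) (use pm in \<open>simp add: case_prod_beta'\<close>)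
  then have K: "(\<lambda>x. distr (\<kappa> x) borel (\<lambda>\<xi>. (\<xi>, x))) \<in> \<mu> \<rightarrow>\<^sub>M subprob_algebra borel"
    using \<mu> by (simp cong: measurable_cong_sets)
  have ne: "space \<mu> \<noteq> {}" using sets_eq_imp_space_eq[OF \<mu>] by simp
  show "sets N = sets borel" unfolding N_def by (rule sets_bind[OF sets_kernel[OF K] ne])
  have "(\<lambda>\<xi>. (\<xi>, x)) \<in> \<kappa> x \<rightarrow>\<^sub>M borel" for x
    using measurable_compose_Pair1[OF _ pm, of x] s[of x] by (simp cong: measurable_cong_sets)
  then have e: "emeasure (distr (\<kappa> x) borel (\<lambda>\<xi>. (\<xi>, x))) A = emeasure (\<kappa> x) {\<xi>. (\<xi>, x) \<in> A}"
    if "A \<in> sets borel" for x A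
    using that sets_eq_imp_space_eq[OF s[of x]] by (subst emeasure_distr) (auto intro!: arg_cong2[where f=emeasure])
  show "is_disintegration \<mu> N \<kappa>"
    unfolding is_disintegration_def N_def
    by (intro conjI ballI k) (subst emeasure_bind[OF ne K]; simp add: e)
qed

text \<open>The defining identity on Borel sets says that the measure is a bind over
  \<open>\<mu>\<close>, which is the form in which integration against kernels is available.\<close>

lemma disintegration_bind:
  fixes \<mu> :: "'a::euclidean_space measure"
  assumes d: "is_disintegration \<mu> N \<kappa>" and N: "sets N = sets borel" and \<mu>: "sets \<mu> = sets borel"
  shows "N = \<mu> \<bind> (\<lambda>x. distr (\<kappa> x) borel (\<lambda>\<xi>. (\<xi>, x)))"
    and "(\<lambda>x. distr (\<kappa> x) borel (\<lambda>\<xi>. (\<xi>, x))) \<in> \<mu> \<rightarrow>\<^sub>M subprob_algebra borel"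
proof -
  note k = disintegration_kernel[OF d]
  have pm: "(\<lambda>(x::'a, \<xi>::real). (\<xi>, x)) \<in> borel \<Otimes>\<^sub>M borel \<rightarrow>\<^sub>M (borel :: (real \<times> 'a) measure)"
    unfolding borel_prod[symmetric] by measurable
  have "(\<lambda>x. distr (\<kappa> x) borel (\<lambda>\<xi>. (\<xi>, x))) \<in> borel \<rightarrow>\<^sub>M subprob_algebra borel"
    by (rule measurable_distr2[OF _ k(2)]) (use pm in \<open>simp add: case_prod_beta'\<close>)
  then show "(\<lambda>x. distr (\<kappa> x) borel (\<lambda>\<xi>. (\<xi>, x))) \<in> \<mu> \<rightarrow>\<^sub>M subprob_algebra borel"
    using \<mu> by (simp cong: measurable_cong_sets)
  note b = is_disintegration_bind[OF k(1) \<mu>]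
  show "N = \<mu> \<bind> (\<lambda>x. distr (\<kappa> x) borel (\<lambda>\<xi>. (\<xi>, x)))"
    by (rule measure_eqI) (use d b N in \<open>auto simp: is_disintegration_def\<close>)
qed

lemma disintegration_nn_integral:
  fixes \<mu> :: "'a::euclidean_space measure"
  assumes d: "is_disintegration \<mu> N \<kappa>" and N: "sets N = sets borel" and \<mu>: "sets \<mu> = sets borel"
    and h: "h \<in> borel_measurable borel"
  shows "(\<integral>\<^sup>+q. h q \<partial>N) = (\<integral>\<^sup>+x. \<integral>\<^sup>+\<xi>. h (\<xi>, x) \<partial>\<kappa> x \<partial>\<mu>)"
    and "(\<lambda>x. \<integral>\<^sup>+\<xi>. h (\<xi>, x) \<partial>\<kappa> x) \<in> borel_measurable borel"
proof -
  note k = disintegration_kernel[OF d]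
  note b = disintegration_bind[OF d N \<mu>]
  have pm: "(\<lambda>(x::'a, \<xi>::real). (\<xi>, x)) \<in> borel \<Otimes>\<^sub>M borel \<rightarrow>\<^sub>M (borel :: (real \<times> 'a) measure)"
    unfolding borel_prod[symmetric] by measurable
  have p1: "(\<lambda>\<xi>. (\<xi>, x)) \<in> \<kappa> x \<rightarrow>\<^sub>M borel" for x
    using measurable_compose_Pair1[OF _ pm, of x] k(4)[of x] by (simp cong: measurable_cong_sets)
  show "(\<integral>\<^sup>+q. h q \<partial>N) = (\<integral>\<^sup>+x. \<integral>\<^sup>+\<xi>. h (\<xi>, x) \<partial>\<kappa> x \<partial>\<mu>)"
    unfolding nn_integral_bind[OF h b(2), folded b(1)]
    by (intro nn_integral_cong) (simp add: nn_integral_distr[OF p1] h)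
  show "(\<lambda>x. \<integral>\<^sup>+\<xi>. h (\<xi>, x) \<partial>\<kappa> x) \<in> borel_measurable borel"
    using nn_integral_measurable_subprob_algebra2[OF _ k(2), of "\<lambda>x \<xi>. h (\<xi>, x)"]
      measurable_compose[OF pm h] by (simp add: case_prod_beta')
qed

text \<open>The positive and negative halves of h go through the nonnegative formula separately;
  finiteness of their total integrals makes the inner integrals finite for \<open>\<mu>\<close>-a.e.
  x only.\<close>

lemma disintegration_integral:
  fixes \<mu> :: "'a::euclidean_space measure" and h :: "real \<times> 'a \<Rightarrow> real"
  assumes d: "is_disintegration \<mu> N \<kappa>" and N: "sets N = sets borel" and \<mu>: "sets \<mu> = sets borel"
    and h: "integrable N h"
  shows "AE x in \<mu>. integrable (\<kappa> x) (\<lambda>\<xi>. h (\<xi>, x))"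
    and "integrable \<mu> (\<lambda>x. \<integral>\<xi>. h (\<xi>, x) \<partial>\<kappa> x)"
    and "(\<integral>q. h q \<partial>N) = (\<integral>x. \<integral>\<xi>. h (\<xi>, x) \<partial>\<kappa> x \<partial>\<mu>)"
proof -
  note k = disintegration_kernel[OF d]
  have hb[measurable]: "h \<in> borel_measurable borel"
    using borel_measurable_integrable[OF h] N by (simp cong: measurable_cong_sets)
  define a where "a x = (\<integral>\<^sup>+\<xi>. ennreal (h (\<xi>, x)) \<partial>\<kappa> x)" for x
  define b where "b x = (\<integral>\<^sup>+\<xi>. ennreal (- h (\<xi>, x)) \<partial>\<kappa> x)" for x
  have A: "(\<integral>\<^sup>+q. ennreal (h q) \<partial>N) = (\<integral>\<^sup>+x. a x \<partial>\<mu>)" and am: "a \<in> borel_measurable \<mu>"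
    unfolding a_def using disintegration_nn_integral[OF d N \<mu>, of "\<lambda>q. ennreal (h q)"] \<mu>
    by (auto cong: measurable_cong_sets)
  have B: "(\<integral>\<^sup>+q. ennreal (- h q) \<partial>N) = (\<integral>\<^sup>+x. b x \<partial>\<mu>)" and bm: "b \<in> borel_measurable \<mu>"
    unfolding b_def using disintegration_nn_integral[OF d N \<mu>, of "\<lambda>q. ennreal (- h q)"] \<mu>
    by (auto cong: measurable_cong_sets)
  from h have fin: "(\<integral>\<^sup>+q. ennreal (h q) \<partial>N) \<noteq> \<infinity>" "(\<integral>\<^sup>+q. ennreal (- h q) \<partial>N) \<noteq> \<infinity>"
    by (auto simp: real_integrable_def)
  have af: "AE x in \<mu>. a x \<noteq> \<infinity>" using nn_integral_PInf_AE[OF am] A fin by simp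
  have bf: "AE x in \<mu>. b x \<noteq> \<infinity>" using nn_integral_PInf_AE[OF bm] B fin by simp
  have hm: "(\<lambda>\<xi>. h (\<xi>, x)) \<in> borel_measurable (\<kappa> x)" for x
  proof -
    have "(\<lambda>\<xi>. h (\<xi>, x)) \<in> borel_measurable borel"
      by (rule measurable_compose[OF _ hb]) (simp add: borel_prod[symmetric])
    then show ?thesis using k(4)[of x] by (simp cong: measurable_cong_sets)
  qed
  show "AE x in \<mu>. integrable (\<kappa> x) (\<lambda>\<xi>. h (\<xi>, x))"
    using af bf by eventually_elim (auto simp: real_integrable_def a_def b_def hm)
  have I: "(\<integral>\<xi>. h (\<xi>, x) \<partial>\<kappa> x) = enn2real (a x) - enn2real (b x)"
    if "a x \<noteq> \<infinity>" "b x \<noteq> \<infinity>" for x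
    using that hm[of x] by (subst real_lebesgue_integral_def) (auto simp: a_def b_def real_integrable_def)
  have Ia: "AE x in \<mu>. (\<integral>\<xi>. h (\<xi>, x) \<partial>\<kappa> x) = enn2real (a x) - enn2real (b x)"
    using af bf by eventually_elim (rule I)
  have an: "(\<integral>\<^sup>+x. ennreal (enn2real (a x)) \<partial>\<mu>) = (\<integral>\<^sup>+x. a x \<partial>\<mu>)"
    by (rule nn_integral_cong_AE) (use af in eventually_elim, auto simp: less_top)
  have bn: "(\<integral>\<^sup>+x. ennreal (enn2real (b x)) \<partial>\<mu>) = (\<integral>\<^sup>+x. b x \<partial>\<mu>)"
    by (rule nn_integral_cong_AE) (use bf in eventually_elim, auto simp: less_top)
  have ai: "integrable \<mu> (\<lambda>x. enn2real (a x))"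
    using am A fin an by (intro integrableI_nonneg) (auto simp: less_top)
  have bi: "integrable \<mu> (\<lambda>x. enn2real (b x))"
    using bm B fin bn by (intro integrableI_nonneg) (auto simp: less_top)
  have Im: "(\<lambda>x. \<integral>\<xi>. h (\<xi>, x) \<partial>\<kappa> x) \<in> borel_measurable \<mu>"
  proof -
    have "(\<lambda>x. enn2real (a x) - enn2real (b x)) \<in> borel_measurable \<mu>" using am bm by measurable
    \<comment> \<open>Where one half is infinite, h is not integrable against
      \<open>\<kappa> x\<close> and the Bochner integral takes its default value 0. The case
      distinction therefore describes the inner integral at every x and gives its
      measurability.\<close>
    moreover have "(\<integral>\<xi>. h (\<xi>, x) \<partial>\<kappa> x) = (if a x \<noteq> \<infinity> \<and> b x \<noteq> \<infinity> then enn2real (a x) - enn2real (b x) else 0)" for x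
      using I[of x] hm[of x] by (auto simp: a_def b_def not_integrable_integral_eq real_integrable_def)
    ultimately show ?thesis using am bm by simp
  qed
  show "integrable \<mu> (\<lambda>x. \<integral>\<xi>. h (\<xi>, x) \<partial>\<kappa> x)"
    using integrable_cong_AE[OF Im _ Ia] ai bi by auto
  have "(\<integral>x. \<integral>\<xi>. h (\<xi>, x) \<partial>\<kappa> x \<partial>\<mu>) = (\<integral>x. enn2real (a x) - enn2real (b x) \<partial>\<mu>)"
    by (rule integral_cong_AE[OF Im _ Ia]) (use am bm in measurable)
  also have "\<dots> = (\<integral>x. enn2real (a x) \<partial>\<mu>) - (\<integral>x. enn2real (b x) \<partial>\<mu>)"
    using ai bi by simp
  also have "\<dots> = enn2real (\<integral>\<^sup>+x. a x \<partial>\<mu>) - enn2real (\<integral>\<^sup>+x. b x \<partial>\<mu>)"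
    by (subst (1 2) integral_eq_nn_integral) (use am bm an bn in auto)
  also have "\<dots> = (\<integral>q. h q \<partial>N)"
    using h by (simp add: real_lebesgue_integral_def A B)
  finally show "(\<integral>q. h q \<partial>N) = (\<integral>x. \<integral>\<xi>. h (\<xi>, x) \<partial>\<kappa> x \<partial>\<mu>)" ..
qed

text \<open>The function g is the Radon-Nikodym derivative, with respect to \<open>\<mu>\<close>, of
  the law of the second coordinate restricted to S. Cutting it at 1 changes it on a null set and
  makes the bounds hold at every x.\<close>

lemma conditional_probability:
  fixes N :: "(real \<times> 'a::euclidean_space) measure"
  assumes "prob_space N" and N: "sets N = sets borel" and \<mu>: "distr N borel snd = \<mu>"
    and S: "S \<in> sets borel"
  shows "\<exists>g\<in>borel_measurable borel. (\<forall>x. 0 \<le> g x \<and> g x \<le> (1::real)) \<and>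
    (\<forall>A\<in>sets borel. (\<integral>x. g x * indicator A x \<partial>\<mu>) = measure N {p. p \<in> S \<and> snd p \<in> A})"
proof -
  interpret N: prob_space N by fact
  have sm: "snd \<in> N \<rightarrow>\<^sub>M borel" using N by (simp cong: measurable_cong_sets add: borel_prod[symmetric])
  have sN: "space N = UNIV" using sets_eq_imp_space_eq[OF N] by simp
  interpret M: prob_space \<mu> unfolding \<mu>[symmetric] by (rule N.prob_space_distr[OF sm])
  have s\<mu>: "sets \<mu> = sets borel" unfolding \<mu>[symmetric] by simp
  have sp\<mu>: "space \<mu> = UNIV" using sets_eq_imp_space_eq[OF s\<mu>] by simp
  define Q where "Q = distr (density N (indicator S)) borel snd"
  have sm': "snd \<in> density N (indicator S) \<rightarrow>\<^sub>M borel" using sm by simp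
  have SN: "S \<in> sets N" using S N by simp
  have Q: "emeasure Q A = emeasure N {p. p \<in> S \<and> snd p \<in> A}" if "A \<in> sets borel" for A
  proof -
    have v: "snd -` A \<in> sets N" using measurable_sets[OF sm that] sN by simp
    have "emeasure Q A = emeasure (density N (indicator S)) (snd -` A)"
      unfolding Q_def using that sm' sN by (subst emeasure_distr) auto
    also have "\<dots> = (\<integral>\<^sup>+p. indicator S p * indicator (snd -` A) p \<partial>N)"
      using SN v by (subst emeasure_density) auto
    also have "\<dots> = (\<integral>\<^sup>+p. indicator (S \<inter> snd -` A) p \<partial>N)"
      by (intro nn_integral_cong) (auto split: split_indicator)
    also have "\<dots> = emeasure N (S \<inter> snd -` A)" using SN v by simp
    also have "S \<inter> snd -` A = {p. p \<in> S \<and> snd p \<in> A}" by auto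
    finally show ?thesis .
  qed
  have Qle: "emeasure Q A \<le> emeasure \<mu> A" if "A \<in> sets borel" for A
  proof -
    have v: "snd -` A \<in> sets N" using measurable_sets[OF sm that] sN by simp
    have "emeasure Q A \<le> emeasure N (snd -` A)" unfolding Q[OF that]
      by (rule emeasure_mono) (use v in auto)
    also have "\<dots> = emeasure \<mu> A" unfolding \<mu>[symmetric] using that sm sN by (subst emeasure_distr) auto
    finally show ?thesis .
  qed
  have sQ: "sets Q = sets \<mu>" unfolding Q_def s\<mu> by simp
  have ac: "absolutely_continuous \<mu> Q"
    unfolding absolutely_continuous_def null_sets_def using Qle sQ s\<mu>
    by (auto simp: le_zero_eq) (metis le_zero_eq)
  define g0 where "g0 = RN_deriv \<mu> Q"
  have g0m: "g0 \<in> borel_measurable \<mu>" unfolding g0_def by simp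
  have dQ: "density \<mu> g0 = Q" unfolding g0_def by (rule M.density_RN_deriv[OF ac sQ])
  have g0: "(\<integral>\<^sup>+x. g0 x * indicator A x \<partial>\<mu>) = emeasure N {p. p \<in> S \<and> snd p \<in> A}" if "A \<in> sets borel" for A
    using emeasure_density[OF g0m, of A] that s\<mu> dQ Q[OF that] by simp
  \<comment> \<open>On the set where the density exceeds 1 the restricted law would be strictly
    larger than \<open>\<mu>\<close>, against \<open>Qle\<close>.\<close>
  have le1: "AE x in \<mu>. g0 x \<le> 1"
  proof (rule ccontr)
    assume n: "\<not> (AE x in \<mu>. g0 x \<le> 1)"
    define A where "A = {x. g0 x > 1}"
    have "{x \<in> space \<mu>. 1 < g0 x} \<in> sets \<mu>" using g0m by measurable
    then have A: "A \<in> sets \<mu>" using sp\<mu> by (simp add: A_def)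
    have "(\<integral>\<^sup>+x. indicator A x \<partial>\<mu>) < (\<integral>\<^sup>+x. g0 x * indicator A x \<partial>\<mu>)"
    proof (rule nn_integral_less)
      show "(\<lambda>x. g0 x * indicator A x) \<in> borel_measurable \<mu>" using g0m A by measurable
      show "(\<integral>\<^sup>+x. indicator A x \<partial>\<mu>) \<noteq> \<infinity>" using A by simp
      show "AE x in \<mu>. indicator A x \<le> g0 x * indicator A x"
        by (auto split: split_indicator simp: A_def less_imp_le)
      show "\<not> (AE x in \<mu>. g0 x * indicator A x \<le> indicator A x)"
      proof
        assume "AE x in \<mu>. g0 x * indicator A x \<le> indicator A x"
        then have "AE x in \<mu>. g0 x \<le> 1"
          by eventually_elim (auto split: split_indicator_asm simp: A_def not_less)
        then show False using n by simp
      qed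
    qed (use A in auto)
    also have "\<dots> = emeasure Q A" using g0 Q A s\<mu> by simp
    also have "\<dots> \<le> emeasure \<mu> A" using Qle A s\<mu> by simp
    also have "\<dots> = (\<integral>\<^sup>+x. indicator A x \<partial>\<mu>)" using A by simp
    finally show False by simp
  qed
  define g where "g x = enn2real (min 1 (g0 x))" for x
  have gm: "g \<in> borel_measurable borel"
    using g0m s\<mu> unfolding g_def by (simp cong: measurable_cong_sets)
  have gb: "0 \<le> g x \<and> g x \<le> 1" for x
    unfolding g_def by (auto intro: enn2real_leI)
  have "(\<integral>x. g x * indicator A x \<partial>\<mu>) = measure N {p. p \<in> S \<and> snd p \<in> A}" if A: "A \<in> sets borel" for A
  proof -
    have "(\<integral>x. g x * indicator A x \<partial>\<mu>) = enn2real (\<integral>\<^sup>+x. ennreal (g x * indicator A x) \<partial>\<mu>)"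
      by (rule integral_eq_nn_integral) (use gm gb A s\<mu> in \<open>auto cong: measurable_cong_sets\<close>)
    also have "(\<integral>\<^sup>+x. ennreal (g x * indicator A x) \<partial>\<mu>) = (\<integral>\<^sup>+x. g0 x * indicator A x \<partial>\<mu>)"
    proof (rule nn_integral_cong_AE)
      have "ennreal (g x) = g0 x" if "g0 x \<le> 1" for x
        using that unfolding g_def by (simp add: min_def le_less_trans[OF that] split: if_splits)
      note * = this
      show "AE x in \<mu>. ennreal (g x * indicator A x) = g0 x * indicator A x"
        using le1 by eventually_elim (auto simp: * split: split_indicator)
    qed
    finally show ?thesis using g0[OF A] by (simp add: measure_def)
  qed
  with gm gb show ?thesis by blast
qed

text \<open>The conditional distribution functions are assembled from their values at rational points.\<close>

lemma right_continuous_extension: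
  fixes G :: "real \<Rightarrow> real"
  assumes mono: "\<And>p q. p \<in> \<rat> \<Longrightarrow> q \<in> \<rat> \<Longrightarrow> p \<le> q \<Longrightarrow> G p \<le> G q"
    and G01: "\<And>q. 0 \<le> G q \<and> G q \<le> 1"
    and top: "(\<lambda>n. G (real n)) \<longlonglongrightarrow> 1" and bot: "(\<lambda>n. G (- real n)) \<longlonglongrightarrow> 0"
  defines "F \<equiv> \<lambda>c. INF q\<in>{q\<in>\<rat>. c < q}. G q"
  shows "\<And>x y. x \<le> y \<Longrightarrow> F x \<le> F y" and "\<And>a. continuous (at_right a) F"
    and "(F \<longlongrightarrow> 0) at_bot" and "(F \<longlongrightarrow> 1) at_top"
    and "\<And>c q. q \<in> \<rat> \<Longrightarrow> c < q \<Longrightarrow> F c \<le> G q" and "\<And>c q. q \<in> \<rat> \<Longrightarrow> q \<le> c \<Longrightarrow> G q \<le> F c"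
proof -
  have bdd: "bdd_below (G ` X)" for X using G01 by (intro bdd_belowI2[where m=0]) auto
  have ne: "{q\<in>\<rat>. c < q} \<noteq> {}" for c :: real using Rats_no_top_le[of "c + 1"] by force
  show upper: "F c \<le> G q" if "q \<in> \<rat>" "c < q" for c q
    unfolding F_def by (rule cINF_lower[OF bdd]) (use that in auto)
  show lower: "G q \<le> F c" if "q \<in> \<rat>" "q \<le> c" for c q
    unfolding F_def by (rule cINF_greatest[OF ne]) (use that in \<open>auto intro: mono\<close>)
  show monoF: "F x \<le> F y" if "x \<le> y" for x y
    unfolding F_def by (rule cINF_superset_mono[OF ne bdd]) (use that in auto)
  have F01: "0 \<le> F c" "F c \<le> 1" for c
  proof -
    show "0 \<le> F c" unfolding F_def by (rule cINF_greatest[OF ne]) (use G01 in auto)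
    obtain q where "q \<in> \<rat>" "c < q" using ne[of c] by auto
    then show "F c \<le> 1" using upper[of q c] G01[of q] by linarith
  qed
  show "continuous (at_right a) F" for a
    unfolding continuous_within
  proof (rule order_tendstoI)
    fix y assume y: "y < F a"
    show "eventually (\<lambda>x. y < F x) (at_right a)"
      using eventually_at_right_less[of a] by eventually_elim (use y monoF in \<open>meson less_imp_le less_le_trans\<close>)
  next
    fix y assume "F a < y"
    then obtain q where q: "q \<in> \<rat>" "a < q" "G q < y"
      unfolding F_def using cINF_less_iff[OF ne bdd, of a] by auto
    have "eventually (\<lambda>x. x < q) (at_right a)" using q(2) by (rule eventually_at_right_real[THEN eventually_mono]) auto
    then show "eventually (\<lambda>x. F x < y) (at_right a)"
      by eventually_elim (use upper q in \<open>meson le_less_trans\<close>)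
  qed
  show "(F \<longlongrightarrow> 0) at_bot"
  proof (rule order_tendstoI)
    fix y :: real assume "y < 0"
    then show "eventually (\<lambda>x. y < F x) at_bot" using F01(1) by (intro always_eventually allI) (meson less_le_trans)
  next
    fix y :: real assume "0 < y"
    then obtain n where n: "G (- real n) < y" using order_tendstoD(2)[OF bot] by (auto simp: eventually_sequentially)
    have "eventually (\<lambda>x. x < - real n) at_bot" by (rule eventually_gt_at_bot)
    then show "eventually (\<lambda>x. F x < y) at_bot"
      by eventually_elim (use upper[of "- real n"] n in \<open>auto intro: le_less_trans\<close>)
  qed
  show "(F \<longlongrightarrow> 1) at_top"
  proof (rule order_tendstoI)
    fix y :: real assume "1 < y"
    then show "eventually (\<lambda>x. F x < y) at_top" using F01(2) by (intro always_eventually allI) (meson le_less_trans)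
  next
    fix y :: real assume "y < 1"
    then obtain n where n: "y < G (real n)" using order_tendstoD(1)[OF top] by (auto simp: eventually_sequentially)
    have "eventually (\<lambda>x. real n \<le> x) at_top" by (rule eventually_ge_at_top)
    then show "eventually (\<lambda>x. y < F x) at_top"
      by eventually_elim (use lower[of "real n"] n in \<open>auto intro: less_le_trans\<close>)
  qed
qed

lemma rational_sequence_above:
  fixes c :: real
  obtains q where "\<And>n. q n \<in> \<rat>" "\<And>n. c < q n" "\<And>n. q n < c + 1 / (Suc n)" "q \<longlonglongrightarrow> c"
proof -
  have "\<exists>q\<in>\<rat>. c < q \<and> q < c + 1 / (Suc n)" for n by (rule Rats_dense_in_real) simp
  then obtain q where q: "\<And>n. q n \<in> \<rat> \<and> c < q n \<and> q n < c + 1 / (Suc n)" by metis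
  have "(\<lambda>n. c + 1 / (Suc n)) \<longlonglongrightarrow> c + 0" by (intro tendsto_intros LIMSEQ_inverse_real_of_nat[unfolded inverse_eq_divide])
  then have "(\<lambda>n. c + 1 / (Suc n)) \<longlonglongrightarrow> c" by simp
  then have "q \<longlonglongrightarrow> c"
    by (rule real_tendsto_sandwich[OF _ _ tendsto_const, rotated 2]) (use q in \<open>auto simp: less_imp_le\<close>)
  then show ?thesis using that q by blast
qed

lemma Int_stable_atMost_times: "Int_stable {{..c::real} \<times> (A::'a::euclidean_space set) | c A. A \<in> sets borel}"
  unfolding Int_stable_def
proof safe
  fix c d :: real and A B :: "'a set" assume "A \<in> sets borel" "B \<in> sets borel"
  then show "\<exists>e C. ({..c} \<times> A) \<inter> ({..d} \<times> B) = {..e} \<times> C \<and> C \<in> sets borel"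
    by (intro exI[of _ "min c d"] exI[of _ "A \<inter> B"]) auto
qed

lemma sigma_sets_atMost_times:
  "sigma_sets UNIV {{..c::real} \<times> (A::'a::euclidean_space set) | c A. A \<in> sets borel} = sets borel"
proof -
  have "sets (borel \<Otimes>\<^sub>M (borel :: 'a measure)) =
     sets (sigma (space borel \<times> space borel) {a \<times> b | a b. a \<in> range (\<lambda>c::real. {..c}) \<and> b \<in> sets (borel :: 'a measure)})"
  proof (rule sets_pair_eq)
    show "sets borel = sigma_sets (space borel) (range (\<lambda>c::real. {..c}))"
      by (subst borel_eq_atMost) (simp add: sigma_le_sets image_comp)
    show "sets (borel :: 'a measure) = sigma_sets (space borel) (sets borel)"
      using sets.sigma_sets_eq[of "borel :: 'a measure"] by simp
    show "countable (range (\<lambda>n::nat. {..real n}))" "countable {UNIV :: 'a set}" by auto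
    show "range (\<lambda>n::nat. {..real n}) \<subseteq> range (\<lambda>c::real. {..c})" "{UNIV :: 'a set} \<subseteq> sets borel" by auto
    show "\<Union> (range (\<lambda>n::nat. {..real n})) = space borel" "\<Union> {UNIV :: 'a set} = space borel"
      using real_arch_simple by auto
  qed (use sets.space_closed in auto)
  moreover have "{a \<times> b | a b. a \<in> range (\<lambda>c::real. {..c}) \<and> b \<in> sets (borel :: 'a measure)} =
     {{..c::real} \<times> (A::'a::euclidean_space set) | c A. A \<in> sets borel}" by auto
  ultimately have "sets (borel :: (real \<times> 'a) measure) = sets (sigma UNIV {{..c::real} \<times> (A::'a::euclidean_space set) | c A. A \<in> sets borel})"
    by (simp only: borel_prod space_borel UNIV_Times_UNIV)
  then show ?thesis by (subst (asm) sets_measure_of) auto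
qed

text \<open>Half-lines times Borel sets are stable under intersection, generate the Borel sets, and
  exhaust the space along integer half-lines.\<close>

lemma measure_eq_atMost_times:
  fixes N N' :: "(real \<times> 'a::euclidean_space) measure"
  assumes "prob_space N" "sets N = sets borel" "sets N' = sets borel"
    and eq: "\<And>c A. A \<in> sets borel \<Longrightarrow> emeasure N ({..c} \<times> A) = emeasure N' ({..c} \<times> A)"
  shows "N = N'"
proof (rule measure_eqI_generator_eq[OF Int_stable_atMost_times, where \<Omega>=UNIV and A="\<lambda>n. {..real n} \<times> UNIV"])
  interpret prob_space N by fact
  show "emeasure N ({..real n} \<times> UNIV) \<noteq> \<infinity>" for n by simp
  show "(\<Union>n. {..real n} \<times> (UNIV::'a set)) = UNIV" using real_arch_simple by auto
  show "range (\<lambda>n. {..real n} \<times> (UNIV::'a set)) \<subseteq> {{..c::real} \<times> (A::'a set) | c A. A \<in> sets borel}"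
    by auto (use sets.top in \<open>metis space_borel\<close>)
qed (use assms in \<open>auto simp: sigma_sets_atMost_times\<close>)

text \<open>Because the fibre coordinate is real, its conditional law can be built from a
  distribution function. The conditional probabilities of half-lines at rational levels are monotone
  with the right limits at both ends outside one null set, and their right-continuous extension
  defines an interval measure.\<close>

lemma exists_disintegration:
  fixes N :: "(real \<times> 'a::euclidean_space) measure"
  assumes "prob_space N" and N: "sets N = sets borel" and \<mu>: "distr N borel snd = \<mu>"
  shows "\<exists>\<kappa>. is_disintegration \<mu> N \<kappa>"
proof -
  interpret N: prob_space N by fact
  have sm: "snd \<in> N \<rightarrow>\<^sub>M borel"
    using N by (simp_all cong: measurable_cong_sets add: borel_prod[symmetric])
  have sN: "space N = UNIV" using sets_eq_imp_space_eq[OF N] by simp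
  interpret M: prob_space \<mu> unfolding \<mu>[symmetric] by (rule N.prob_space_distr[OF sm])
  have s\<mu>[measurable_cong]: "sets \<mu> = sets borel" unfolding \<mu>[symmetric] by simp
  have sp\<mu>: "space \<mu> = UNIV" using sets_eq_imp_space_eq[OF s\<mu>] by simp
  have Sb: "{p :: real \<times> 'a. fst p \<le> q} \<in> sets borel" for q
  proof -
    have "{p :: real \<times> 'a. fst p \<le> q} = {..q} \<times> UNIV" by auto
    then show ?thesis by (simp add: Times_in_borel)
  qed
  obtain G where Gm[measurable]: "\<And>q. G q \<in> borel_measurable borel" and G01: "\<And>q x. 0 \<le> G q x \<and> G q x \<le> (1::real)"
    and G: "\<And>q A. A \<in> sets borel \<Longrightarrow> (\<integral>x. G q x * indicator A x \<partial>\<mu>) = measure N {p. fst p \<le> q \<and> snd p \<in> A}"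
  proof -
    have "\<forall>q. \<exists>g\<in>borel_measurable borel. (\<forall>x. 0 \<le> g x \<and> g x \<le> (1::real)) \<and>
      (\<forall>A\<in>sets borel. (\<integral>x. g x * indicator A x \<partial>\<mu>) = measure N {p. p \<in> {p. fst p \<le> q} \<and> snd p \<in> A})"
      using conditional_probability[OF \<open>prob_space N\<close> N \<mu> Sb] by blast
    then have "\<exists>g. \<forall>q. g q \<in>borel_measurable borel \<and> (\<forall>x. 0 \<le> g q x \<and> g q x \<le> (1::real)) \<and>
      (\<forall>A\<in>sets borel. (\<integral>x. g q x * indicator A x \<partial>\<mu>) = measure N {p. fst p \<le> q \<and> snd p \<in> A})"
      unfolding mem_Collect_eq Bex_def by (rule choice)
    then show ?thesis using that by blast
  qed
  have bi: "integrable \<mu> h" if "h \<in> borel_measurable borel" "\<And>x. 0 \<le> h x \<and> h x \<le> (1::real)" for h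
    by (rule M.integrable_const_bound[where B=1]) (use that in auto)
  have rect: "{p. fst p \<le> q \<and> snd p \<in> A} \<in> sets N" if "A \<in> sets borel" for q and A :: "'a set"
  proof -
    have "{p. fst p \<le> q \<and> snd p \<in> A} = {..q} \<times> A" by auto
    then show ?thesis using that by (simp add: Times_in_borel N)
  qed
  have Gmono: "AE x in \<mu>. G p x \<le> G q x" if "p \<le> q" for p q
  proof -
    define A where "A = {x. G p x > G q x}"
    have A: "A \<in> sets borel" unfolding A_def by measurable
    have i: "integrable \<mu> (\<lambda>x. G r x * indicator A x)" for r
      by (rule bi) (use A G01 in \<open>auto split: split_indicator\<close>)
    have "(\<integral>x. G p x * indicator A x - G q x * indicator A x \<partial>\<mu>) \<le> 0"
      using i G[OF A] that rect[OF A]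
      by (auto intro!: N.finite_measure_mono)
    moreover have nn: "0 \<le> G p x * indicator A x - G q x * indicator A x" for x
      by (auto simp: A_def split: split_indicator)
    ultimately have "(\<integral>x. G p x * indicator A x - G q x * indicator A x \<partial>\<mu>) = 0"
      by (meson Bochner_Integration.integral_nonneg antisym)
    then have "AE x in \<mu>. G p x * indicator A x - G q x * indicator A x = 0"
      using integral_nonneg_eq_0_iff_AE[of \<mu> "\<lambda>x. G p x * indicator A x - G q x * indicator A x"] i nn by auto
    then show ?thesis by eventually_elim (auto simp: A_def split: split_indicator_asm)
  qed
  then have AEmono: "AE x in \<mu>. \<forall>p\<in>\<rat>. \<forall>q\<in>\<rat>. p \<le> q \<longrightarrow> G p x \<le> G q x"
    by (intro AE_ball_countable' countable_rat) (auto intro: AE_I2)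
  have lim: "(\<lambda>n. measure N {p. fst p \<le> q n \<and> snd p \<in> A}) \<longlonglongrightarrow> measure N {p. fst p \<in> L \<and> snd p \<in> A}"
    if A: "A \<in> sets borel" and q: "\<And>y. (\<lambda>n. indicator {..q n} y :: real) \<longlonglongrightarrow> indicator L y" and L: "L \<in> sets borel" for q A L
  proof -
    have rL: "{p. fst p \<in> L \<and> snd p \<in> A} \<in> sets N"
    proof -
      have "{p. fst p \<in> L \<and> snd p \<in> A} = L \<times> A" by auto
      then show ?thesis using A L by (simp add: Times_in_borel N)
    qed
    have "(\<lambda>n. \<integral>p. indicator {p. fst p \<le> q n \<and> snd p \<in> A} p \<partial>N) \<longlonglongrightarrow> (\<integral>p. indicator {p. fst p \<in> L \<and> snd p \<in> A} p \<partial>N :: real)"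
    proof (rule integral_dominated_convergence[where w="\<lambda>_. 1"])
      show "AE p in N. (\<lambda>n. indicator {p. fst p \<le> q n \<and> snd p \<in> A} p :: real) \<longlonglongrightarrow> indicator {p. fst p \<in> L \<and> snd p \<in> A} p"
      proof (rule AE_I2)
        fix p :: "real \<times> 'a"
        show "(\<lambda>n. indicator {p. fst p \<le> q n \<and> snd p \<in> A} p :: real) \<longlonglongrightarrow> indicator {p. fst p \<in> L \<and> snd p \<in> A} p"
          using q[of "fst p"] by (cases "snd p \<in> A") (auto simp: indicator_def)
      qed
    qed (use rect[OF A] rL in auto)
    then show ?thesis using rect[OF A] rL by simp
  qed
  have GUN: "(\<integral>x. G q x \<partial>\<mu>) = measure N {p. fst p \<le> q \<and> snd p \<in> UNIV}" for q
    using G[of UNIV q] by simp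
  have AEtop: "AE x in \<mu>. (\<lambda>n. G (real n) x) \<longlonglongrightarrow> 1"
  proof -
    \<comment> \<open>The limit exists by monotonicity and is at most 1; its integral is the total
      mass 1, so it equals 1 almost everywhere. The lower end is treated in the same way with mass
      0.\<close>
    define L where "L x = lim (\<lambda>n. G (real n) x)" for x
    have Lm: "L \<in> borel_measurable borel" unfolding L_def by measurable
    have conv: "AE x in \<mu>. (\<lambda>n. G (real n) x) \<longlonglongrightarrow> L x"
      using AEmono
    proof eventually_elim
      case (elim x)
      then have "incseq (\<lambda>n. G (real n) x)" by (auto simp: incseq_def)
      then have "convergent (\<lambda>n. G (real n) x)"
        using G01 by (intro Bseq_mono_convergent BseqI'[where K=1]) (auto simp: incseq_def)
      then show ?case unfolding L_def by (simp add: convergent_LIMSEQ_iff)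
    qed
    have L1: "AE x in \<mu>. L x \<le> 1"
      using conv by eventually_elim (rule LIMSEQ_le_const2, use G01 in auto)
    have L0: "AE x in \<mu>. 0 \<le> L x"
      using conv by eventually_elim (rule LIMSEQ_le_const, use G01 in auto)
    have "(\<lambda>n. \<integral>x. G (real n) x \<partial>\<mu>) \<longlonglongrightarrow> (\<integral>x. L x \<partial>\<mu>)"
      by (rule integral_dominated_convergence[where w="\<lambda>_. 1"]) (use Lm conv G01 in auto)
    moreover have "(\<lambda>n. \<integral>x. G (real n) x \<partial>\<mu>) \<longlonglongrightarrow> measure N {p. fst p \<in> UNIV \<and> snd p \<in> UNIV}"
      unfolding GUN
    proof (rule lim)
      fix y :: real
      obtain k where k: "y \<le> real k" using real_arch_simple by blast
      have "eventually (\<lambda>n. indicator {..real n} y = (1::real)) sequentially"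
        using eventually_ge_at_top[of k] by eventually_elim (use k in auto)
      then show "(\<lambda>n. indicator {..real n} y :: real) \<longlonglongrightarrow> indicator UNIV y"
        by (simp add: tendsto_eventually)
    qed auto
    ultimately have "(\<integral>x. L x \<partial>\<mu>) = 1"
      using LIMSEQ_unique N.prob_space sN by fastforce
    moreover have iL: "integrable \<mu> L"
      by (rule M.integrable_const_bound[where B=1]) (use L0 L1 Lm in \<open>auto elim!: AE_mp\<close>)
    ultimately have "(\<integral>x. 1 - L x \<partial>\<mu>) = 0" using M.prob_space by simp
    then have "AE x in \<mu>. 1 - L x = 0"
      by (subst (asm) integral_nonneg_eq_0_iff_AE) (use L1 iL in auto)
    then show ?thesis using conv by eventually_elim simp
  qed
  have AEbot: "AE x in \<mu>. (\<lambda>n. G (- real n) x) \<longlonglongrightarrow> 0"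
  proof -
    define L where "L x = lim (\<lambda>n. G (- real n) x)" for x
    have Lm: "L \<in> borel_measurable borel" unfolding L_def by measurable
    have conv: "AE x in \<mu>. (\<lambda>n. G (- real n) x) \<longlonglongrightarrow> L x"
      using AEmono
    proof eventually_elim
      case (elim x)
      then have "decseq (\<lambda>n. G (- real n) x)" by (auto simp: decseq_def)
      then have "convergent (\<lambda>n. G (- real n) x)"
        using G01 by (intro Bseq_monoseq_convergent BseqI'[where K=1]) (auto simp: monoseq_iff)
      then show ?case unfolding L_def by (simp add: convergent_LIMSEQ_iff)
    qed
    have L1: "AE x in \<mu>. L x \<le> 1"
      using conv by eventually_elim (rule LIMSEQ_le_const2, use G01 in auto)
    have L0: "AE x in \<mu>. 0 \<le> L x"
      using conv by eventually_elim (rule LIMSEQ_le_const, use G01 in auto)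
    have "(\<lambda>n. \<integral>x. G (- real n) x \<partial>\<mu>) \<longlonglongrightarrow> (\<integral>x. L x \<partial>\<mu>)"
      by (rule integral_dominated_convergence[where w="\<lambda>_. 1"]) (use Lm conv G01 in auto)
    moreover have "(\<lambda>n. \<integral>x. G (- real n) x \<partial>\<mu>) \<longlonglongrightarrow> measure N {p. fst p \<in> {} \<and> snd p \<in> UNIV}"
      unfolding GUN
    proof (rule lim)
      fix y :: real
      obtain k where k: "- y < real k" using reals_Archimedean2 by blast
      have "eventually (\<lambda>n. indicator {..- real n} y = (0::real)) sequentially"
        using eventually_ge_at_top[of k] by eventually_elim (use k in auto)
      then show "(\<lambda>n. indicator {..- real n} y :: real) \<longlonglongrightarrow> indicator {} y"
        by (simp add: tendsto_eventually)
    qed auto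
    ultimately have "(\<integral>x. L x \<partial>\<mu>) = 0"
      using LIMSEQ_unique by fastforce
    moreover have iL: "integrable \<mu> L"
      by (rule M.integrable_const_bound[where B=1]) (use L0 L1 Lm in \<open>auto elim!: AE_mp\<close>)
    ultimately have "AE x in \<mu>. L x = 0"
      by (subst (asm) integral_nonneg_eq_0_iff_AE) (use L0 iL in auto)
    then show ?thesis using conv by eventually_elim simp
  qed
  have "AE x in \<mu>. (\<forall>p\<in>\<rat>. \<forall>q\<in>\<rat>. p \<le> q \<longrightarrow> G p x \<le> G q x) \<and> (\<lambda>n. G (real n) x) \<longlonglongrightarrow> 1 \<and> (\<lambda>n. G (- real n) x) \<longlonglongrightarrow> 0"
    using AEmono AEtop AEbot by eventually_elim auto
  then obtain Z where Z: "Z \<in> null_sets \<mu>" and Zg: "\<And>x. x \<notin> Z \<Longrightarrow> (\<forall>p\<in>\<rat>. \<forall>q\<in>\<rat>. p \<le> q \<longrightarrow> G p x \<le> G q x)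
      \<and> (\<lambda>n. G (real n) x) \<longlonglongrightarrow> 1 \<and> (\<lambda>n. G (- real n) x) \<longlonglongrightarrow> 0"
    using sp\<mu> by (elim AE_E3) (metis Diff_iff UNIV_I)
  have Zm: "Z \<in> sets borel" using Z s\<mu> by auto
  define F where "F x c = (INF q\<in>{q\<in>\<rat>. c < q}. G q x)" for x c
  have F: "\<And>a b. a \<le> b \<Longrightarrow> F x a \<le> F x b" "\<And>a. continuous (at_right a) (F x)" "(F x \<longlongrightarrow> 0) at_bot"
      "(F x \<longlongrightarrow> 1) at_top" "\<And>c q. q \<in> \<rat> \<Longrightarrow> c < q \<Longrightarrow> F x c \<le> G q x" "\<And>c q. q \<in> \<rat> \<Longrightarrow> q \<le> c \<Longrightarrow> G q x \<le> F x c"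
    if "x \<notin> Z" for x
    unfolding F_def using right_continuous_extension[of "\<lambda>q. G q x"] Zg[OF that] G01 by auto
  have Fm[measurable]: "(\<lambda>x. F x c) \<in> borel_measurable borel" for c
    unfolding F_def
  proof (rule borel_measurable_cINF)
    show "countable {q \<in> \<rat>. c < q}" using countable_rat by (rule countable_subset[rotated]) auto
    show "bdd_below ((\<lambda>i. G i x) ` {q \<in> \<rat>. c < q})" for x
      using G01 by (intro bdd_belowI2[where m=0]) auto
  qed simp
  \<comment> \<open>On the exceptional null set the Dirac mass at 0 keeps every
    \<open>\<kappa> x\<close> a probability measure.\<close>
  define \<kappa> where "\<kappa> x = (if x \<in> Z then return borel 0 else interval_measure (F x))" for x
  have kp: "prob_space (\<kappa> x)" for x
    using real_distribution_interval_measure[OF F(1-4), of x]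
    by (auto simp: \<kappa>_def real_distribution_def intro!: prob_space_return)
  have ks: "sets (\<kappa> x) = sets borel" for x by (simp add: \<kappa>_def)
  have ke: "emeasure (\<kappa> x) {..c} = (if x \<in> Z then indicator {..c} 0 else ennreal (F x c))" for x c
    by (auto simp: \<kappa>_def emeasure_interval_measure_Iic[OF F(1-3)])
  have k: "\<kappa> \<in> borel \<rightarrow>\<^sub>M prob_algebra borel"
  proof (rule measurable_prob_algebra_generated[where \<Omega>=UNIV and G="range (\<lambda>c::real. {..c})"])
    show "sets borel = sigma_sets UNIV (range (\<lambda>c::real. {..c}))"
      by (subst borel_eq_atMost) simp
    show "Int_stable (range (\<lambda>c::real. {..c}))" by (auto simp: Int_stable_def)
    fix A :: "real set" assume "A \<in> range (\<lambda>c. {..c})"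
    then obtain c where "A = {..c}" by auto
    then show "(\<lambda>x. emeasure (\<kappa> x) A) \<in> borel_measurable borel"
      using Zm by (simp add: ke)
  qed (use kp ks in auto)
  define N' where "N' = \<mu> \<bind> (\<lambda>x. distr (\<kappa> x) borel (\<lambda>\<xi>. (\<xi>, x)))"
  note b = is_disintegration_bind[OF k s\<mu>, folded N'_def]
  have "N = N'"
  proof (rule measure_eq_atMost_times[OF \<open>prob_space N\<close> N b(2)])
    fix c and A :: "'a set" assume A: "A \<in> sets borel"
    obtain q where q: "\<And>n. q n \<in> \<rat>" "\<And>n. c < q n" "\<And>n. q n < c + 1 / (Suc n)" "q \<longlonglongrightarrow> c"
      using rational_sequence_above[of c] by metis
    \<comment> \<open>\<open>F x c\<close> lies below \<open>G (q n) x\<close>, and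
      \<open>q n < c + 1 / Suc n\<close> puts \<open>F x (c + 1 / Suc n)\<close> above it, so right
      continuity of \<open>F x\<close> identifies the limit.\<close>
    have Flim: "(\<lambda>n. G (q n) x) \<longlonglongrightarrow> F x c" if "x \<notin> Z" for x
    proof (rule real_tendsto_sandwich[where f="\<lambda>_. F x c" and h="\<lambda>n. F x (c + 1 / (Suc n))"])
      have "filterlim (\<lambda>n. c + 1 / (Suc n)) (at_right c) sequentially"
        unfolding filterlim_at
      proof (rule conjI[rotated])
        have "(\<lambda>n. c + 1 / (Suc n)) \<longlonglongrightarrow> c + 0" by (intro tendsto_intros LIMSEQ_inverse_real_of_nat[unfolded inverse_eq_divide])
        then show "(\<lambda>n. c + 1 / (Suc n)) \<longlonglongrightarrow> c" by simp
      qed auto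
      then show "(\<lambda>n. F x (c + 1 / (Suc n))) \<longlonglongrightarrow> F x c"
        using F(2)[OF that, of c] unfolding continuous_within by (rule filterlim_compose[rotated])
      show "eventually (\<lambda>n. F x c \<le> G (q n) x) sequentially" using F(5)[OF that] q by auto
      show "eventually (\<lambda>n. G (q n) x \<le> F x (c + 1 / (Suc n))) sequentially"
        using F(6)[OF that q(1)] q(3) by (auto simp: less_imp_le)
    qed simp
    have AEZ: "AE x in \<mu>. x \<notin> Z" using Z by (rule AE_not_in)
    have "(\<lambda>n. \<integral>x. G (q n) x * indicator A x \<partial>\<mu>) \<longlonglongrightarrow> (\<integral>x. F x c * indicator A x \<partial>\<mu>)"
    proof (rule integral_dominated_convergence[where w="\<lambda>_. 1"])
      show "AE x in \<mu>. (\<lambda>n. G (q n) x * indicator A x) \<longlonglongrightarrow> F x c * indicator A x"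
        using AEZ by eventually_elim (intro tendsto_intros Flim)
      show "AE x in \<mu>. norm (G (q n) x * indicator A x) \<le> 1" for n
        using G01 by (auto split: split_indicator)
    qed (use A in auto)
    moreover have "(\<lambda>n. \<integral>x. G (q n) x * indicator A x \<partial>\<mu>) \<longlonglongrightarrow> measure N {p. fst p \<in> {..c} \<and> snd p \<in> A}"
      unfolding G[OF A]
    proof (rule lim[OF A])
      fix y :: real
      show "(\<lambda>n. indicator {..q n} y :: real) \<longlonglongrightarrow> indicator {..c} y"
      proof (cases "y \<le> c")
        case True
        then have "y \<le> q n" for n using q(2)[of n] by simp
        then show ?thesis using True by simp
      next
        case False
        then have "eventually (\<lambda>n. q n < y) sequentially" using order_tendstoD(2)[OF q(4)] by simp
        then have "eventually (\<lambda>n. indicator {..q n} y = (0::real)) sequentially" by eventually_elim auto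
        then show ?thesis using False by (simp add: tendsto_eventually)
      qed
    qed auto
    ultimately have e: "(\<integral>x. F x c * indicator A x \<partial>\<mu>) = measure N {p. fst p \<in> {..c} \<and> snd p \<in> A}"
      by (rule LIMSEQ_unique)
    have F01: "0 \<le> F x c" "F x c \<le> 1" if "x \<notin> Z" for x
      using G01 LIMSEQ_le_const[OF Flim[OF that], of 0] LIMSEQ_le_const2[OF Flim[OF that], of 1] by auto
    have "emeasure N' ({..c} \<times> A) = (\<integral>\<^sup>+x. emeasure (\<kappa> x) {\<xi>. (\<xi>, x) \<in> {..c} \<times> A} \<partial>\<mu>)"
      using b(1) A Times_in_borel[of "{..c}" A] by (simp add: is_disintegration_def)
    also have "\<dots> = (\<integral>\<^sup>+x. ennreal (F x c * indicator A x) \<partial>\<mu>)"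
    proof (rule nn_integral_cong_AE)
      have "emeasure (\<kappa> x) {\<xi>. (\<xi>, x) \<in> {..c} \<times> A} = ennreal (F x c * indicator A x)" if "x \<notin> Z" for x
      proof -
        have "{\<xi>. (\<xi>, x) \<in> {..c} \<times> A} = (if x \<in> A then {..c} else {})" by auto
        then show ?thesis using that by (simp add: ke)
      qed
      then show "AE x in \<mu>. emeasure (\<kappa> x) {\<xi>. (\<xi>, x) \<in> {..c} \<times> A} = ennreal (F x c * indicator A x)"
        using AEZ by auto
    qed
    also have "\<dots> = ennreal (\<integral>x. F x c * indicator A x \<partial>\<mu>)"
    proof (rule nn_integral_eq_integral)
      show "AE x in \<mu>. 0 \<le> F x c * indicator A x" using AEZ by eventually_elim (use F01 in \<open>auto split: split_indicator\<close>)
      show "integrable \<mu> (\<lambda>x. F x c * indicator A x)"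
      proof (rule M.integrable_const_bound[where B=1])
        show "AE x in \<mu>. norm (F x c * indicator A x) \<le> 1"
          using AEZ by eventually_elim (use F01 in \<open>auto split: split_indicator\<close>)
      qed (use A in auto)
    qed
    also have "\<dots> = emeasure N {p. fst p \<in> {..c} \<and> snd p \<in> A}" unfolding e by (simp add: N.emeasure_eq_measure)
    also have "{p. fst p \<in> {..c} \<and> snd p \<in> A} = {..c} \<times> A" by auto
    finally show "emeasure N ({..c} \<times> A) = emeasure N' ({..c} \<times> A)" ..
  qed
  with b show ?thesis by auto
qed

text \<open>For a fixed half-line both fibre masses are densities of one and the same measure, hence
  agree almost everywhere. Countably many rational levels and right continuity of distribution
  functions recover the whole fibre.\<close>

lemma disintegration_unique:
  fixes \<mu> :: "'a::euclidean_space measure"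
  assumes d1: "is_disintegration \<mu> N \<kappa>1" and d2: "is_disintegration \<mu> N \<kappa>2"
    and \<mu>: "prob_space \<mu>" and s\<mu>: "sets \<mu> = sets borel"
  shows "AE x in \<mu>. \<kappa>1 x = \<kappa>2 x"
proof -
  interpret prob_space \<mu> by fact
  note k1 = disintegration_kernel[OF d1] and k2 = disintegration_kernel[OF d2]
  have m: "(\<lambda>x. emeasure (\<kappa> x) {..c}) \<in> borel_measurable \<mu>" if "is_disintegration \<mu> N \<kappa>" for \<kappa> and c :: real
    using measurable_compose[OF disintegration_kernel(2)[OF that] measurable_emeasure_subprob_algebra[of "{..c}"]] s\<mu>
    by (simp cong: measurable_cong_sets)
  have "AE x in \<mu>. emeasure (\<kappa>1 x) {..q} = emeasure (\<kappa>2 x) {..q}" for q :: real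
  proof -
    have e: "(\<integral>\<^sup>+x. emeasure (\<kappa> x) {..q} * indicator A x \<partial>\<mu>) = emeasure N ({..q} \<times> A)"
      if "is_disintegration \<mu> N \<kappa>" "A \<in> sets \<mu>" for \<kappa> A
    proof -
      have "emeasure N ({..q} \<times> A) = (\<integral>\<^sup>+x. emeasure (\<kappa> x) {\<xi>. (\<xi>, x) \<in> {..q} \<times> A} \<partial>\<mu>)"
        using that s\<mu> by (simp add: is_disintegration_def Times_in_borel)
      also have "\<dots> = (\<integral>\<^sup>+x. emeasure (\<kappa> x) {..q} * indicator A x \<partial>\<mu>)"
        by (intro nn_integral_cong) (auto split: split_indicator simp: atMost_def)
      finally show ?thesis ..
    qed
    have "density \<mu> (\<lambda>x. emeasure (\<kappa>1 x) {..q}) = density \<mu> (\<lambda>x. emeasure (\<kappa>2 x) {..q})"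
      by (rule measure_eqI) (simp_all add: emeasure_density m[OF d1] m[OF d2] e[OF d1] e[OF d2])
    then show ?thesis
      by (rule density_unique_iff[OF m[OF d1] m[OF d2], THEN iffD1])
  qed
  then have "AE x in \<mu>. \<forall>q\<in>\<rat>. emeasure (\<kappa>1 x) {..q} = emeasure (\<kappa>2 x) {..q}"
    by (intro AE_ball_countable' countable_rat) auto
  then show ?thesis
  proof eventually_elim
    case (elim x)
    interpret k1: real_distribution "\<kappa>1 x" using k1(3,4)[of x] by (simp add: real_distribution_def real_distribution_axioms_def)
    interpret k2: real_distribution "\<kappa>2 x" using k2(3,4)[of x] by (simp add: real_distribution_def real_distribution_axioms_def)
    show ?case
    proof (rule cdf_unique)
      show "cdf (\<kappa>1 x) = cdf (\<kappa>2 x)"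
      proof
        fix c
        obtain q where q: "\<And>n. q n \<in> \<rat>" "\<And>n. c < q n" "\<And>n. q n < c + 1 / (Suc n)" "q \<longlonglongrightarrow> c"
          using rational_sequence_above[of c] by metis
        have fl: "filterlim q (at_right c) sequentially" unfolding filterlim_at using q(4) less_imp_neq[OF q(2)] q(2) by (auto intro!: always_eventually)
        have "(\<lambda>n. cdf (\<kappa>1 x) (q n)) \<longlonglongrightarrow> cdf (\<kappa>1 x) c"
          using k1.cdf_is_right_cont[of c] unfolding continuous_within by (rule filterlim_compose[OF _ fl])
        moreover have "(\<lambda>n. cdf (\<kappa>2 x) (q n)) \<longlonglongrightarrow> cdf (\<kappa>2 x) c"
          using k2.cdf_is_right_cont[of c] unfolding continuous_within by (rule filterlim_compose[OF _ fl])
        moreover have "cdf (\<kappa>1 x) (q n) = cdf (\<kappa>2 x) (q n)" for n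
          using elim q(1)[of n] by (simp add: cdf_def measure_def)
        ultimately show "cdf (\<kappa>1 x) c = cdf (\<kappa>2 x) c" by (auto intro: LIMSEQ_unique)
      qed
    qed unfold_locales
  qed
qed

section \<open>Moments, duality and push-forward bounds for the fibrewise metric\<close>

lemma fst_borel: "(fst :: 'a::second_countable_topology \<times> 'b::second_countable_topology \<Rightarrow> 'a) \<in> borel \<rightarrow>\<^sub>M borel"
  using measurable_fst[of "borel :: 'a measure" "borel :: 'b measure"] by (simp only: borel_prod)

lemma snd_borel: "(snd :: 'a::second_countable_topology \<times> 'b::second_countable_topology \<Rightarrow> 'b) \<in> borel \<rightarrow>\<^sub>M borel"
  using measurable_snd[of "borel :: 'a measure" "borel :: 'b measure"] by (simp only: borel_prod)

lemma P2D:
  fixes \<mu> :: "'a::euclidean_space measure"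
  assumes "N \<in> P2 \<mu>"
  shows "prob_space N" "sets N = sets borel" "space N = UNIV" "distr N borel snd = \<mu>"
    "integrable N (\<lambda>q. (fst q)\<^sup>2)" "integrable N fst" "fst \<in> N \<rightarrow>\<^sub>M borel" "snd \<in> N \<rightarrow>\<^sub>M borel"
    "\<And>h :: _ \<Rightarrow> real. h \<in> borel_measurable borel \<Longrightarrow> h \<in> borel_measurable N"
proof -
  show 1: "prob_space N" "sets N = sets borel" "distr N borel snd = \<mu>" using assms by (auto simp: P2_def)
  show "space N = UNIV" using sets_eq_imp_space_eq[OF 1(2)] by simp
  show m: "fst \<in> N \<rightarrow>\<^sub>M borel" "snd \<in> N \<rightarrow>\<^sub>M borel"
    using 1(2) by (simp_all cong: measurable_cong_sets add: borel_prod[symmetric])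
  show "\<And>h :: _ \<Rightarrow> real. h \<in> borel_measurable borel \<Longrightarrow> h \<in> borel_measurable N"
    using 1(2) by (simp cong: measurable_cong_sets)
  have i: "integrable N (\<lambda>p. (norm p)\<^sup>2)" using assms by (simp add: P2_def)
  show i2: "integrable N (\<lambda>q. (fst q)\<^sup>2)"
  proof (rule Bochner_Integration.integrable_bound[OF i])
    show "AE q in N. norm ((fst q)\<^sup>2) \<le> norm ((norm q)\<^sup>2)"
    proof (rule AE_I2)
      fix q :: "real \<times> 'a"
      have "\<bar>fst q\<bar>\<^sup>2 \<le> (norm q)\<^sup>2" using norm_fst_le[of "fst q" "snd q"] by (intro power_mono) auto
      then show "norm ((fst q)\<^sup>2) \<le> norm ((norm q)\<^sup>2)" by simp
    qed
  qed (use m in measurable)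
  interpret prob_space N by fact
  show "integrable N fst"
    by (rule square_integrable_imp_integrable[OF m(1) i2])
qed

lemma P2_disintegration:
  fixes \<mu> :: "'a::euclidean_space measure"
  assumes "N \<in> P2 \<mu>"
  shows "is_disintegration \<mu> N (disintegration \<mu> N)"
  unfolding disintegration_def
  using exists_disintegration[OF P2D(1,2,4)[OF assms]] by (rule someI_ex)

lemma P2_disintegration_AE:
  fixes \<mu> :: "'a::euclidean_space measure"
  assumes "N \<in> P2 \<mu>" "is_disintegration \<mu> N \<kappa>" "prob_space \<mu>" "sets \<mu> = sets borel"
  shows "AE x in \<mu>. disintegration \<mu> N x = \<kappa> x"
  by (rule disintegration_unique[OF P2_disintegration]) (use assms in auto)

lemma P2_integral_snd:
  fixes \<mu> :: "'a::euclidean_space measure" and h :: "'a \<Rightarrow> real"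
  assumes "N \<in> P2 \<mu>" "h \<in> borel_measurable borel"
  shows "(\<integral>q. h (snd q) \<partial>N) = (\<integral>x. h x \<partial>\<mu>)" "integrable N (\<lambda>q. h (snd q)) \<longleftrightarrow> integrable \<mu> h"
  using P2D[OF assms(1)] assms(2) integral_distr[of snd N borel h] integrable_distr_eq[of snd N borel h] by auto

lemma nn_integral_power2_le:
  assumes "prob_space M" "f \<in> borel_measurable M"
  shows "(\<integral>\<^sup>+x. f x \<partial>M)\<^sup>2 \<le> (\<integral>\<^sup>+x. (f x)\<^sup>2 \<partial>M)"
  using Cauchy_Schwarz_nn_integral[of f M "\<lambda>_. 1"] assms prob_space.emeasure_space_1[of M] by simp

text \<open>The easy direction of Kantorovich duality: for each coupling the difference of the
  integrals is at most l times the mean distance, and Jensen's inequality passes to the mean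
  square.\<close>

lemma d2_sq_lipschitz:
  fixes g :: "real \<Rightarrow> real"
  assumes g: "g \<in> borel_measurable borel" and l: "l \<ge> 0" and lip: "\<And>\<xi> \<zeta>. \<bar>g \<xi> - g \<zeta>\<bar> \<le> l * \<bar>\<xi> - \<zeta>\<bar>"
    and i: "integrable \<alpha> g" "integrable \<beta> g"
  shows "ennreal (((\<integral>\<xi>. g \<xi> \<partial>\<alpha>) - (\<integral>\<xi>. g \<xi> \<partial>\<beta>))\<^sup>2 / l\<^sup>2) \<le> d2_sq \<alpha> \<beta>"
  unfolding d2_sq_def
proof (rule INF_greatest)
  fix \<pi> assume "\<pi> \<in> couplings \<alpha> \<beta>"
  then have \<pi>: "prob_space \<pi>" "sets \<pi> = sets borel" "distr \<pi> borel fst = \<alpha>" "distr \<pi> borel snd = \<beta>"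
    by (auto simp: couplings_def)
  have m[measurable]: "fst \<in> \<pi> \<rightarrow>\<^sub>M borel" "snd \<in> \<pi> \<rightarrow>\<^sub>M borel"
    using \<pi>(2) by (simp_all cong: measurable_cong_sets add: borel_prod[symmetric])
  note g[measurable]
  show "ennreal (((\<integral>\<xi>. g \<xi> \<partial>\<alpha>) - (\<integral>\<xi>. g \<xi> \<partial>\<beta>))\<^sup>2 / l\<^sup>2) \<le> (\<integral>\<^sup>+(\<xi>, \<zeta>). ennreal ((\<xi> - \<zeta>)\<^sup>2) \<partial>\<pi>)"
  \<comment> \<open>Division by zero yields 0, so only positive l has content.\<close>
  proof (cases "l = 0")
    case False
    have ip: "integrable \<pi> (\<lambda>p. g (fst p))" "integrable \<pi> (\<lambda>p. g (snd p))"
      using i unfolding \<pi>(3,4)[symmetric] by (simp_all add: integrable_distr_eq)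
    have e: "(\<integral>\<xi>. g \<xi> \<partial>\<alpha>) - (\<integral>\<xi>. g \<xi> \<partial>\<beta>) = (\<integral>p. g (fst p) - g (snd p) \<partial>\<pi>)"
      unfolding \<pi>(3,4)[symmetric] using ip by (simp add: integral_distr)
    define D where "D = \<bar>(\<integral>\<xi>. g \<xi> \<partial>\<alpha>) - (\<integral>\<xi>. g \<xi> \<partial>\<beta>)\<bar>"
    have "ennreal D \<le> (\<integral>\<^sup>+p. ennreal \<bar>g (fst p) - g (snd p)\<bar> \<partial>\<pi>)"
      unfolding D_def e using integral_norm_bound_ennreal[of \<pi> "\<lambda>p. g (fst p) - g (snd p)"] ip by auto
    also have "\<dots> \<le> (\<integral>\<^sup>+p. ennreal (l * \<bar>fst p - snd p\<bar>) \<partial>\<pi>)"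
      by (intro nn_integral_mono ennreal_leI lip)
    finally have "(ennreal D)\<^sup>2 \<le> (\<integral>\<^sup>+p. ennreal (l * \<bar>fst p - snd p\<bar>) \<partial>\<pi>)\<^sup>2"
      by (rule power_mono) simp
    also have "\<dots> \<le> (\<integral>\<^sup>+p. (ennreal (l * \<bar>fst p - snd p\<bar>))\<^sup>2 \<partial>\<pi>)"
      by (rule nn_integral_power2_le[OF \<pi>(1)]) measurable
    also have "\<dots> = (\<integral>\<^sup>+p. ennreal (l\<^sup>2) * ennreal ((fst p - snd p)\<^sup>2) \<partial>\<pi>)"
      using l by (intro nn_integral_cong) (simp add: ennreal_power power_mult_distrib flip: ennreal_mult)
    also have "\<dots> = ennreal (l\<^sup>2) * (\<integral>\<^sup>+p. ennreal ((fst p - snd p)\<^sup>2) \<partial>\<pi>)"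
      by (rule nn_integral_cmult) measurable
    finally have le: "ennreal (D\<^sup>2) \<le> ennreal (l\<^sup>2) * (\<integral>\<^sup>+p. ennreal ((fst p - snd p)\<^sup>2) \<partial>\<pi>)"
      by (simp add: ennreal_power D_def)
    have "ennreal (D\<^sup>2 / l\<^sup>2) = ennreal (1 / l\<^sup>2) * ennreal (D\<^sup>2)"
      by (simp flip: ennreal_mult)
    also have "\<dots> \<le> ennreal (1 / l\<^sup>2) * (ennreal (l\<^sup>2) * (\<integral>\<^sup>+p. ennreal ((fst p - snd p)\<^sup>2) \<partial>\<pi>))"
      by (rule mult_left_mono[OF le]) simp
    also have "\<dots> = (\<integral>\<^sup>+p. ennreal ((fst p - snd p)\<^sup>2) \<partial>\<pi>)"
      using False by (simp flip: mult.assoc ennreal_mult)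
    finally show ?thesis by (simp add: D_def case_prod_beta')
  qed simp
qed

text \<open>The product measure is the competitor in the infimum.\<close>

lemma d2_sq_le_moments:
  assumes "prob_space \<alpha>" "sets \<alpha> = sets borel" "prob_space \<beta>" "sets \<beta> = sets borel"
  shows "d2_sq \<alpha> \<beta> \<le> 2 * (\<integral>\<^sup>+\<xi>. ennreal (\<xi>\<^sup>2) \<partial>\<alpha>) + 2 * (\<integral>\<^sup>+\<xi>. ennreal (\<xi>\<^sup>2) \<partial>\<beta>)"
proof -
  interpret a: prob_space \<alpha> by fact
  interpret b: prob_space \<beta> by fact
  interpret ab: pair_prob_space \<alpha> \<beta> ..
  let ?p = "\<alpha> \<Otimes>\<^sub>M \<beta>"
  have s: "sets ?p = sets borel"
    using sets_pair_measure_cong[OF assms(2,4)] by (simp only: borel_prod)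
  have d1: "distr ?p borel fst = \<alpha>"
    using b.distr_pair_fst[of \<alpha>] distr_cong[of ?p ?p borel \<alpha> fst fst] assms(2) by simp
  have "distr ?p \<beta> snd = distr (\<beta> \<Otimes>\<^sub>M \<alpha>) \<beta> (snd \<circ> (\<lambda>(x, y). (y, x)))"
    by (subst ab.distr_pair_swap) (subst distr_distr; simp)
  also have "snd \<circ> (\<lambda>(x, y). (y, x)) = fst" by auto
  finally have d2: "distr ?p borel snd = \<beta>"
    using a.distr_pair_fst[of \<beta>] distr_cong[of ?p ?p borel \<beta> snd snd] assms(4) by simp
  have m: "fst \<in> ?p \<rightarrow>\<^sub>M borel" "snd \<in> ?p \<rightarrow>\<^sub>M borel"
    using s by (simp_all cong: measurable_cong_sets add: borel_prod[symmetric])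
  note m[measurable]
  have "d2_sq \<alpha> \<beta> \<le> (\<integral>\<^sup>+(\<xi>, \<zeta>). ennreal ((\<xi> - \<zeta>)\<^sup>2) \<partial>?p)"
    unfolding d2_sq_def by (rule INF_lower) (use s d1 d2 ab.prob_space_axioms in \<open>auto simp: couplings_def\<close>)
  also have "\<dots> \<le> (\<integral>\<^sup>+p. 2 * ennreal ((fst p)\<^sup>2) + 2 * ennreal ((snd p)\<^sup>2) \<partial>?p)"
  proof (rule nn_integral_mono, clarsimp)
    fix a b :: real
    have "(a - b)\<^sup>2 \<le> 2 * a\<^sup>2 + 2 * b\<^sup>2" using sum_squares_ge_zero[of "a + b" 0] by (simp add: power2_eq_square algebra_simps)
    then have "ennreal ((a - b)\<^sup>2) \<le> ennreal (2 * a\<^sup>2 + 2 * b\<^sup>2)" by (rule ennreal_leI)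
    then show "ennreal ((a - b)\<^sup>2) \<le> 2 * ennreal (a\<^sup>2) + 2 * ennreal (b\<^sup>2)" by (simp add: ennreal_mult ennreal_plus)
  qed
  also have "\<dots> = 2 * (\<integral>\<^sup>+p. ennreal ((fst p)\<^sup>2) \<partial>?p) + 2 * (\<integral>\<^sup>+p. ennreal ((snd p)\<^sup>2) \<partial>?p)"
    by (subst nn_integral_add) (auto simp: nn_integral_cmult)
  also have "(\<integral>\<^sup>+p. ennreal ((fst p)\<^sup>2) \<partial>?p) = (\<integral>\<^sup>+\<xi>. ennreal (\<xi>\<^sup>2) \<partial>\<alpha>)"
    by (subst d1[symmetric], subst nn_integral_distr) auto
  also have "(\<integral>\<^sup>+p. ennreal ((snd p)\<^sup>2) \<partial>?p) = (\<integral>\<^sup>+\<xi>. ennreal (\<xi>\<^sup>2) \<partial>\<beta>)"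
    by (subst (2) d2[symmetric], subst nn_integral_distr) auto
  finally show ?thesis .
qed

text \<open>\<open>L2d2\<close> passes through \<open>enn2real\<close>, which would turn an infinite
  cost into 0; finite second moments exclude this. Only monotonicity of the nonnegative integral is
  applied to the fibre distance as a function of x.\<close>

lemma L2d2_finite:
  fixes \<mu> :: "'a::euclidean_space measure"
  assumes "N1 \<in> P2 \<mu>" "N2 \<in> P2 \<mu>" "sets \<mu> = sets borel"
  shows "(\<integral>\<^sup>+x. d2_sq (disintegration \<mu> N1 x) (disintegration \<mu> N2 x) \<partial>\<mu>) = ennreal ((L2d2 \<mu> N1 N2)\<^sup>2)"
proof -
  note d1 = P2_disintegration[OF assms(1)] and d2 = P2_disintegration[OF assms(2)]
  note k1 = disintegration_kernel[OF d1] and k2 = disintegration_kernel[OF d2]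
  have fm: "(\<lambda>q. ennreal ((fst q)\<^sup>2)) \<in> borel_measurable (borel :: (real \<times> 'a) measure)"
    unfolding borel_prod[symmetric] by measurable
  note n1 = disintegration_nn_integral[OF d1 P2D(2)[OF assms(1)] assms(3) fm]
  note n2 = disintegration_nn_integral[OF d2 P2D(2)[OF assms(2)] assms(3) fm]
  have f1: "(\<integral>\<^sup>+q. ennreal ((fst q)\<^sup>2) \<partial>N1) < \<infinity>" using P2D(5)[OF assms(1)]
    by (simp add: integrable_iff_bounded)
  have f2: "(\<integral>\<^sup>+q. ennreal ((fst q)\<^sup>2) \<partial>N2) < \<infinity>" using P2D(5)[OF assms(2)]
    by (simp add: integrable_iff_bounded)
  have "(\<integral>\<^sup>+x. d2_sq (disintegration \<mu> N1 x) (disintegration \<mu> N2 x) \<partial>\<mu>) \<le>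
     (\<integral>\<^sup>+x. 2 * (\<integral>\<^sup>+\<xi>. ennreal (\<xi>\<^sup>2) \<partial>disintegration \<mu> N1 x) + 2 * (\<integral>\<^sup>+\<xi>. ennreal (\<xi>\<^sup>2) \<partial>disintegration \<mu> N2 x) \<partial>\<mu>)"
    by (intro nn_integral_mono d2_sq_le_moments k1 k2)
  also have "\<dots> = 2 * (\<integral>\<^sup>+q. ennreal ((fst q)\<^sup>2) \<partial>N1) + 2 * (\<integral>\<^sup>+q. ennreal ((fst q)\<^sup>2) \<partial>N2)"
    using n1 n2 assms(3) by (subst nn_integral_add) (auto simp: nn_integral_cmult cong: measurable_cong_sets)
  also have "\<dots> < \<infinity>" using f1 f2 by (simp add: ennreal_mult_less_top)
  finally have "(\<integral>\<^sup>+x. d2_sq (disintegration \<mu> N1 x) (disintegration \<mu> N2 x) \<partial>\<mu>) < \<infinity>" .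
  then show ?thesis by (simp add: L2d2_def)
qed

lemma L2d2_nonneg: "L2d2 \<mu> N1 N2 \<ge> 0"
  by (simp add: L2d2_def)

text \<open>Cauchy-Schwarz in x between the fibrewise Lipschitz constant and the fibrewise distance.
  The constant may depend on x and is controlled only in mean square, which is the situation of the
  kernel with its constant \<open>k t x\<close>.\<close>

lemma L2d2_dual:
  fixes \<mu> :: "'a::euclidean_space measure" and g :: "real \<times> 'a \<Rightarrow> real"
  assumes N: "N1 \<in> P2 \<mu>" "N2 \<in> P2 \<mu>" and s\<mu>: "sets \<mu> = sets borel"
    and g: "g \<in> borel_measurable borel" and l: "l \<in> borel_measurable borel" "\<And>x. l x \<ge> 0"
    and lip: "\<And>\<xi> \<zeta> x. \<bar>g (\<xi>, x) - g (\<zeta>, x)\<bar> \<le> l x * \<bar>\<xi> - \<zeta>\<bar>"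
    and i: "integrable N1 g" "integrable N2 g"
    and c: "(\<integral>\<^sup>+x. ennreal ((l x)\<^sup>2) \<partial>\<mu>) \<le> ennreal (c\<^sup>2)" "c \<ge> 0"
  shows "\<bar>(\<integral>q. g q \<partial>N1) - (\<integral>q. g q \<partial>N2)\<bar> \<le> c * L2d2 \<mu> N1 N2"
proof -
  let ?k1 = "disintegration \<mu> N1" and ?k2 = "disintegration \<mu> N2"
  note d1 = P2_disintegration[OF N(1)] and d2 = P2_disintegration[OF N(2)]
  note k1 = disintegration_kernel[OF d1] and k2 = disintegration_kernel[OF d2]
  note n1 = disintegration_integral[OF d1 P2D(2)[OF N(1)] s\<mu> i(1)]
  note n2 = disintegration_integral[OF d2 P2D(2)[OF N(2)] s\<mu> i(2)]
  define I where "I x = (\<integral>\<xi>. g (\<xi>, x) \<partial>?k1 x) - (\<integral>\<xi>. g (\<xi>, x) \<partial>?k2 x)" for x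
  have I: "integrable \<mu> I" "(\<integral>q. g q \<partial>N1) - (\<integral>q. g q \<partial>N2) = (\<integral>x. I x \<partial>\<mu>)"
    unfolding I_def using n1 n2 by auto
  then have Im[measurable]: "I \<in> borel_measurable \<mu>" by auto
  have lm[measurable]: "l \<in> borel_measurable \<mu>" using l(1) s\<mu> by (simp cong: measurable_cong_sets)
  have gx: "(\<lambda>\<xi>. g (\<xi>, x)) \<in> borel_measurable borel" for x
    by (rule measurable_compose[OF _ g]) (simp add: borel_prod[symmetric])
  have D: "AE x in \<mu>. ennreal ((I x)\<^sup>2 / (l x)\<^sup>2) \<le> d2_sq (?k1 x) (?k2 x)"
    using n1(1) n2(1) by eventually_elim (unfold I_def, rule d2_sq_lipschitz[OF gx], auto intro: l lip)
  \<comment> \<open>Where \<open>l x\<close> vanishes, g is constant in \<xi> and both fibres are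
    probabilities, so \<open>I x = 0\<close> and the quotient by zero does no harm.\<close>
  have Iz: "AE x in \<mu>. ennreal \<bar>I x\<bar> = ennreal (l x) * ennreal (\<bar>I x\<bar> / l x)"
  proof (rule AE_I2)
    fix x
    show "ennreal \<bar>I x\<bar> = ennreal (l x) * ennreal (\<bar>I x\<bar> / l x)"
    proof (cases "l x = 0")
      case True
      have "g (\<xi>, x) = g (0, x)" for \<xi> using lip[of \<xi> x 0] True by simp
      then have c: "(\<lambda>\<xi>. g (\<xi>, x)) = (\<lambda>_. g (0, x))" by (intro ext)
      have "I x = 0" unfolding I_def c
        by (simp add: prob_space.prob_space[OF k1(3)] prob_space.prob_space[OF k2(3)])
      then show ?thesis by simp
    next
      case False
      then show ?thesis using l(2)[of x] by (subst ennreal_mult[symmetric]) auto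
    qed
  qed
  have "ennreal \<bar>\<integral>x. I x \<partial>\<mu>\<bar> \<le> (\<integral>\<^sup>+x. ennreal \<bar>I x\<bar> \<partial>\<mu>)"
    using integral_norm_bound_ennreal[OF I(1)] by simp
  also have "\<dots> = (\<integral>\<^sup>+x. ennreal (l x) * ennreal (\<bar>I x\<bar> / l x) \<partial>\<mu>)"
    by (rule nn_integral_cong_AE[OF Iz])
  finally have "(ennreal \<bar>\<integral>x. I x \<partial>\<mu>\<bar>)\<^sup>2 \<le> (\<integral>\<^sup>+x. ennreal (l x) * ennreal (\<bar>I x\<bar> / l x) \<partial>\<mu>)\<^sup>2"
    by (rule power_mono) simp
  also have "\<dots> \<le> (\<integral>\<^sup>+x. (ennreal (l x))\<^sup>2 \<partial>\<mu>) * (\<integral>\<^sup>+x. (ennreal (\<bar>I x\<bar> / l x))\<^sup>2 \<partial>\<mu>)"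
    by (rule Cauchy_Schwarz_nn_integral) measurable
  also have "(\<integral>\<^sup>+x. (ennreal (l x))\<^sup>2 \<partial>\<mu>) = (\<integral>\<^sup>+x. ennreal ((l x)\<^sup>2) \<partial>\<mu>)"
    using l(2) by (simp add: ennreal_power)
  also have "(\<integral>\<^sup>+x. (ennreal (\<bar>I x\<bar> / l x))\<^sup>2 \<partial>\<mu>) = (\<integral>\<^sup>+x. ennreal ((I x)\<^sup>2 / (l x)\<^sup>2) \<partial>\<mu>)"
    using l(2) by (simp add: ennreal_power power_divide)
  also have "(\<integral>\<^sup>+x. ennreal ((l x)\<^sup>2) \<partial>\<mu>) * (\<integral>\<^sup>+x. ennreal ((I x)\<^sup>2 / (l x)\<^sup>2) \<partial>\<mu>) \<le>
      ennreal (c\<^sup>2) * (\<integral>\<^sup>+x. d2_sq (?k1 x) (?k2 x) \<partial>\<mu>)"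
    by (intro mult_mono c nn_integral_mono_AE D) auto
  also have "\<dots> = ennreal ((c * L2d2 \<mu> N1 N2)\<^sup>2)"
    by (simp add: L2d2_finite[OF N s\<mu>] power_mult_distrib flip: ennreal_mult)
  finally have "\<bar>\<integral>x. I x \<partial>\<mu>\<bar>\<^sup>2 \<le> (c * L2d2 \<mu> N1 N2)\<^sup>2"
    by (simp add: ennreal_power)
  then show ?thesis unfolding I(2)
    by (rule power2_le_imp_le) (intro mult_nonneg_nonneg c L2d2_nonneg)
qed

text \<open>Only the real coordinate moves, so the map acts inside each fibre.\<close>

lemma disintegration_push:
  fixes \<mu> :: "'a::euclidean_space measure" and f :: "real \<times> 'a \<Rightarrow> real"
  assumes d: "is_disintegration \<mu> \<nu> \<nu>x" and \<nu>: "sets \<nu> = sets borel"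
    and f: "f \<in> borel_measurable borel"
  shows "is_disintegration \<mu> (distr \<nu> borel (\<lambda>q. (f q, snd q))) (\<lambda>x. distr (\<nu>x x) borel (\<lambda>u. f (u, x)))"
  unfolding is_disintegration_def
proof (intro conjI ballI)
  note k = disintegration_kernel[OF d]
  have pm: "(\<lambda>(x::'a, \<xi>::real). (\<xi>, x)) \<in> borel \<Otimes>\<^sub>M borel \<rightarrow>\<^sub>M (borel :: (real \<times> 'a) measure)"
    unfolding borel_prod[symmetric] by measurable
  show "(\<lambda>x. distr (\<nu>x x) borel (\<lambda>u. f (u, x))) \<in> borel \<rightarrow>\<^sub>M prob_algebra borel"
    by (rule measurable_distr_prob_space2[OF k(1)])
      (use measurable_compose[OF pm f] in \<open>simp add: case_prod_beta'\<close>)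
  have fm: "(\<lambda>q. (f q, snd q)) \<in> \<nu> \<rightarrow>\<^sub>M borel"
    using f \<nu> unfolding borel_prod[symmetric] by (simp cong: measurable_cong_sets add: borel_prod)
  fix A :: "(real \<times> 'a) set" assume A: "A \<in> sets borel"
  have fA: "(\<lambda>q. (f q, snd q)) -` A \<in> sets borel"
    using measurable_sets[OF fm A] \<nu> sets_eq_imp_space_eq[OF \<nu>] by simp
  have fx: "(\<lambda>u. f (u, x)) \<in> borel_measurable (\<nu>x x)" for x
  proof -
    have "(\<lambda>u. f (u, x)) \<in> borel_measurable borel"
      by (rule measurable_compose[OF _ f]) (simp add: borel_prod[symmetric])
    then show ?thesis using k(4)[of x] by (simp cong: measurable_cong_sets)
  qed
  have Ax: "{\<xi>. (\<xi>, x) \<in> A} \<in> sets borel" for x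
  proof -
    have "(\<lambda>\<xi>::real. (\<xi>, x)) \<in> borel \<rightarrow>\<^sub>M borel" by (simp add: borel_prod[symmetric])
    from measurable_sets[OF this A] show ?thesis by (simp add: vimage_def)
  qed
  have "emeasure (distr \<nu> borel (\<lambda>q. (f q, snd q))) A = emeasure \<nu> ((\<lambda>q. (f q, snd q)) -` A)"
    using A fm sets_eq_imp_space_eq[OF \<nu>] by (subst emeasure_distr) auto
  also have "\<dots> = (\<integral>\<^sup>+x. emeasure (\<nu>x x) {\<xi>. (\<xi>, x) \<in> (\<lambda>q. (f q, snd q)) -` A} \<partial>\<mu>)"
    using d fA by (simp add: is_disintegration_def)
  also have "\<dots> = (\<integral>\<^sup>+x. emeasure (distr (\<nu>x x) borel (\<lambda>u. f (u, x))) {\<xi>. (\<xi>, x) \<in> A} \<partial>\<mu>)"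
    using Ax fx sets_eq_imp_space_eq[OF k(4)] by (intro nn_integral_cong) (simp add: emeasure_distr vimage_def)
  finally show "emeasure (distr \<nu> borel (\<lambda>q. (f q, snd q))) A =
      (\<integral>\<^sup>+x. emeasure (distr (\<nu>x x) borel (\<lambda>u. f (u, x))) {\<xi>. (\<xi>, x) \<in> A} \<partial>\<mu>)" .
qed

lemma P2_push:
  fixes \<mu> :: "'a::euclidean_space measure" and f :: "real \<times> 'a \<Rightarrow> real"
  assumes \<nu>: "\<nu> \<in> P2 \<mu>" and f: "f \<in> borel_measurable borel" and i: "integrable \<nu> (\<lambda>q. (f q)\<^sup>2)"
    and \<mu>2: "integrable \<mu> (\<lambda>x. (norm x)\<^sup>2)"
  shows "distr \<nu> borel (\<lambda>q. (f q, snd q)) \<in> P2 \<mu>"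
proof -
  note n = P2D[OF \<nu>]
  interpret prob_space \<nu> by fact
  have fm: "(\<lambda>q. (f q, snd q)) \<in> \<nu> \<rightarrow>\<^sub>M borel"
    using f n(2) unfolding borel_prod[symmetric] by (simp cong: measurable_cong_sets add: borel_prod)
  have "integrable \<nu> (\<lambda>q. (norm (snd q))\<^sup>2)"
    using P2_integral_snd(2)[OF \<nu>, of "\<lambda>x. (norm x)\<^sup>2"] \<mu>2 by simp
  then have "integrable \<nu> (\<lambda>q. (norm (f q, snd q))\<^sup>2)"
    using i by (simp add: norm_Pair)
  then show ?thesis
    using fm n(4) snd_borel[where 'a=real and 'b='a] unfolding P2_def
    by (simp add: integrable_distr_eq prob_space_distr distr_distr comp_def)
qed

text \<open>The image of the fibre \<open>\<nu>x x\<close> under the pair (f, g) couples the two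
  image fibres, so the mean square displacement of the particles bounds the distance.\<close>

lemma L2d2_push:
  fixes \<mu> :: "'a::euclidean_space measure" and f g :: "real \<times> 'a \<Rightarrow> real"
  assumes \<nu>: "\<nu> \<in> P2 \<mu>" and s\<mu>: "sets \<mu> = sets borel" "prob_space \<mu>" "integrable \<mu> (\<lambda>x. (norm x)\<^sup>2)"
    and f: "f \<in> borel_measurable borel" "integrable \<nu> (\<lambda>q. (f q)\<^sup>2)"
    and g: "g \<in> borel_measurable borel" "integrable \<nu> (\<lambda>q. (g q)\<^sup>2)"
    and c: "(\<integral>\<^sup>+q. ennreal ((f q - g q)\<^sup>2) \<partial>\<nu>) \<le> ennreal (c\<^sup>2)" "c \<ge> 0"
  shows "L2d2 \<mu> (distr \<nu> borel (\<lambda>q. (f q, snd q))) (distr \<nu> borel (\<lambda>q. (g q, snd q))) \<le> c"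
proof -
  define \<nu>x where "\<nu>x = disintegration \<mu> \<nu>"
  have d: "is_disintegration \<mu> \<nu> \<nu>x" unfolding \<nu>x_def by (rule P2_disintegration[OF \<nu>])
  note k = disintegration_kernel[OF d] and n = P2D[OF \<nu>]
  let ?F = "distr \<nu> borel (\<lambda>q. (f q, snd q))" and ?G = "distr \<nu> borel (\<lambda>q. (g q, snd q))"
  have F: "?F \<in> P2 \<mu>" and G: "?G \<in> P2 \<mu>" using P2_push \<nu> f g s\<mu> by auto
  have "AE x in \<mu>. disintegration \<mu> ?F x = distr (\<nu>x x) borel (\<lambda>u. f (u, x))"
    by (rule P2_disintegration_AE[OF F disintegration_push]) (use d n s\<mu> f in auto)
  moreover have "AE x in \<mu>. disintegration \<mu> ?G x = distr (\<nu>x x) borel (\<lambda>u. g (u, x))"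
    by (rule P2_disintegration_AE[OF G disintegration_push]) (use d n s\<mu> g in auto)
  ultimately have "AE x in \<mu>. d2_sq (disintegration \<mu> ?F x) (disintegration \<mu> ?G x) \<le> (\<integral>\<^sup>+u. ennreal ((f (u, x) - g (u, x))\<^sup>2) \<partial>\<nu>x x)"
  proof eventually_elim
    case (elim x)
    have fx: "(\<lambda>u. h (u, x)) \<in> borel_measurable (\<nu>x x)" if "h \<in> borel_measurable borel" for h :: "real \<times> 'a \<Rightarrow> real"
    proof -
      have "(\<lambda>u. h (u, x)) \<in> borel_measurable borel"
        by (rule measurable_compose[OF _ that]) (simp add: borel_prod[symmetric])
      then show ?thesis using k(4)[of x] by (simp cong: measurable_cong_sets)
    qed
    interpret p: prob_space "\<nu>x x" by (rule k)
    let ?\<pi> = "distr (\<nu>x x) borel (\<lambda>u. (f (u, x), g (u, x)))"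
    have m: "(\<lambda>u. (f (u, x), g (u, x))) \<in> \<nu>x x \<rightarrow>\<^sub>M borel"
      unfolding borel_prod[symmetric] using fx f g by measurable
    note m2 = fst_borel[where 'a=real and 'b=real] snd_borel[where 'a=real and 'b=real]
    have "?\<pi> \<in> couplings (distr (\<nu>x x) borel (\<lambda>u. f (u, x))) (distr (\<nu>x x) borel (\<lambda>u. g (u, x)))"
      using m m2 by (auto simp: couplings_def p.prob_space_distr distr_distr comp_def)
    then have "d2_sq (distr (\<nu>x x) borel (\<lambda>u. f (u, x))) (distr (\<nu>x x) borel (\<lambda>u. g (u, x))) \<le>
       (\<integral>\<^sup>+(\<xi>, \<zeta>). ennreal ((\<xi> - \<zeta>)\<^sup>2) \<partial>?\<pi>)"
      unfolding d2_sq_def by (rule INF_lower)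
    also have "\<dots> = (\<integral>\<^sup>+u. ennreal ((f (u, x) - g (u, x))\<^sup>2) \<partial>\<nu>x x)"
      by (subst nn_integral_distr[OF m]) (auto simp: case_prod_beta' borel_prod[symmetric])
    finally show ?case using elim by simp
  qed
  then have "(\<integral>\<^sup>+x. d2_sq (disintegration \<mu> ?F x) (disintegration \<mu> ?G x) \<partial>\<mu>) \<le>
     (\<integral>\<^sup>+x. (\<integral>\<^sup>+u. ennreal ((f (u, x) - g (u, x))\<^sup>2) \<partial>\<nu>x x) \<partial>\<mu>)"
    by (rule nn_integral_mono_AE)
  also have "\<dots> = (\<integral>\<^sup>+q. ennreal ((f q - g q)\<^sup>2) \<partial>\<nu>)"
    using disintegration_nn_integral(1)[OF d n(2) s\<mu>(1), of "\<lambda>q. ennreal ((f q - g q)\<^sup>2)"] f g by simp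
  also note c(1)
  finally have "(L2d2 \<mu> ?F ?G)\<^sup>2 \<le> c\<^sup>2" using L2d2_finite[OF F G s\<mu>(1)] by simp
  then show ?thesis by (rule power2_le_imp_le) (rule c)
qed

section \<open>Mean-field characteristics\<close>

declare fst_borel[measurable] snd_borel[measurable]

lemma Cauchy_Schwarz_integral:
  fixes f g :: "'b \<Rightarrow> real"
  assumes [measurable]: "f \<in> borel_measurable M" "g \<in> borel_measurable M"
    and f: "integrable M (\<lambda>x. (f x)\<^sup>2)" and g: "integrable M (\<lambda>x. (g x)\<^sup>2)"
  shows "integrable M (\<lambda>x. f x * g x)"
    and "(\<integral>x. \<bar>f x * g x\<bar> \<partial>M) \<le> sqrt (\<integral>x. (f x)\<^sup>2 \<partial>M) * sqrt (\<integral>x. (g x)\<^sup>2 \<partial>M)"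
proof -
  show i: "integrable M (\<lambda>x. f x * g x)"
  proof (rule Bochner_Integration.integrable_bound[OF Bochner_Integration.integrable_add[OF f g]])
    have "\<bar>f x * g x\<bar> \<le> (f x)\<^sup>2 + (g x)\<^sup>2" for x
      using sum_squares_bound[of "\<bar>f x\<bar>" "\<bar>g x\<bar>"] mult_nonneg_nonneg[OF abs_ge_zero[of "f x"] abs_ge_zero[of "g x"]]
      unfolding abs_mult power2_abs by linarith
    then show "AE x in M. norm (f x * g x) \<le> norm ((f x)\<^sup>2 + (g x)\<^sup>2)" by auto
  qed measurable
  let ?I = "\<integral>x. \<bar>f x * g x\<bar> \<partial>M"
  have "ennreal ?I = (\<integral>\<^sup>+x. ennreal \<bar>f x * g x\<bar> \<partial>M)"
    using i by (subst nn_integral_eq_integral) auto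
  also have "\<dots> = (\<integral>\<^sup>+x. ennreal \<bar>f x\<bar> * ennreal \<bar>g x\<bar> \<partial>M)"
    by (simp add: abs_mult ennreal_mult)
  finally have "(ennreal ?I)\<^sup>2 \<le> (\<integral>\<^sup>+x. (ennreal \<bar>f x\<bar>)\<^sup>2 \<partial>M) * (\<integral>\<^sup>+x. (ennreal \<bar>g x\<bar>)\<^sup>2 \<partial>M)"
    by (simp add: Cauchy_Schwarz_nn_integral)
  also have "\<dots> = ennreal (\<integral>x. (f x)\<^sup>2 \<partial>M) * ennreal (\<integral>x. (g x)\<^sup>2 \<partial>M)"
    using f g by (simp add: ennreal_power nn_integral_eq_integral)
  finally have "?I\<^sup>2 \<le> (\<integral>x. (f x)\<^sup>2 \<partial>M) * (\<integral>x. (g x)\<^sup>2 \<partial>M)"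
    by (simp add: ennreal_power flip: ennreal_mult)
  then have "?I \<le> sqrt ((\<integral>x. (f x)\<^sup>2 \<partial>M) * (\<integral>x. (g x)\<^sup>2 \<partial>M))"
    by (rule real_le_rsqrt)
  then show "?I \<le> sqrt (\<integral>x. (f x)\<^sup>2 \<partial>M) * sqrt (\<integral>x. (g x)\<^sup>2 \<partial>M)"
    by (simp add: real_sqrt_mult)
qed

lemma measurable_integral_parameter:
  fixes h :: "'b::second_countable_topology \<Rightarrow> 'c::second_countable_topology \<Rightarrow> real"
  assumes "sigma_finite_measure N" and s: "sets N = sets borel"
    and h: "(\<lambda>p. h (fst p) (snd p)) \<in> borel_measurable borel"
  shows "(\<lambda>z. \<integral>q. h z q \<partial>N) \<in> borel_measurable borel"
proof -
  interpret sigma_finite_measure N by fact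
  have "sets (borel \<Otimes>\<^sub>M N) = sets (borel :: ('b \<times> 'c) measure)"
    using sets_pair_measure_cong[OF refl s, of "borel :: 'b measure"] by (simp only: borel_prod)
  then have "(\<lambda>p. h (fst p) (snd p)) \<in> borel_measurable (borel \<Otimes>\<^sub>M N)"
    using h by (simp cong: measurable_cong_sets)
  then show ?thesis by (intro borel_measurable_lebesgue_integral) (simp add: case_prod_beta')
qed

text \<open>The term -1 is kept because \<open>picard_admissible\<close> spends it: it absorbs the
  starting position |u|, so that Picard steps preserve one and the same exponential bound.\<close>

lemma exp_integral_bound:
  fixes h :: "real \<Rightarrow> real"
  assumes h: "h \<in> borel_measurable borel" and a: "a > 0" and t: "t \<ge> 0"
    and b: "\<And>s. 0 \<le> s \<Longrightarrow> s \<le> t \<Longrightarrow> \<bar>h s\<bar> \<le> c * exp (a * s)"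
  shows "set_integrable lborel {0..t} h" "\<bar>LINT s:{0..t}|lborel. h s\<bar> \<le> c * (exp (a * t) - 1) / a"
proof -
  have I: "has_bochner_integral lborel (\<lambda>s. indicator {0..t} s *\<^sub>R (c * exp (a * s))) (c * exp (a * t) / a - c * exp (a * 0) / a)"
  proof (rule has_bochner_integral_FTC_Icc[OF t])
    fix s assume "0 \<le> s" "s \<le> t"
    show "((\<lambda>s. c * exp (a * s) / a) has_vector_derivative c * exp (a * s)) (at s within {0..t})"
      using a by (auto intro!: derivative_eq_intros simp flip: has_real_derivative_iff_has_vector_derivative)
  qed (auto intro!: continuous_intros)
  have i: "set_integrable lborel {0..t} (\<lambda>s. c * exp (a * s))"
    using I unfolding set_integrable_def by (auto simp: has_bochner_integral_iff)
  have e: "(LINT s:{0..t}|lborel. c * exp (a * s)) = c * (exp (a * t) - 1) / a"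
    using I unfolding set_lebesgue_integral_def by (simp add: has_bochner_integral_iff right_diff_distrib diff_divide_distrib)
  show s: "set_integrable lborel {0..t} h"
    by (rule set_integrable_bound[OF i]) (use h b in \<open>auto simp: set_borel_measurable_def intro!: AE_I2 order_trans[OF b abs_ge_self]\<close>)
  have "\<bar>LINT s:{0..t}|lborel. h s\<bar> \<le> (LINT s:{0..t}|lborel. \<bar>h s\<bar>)"
    using set_integral_norm_bound[OF s] by simp
  also have "\<dots> \<le> (LINT s:{0..t}|lborel. c * exp (a * s))"
    by (rule set_integral_mono[OF set_integrable_abs[OF s] i]) (use b in auto)
  finally show "\<bar>LINT s:{0..t}|lborel. h s\<bar> \<le> c * (exp (a * t) - 1) / a" unfolding e .
qed

text \<open>Abstract interaction kernel \<open>\<Psi>\<close> whose Lipschitz constant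
  \<open>k\<close> is square integrable in y, uniformly in t and x. Time runs over the whole line;
  the concrete kernel achieves this by clamping. Continuity in time is asked only of integrals
  against \<open>P2\<close> measures, since a field evaluated along a moving r is in general not
  continuous in time at fixed x and y.\<close>

locale mean_field =
  fixes \<mu> :: "'a::euclidean_space measure"
    and \<Psi> :: "real \<Rightarrow> real \<Rightarrow> real \<Rightarrow> 'a \<Rightarrow> 'a \<Rightarrow> real"
    and k :: "real \<Rightarrow> 'a \<Rightarrow> 'a \<Rightarrow> real" and C :: real
  assumes prob_\<mu>: "prob_space \<mu>" and sets_\<mu>: "sets \<mu> = sets borel" and moment_\<mu>: "integrable \<mu> (\<lambda>x. (norm x)\<^sup>2)"
    and \<Psi>_meas: "(\<lambda>(t, \<xi>, \<zeta>, x, y). \<Psi> t \<xi> \<zeta> x y) \<in> borel_measurable borel"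
    and k_meas: "(\<lambda>(t, x, y). k t x y) \<in> borel_measurable borel"
    and k_nonneg: "\<And>t x y. k t x y \<ge> 0"
    and k_bound: "\<And>t x. (\<integral>\<^sup>+y. ennreal ((k t x y)\<^sup>2) \<partial>\<mu>) \<le> ennreal (C\<^sup>2)" and C_pos: "C > 0"
    and \<Psi>_lip: "\<And>t a b c d x y. \<bar>\<Psi> t a b x y - \<Psi> t c d x y\<bar> \<le> k t x y * (\<bar>a - c\<bar> + \<bar>b - d\<bar>)"
    and \<Psi>_zero: "\<And>t x y. \<Psi> t 0 0 x y = 0"
    and \<Psi>_cont: "\<And>N \<xi> x. N \<in> P2 \<mu> \<Longrightarrow> continuous_on UNIV (\<lambda>t. \<integral>q. \<Psi> t \<xi> (fst q) x (snd q) \<partial>N)"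
begin

lemma \<Psi>_measurable[measurable (raw)]:
  assumes "a \<in> borel_measurable M" "b \<in> borel_measurable M" "c \<in> borel_measurable M"
    "d \<in> M \<rightarrow>\<^sub>M borel" "e \<in> M \<rightarrow>\<^sub>M borel"
  shows "(\<lambda>z. \<Psi> (a z) (b z) (c z) (d z) (e z)) \<in> borel_measurable M"
proof -
  have "(\<lambda>z. (a z, b z, c z, d z, e z)) \<in> M \<rightarrow>\<^sub>M borel" using assms by (intro borel_measurable_Pair)
  from measurable_compose[OF this \<Psi>_meas] show ?thesis by simp
qed

lemma k_measurable[measurable (raw)]:
  assumes "a \<in> borel_measurable M" "d \<in> M \<rightarrow>\<^sub>M borel" "e \<in> M \<rightarrow>\<^sub>M borel"
  shows "(\<lambda>z. k (a z) (d z) (e z)) \<in> borel_measurable M"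
proof -
  have "(\<lambda>z. (a z, d z, e z)) \<in> M \<rightarrow>\<^sub>M borel" using assms by (intro borel_measurable_Pair)
  from measurable_compose[OF this k_meas] show ?thesis by simp
qed

lemma \<Psi>_bound: "\<bar>\<Psi> t a b x y\<bar> \<le> k t x y * (\<bar>a\<bar> + \<bar>b\<bar>)"
  using \<Psi>_lip[of t a b x y 0 0] \<Psi>_zero[of t x y] by simp

lemma k_square_integrable:
  "integrable \<mu> (\<lambda>y. (k t x y)\<^sup>2)" "(\<integral>y. (k t x y)\<^sup>2 \<partial>\<mu>) \<le> C\<^sup>2"
proof -
  have m: "(\<lambda>y. (k t x y)\<^sup>2) \<in> borel_measurable \<mu>"
    using sets_\<mu> by (simp cong: measurable_cong_sets) measurable
  show i: "integrable \<mu> (\<lambda>y. (k t x y)\<^sup>2)"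
    by (rule integrableI_bounded[OF m]) (use k_bound[of t x] in \<open>auto intro: le_less_trans\<close>)
  show "(\<integral>y. (k t x y)\<^sup>2 \<partial>\<mu>) \<le> C\<^sup>2"
    using k_bound[of t x] i by (simp add: nn_integral_eq_integral)
qed

lemma k_weighted:
  assumes N: "N \<in> P2 \<mu>" and w: "w \<in> borel_measurable borel" "integrable N (\<lambda>q. (w q)\<^sup>2)"
  shows "integrable N (\<lambda>q. k t x (snd q) * \<bar>w q\<bar>)"
    and "(\<integral>q. k t x (snd q) * \<bar>w q\<bar> \<partial>N) \<le> C * sqrt (\<integral>q. (w q)\<^sup>2 \<partial>N)"
proof -
  note n = P2D[OF N]
  have km: "(\<lambda>q. k t x (snd q)) \<in> borel_measurable N" by (rule n(9)) measurable
  have wm: "(\<lambda>q. \<bar>w q\<bar>) \<in> borel_measurable N" by (rule n(9)) (use w in measurable)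
  have ki: "integrable N (\<lambda>q. (k t x (snd q))\<^sup>2)" "(\<integral>q. (k t x (snd q))\<^sup>2 \<partial>N) \<le> C\<^sup>2"
    using P2_integral_snd[OF N, of "\<lambda>y. (k t x y)\<^sup>2"] k_square_integrable[of t x] by auto
  note cs = Cauchy_Schwarz_integral[OF km wm ki(1)]
  show "integrable N (\<lambda>q. k t x (snd q) * \<bar>w q\<bar>)" by (rule cs(1)) (use w in simp)
  have "(\<integral>q. k t x (snd q) * \<bar>w q\<bar> \<partial>N) = (\<integral>q. \<bar>k t x (snd q) * \<bar>w q\<bar>\<bar> \<partial>N)"
    using k_nonneg by (simp add: abs_mult)
  also have "\<dots> \<le> sqrt (\<integral>q. (k t x (snd q))\<^sup>2 \<partial>N) * sqrt (\<integral>q. (w q)\<^sup>2 \<partial>N)"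
    using cs(2) w by simp
  also have "\<dots> \<le> C * sqrt (\<integral>q. (w q)\<^sup>2 \<partial>N)"
    using ki(2) C_pos by (intro mult_right_mono) (auto intro: real_le_lsqrt)
  finally show "(\<integral>q. k t x (snd q) * \<bar>w q\<bar> \<partial>N) \<le> C * sqrt (\<integral>q. (w q)\<^sup>2 \<partial>N)" .
qed

lemma k_integrable:
  assumes N: "N \<in> P2 \<mu>"
  shows "integrable N (\<lambda>q. k t x (snd q))" "(\<integral>q. k t x (snd q) \<partial>N) \<le> C"
proof -
  interpret prob_space N by (rule P2D[OF N])
  show "integrable N (\<lambda>q. k t x (snd q))" "(\<integral>q. k t x (snd q) \<partial>N) \<le> C"
    using k_weighted[OF N, of "\<lambda>_. 1" t x] by (simp_all add: prob_space)
qed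

lemma \<Psi>_integrable:
  assumes N: "N \<in> P2 \<mu>" and f: "f \<in> borel_measurable borel" "integrable N (\<lambda>q. (f q)\<^sup>2)"
  shows "integrable N (\<lambda>q. \<Psi> t \<xi> (f q) x (snd q))"
proof (rule Bochner_Integration.integrable_bound)
  have "integrable N (\<lambda>q. \<bar>\<xi>\<bar> * k t x (snd q) + k t x (snd q) * \<bar>f q\<bar>)"
    by (intro Bochner_Integration.integrable_add integrable_mult_right k_integrable[OF N] k_weighted(1)[OF N f])
  then show "integrable N (\<lambda>q. k t x (snd q) * (\<bar>\<xi>\<bar> + \<bar>f q\<bar>))" by (simp add: algebra_simps)
  show "(\<lambda>q. \<Psi> t \<xi> (f q) x (snd q)) \<in> borel_measurable N"
    by (rule P2D(9)[OF N]) (use f in measurable)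
  show "AE q in N. norm (\<Psi> t \<xi> (f q) x (snd q)) \<le> norm (k t x (snd q) * (\<bar>\<xi>\<bar> + \<bar>f q\<bar>))"
    using \<Psi>_bound k_nonneg by (auto simp: abs_mult)
qed

text \<open>The common source of the velocity estimates: f = g gives the Lipschitz bound in \<xi>,
  the choice g = 0 and \<zeta> = 0 gives linear growth, and two particle maps give the contraction
  of the Picard iteration.\<close>

lemma \<Psi>_integral_diff:
  assumes N: "N \<in> P2 \<mu>" and f: "f \<in> borel_measurable borel" "integrable N (\<lambda>q. (f q)\<^sup>2)"
    and g: "g \<in> borel_measurable borel" "integrable N (\<lambda>q. (g q)\<^sup>2)"
  shows "\<bar>(\<integral>q. \<Psi> t \<xi> (f q) x (snd q) \<partial>N) - (\<integral>q. \<Psi> t \<zeta> (g q) x (snd q) \<partial>N)\<bar>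
    \<le> C * (\<bar>\<xi> - \<zeta>\<bar> + sqrt (\<integral>q. (f q - g q)\<^sup>2 \<partial>N))"
proof -
  have fg: "integrable N (\<lambda>q. (f q - g q)\<^sup>2)"
  proof (rule Bochner_Integration.integrable_bound)
    show "integrable N (\<lambda>q. 2 * (f q)\<^sup>2 + 2 * (g q)\<^sup>2)" using f g by auto
    show "(\<lambda>q. (f q - g q)\<^sup>2) \<in> borel_measurable N" by (rule P2D(9)[OF N]) (use f g in measurable)
    have "(a - b)\<^sup>2 \<le> 2 * a\<^sup>2 + 2 * b\<^sup>2" for a b :: real
      using zero_le_power2[of "a + b"] by (simp add: power2_eq_square algebra_simps)
    then show "AE q in N. norm ((f q - g q)\<^sup>2) \<le> norm (2 * (f q)\<^sup>2 + 2 * (g q)\<^sup>2)" by auto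
  qed
  have fgm: "(\<lambda>q. f q - g q) \<in> borel_measurable borel" using f g by measurable
  note kw = k_weighted[OF N fgm fg, of t x] and ki = k_integrable[OF N, of t x]
  have "\<bar>(\<integral>q. \<Psi> t \<xi> (f q) x (snd q) \<partial>N) - (\<integral>q. \<Psi> t \<zeta> (g q) x (snd q) \<partial>N)\<bar>
     = \<bar>\<integral>q. \<Psi> t \<xi> (f q) x (snd q) - \<Psi> t \<zeta> (g q) x (snd q) \<partial>N\<bar>"
    using \<Psi>_integrable[OF N f] \<Psi>_integrable[OF N g] by simp
  also have "\<dots> \<le> (\<integral>q. \<bar>\<Psi> t \<xi> (f q) x (snd q) - \<Psi> t \<zeta> (g q) x (snd q)\<bar> \<partial>N)"
    by (rule integral_abs_bound)
  also have "\<dots> \<le> (\<integral>q. \<bar>\<xi> - \<zeta>\<bar> * k t x (snd q) + k t x (snd q) * \<bar>f q - g q\<bar> \<partial>N)"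
  proof (rule integral_mono)
    show "integrable N (\<lambda>q. \<bar>\<Psi> t \<xi> (f q) x (snd q) - \<Psi> t \<zeta> (g q) x (snd q)\<bar>)"
      using \<Psi>_integrable[OF N f] \<Psi>_integrable[OF N g] by auto
    show "integrable N (\<lambda>q. \<bar>\<xi> - \<zeta>\<bar> * k t x (snd q) + k t x (snd q) * \<bar>f q - g q\<bar>)"
      using kw ki by auto
    show "\<bar>\<Psi> t \<xi> (f q) x (snd q) - \<Psi> t \<zeta> (g q) x (snd q)\<bar> \<le> \<bar>\<xi> - \<zeta>\<bar> * k t x (snd q) + k t x (snd q) * \<bar>f q - g q\<bar>" for q
      using \<Psi>_lip[of t \<xi> "f q" x "snd q" \<zeta> "g q"] by (simp add: algebra_simps)
  qed
  also have "\<dots> = \<bar>\<xi> - \<zeta>\<bar> * (\<integral>q. k t x (snd q) \<partial>N) + (\<integral>q. k t x (snd q) * \<bar>f q - g q\<bar> \<partial>N)"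
    using kw ki by simp
  also have "\<dots> \<le> \<bar>\<xi> - \<zeta>\<bar> * C + C * sqrt (\<integral>q. (f q - g q)\<^sup>2 \<partial>N)"
    by (intro add_mono mult_left_mono ki kw) auto
  finally show ?thesis by (simp add: algebra_simps)
qed

definition vel :: "(real \<times> 'a) measure \<Rightarrow> real \<Rightarrow> real \<Rightarrow> 'a \<Rightarrow> real" where
  "vel N t \<xi> x = - (\<integral>q. \<Psi> t \<xi> (fst q) x (snd q) \<partial>N)"

lemma vel_lip:
  assumes N: "N \<in> P2 \<mu>"
  shows "\<bar>vel N t \<xi> x - vel N t \<zeta> x\<bar> \<le> C * \<bar>\<xi> - \<zeta>\<bar>"
  using \<Psi>_integral_diff[OF N, of fst fst t \<xi> x \<zeta>] P2D[OF N] by (simp add: vel_def)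

text \<open>For frozen t, \<xi> and x the kernel is itself a test function for
  \<open>L2d2_dual\<close>, with fibrewise constant \<open>k t x\<close>; hence the bound is uniform
  in \<xi> and x.\<close>

lemma vel_diff_L2d2:
  assumes N: "N1 \<in> P2 \<mu>" "N2 \<in> P2 \<mu>"
  shows "\<bar>vel N1 t \<xi> x - vel N2 t \<xi> x\<bar> \<le> C * L2d2 \<mu> N1 N2"
proof -
  have "\<bar>(\<integral>q. \<Psi> t \<xi> (fst q) x (snd q) \<partial>N1) - (\<integral>q. \<Psi> t \<xi> (fst q) x (snd q) \<partial>N2)\<bar> \<le> C * L2d2 \<mu> N1 N2"
  proof (rule L2d2_dual[OF N sets_\<mu>, where l="k t x"])
    show "\<bar>\<Psi> t \<xi> (fst (a, y)) x (snd (a, y)) - \<Psi> t \<xi> (fst (b, y)) x (snd (b, y))\<bar> \<le> k t x y * \<bar>a - b\<bar>" for a b y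
      using \<Psi>_lip[of t \<xi> a x y \<xi> b] by simp
    show "integrable N1 (\<lambda>q. \<Psi> t \<xi> (fst q) x (snd q))"
      by (rule \<Psi>_integrable[OF N(1) fst_borel P2D(5)[OF N(1)]])
    show "integrable N2 (\<lambda>q. \<Psi> t \<xi> (fst q) x (snd q))"
      by (rule \<Psi>_integrable[OF N(2) fst_borel P2D(5)[OF N(2)]])
    show "(\<lambda>q. \<Psi> t \<xi> (fst q) x (snd q)) \<in> borel_measurable borel" by measurable
    show "k t x \<in> borel_measurable borel" by measurable
  qed (fact k_nonneg k_bound less_imp_le[OF C_pos])+
  then show ?thesis by (simp add: vel_def abs_minus_commute)
qed

lemma vel_measurable:
  assumes N: "N \<in> P2 \<mu>"
  shows "(\<lambda>p. vel N (fst p) (fst (snd p)) (snd (snd p))) \<in> borel_measurable borel"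
  unfolding vel_def
proof (intro borel_measurable_uminus measurable_integral_parameter)
  interpret prob_space N by (rule P2D[OF N])
  show "sigma_finite_measure N" ..
  show "sets N = sets borel" by (rule P2D[OF N])
qed measurable

lemma vel_push:
  assumes N: "N \<in> P2 \<mu>" and f: "f \<in> borel_measurable borel"
  shows "vel (distr N borel (\<lambda>q. (f q, snd q))) t \<xi> x = - (\<integral>q. \<Psi> t \<xi> (f q) x (snd q) \<partial>N)"
proof -
  have "(\<lambda>q. (f q, snd q)) \<in> N \<rightarrow>\<^sub>M borel"
    using f P2D(2)[OF N] by (intro borel_measurable_Pair) (simp_all add: snd_borel cong: measurable_cong_sets)
  moreover have "(\<lambda>q. \<Psi> t \<xi> (fst q) x (snd q)) \<in> borel_measurable borel" by measurable
  ultimately show ?thesis unfolding vel_def by (simp add: integral_distr)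
qed

text \<open>The three sources of variation are separated: position through \<open>vel_lip\<close>,
  the measure through \<open>vel_diff_L2d2\<close>, and explicit time through
  \<open>\<Psi>_cont\<close>.\<close>

lemma vel_continuous:
  assumes \<sigma>: "cont_curve T (P2 \<mu>) (L2d2 \<mu>) \<sigma>" and g: "continuous_on {0..T} g"
  shows "continuous_on {0..T} (\<lambda>t. vel (\<sigma> t) t (g t) x)"
  unfolding continuous_on_def
proof
  fix t assume t: "t \<in> {0..T}"
  from \<sigma> t have L: "((\<lambda>s. L2d2 \<mu> (\<sigma> s) (\<sigma> t)) \<longlongrightarrow> 0) (at t within {0..T})" by (simp add: cont_curve_def)
  have P: "s \<in> {0..T} \<Longrightarrow> \<sigma> s \<in> P2 \<mu>" for s using \<sigma> by (simp add: cont_curve_def)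
  have g: "((\<lambda>s. g s) \<longlongrightarrow> g t) (at t within {0..T})" using g t by (simp add: continuous_on_def)
  have v: "((\<lambda>s. vel (\<sigma> t) s (g t) x) \<longlongrightarrow> vel (\<sigma> t) t (g t) x) (at t within {0..T})"
    using \<Psi>_cont[OF P[OF t], of "g t" x] unfolding vel_def continuous_on_def
    by (intro tendsto_minus) (auto intro: tendsto_within_subset)
  have "((\<lambda>s. C * \<bar>g s - g t\<bar> + C * L2d2 \<mu> (\<sigma> s) (\<sigma> t) + \<bar>vel (\<sigma> t) s (g t) x - vel (\<sigma> t) t (g t) x\<bar>) \<longlongrightarrow>
      C * \<bar>g t - g t\<bar> + C * 0 + \<bar>vel (\<sigma> t) t (g t) x - vel (\<sigma> t) t (g t) x\<bar>) (at t within {0..T})"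
    by (intro tendsto_intros g L v)
  then have z: "((\<lambda>s. C * \<bar>g s - g t\<bar> + C * L2d2 \<mu> (\<sigma> s) (\<sigma> t) + \<bar>vel (\<sigma> t) s (g t) x - vel (\<sigma> t) t (g t) x\<bar>) \<longlongrightarrow> 0) (at t within {0..T})"
    by simp
  have "((\<lambda>s. vel (\<sigma> s) s (g s) x - vel (\<sigma> t) t (g t) x) \<longlongrightarrow> 0) (at t within {0..T})"
  proof (rule Lim_null_comparison[OF _ z])
    have "norm (vel (\<sigma> s) s (g s) x - vel (\<sigma> t) t (g t) x) \<le>
       C * \<bar>g s - g t\<bar> + C * L2d2 \<mu> (\<sigma> s) (\<sigma> t) + \<bar>vel (\<sigma> t) s (g t) x - vel (\<sigma> t) t (g t) x\<bar>" if "s \<in> {0..T}" for s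
      using vel_lip[OF P[OF that], of s "g s" x "g t"] vel_diff_L2d2[OF P[OF that] P[OF t], of s "g t" x] by simp
    then show "\<forall>\<^sub>F s in at t within {0..T}. norm (vel (\<sigma> s) s (g s) x - vel (\<sigma> t) t (g t) x) \<le>
       C * \<bar>g s - g t\<bar> + C * L2d2 \<mu> (\<sigma> s) (\<sigma> t) + \<bar>vel (\<sigma> t) s (g t) x - vel (\<sigma> t) t (g t) x\<bar>"
      by (auto simp: eventually_at_filter)
  qed
  then show "((\<lambda>t. vel (\<sigma> t) t (g t) x) \<longlongrightarrow> vel (\<sigma> t) t (g t) x) (at t within {0..T})"
    by (simp add: LIM_zero_iff)
qed

end

section \<open>Picard iteration for the characteristics\<close>

context mean_field begin

text \<open>The law at time t is the image of \<open>\<nu>\<close> under the particle map, so the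
  field is integrated against \<open>\<nu>\<close> itself and f remains the only unknown.\<close>

definition drift :: "(real \<times> 'a) measure \<Rightarrow> (real \<times> real \<times> 'a \<Rightarrow> real) \<Rightarrow> real \<times> real \<times> 'a \<Rightarrow> real" where
  "drift \<nu> f p = - (\<integral>q. \<Psi> (fst p) (f p) (f (fst p, q)) (snd (snd p)) (snd q) \<partial>\<nu>)"

definition picard :: "(real \<times> 'a) measure \<Rightarrow> (real \<times> real \<times> 'a \<Rightarrow> real) \<Rightarrow> real \<times> real \<times> 'a \<Rightarrow> real" where
  "picard \<nu> f p = fst (snd p) + (LINT s:{0..fst p}|lborel. drift \<nu> f (s, snd p))"

text \<open>Lipschitz constant of \<open>drift\<close> in the norm weighted by 1 + |u|: the summand
  1 comes from the particle itself, the square root from the mean field.\<close>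

definition growth :: "(real \<times> 'a) measure \<Rightarrow> real" where
  "growth \<nu> = C * (1 + sqrt (\<integral>q. (1 + \<bar>fst q\<bar>)\<^sup>2 \<partial>\<nu>))"

context
  fixes \<nu> :: "(real \<times> 'a) measure"
  assumes \<nu>: "\<nu> \<in> P2 \<mu>"
begin

interpretation prob_space \<nu> by (rule P2D[OF \<nu>])

lemma growth_pos: "growth \<nu> > 0"
proof -
  have "0 \<le> (\<integral>q. (1 + \<bar>fst q\<bar>)\<^sup>2 \<partial>\<nu>)" by (intro integral_nonneg_AE) auto
  then show ?thesis using C_pos unfolding growth_def by (intro mult_pos_pos) (auto intro: add_pos_nonneg)
qed

lemma linear_growth_integrable:
  assumes h: "h \<in> borel_measurable borel" and b: "\<And>q. \<bar>h q\<bar> \<le> A * (1 + \<bar>fst q\<bar>)" and A: "A \<ge> 0"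
  shows "integrable \<nu> (\<lambda>q. (h q)\<^sup>2)" "sqrt (\<integral>q. (h q)\<^sup>2 \<partial>\<nu>) \<le> A * sqrt (\<integral>q. (1 + \<bar>fst q\<bar>)\<^sup>2 \<partial>\<nu>)"
proof -
  have i: "integrable \<nu> (\<lambda>q. (1 + \<bar>fst q\<bar>)\<^sup>2)"
  proof -
    have "integrable \<nu> (\<lambda>q. 1 + 2 * \<bar>fst q\<bar> + (fst q)\<^sup>2)" using P2D[OF \<nu>] by auto
    then show ?thesis by (simp add: power2_sum add_ac)
  qed
  have le: "(h q)\<^sup>2 \<le> A\<^sup>2 * (1 + \<bar>fst q\<bar>)\<^sup>2" for q
    using power_mono[OF b[of q], of 2] by (simp add: power_mult_distrib)
  show i2: "integrable \<nu> (\<lambda>q. (h q)\<^sup>2)"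
  proof (rule Bochner_Integration.integrable_bound)
    show "integrable \<nu> (\<lambda>q. A\<^sup>2 * (1 + \<bar>fst q\<bar>)\<^sup>2)" using i by simp
    show "(\<lambda>q. (h q)\<^sup>2) \<in> borel_measurable \<nu>" by (rule P2D(9)[OF \<nu>]) (use h in measurable)
    show "AE q in \<nu>. norm ((h q)\<^sup>2) \<le> norm (A\<^sup>2 * (1 + \<bar>fst q\<bar>)\<^sup>2)" using le by (auto simp: abs_mult)
  qed
  have "(\<integral>q. (h q)\<^sup>2 \<partial>\<nu>) \<le> (\<integral>q. A\<^sup>2 * (1 + \<bar>fst q\<bar>)\<^sup>2 \<partial>\<nu>)"
    by (rule integral_mono[OF i2]) (use i le in auto)
  also have "\<dots> = A\<^sup>2 * (\<integral>q. (1 + \<bar>fst q\<bar>)\<^sup>2 \<partial>\<nu>)" by simp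
  finally have "sqrt (\<integral>q. (h q)\<^sup>2 \<partial>\<nu>) \<le> sqrt (A\<^sup>2 * (\<integral>q. (1 + \<bar>fst q\<bar>)\<^sup>2 \<partial>\<nu>))" by simp
  then show "sqrt (\<integral>q. (h q)\<^sup>2 \<partial>\<nu>) \<le> A * sqrt (\<integral>q. (1 + \<bar>fst q\<bar>)\<^sup>2 \<partial>\<nu>)"
    using A by (simp add: real_sqrt_mult)
qed

lemma section_measurable:
  "f \<in> borel_measurable borel \<Longrightarrow> (\<lambda>q. f (s, q)) \<in> borel_measurable borel" for f :: "real \<times> real \<times> 'a \<Rightarrow> real"
  by (rule measurable_compose[of "\<lambda>q. (s, q)" borel borel f borel]) simp_all

lemma drift_measurable:
  assumes f[measurable]: "f \<in> borel_measurable borel"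
  shows "drift \<nu> f \<in> borel_measurable borel"
  unfolding drift_def[abs_def]
proof (intro borel_measurable_uminus measurable_integral_parameter)
  show "sigma_finite_measure \<nu>" ..
  show "sets \<nu> = sets borel" by (rule P2D[OF \<nu>])
  show "(\<lambda>p. \<Psi> (fst (fst p)) (f (fst p)) (f (fst (fst p), snd p)) (snd (snd (fst p))) (snd (snd p))) \<in> borel_measurable borel"
    by measurable
qed

lemma picard_measurable:
  assumes f: "f \<in> borel_measurable borel"
  shows "picard \<nu> f \<in> borel_measurable borel"
proof -
  note drift_measurable[OF f, measurable]
  have "(\<lambda>p. \<integral>s. indicator {0..fst p} s *\<^sub>R drift \<nu> f (s, snd p) \<partial>lborel) \<in> borel_measurable borel"
  proof (rule measurable_integral_parameter)
    show "sigma_finite_measure (lborel :: real measure)" ..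
    have "(\<lambda>p::(real \<times> real \<times> 'a) \<times> real. (if 0 \<le> snd p \<and> snd p \<le> fst (fst p) then 1 else 0) *\<^sub>R drift \<nu> f (snd p, snd (fst p))) \<in> borel_measurable borel"
      by measurable
    also have "(\<lambda>p::(real \<times> real \<times> 'a) \<times> real. (if 0 \<le> snd p \<and> snd p \<le> fst (fst p) then 1 else 0) *\<^sub>R drift \<nu> f (snd p, snd (fst p))) =
      (\<lambda>p. indicator {0..fst (fst p)} (snd p) *\<^sub>R drift \<nu> f (snd p, snd (fst p)))"
      by (auto simp: fun_eq_iff indicator_def)
    finally show "(\<lambda>p. indicator {0..fst (fst p)} (snd p) *\<^sub>R drift \<nu> f (snd p, snd (fst p))) \<in> borel_measurable borel" .
  qed simp
  then show ?thesis unfolding picard_def[abs_def] set_lebesgue_integral_def by measurable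
qed

lemma drift_diff:
  assumes f: "f \<in> borel_measurable borel" "\<And>q. \<bar>f (s, q)\<bar> \<le> A' * (1 + \<bar>fst q\<bar>)"
    and g: "g \<in> borel_measurable borel" "\<And>q. \<bar>g (s, q)\<bar> \<le> A' * (1 + \<bar>fst q\<bar>)" and A': "A' \<ge> 0"
    and A: "A \<ge> 0" "\<And>q. \<bar>f (s, q) - g (s, q)\<bar> \<le> A * (1 + \<bar>fst q\<bar>)"
  shows "\<bar>drift \<nu> f (s, u, x) - drift \<nu> g (s, u, x)\<bar> \<le> growth \<nu> * A * (1 + \<bar>u\<bar>)"
proof -
  let ?m = "sqrt (\<integral>q. (1 + \<bar>fst q\<bar>)\<^sup>2 \<partial>\<nu>)"
  have fm: "(\<lambda>q. f (s, q)) \<in> borel_measurable borel" and gm: "(\<lambda>q. g (s, q)) \<in> borel_measurable borel"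
    using f g by (auto intro: section_measurable)
  have dm: "(\<lambda>q. f (s, q) - g (s, q)) \<in> borel_measurable borel" using fm gm by measurable
  have "\<bar>drift \<nu> f (s, u, x) - drift \<nu> g (s, u, x)\<bar> \<le> C * (\<bar>f (s, u, x) - g (s, u, x)\<bar> + sqrt (\<integral>q. (f (s, q) - g (s, q))\<^sup>2 \<partial>\<nu>))"
    using \<Psi>_integral_diff[OF \<nu> fm linear_growth_integrable(1)[OF fm f(2) A'] gm linear_growth_integrable(1)[OF gm g(2) A'], of s "f (s, u, x)" x "g (s, u, x)"]
    by (simp add: drift_def abs_minus_commute)
  also have "\<dots> \<le> C * (A * (1 + \<bar>u\<bar>) + A * ?m)"
    using A(2)[of "(u, x)"] linear_growth_integrable(2)[OF dm A(2) A(1)] C_pos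
    by (intro mult_left_mono add_mono) auto
  \<comment> \<open>The mean-field contribution is independent of u; enlarging it by the factor 1 +
    |u| puts both contributions under one weight.\<close>
  also have "\<dots> \<le> C * (A * (1 + \<bar>u\<bar>) + A * ?m * (1 + \<bar>u\<bar>))"
  proof (intro mult_left_mono add_left_mono)
    have "0 \<le> A * ?m" using A(1) by (intro mult_nonneg_nonneg real_sqrt_ge_zero integral_nonneg_AE) auto
    then have "A * ?m * 1 \<le> A * ?m * (1 + \<bar>u\<bar>)" by (rule mult_left_mono[rotated]) simp
    then show "A * ?m \<le> A * ?m * (1 + \<bar>u\<bar>)" by simp
  qed (use C_pos in simp)
  also have "\<dots> = growth \<nu> * A * (1 + \<bar>u\<bar>)" by (simp add: growth_def algebra_simps)
  finally show ?thesis .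
qed

lemma drift_bound:
  assumes f: "f \<in> borel_measurable borel" "\<And>q. \<bar>f (s, q)\<bar> \<le> A * (1 + \<bar>fst q\<bar>)" and A: "A \<ge> 0"
  shows "\<bar>drift \<nu> f (s, u, x)\<bar> \<le> growth \<nu> * A * (1 + \<bar>u\<bar>)"
proof -
  have "drift \<nu> (\<lambda>_. 0) (s, u, x) = 0" by (simp add: drift_def \<Psi>_zero)
  then show ?thesis
    using drift_diff[OF f, of "\<lambda>_. 0" A u x] f A by (simp add: mult_nonneg_nonneg)
qed

text \<open>Class preserved by the Picard map. The growth bound supplies the second moments that
  give \<open>drift\<close> its meaning.\<close>

definition admissible :: "(real \<times> real \<times> 'a \<Rightarrow> real) \<Rightarrow> bool" where
  "admissible f \<longleftrightarrow> f \<in> borel_measurable borel \<and>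
     (\<forall>t u x. t \<ge> 0 \<longrightarrow> \<bar>f (t, u, x)\<bar> \<le> exp (growth \<nu> * t) * (1 + \<bar>u\<bar>))"

lemma admissibleD:
  assumes "admissible f" "t \<ge> 0"
  shows "\<bar>f (t, q)\<bar> \<le> exp (growth \<nu> * t) * (1 + \<bar>fst q\<bar>)"
  using assms by (cases q) (auto simp: admissible_def)

lemma drift_integrable:
  assumes f: "admissible f" and t: "t \<ge> 0"
  shows "set_integrable lborel {0..t} (\<lambda>s. drift \<nu> f (s, u, x))"
    "\<bar>LINT s:{0..t}|lborel. drift \<nu> f (s, u, x)\<bar> \<le> (exp (growth \<nu> * t) - 1) * (1 + \<bar>u\<bar>)"
proof -
  have fm: "f \<in> borel_measurable borel" using f by (simp add: admissible_def)
  have m: "(\<lambda>s. drift \<nu> f (s, u, x)) \<in> borel_measurable borel"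
    by (rule measurable_compose[OF _ drift_measurable[OF fm]]) simp
  have b: "\<bar>drift \<nu> f (s, u, x)\<bar> \<le> (growth \<nu> * (1 + \<bar>u\<bar>)) * exp (growth \<nu> * s)" if "0 \<le> s" for s
    using drift_bound[OF fm admissibleD[OF f that], of u x] by (simp add: mult_ac)
  show "set_integrable lborel {0..t} (\<lambda>s. drift \<nu> f (s, u, x))"
    by (rule exp_integral_bound(1)[OF m growth_pos t b])
  show "\<bar>LINT s:{0..t}|lborel. drift \<nu> f (s, u, x)\<bar> \<le> (exp (growth \<nu> * t) - 1) * (1 + \<bar>u\<bar>)"
    using exp_integral_bound(2)[OF m growth_pos t b] growth_pos by (simp add: mult_ac)
qed

lemma picard_admissible:
  assumes f: "admissible f" shows "admissible (picard \<nu> f)"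
  unfolding admissible_def
proof (intro conjI allI impI picard_measurable)
  show "f \<in> borel_measurable borel" using f by (simp add: admissible_def)
  fix t u :: real and x :: 'a assume t: "t \<ge> 0"
  have "\<bar>picard \<nu> f (t, u, x)\<bar> \<le> \<bar>u\<bar> + (exp (growth \<nu> * t) - 1) * (1 + \<bar>u\<bar>)"
    using drift_integrable(2)[OF f t, of u x] by (simp add: picard_def)
  then show "\<bar>picard \<nu> f (t, u, x)\<bar> \<le> exp (growth \<nu> * t) * (1 + \<bar>u\<bar>)"
    by (simp add: algebra_simps)
qed

text \<open>In the norm weighted by \<open>exp (- 2 growth t) / (1 + |u|)\<close> the Picard map halves distances.\<close>

lemma picard_contraction:
  assumes f: "admissible f" and g: "admissible g" and A: "A \<ge> 0"
    and d: "\<And>t u x. t \<ge> 0 \<Longrightarrow> \<bar>f (t, u, x) - g (t, u, x)\<bar> \<le> A * exp (2 * growth \<nu> * t) * (1 + \<bar>u\<bar>)" and t: "t \<ge> 0"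
  shows "\<bar>picard \<nu> f (t, u, x) - picard \<nu> g (t, u, x)\<bar> \<le> A / 2 * exp (2 * growth \<nu> * t) * (1 + \<bar>u\<bar>)"
proof -
  have fm: "f \<in> borel_measurable borel" and gm: "g \<in> borel_measurable borel" using f g by (auto simp: admissible_def)
  have m: "(\<lambda>s. drift \<nu> f (s, u, x) - drift \<nu> g (s, u, x)) \<in> borel_measurable borel"
    by (intro borel_measurable_diff measurable_compose[OF _ drift_measurable[OF fm]] measurable_compose[OF _ drift_measurable[OF gm]]) simp_all
  have b: "\<bar>drift \<nu> f (s, u, x) - drift \<nu> g (s, u, x)\<bar> \<le> (A * growth \<nu> * (1 + \<bar>u\<bar>)) * exp ((2 * growth \<nu>) * s)" if "0 \<le> s" for s
  proof -
    have "\<bar>f (s, q) - g (s, q)\<bar> \<le> A * exp (2 * growth \<nu> * s) * (1 + \<bar>fst q\<bar>)" for q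
      using d[OF that, of "fst q" "snd q"] by simp
    then show ?thesis
      using drift_diff[OF fm admissibleD[OF f that] gm admissibleD[OF g that], of "A * exp (2 * growth \<nu> * s)" u x] A
      by (simp add: mult_ac)
  qed
  have "picard \<nu> f (t, u, x) - picard \<nu> g (t, u, x) = (LINT s:{0..t}|lborel. drift \<nu> f (s, u, x) - drift \<nu> g (s, u, x))"
    using drift_integrable(1)[OF f t] drift_integrable(1)[OF g t] by (simp add: picard_def)
  also have "\<bar>\<dots>\<bar> \<le> (A * growth \<nu> * (1 + \<bar>u\<bar>)) * (exp (2 * growth \<nu> * t) - 1) / (2 * growth \<nu>)"
    using growth_pos by (intro exp_integral_bound(2)[OF m _ t b]) auto
  also have "\<dots> = A / 2 * (exp (2 * growth \<nu> * t) - 1) * (1 + \<bar>u\<bar>)" using growth_pos by simp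
  also have "\<dots> \<le> A / 2 * exp (2 * growth \<nu> * t) * (1 + \<bar>u\<bar>)"
    using A by (intro mult_right_mono mult_left_mono) auto
  finally show ?thesis .
qed

text \<open>The iterates of the motionless flow are Cauchy at every point, at a geometric rate in
  the weighted norm of \<open>picard_contraction\<close>. The limit is taken pointwise, so that it
  is Borel, and the contraction identifies it as a fixed point.\<close>

lemma picard_fixed_point:
  obtains f where "admissible f" "\<And>t u x. t \<ge> 0 \<Longrightarrow> f (t, u, x) = picard \<nu> f (t, u, x)"
proof -
  define F where "F n = (picard \<nu> ^^ n) (\<lambda>p. fst (snd p))" for n
  have FS: "F (Suc n) = picard \<nu> (F n)" for n by (simp add: F_def)
  have ga: "growth \<nu> > 0" by (rule growth_pos)
  have "admissible (F 0)" unfolding F_def admissible_def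
  proof (simp, intro conjI allI impI)
    fix t u :: real assume "t \<ge> 0"
    then have "1 \<le> exp (growth \<nu> * t)" using ga by simp
    then have "1 * (1 + \<bar>u\<bar>) \<le> exp (growth \<nu> * t) * (1 + \<bar>u\<bar>)" by (rule mult_right_mono) simp
    then show "\<bar>u\<bar> \<le> exp (growth \<nu> * t) * (1 + \<bar>u\<bar>)" by simp
  qed
  then have Fa: "admissible (F n)" for n
    by (induction n) (simp_all add: FS picard_admissible)
  define w where "w t u = exp (2 * growth \<nu> * t) * (1 + \<bar>u\<bar>)" for t u :: real
  have w: "w t u > 0" for t u by (simp add: w_def)
  have Fw: "\<bar>F n (t, u, x)\<bar> \<le> w t u" if "t \<ge> 0" for n t u x
  proof -
    have "\<bar>F n (t, u, x)\<bar> \<le> exp (growth \<nu> * t) * (1 + \<bar>u\<bar>)" using admissibleD[OF Fa that, of n "(u, x)"] by simp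
    also have "\<dots> \<le> w t u" unfolding w_def using ga that by (intro mult_right_mono) auto
    finally show ?thesis .
  qed
  \<comment> \<open>The factor 2 is the trivial bound by w on each of the first two
    iterates.\<close>
  have step: "\<bar>F (Suc n) (t, u, x) - F n (t, u, x)\<bar> \<le> 2 * (1/2)^n * w t u" if "t \<ge> 0" for n t u x
    using that
  proof (induction n arbitrary: t u x)
    case 0
    then show ?case using Fw[of t "Suc 0" u x] Fw[of t 0 u x] by simp
  next
    case (Suc n)
    have "\<bar>picard \<nu> (F (Suc n)) (t, u, x) - picard \<nu> (F n) (t, u, x)\<bar> \<le> (2 * (1/2)^n) / 2 * exp (2 * growth \<nu> * t) * (1 + \<bar>u\<bar>)"
      by (rule picard_contraction[OF Fa Fa _ _ Suc.prems]) (use Suc.IH in \<open>auto simp: w_def mult.assoc\<close>)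
    then show ?case by (simp add: FS w_def mult.assoc)
  qed
  \<comment> \<open>The bound is a difference of two tails of the geometric series, which is the
    form in which the induction on m closes.\<close>
  have tele: "\<bar>F (n + m) (t, u, x) - F n (t, u, x)\<bar> \<le> 4 * (1/2)^n * w t u - 4 * (1/2)^(n+m) * w t u" if "t \<ge> 0" for n m t u x
  proof (induction m)
    case (Suc m)
    have "\<bar>F (n + Suc m) (t, u, x) - F n (t, u, x)\<bar> \<le> \<bar>F (Suc (n + m)) (t, u, x) - F (n + m) (t, u, x)\<bar> + \<bar>F (n + m) (t, u, x) - F n (t, u, x)\<bar>" by simp
    also have "\<dots> \<le> 2 * (1/2)^(n+m) * w t u + (4 * (1/2)^n * w t u - 4 * (1/2)^(n+m) * w t u)"
      by (intro add_mono step Suc that)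
    finally show ?case by (simp add: mult_ac)
  qed simp
  define f where "f p = (if fst p \<ge> 0 then lim (\<lambda>n. F n p) else 0)" for p
  have conv: "(\<lambda>n. F n (t, u, x)) \<longlonglongrightarrow> f (t, u, x)" if "t \<ge> 0" for t u x
  proof -
    have "Cauchy (\<lambda>n. F n (t, u, x))"
    proof (rule metric_CauchyI)
      fix e :: real assume e: "e > 0"
      obtain M where "(1/2)^M < e / (8 * w t u)" using real_arch_pow_inv[of "e / (8 * w t u)" "1/2"] e w[of t u] by auto
      then have M: "8 * (1/2)^M * w t u < e" using w[of t u] by (simp add: field_simps)
      have b: "\<bar>F n (t, u, x) - F M (t, u, x)\<bar> \<le> 4 * (1/2)^M * w t u" if "n \<ge> M" for n
      proof -
        have "0 \<le> 4 * (1/2)^n * w t u" using w[of t u] by simp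
        moreover have "M + (n - M) = n" using that by simp
        ultimately show ?thesis using tele[OF \<open>t \<ge> 0\<close>, of M "n - M" u x] by (simp only:)
      qed
      show "\<exists>M. \<forall>m\<ge>M. \<forall>n\<ge>M. dist (F m (t, u, x)) (F n (t, u, x)) < e"
      proof (intro exI allI impI)
        fix m n assume mn: "m \<ge> M" "n \<ge> M"
        show "dist (F m (t, u, x)) (F n (t, u, x)) < e"
          using b[OF mn(1)] b[OF mn(2)] M unfolding dist_real_def by linarith
      qed
    qed
    then show ?thesis using that by (simp add: f_def Cauchy_convergent_iff convergent_LIMSEQ_iff)
  qed
  have Fb[measurable]: "F n \<in> borel_measurable borel" for n using Fa by (simp add: admissible_def)
  have fm: "f \<in> borel_measurable borel" unfolding f_def by measurable
  have fa: "admissible f"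
    unfolding admissible_def
  proof (intro conjI allI impI fm)
    fix t u :: real and x :: 'a assume t: "t \<ge> 0"
    show "\<bar>f (t, u, x)\<bar> \<le> exp (growth \<nu> * t) * (1 + \<bar>u\<bar>)"
      by (rule LIMSEQ_le_const2[OF tendsto_rabs[OF conv[OF t]]]) (use admissibleD[OF Fa t, of _ "(u, x)"] in auto)
  qed
  have fF: "\<bar>f (t, u, x) - F n (t, u, x)\<bar> \<le> 4 * (1/2)^n * w t u" if t: "t \<ge> 0" for n t u x
  proof (rule LIMSEQ_le_const2[OF tendsto_rabs[OF tendsto_diff[OF LIMSEQ_ignore_initial_segment[OF conv[OF t], of n] tendsto_const]]])
    have "\<bar>F (m + n) (t, u, x) - F n (t, u, x)\<bar> \<le> 4 * (1/2)^n * w t u" for m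
    proof -
      have "0 \<le> 4 * (1/2)^(n+m) * w t u" using w[of t u] by simp
      with tele[OF t, of n m u x] show ?thesis unfolding add.commute[of m n] by linarith
    qed
    then show "\<exists>N. \<forall>m\<ge>N. \<bar>F (m + n) (t, u, x) - F n (t, u, x)\<bar> \<le> 4 * (1/2)^n * w t u" by blast
  qed
  show ?thesis
  proof (rule that[OF fa])
    fix t u :: real and x :: 'a assume t: "t \<ge> 0"
    have b: "\<bar>picard \<nu> f (t, u, x) - F (Suc n) (t, u, x)\<bar> \<le> (2 * w t u) * (1/2)^n" for n
    proof -
      have "\<bar>picard \<nu> f (t, u, x) - picard \<nu> (F n) (t, u, x)\<bar> \<le> (4 * (1/2)^n) / 2 * exp (2 * growth \<nu> * t) * (1 + \<bar>u\<bar>)"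
        by (rule picard_contraction[OF fa Fa _ _ t]) (use fF in \<open>auto simp: w_def mult.assoc\<close>)
      then show ?thesis by (simp add: FS w_def mult_ac)
    qed
    have "(\<lambda>n. (2 * w t u) * (1/2)^n) \<longlonglongrightarrow> (2 * w t u) * 0"
      by (intro tendsto_intros LIMSEQ_power_zero) simp
    then have z: "(\<lambda>n. (2 * w t u) * (1/2)^n) \<longlonglongrightarrow> 0" by simp
    have "(\<lambda>n. picard \<nu> f (t, u, x) - F (Suc n) (t, u, x)) \<longlonglongrightarrow> 0"
      by (rule Lim_null_comparison[OF _ z]) (use b in auto)
    then have "(\<lambda>n. picard \<nu> f (t, u, x) - (picard \<nu> f (t, u, x) - F (Suc n) (t, u, x))) \<longlonglongrightarrow> picard \<nu> f (t, u, x) - 0"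
      by (intro tendsto_intros)
    then have "(\<lambda>n. F (Suc n) (t, u, x)) \<longlonglongrightarrow> picard \<nu> f (t, u, x)" by simp
    moreover have "(\<lambda>n. F (Suc n) (t, u, x)) \<longlonglongrightarrow> f (t, u, x)" by (rule LIMSEQ_Suc[OF conv[OF t]])
    ultimately show "f (t, u, x) = picard \<nu> f (t, u, x)" by (rule LIMSEQ_unique[rotated])
  qed
qed

end
end

lemma set_integral_increment:
  fixes h :: "real \<Rightarrow> real"
  assumes h: "set_integrable lborel {0..t} h" and s: "0 \<le> s" "s \<le> t"
  shows "(LINT \<tau>:{0..t}|lborel. h \<tau>) - (LINT \<tau>:{0..s}|lborel. h \<tau>) = (LINT \<tau>:{s..t}|lborel. h \<tau>)"
proof -
  have i: "set_integrable lborel {0..s} h" "set_integrable lborel {s..t} h"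
    using s by (auto intro: set_integrable_subset[OF h])
  \<comment> \<open>The two intervals overlap only in the point s.\<close>
  have "AE \<tau> in lborel. \<tau> \<noteq> s" by (rule AE_lborel_singleton)
  then have "(LINT \<tau>:{0..t}|lborel. h \<tau>) = (\<integral>\<tau>. indicator {0..s} \<tau> *\<^sub>R h \<tau> + indicator {s..t} \<tau> *\<^sub>R h \<tau> \<partial>lborel)"
    unfolding set_lebesgue_integral_def
    using h i s unfolding set_integrable_def
    by (intro integral_cong_AE) (auto split: split_indicator elim!: AE_mp)
  also have "\<dots> = (LINT \<tau>:{0..s}|lborel. h \<tau>) + (LINT \<tau>:{s..t}|lborel. h \<tau>)"
    using i unfolding set_lebesgue_integral_def set_integrable_def by simp
  finally show ?thesis by simp
qed

lemma set_integral_Icc_bound: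
  fixes h :: "real \<Rightarrow> real"
  assumes h: "set_integrable lborel {s..t} h" and b: "\<And>\<tau>. \<tau> \<in> {s..t} \<Longrightarrow> \<bar>h \<tau>\<bar> \<le> B" and st: "s \<le> t"
  shows "\<bar>LINT \<tau>:{s..t}|lborel. h \<tau>\<bar> \<le> B * (t - s)"
proof -
  have c: "set_integrable lborel {s..t} (\<lambda>_. B)" by (rule borel_integrable_atLeastAtMost') (intro continuous_intros)
  have "\<bar>LINT \<tau>:{s..t}|lborel. h \<tau>\<bar> \<le> (LINT \<tau>:{s..t}|lborel. \<bar>h \<tau>\<bar>)"
    using set_integral_norm_bound[OF h] by simp
  also have "\<dots> \<le> (LINT \<tau>:{s..t}|lborel. B)"
    by (rule set_integral_mono[OF set_integrable_abs[OF h] c b])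
  also have "\<dots> = B * (t - s)" using st by (simp add: set_lebesgue_integral_def)
  finally show ?thesis .
qed

lemma cont_curve_lipschitz:
  assumes X: "\<And>t. t \<in> {0..T} \<Longrightarrow> c t \<in> X" and nn: "\<And>s t. dst (c s) (c t) \<ge> 0"
    and L: "\<And>s t. s \<in> {0..T} \<Longrightarrow> t \<in> {0..T} \<Longrightarrow> dst (c s) (c t) \<le> B * \<bar>s - t\<bar>"
  shows "cont_curve T X dst c"
  unfolding cont_curve_def
proof (intro conjI ballI X)
  fix t assume t: "t \<in> {0..T}"
  have "((\<lambda>s. B * \<bar>s - t\<bar>) \<longlongrightarrow> B * \<bar>t - t\<bar>) (at t within {0..T})" by (intro tendsto_intros)
  then have z: "((\<lambda>s. B * \<bar>s - t\<bar>) \<longlongrightarrow> 0) (at t within {0..T})" by simp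
  show "((\<lambda>s. dst (c s) (c t)) \<longlongrightarrow> 0) (at t within {0..T})"
    by (rule Lim_null_comparison[OF _ z]) (use L[OF _ t] nn in \<open>auto simp: eventually_at_filter\<close>)
qed

text \<open>Lagrangian description of a solution: \<open>f (t, u, x)\<close> is the position at time
  t of the particle that starts at u in the fibre of x, and \<open>\<sigma>\<close> is the law of
  the particles.\<close>

locale mean_field_flow = mean_field +
  fixes T :: real and \<nu> :: "(real \<times> 'a) measure" and \<sigma> :: "real \<Rightarrow> (real \<times> 'a) measure"
    and f :: "real \<times> real \<times> 'a \<Rightarrow> real" and K :: real
  assumes T_pos: "T > 0" and \<nu>: "\<nu> \<in> P2 \<mu>"
    and f_meas: "f \<in> borel_measurable borel"
    and \<sigma>_push: "\<And>t. \<sigma> t = distr \<nu> borel (\<lambda>q. (f (t, q), snd q))"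
    and f_0: "\<And>q. f (0, q) = fst q"
    and K_pos: "K > 0" and f_bound: "\<And>t q. t \<in> {0..T} \<Longrightarrow> \<bar>f (t, q)\<bar> \<le> K * (1 + \<bar>fst q\<bar>)"
    and f_deriv: "\<And>t u x. t \<in> {0..T} \<Longrightarrow>
       ((\<lambda>t. f (t, u, x)) has_real_derivative vel (\<sigma> t) t (f (t, u, x)) x) (at t within {0..T})"
    and \<sigma>_cont: "cont_curve T (P2 \<mu>) (L2d2 \<mu>) \<sigma>"

text \<open>The Picard fixed point solves only an integral equation. Its Lipschitz continuity in
  time makes \<open>\<sigma>\<close> continuous in \<open>L2d2\<close>, hence the velocity
  continuous along trajectories, and then the integral equation can be differentiated.\<close>

lemma (in mean_field) exists_flow:
  assumes \<nu>: "\<nu> \<in> P2 \<mu>" and T: "T > 0"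
  shows "\<exists>\<sigma> f K. mean_field_flow \<mu> \<Psi> k C T \<nu> \<sigma> f K"
proof -
  interpret N: prob_space \<nu> by (rule P2D[OF \<nu>])
  obtain f where fa: "admissible \<nu> f" and fp: "\<And>t u x. t \<ge> 0 \<Longrightarrow> f (t, u, x) = picard \<nu> f (t, u, x)"
    using picard_fixed_point[OF \<nu>] by blast
  have fm: "f \<in> borel_measurable borel" using fa by (simp add: admissible_def[OF \<nu>])
  define G where "G = growth \<nu>"
  have G: "G > 0" unfolding G_def by (rule growth_pos[OF \<nu>])
  define K where "K = exp (G * T)"
  have fb: "\<bar>f (t, q)\<bar> \<le> K * (1 + \<bar>fst q\<bar>)" if "t \<in> {0..T}" for t q
  proof -
    have "\<bar>f (t, q)\<bar> \<le> exp (G * t) * (1 + \<bar>fst q\<bar>)" using admissibleD[OF \<nu> fa, of t q] that by (simp add: G_def)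
    also have "\<dots> \<le> K * (1 + \<bar>fst q\<bar>)" unfolding K_def using that G by (intro mult_right_mono) auto
    finally show ?thesis .
  qed
  have ftm: "(\<lambda>q. f (t, q)) \<in> borel_measurable borel" for t by (rule section_measurable[OF \<nu> fm])
  have fsq: "integrable \<nu> (\<lambda>q. (f (t, q))\<^sup>2)" if "t \<in> {0..T}" for t
    by (rule linear_growth_integrable(1)[OF \<nu> ftm fb[OF that]]) (simp add: K_def)
  define \<sigma> where "\<sigma> t = distr \<nu> borel (\<lambda>q. (f (t, q), snd q))" for t
  have P: "\<sigma> t \<in> P2 \<mu>" if "t \<in> {0..T}" for t
    unfolding \<sigma>_def by (rule P2_push[OF \<nu> ftm fsq[OF that] moment_\<mu>])
  \<comment> \<open>The drift of an admissible map is at most G K (1 + |u|) on [0,T]. The weight 1 +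
    |u| is kept because it is square integrable against \<open>\<nu>\<close>.\<close>
  have lip: "\<bar>f (s, q) - f (t, q)\<bar> \<le> (G * K * \<bar>s - t\<bar>) * (1 + \<bar>fst q\<bar>)" if st: "s \<in> {0..T}" "t \<in> {0..T}" for s t q
  proof -
    have *: "\<bar>f (t, q) - f (s, q)\<bar> \<le> (G * K * \<bar>s - t\<bar>) * (1 + \<bar>fst q\<bar>)" if st: "0 \<le> s" "s \<le> t" "t \<le> T" for s t
    proof -
      have i: "set_integrable lborel {0..t} (\<lambda>s. drift \<nu> f (s, q))"
        using drift_integrable(1)[OF \<nu> fa, of t "fst q" "snd q"] st by simp
      have "f (t, q) - f (s, q) = (LINT \<tau>:{s..t}|lborel. drift \<nu> f (\<tau>, q))"
        using fp[of t "fst q" "snd q"] fp[of s "fst q" "snd q"] st set_integral_increment[OF i st(1,2)] by (simp add: picard_def)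
      also have "\<bar>\<dots>\<bar> \<le> (G * K * (1 + \<bar>fst q\<bar>)) * (t - s)"
      proof (rule set_integral_Icc_bound)
        show "set_integrable lborel {s..t} (\<lambda>s. drift \<nu> f (s, q))" by (rule set_integrable_subset[OF i]) (use st in auto)
        show "\<bar>drift \<nu> f (\<tau>, q)\<bar> \<le> G * K * (1 + \<bar>fst q\<bar>)" if "\<tau> \<in> {s..t}" for \<tau>
          using drift_bound[OF \<nu> fm fb, of \<tau> "fst q" "snd q"] that st by (simp add: G_def K_def)
      qed (use st in simp)
      finally show ?thesis using st by (simp add: mult_ac)
    qed
    show ?thesis
      using *[of s t] *[of t s] st by (cases "s \<le> t") (auto simp: abs_minus_commute)
  qed
  have cc: "cont_curve T (P2 \<mu>) (L2d2 \<mu>) \<sigma>"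
  proof (rule cont_curve_lipschitz[OF P L2d2_nonneg])
    fix s t assume st: "s \<in> {0..T}" "t \<in> {0..T}"
    have dm: "(\<lambda>q. f (s, q) - f (t, q)) \<in> borel_measurable borel" using ftm by measurable
    have A: "G * K * \<bar>s - t\<bar> \<ge> 0" using G by (simp add: K_def)
    note lg = linear_growth_integrable[OF \<nu> dm lip[OF st] A]
    have "L2d2 \<mu> (\<sigma> s) (\<sigma> t) \<le> sqrt (\<integral>q. (f (s, q) - f (t, q))\<^sup>2 \<partial>\<nu>)"
      unfolding \<sigma>_def
    proof (rule L2d2_push[OF \<nu> sets_\<mu> prob_\<mu> moment_\<mu> ftm fsq[OF st(1)] ftm fsq[OF st(2)]])
      show "(\<integral>\<^sup>+q. ennreal ((f (s, q) - f (t, q))\<^sup>2) \<partial>\<nu>) \<le> ennreal ((sqrt (\<integral>q. (f (s, q) - f (t, q))\<^sup>2 \<partial>\<nu>))\<^sup>2)"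
        using lg(1) by (subst nn_integral_eq_integral) (auto intro!: integral_nonneg_AE)
    qed (auto intro!: integral_nonneg_AE)
    also have "\<dots> \<le> G * K * sqrt (\<integral>q. (1 + \<bar>fst q\<bar>)\<^sup>2 \<partial>\<nu>) * \<bar>s - t\<bar>"
      using lg(2) by (simp add: mult_ac)
    finally show "L2d2 \<mu> (\<sigma> s) (\<sigma> t) \<le> G * K * sqrt (\<integral>q. (1 + \<bar>fst q\<bar>)\<^sup>2 \<partial>\<nu>) * \<bar>s - t\<bar>" .
  qed
  have dv: "drift \<nu> f (t, u, x) = vel (\<sigma> t) t (f (t, u, x)) x" for t u x
    unfolding \<sigma>_def vel_push[OF \<nu> ftm] by (simp add: drift_def)
  have fc: "continuous_on {0..T} (\<lambda>t. f (t, u, x))" for u x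
    unfolding continuous_on_def
  proof
    fix t assume t: "t \<in> {0..T}"
    have "((\<lambda>s. (G * K * \<bar>s - t\<bar>) * (1 + \<bar>u\<bar>)) \<longlongrightarrow> (G * K * \<bar>t - t\<bar>) * (1 + \<bar>u\<bar>)) (at t within {0..T})" by (intro tendsto_intros)
    then have z: "((\<lambda>s. (G * K * \<bar>s - t\<bar>) * (1 + \<bar>u\<bar>)) \<longlongrightarrow> 0) (at t within {0..T})" by simp
    have "((\<lambda>s. f (s, u, x) - f (t, u, x)) \<longlongrightarrow> 0) (at t within {0..T})"
      by (rule Lim_null_comparison[OF _ z]) (use lip[OF _ t, of _ "(u, x)"] in \<open>auto simp: eventually_at_filter\<close>)
    then show "((\<lambda>t. f (t, u, x)) \<longlongrightarrow> f (t, u, x)) (at t within {0..T})" by (simp add: LIM_zero_iff)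
  qed
  have fd: "((\<lambda>t. f (t, u, x)) has_real_derivative vel (\<sigma> t) t (f (t, u, x)) x) (at t within {0..T})"
    if t: "t \<in> {0..T}" for t u x
  proof -
    let ?v = "\<lambda>t. vel (\<sigma> t) t (f (t, u, x)) x"
    have c: "continuous_on {0..T} ?v" by (rule vel_continuous[OF cc fc])
    have d: "((\<lambda>t. u + integral {0..t} ?v) has_real_derivative ?v t) (at t within {0..T})"
      using integral_has_real_derivative[OF c t] by (auto intro!: derivative_eq_intros)
    \<comment> \<open>The Picard equation is written with a Lebesgue integral; for the integrand now
      known to be continuous it equals the Henstock-Kurzweil integral whose derivative was just
      computed.\<close>
    have e: "f (s, u, x) = u + integral {0..s} ?v" if "s \<in> {0..T}" for s
    proof -
      have "set_integrable lborel {0..s} ?v"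
        by (rule borel_integrable_atLeastAtMost', rule continuous_on_subset[OF c]) (use that in auto)
      then show ?thesis
        using fp[of s u x] that set_borel_integral_eq_integral(2)[of "{0..s}" ?v] by (simp add: picard_def dv)
    qed
    show ?thesis
      by (rule has_field_derivative_transform_within[OF d zero_less_one t]) (use e in simp)
  qed
  have "mean_field_flow \<mu> \<Psi> k C T \<nu> \<sigma> f K"
  proof unfold_locales
    show "f (0, q) = fst q" for q
      using fp[of 0 "fst q" "snd q"] drift_integrable(2)[OF \<nu> fa, of 0 "fst q" "snd q"] by (simp add: picard_def)
  qed (use T \<nu> fm fb fd cc in \<open>auto simp: K_def \<sigma>_def\<close>)
  then show ?thesis by blast
qed

section \<open>The flow solves the weak equation\<close>

lemma Fubini_Icc:
  fixes h :: "real \<times> 'b::second_countable_topology \<Rightarrow> real"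
  assumes N: "prob_space N" "sets N = sets borel" and h[measurable]: "h \<in> borel_measurable borel"
    and B: "integrable N B" and b: "\<And>t q. t \<in> {s..s'} \<Longrightarrow> \<bar>h (t, q)\<bar> \<le> B q"
  shows "(LINT t:{s..s'}|lborel. \<integral>q. h (t, q) \<partial>N) = (\<integral>q. (LINT t:{s..s'}|lborel. h (t, q)) \<partial>N)"
    and "set_integrable lborel {s..s'} (\<lambda>t. \<integral>q. h (t, q) \<partial>N)"
    and "integrable N (\<lambda>q. LINT t:{s..s'}|lborel. h (t, q))"
proof -
  interpret N: prob_space N by fact
  interpret P: pair_sigma_finite "lborel :: real measure" N ..
  define H where "H p = indicator {s..s'} (fst p) * h p" for p
  have Hm: "H \<in> borel_measurable borel" unfolding H_def by measurable
  have "sets (lborel \<Otimes>\<^sub>M N) = sets (borel :: (real \<times> 'b) measure)"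
    using sets_pair_measure_cong[OF sets_lborel N(2)] by (simp only: borel_prod)
  then have HP: "H \<in> borel_measurable (lborel \<Otimes>\<^sub>M N)" using Hm by (simp cong: measurable_cong_sets)
  have hN: "(\<lambda>q. h (t, q)) \<in> borel_measurable N" for t
    using measurable_compose[of "\<lambda>q. (t, q)" borel borel h borel] N(2) by (simp cong: measurable_cong_sets)
  have hi: "integrable N (\<lambda>q. h (t, q))" if "t \<in> {s..s'}" for t
    by (rule Bochner_Integration.integrable_bound[OF B hN]) (use b[OF that] in \<open>auto intro!: order_trans[OF b[OF that]]\<close>)
  have i: "integrable (lborel \<Otimes>\<^sub>M N) H"
  proof (rule P.Fubini_integrable[OF HP])
    show "AE t in lborel. integrable N (\<lambda>q. H (t, q))"
      using hi by (intro AE_I2) (auto simp: H_def indicator_def)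
    show "integrable lborel (\<lambda>t. \<integral>q. norm (H (t, q)) \<partial>N)"
    proof (rule Bochner_Integration.integrable_bound)
      show "integrable lborel (\<lambda>t. indicator {s..s'} t * (\<integral>q. B q \<partial>N))"
        using borel_integrable_atLeastAtMost'[of s s' "\<lambda>_. \<integral>q. B q \<partial>N"] by (simp add: set_integrable_def)
      show "(\<lambda>t. \<integral>q. norm (H (t, q)) \<partial>N) \<in> borel_measurable lborel"
        using measurable_integral_parameter[of N "\<lambda>t q. norm (H (t, q))"] N Hm N.sigma_finite_measure_axioms by simp
      show "AE t in lborel. norm (\<integral>q. norm (H (t, q)) \<partial>N) \<le> norm (indicator {s..s'} t * (\<integral>q. B q \<partial>N))"
      proof (rule AE_I2)
        fix t
        show "norm (\<integral>q. norm (H (t, q)) \<partial>N) \<le> norm (indicator {s..s'} t * (\<integral>q. B q \<partial>N))"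
        proof (cases "t \<in> {s..s'}")
          case True
          then have "(\<integral>q. norm (H (t, q)) \<partial>N) \<le> (\<integral>q. B q \<partial>N)"
            using hi[OF True] b B by (intro integral_mono) (auto simp: H_def)
          moreover have "0 \<le> (\<integral>q. norm (H (t, q)) \<partial>N)" by (intro integral_nonneg_AE) auto
          ultimately show ?thesis using True by simp
        qed (simp add: H_def)
      qed
    qed
  qed
  have e: "(\<integral>q. H (t, q) \<partial>N) = indicator {s..s'} t *\<^sub>R (\<integral>q. h (t, q) \<partial>N)" for t
    by (simp add: H_def)
  show "set_integrable lborel {s..s'} (\<lambda>t. \<integral>q. h (t, q) \<partial>N)"
    using P.integrable_fst'[OF i] unfolding set_integrable_def e .
  show "integrable N (\<lambda>q. LINT t:{s..s'}|lborel. h (t, q))"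
    using P.integrable_snd[of "\<lambda>t q. H (t, q)", unfolded case_prod_eta, OF i] unfolding set_lebesgue_integral_def by (simp add: H_def)
  show "(LINT t:{s..s'}|lborel. \<integral>q. h (t, q) \<partial>N) = (\<integral>q. (LINT t:{s..s'}|lborel. h (t, q)) \<partial>N)"
    using P.Fubini_integral[of "\<lambda>t q. H (t, q)", unfolded case_prod_eta, OF i] unfolding set_lebesgue_integral_def by (simp add: H_def)
qed

text \<open>Extends objects given on [0,T] to all times, so that measurability can be stated on the
  whole space.\<close>

definition clamp :: "real \<Rightarrow> real \<Rightarrow> real" where
  "clamp T t = max 0 (min T t)"

lemma clamp: "T \<ge> 0 \<Longrightarrow> clamp T t \<in> {0..T}" "t \<in> {0..T} \<Longrightarrow> clamp T t = t"
  by (auto simp: clamp_def)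

lemma clamp_continuous[continuous_intros]: "continuous_on S g \<Longrightarrow> continuous_on S (\<lambda>x. clamp T (g x))"
  unfolding clamp_def by (intro continuous_intros)

text \<open>On the compact closed support continuity gives the bounds. Off it \<open>\<phi>\<close>
  vanishes on a neighbourhood within the slab, so uniqueness of derivatives, one-sided in time at
  the end points, makes the partial derivatives in t and \<xi> vanish.\<close>

lemma C1c_test_facts:
  fixes \<phi> :: "real \<times> real \<times> 'a::euclidean_space \<Rightarrow> real"
  assumes T: "T > 0" and \<phi>: "C1c_test T \<phi> \<phi>'"
  shows "(\<lambda>p. \<phi> (clamp T (fst p), snd p)) \<in> borel_measurable borel"
    and "(\<lambda>p. blinfun_apply (\<phi>' (clamp T (fst p), snd p)) v) \<in> borel_measurable borel"
    and "\<exists>M. \<forall>p\<in>{0..T}\<times>UNIV. \<bar>\<phi> p\<bar> \<le> M \<and> \<bar>blinfun_apply (\<phi>' p) (1, 0, 0)\<bar> \<le> M \<and> \<bar>blinfun_apply (\<phi>' p) (0, 1, 0)\<bar> \<le> M"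
proof -
  let ?S = "{0..T} \<times> (UNIV :: (real \<times> 'a) set)"
  from \<phi> have c': "continuous_on ?S \<phi>'" and d: "\<And>p. p \<in> ?S \<Longrightarrow> (\<phi> has_derivative blinfun_apply (\<phi>' p)) (at p within ?S)"
    and K: "compact (closure {p \<in> ?S. \<phi> p \<noteq> 0})" by (auto simp: C1c_test_def)
  have c: "continuous_on ?S \<phi>" using d by (rule has_derivative_continuous_on)
  have cl: "continuous_on UNIV (\<lambda>p::real \<times> real \<times> 'a. (clamp T (fst p), snd p))"
    by (intro continuous_intros)
  have im: "range (\<lambda>p::real \<times> real \<times> 'a. (clamp T (fst p), snd p)) \<subseteq> ?S" using clamp(1)[of T] T by auto
  show "(\<lambda>p. \<phi> (clamp T (fst p), snd p)) \<in> borel_measurable borel"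
    by (rule borel_measurable_continuous_onI) (rule continuous_on_compose2[OF c cl im])
  have c'2: "continuous_on UNIV (\<lambda>p. \<phi>' (clamp T (fst p), snd p))" by (rule continuous_on_compose2[OF c' cl im])
  show "(\<lambda>p. blinfun_apply (\<phi>' (clamp T (fst p), snd p)) v) \<in> borel_measurable borel"
    by (rule borel_measurable_continuous_onI) (intro continuous_intros c'2)
  define Z where "Z = closure {p \<in> ?S. \<phi> p \<noteq> 0}"
  have ZS: "Z \<subseteq> ?S" unfolding Z_def by (rule closure_minimal) (auto intro!: closed_Times)
  have Zc: "compact Z" using K by (simp add: Z_def)
  have "bounded (\<phi> ` Z)" "bounded (\<phi>' ` Z)"
    by (intro compact_imp_bounded compact_continuous_image Zc continuous_on_subset[OF c ZS] continuous_on_subset[OF c' ZS])+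
  then obtain M1 M2 where M1: "\<And>p. p \<in> Z \<Longrightarrow> norm (\<phi> p) \<le> M1" and M2: "\<And>p. p \<in> Z \<Longrightarrow> norm (\<phi>' p) \<le> M2"
    unfolding bounded_iff by blast
  have out: "\<exists>e>0. \<forall>p'\<in>?S. dist p' p < e \<longrightarrow> \<phi> p' = 0" if "p \<notin> Z" for p
  proof -
    have "open (- Z)" using Zc by (simp add: compact_imp_closed open_Compl)
    moreover have "p \<in> - Z" using that by simp
    ultimately obtain e where e: "e > 0" "ball p e \<subseteq> - Z" by (rule openE)
    have "\<phi> p' = 0" if "p' \<in> ?S" "dist p' p < e" for p'
    proof (rule ccontr)
      assume "\<phi> p' \<noteq> 0"
      then have "p' \<in> Z" using closure_subset[of "{p \<in> ?S. \<phi> p \<noteq> 0}"] that unfolding Z_def by blast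
      then show False using e that by (auto simp: dist_commute)
    qed
    then show ?thesis using e by blast
  qed
  have dt0: "blinfun_apply (\<phi>' p) (1, 0, 0) = 0" if p: "p \<in> ?S" "p \<notin> Z" for p
  proof -
    obtain t \<xi> x where [simp]: "p = (t, \<xi>, x)" by (cases p) auto
    have t: "t \<in> {0..T}" using p by auto
    obtain e where e: "e > 0" "\<And>p'. p' \<in> ?S \<Longrightarrow> dist p' p < e \<Longrightarrow> \<phi> p' = 0" using out[OF p(2)] by blast
    have "((\<lambda>s. (s, \<xi>, x)) has_derivative (\<lambda>h. (h, 0, 0))) (at t within {0..T})"
      by (auto intro!: derivative_eq_intros simp: zero_prod_def)
    from has_derivative_in_compose2[of ?S \<phi> "\<lambda>p. blinfun_apply (\<phi>' p)", OF d _ t this]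
    have "((\<lambda>s. \<phi> (s, \<xi>, x)) has_derivative (\<lambda>h. blinfun_apply (\<phi>' p) (h, 0, 0))) (at t within {0..T})"
      by auto
    moreover have "(\<lambda>h. blinfun_apply (\<phi>' p) (h, 0, 0)) = (\<lambda>h. h *\<^sub>R blinfun_apply (\<phi>' p) (1, 0, 0))"
    proof
      fix h :: real
      show "blinfun_apply (\<phi>' p) (h, 0, 0) = h *\<^sub>R blinfun_apply (\<phi>' p) (1, 0, 0)"
        using blinfun.scaleR_right[of "\<phi>' p" h "(1, 0, 0)"] by simp
    qed
    ultimately have 1: "((\<lambda>s. \<phi> (s, \<xi>, x)) has_vector_derivative blinfun_apply (\<phi>' p) (1, 0, 0)) (at t within {0..T})"
      by (simp add: has_vector_derivative_def)
    have "((\<lambda>s. 0) has_vector_derivative (0::real)) (at t within {0..T})" by simp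
    then have 2: "((\<lambda>s. \<phi> (s, \<xi>, x)) has_vector_derivative 0) (at t within {0..T})"
      by (rule has_vector_derivative_transform_within[OF _ e(1) t]) (use e(2) in \<open>auto simp: dist_Pair_Pair\<close>)
    show ?thesis using vector_derivative_unique_within_closed_interval[unfolded cbox_interval, OF T t 1 2] .
  qed
  have dx0: "blinfun_apply (\<phi>' p) (0, 1, 0) = 0" if p: "p \<in> ?S" "p \<notin> Z" for p
  proof -
    obtain t \<xi> x where [simp]: "p = (t, \<xi>, x)" by (cases p) auto
    have t: "t \<in> {0..T}" using p by auto
    obtain e where e: "e > 0" "\<And>p'. p' \<in> ?S \<Longrightarrow> dist p' p < e \<Longrightarrow> \<phi> p' = 0" using out[OF p(2)] by blast
    \<comment> \<open>A partial derivative in \<xi> is determined on any nondegenerate closed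
      interval, so the uniqueness argument used for t applies again at the left end point of this
      one.\<close>
    have "((\<lambda>s. (t, s, x)) has_derivative (\<lambda>h. (0, h, 0))) (at \<xi> within {\<xi>..\<xi>+1})"
      by (auto intro!: derivative_eq_intros simp: zero_prod_def)
    moreover have "(\<lambda>s. (t, s, x)) ` {\<xi>..\<xi>+1} \<subseteq> ?S" using t by auto
    ultimately have "((\<lambda>s. \<phi> (t, s, x)) has_derivative (\<lambda>h. blinfun_apply (\<phi>' p) (0, h, 0))) (at \<xi> within {\<xi>..\<xi>+1})"
      using has_derivative_in_compose2[of ?S \<phi> "\<lambda>p. blinfun_apply (\<phi>' p)" "\<lambda>s. (t, s, x)" "{\<xi>..\<xi>+1}" \<xi>, OF d] by simp
    moreover have "(\<lambda>h. blinfun_apply (\<phi>' p) (0, h, 0)) = (\<lambda>h. h *\<^sub>R blinfun_apply (\<phi>' p) (0, 1, 0))"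
    proof
      fix h :: real
      show "blinfun_apply (\<phi>' p) (0, h, 0) = h *\<^sub>R blinfun_apply (\<phi>' p) (0, 1, 0)"
        using blinfun.scaleR_right[of "\<phi>' p" h "(0, 1, 0)"] by simp
    qed
    ultimately have 1: "((\<lambda>s. \<phi> (t, s, x)) has_vector_derivative blinfun_apply (\<phi>' p) (0, 1, 0)) (at \<xi> within {\<xi>..\<xi>+1})"
      by (simp add: has_vector_derivative_def)
    have "((\<lambda>s. 0) has_vector_derivative (0::real)) (at \<xi> within {\<xi>..\<xi>+1})" by simp
    then have 2: "((\<lambda>s. \<phi> (t, s, x)) has_vector_derivative 0) (at \<xi> within {\<xi>..\<xi>+1})"
      by (rule has_vector_derivative_transform_within[OF _ e(1)]) (use e(2) t in \<open>auto simp: dist_Pair_Pair\<close>)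
    show ?thesis using vector_derivative_unique_within_closed_interval[unfolded cbox_interval, OF _ _ 1 2] by simp
  qed
  have n1: "norm (1::real, 0::real, 0::'a) = 1" "norm (0::real, 1::real, 0::'a) = 1" by (simp_all add: norm_Pair)
  have "\<bar>\<phi> p\<bar> \<le> max 0 (max M1 M2) \<and> \<bar>blinfun_apply (\<phi>' p) (1, 0, 0)\<bar> \<le> max 0 (max M1 M2) \<and> \<bar>blinfun_apply (\<phi>' p) (0, 1, 0)\<bar> \<le> max 0 (max M1 M2)"
    if p: "p \<in> ?S" for p
  proof (cases "p \<in> Z")
    case True
    have "norm (blinfun_apply (\<phi>' p) (1, 0, 0)) \<le> M2" "norm (blinfun_apply (\<phi>' p) (0, 1, 0)) \<le> M2"
      using norm_blinfun[of "\<phi>' p" "(1, 0, 0)"] norm_blinfun[of "\<phi>' p" "(0, 1, 0)"] M2[OF True] by (simp_all add: n1)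
    then show ?thesis using M1[OF True] by auto
  next
    case False
    then have "\<phi> p = 0" using out[OF False] p by (metis dist_self)
    then show ?thesis using dt0[OF p False] dx0[OF p False] by simp
  qed
  then show "\<exists>M. \<forall>p\<in>{0..T}\<times>UNIV. \<bar>\<phi> p\<bar> \<le> M \<and> \<bar>blinfun_apply (\<phi>' p) (1, 0, 0)\<bar> \<le> M \<and> \<bar>blinfun_apply (\<phi>' p) (0, 1, 0)\<bar> \<le> M"
    by blast
qed

context mean_field begin

text \<open>Weak equation after the inner integral has been collapsed into \<open>vel\<close>; the
  minus sign on the right undoes the one inside \<open>vel\<close>.\<close>

definition CE_solution :: "real \<Rightarrow> (real \<times> 'a) measure \<Rightarrow> (real \<Rightarrow> (real \<times> 'a) measure) \<Rightarrow> bool" where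
  "CE_solution T \<sigma>\<^sub>0 \<sigma> \<longleftrightarrow> \<sigma> 0 = \<sigma>\<^sub>0 \<and> (\<forall>\<phi> \<phi>'. C1c_test T \<phi> \<phi>' \<longrightarrow>
     (LINT t:{0..T}|lborel. LINT p|\<sigma> t. blinfun_apply (\<phi>' (t, p)) (1, 0, 0))
       + (LINT p|\<sigma>\<^sub>0. \<phi> (0, p)) - (LINT p|\<sigma> T. \<phi> (T, p))
     = - (LINT t:{0..T}|lborel. LINT p|\<sigma> t. blinfun_apply (\<phi>' (t, p)) (0, 1, 0) * vel (\<sigma> t) t (fst p) (snd p)))"

lemma vel_bound:
  assumes N: "N \<in> P2 \<mu>"
  shows "\<bar>vel N t \<xi> x\<bar> \<le> C * (\<bar>\<xi>\<bar> + sqrt (\<integral>q. (fst q)\<^sup>2 \<partial>N))"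
  using \<Psi>_integral_diff[OF N fst_borel P2D(5)[OF N], of "\<lambda>_. 0" t \<xi> x 0] by (simp add: vel_def \<Psi>_zero)

end

context mean_field_flow begin

lemma \<sigma>_P2: "t \<in> {0..T} \<Longrightarrow> \<sigma> t \<in> P2 \<mu>"
  using \<sigma>_cont by (simp add: cont_curve_def)

lemma f_section: "(\<lambda>q. f (t, q)) \<in> borel_measurable borel"
  by (rule section_measurable[OF \<nu> f_meas])

lemma flow_pair_measurable: "(\<lambda>q. (f (t, q), snd q)) \<in> \<nu> \<rightarrow>\<^sub>M borel"
  using f_section[of t] P2D(2)[OF \<nu>] by (intro borel_measurable_Pair) (simp_all add: snd_borel cong: measurable_cong_sets)

lemma integral_\<sigma>:
  "h \<in> borel_measurable borel \<Longrightarrow> (\<integral>p. h p \<partial>\<sigma> t) = (\<integral>q. h (f (t, q), snd q) \<partial>\<nu>)" for h :: "_ \<Rightarrow> real"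
  unfolding \<sigma>_push by (rule integral_distr[OF flow_pair_measurable])

lemma \<sigma>_0: "\<sigma> 0 = \<nu>"
  unfolding \<sigma>_push f_0 using distr_id2[of borel \<nu>] P2D(2)[OF \<nu>] by (simp add: id_def)

lemma flow_vel_eq: "vel (\<sigma> t) t \<xi> x = - (\<integral>q. \<Psi> t \<xi> (f (t, q)) x (snd q) \<partial>\<nu>)"
  unfolding \<sigma>_push by (rule vel_push[OF \<nu> f_section])

lemma flow_vel_measurable: "(\<lambda>p. vel (\<sigma> (fst p)) (fst p) (fst (snd p)) (snd (snd p))) \<in> borel_measurable borel"
  unfolding flow_vel_eq
proof (intro borel_measurable_uminus measurable_integral_parameter)
  interpret prob_space \<nu> by (rule P2D[OF \<nu>])
  show "sigma_finite_measure \<nu>" ..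
  show "sets \<nu> = sets borel" by (rule P2D[OF \<nu>])
  note f_meas[measurable]
  show "(\<lambda>p. \<Psi> (fst (fst p)) (fst (snd (fst p))) (f (fst (fst p), snd p)) (snd (snd (fst p))) (snd (snd p))) \<in> borel_measurable borel"
    by measurable
qed

lemma flow_vel_bound: "\<exists>B>0. \<forall>t\<in>{0..T}. \<forall>\<xi> x. \<bar>vel (\<sigma> t) t \<xi> x\<bar> \<le> B * (1 + \<bar>\<xi>\<bar>)"
proof -
  let ?m = "K * sqrt (\<integral>q. (1 + \<bar>fst q\<bar>)\<^sup>2 \<partial>\<nu>)"
  have m: "?m \<ge> 0" using K_pos by (auto intro!: integral_nonneg_AE mult_nonneg_nonneg)
  show ?thesis
  proof (intro exI[of _ "C * (1 + ?m)"] conjI ballI allI)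
    show "C * (1 + ?m) > 0" using C_pos m by (intro mult_pos_pos) auto
    fix t \<xi> and x :: 'a assume t: "t \<in> {0..T}"
    have "sqrt (\<integral>q. (fst q)\<^sup>2 \<partial>\<sigma> t) = sqrt (\<integral>q. (f (t, q))\<^sup>2 \<partial>\<nu>)"
      by (subst integral_\<sigma>) auto
    also have "\<dots> \<le> ?m" by (rule linear_growth_integrable(2)[OF \<nu> f_section f_bound[OF t]]) (use K_pos in simp)
    finally have "\<bar>vel (\<sigma> t) t \<xi> x\<bar> \<le> C * (\<bar>\<xi>\<bar> + ?m)"
      using vel_bound[OF \<sigma>_P2[OF t], of t \<xi> x] C_pos by (auto elim!: order_trans intro!: mult_left_mono)
    also have "\<dots> \<le> C * ((1 + ?m) * (1 + \<bar>\<xi>\<bar>))"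
    proof (intro mult_left_mono)
      have "a + b \<le> (1 + b) * (1 + a)" if "a \<ge> 0" "b \<ge> 0" for a b :: real
        using that by (simp add: algebra_simps)
      from this[OF abs_ge_zero m] show "\<bar>\<xi>\<bar> + ?m \<le> (1 + ?m) * (1 + \<bar>\<xi>\<bar>)" .
    qed (use C_pos in simp)
    finally show "\<bar>vel (\<sigma> t) t \<xi> x\<bar> \<le> C * (1 + ?m) * (1 + \<bar>\<xi>\<bar>)" by (simp add: mult.assoc)
  qed
qed

lemma flow_continuous: "continuous_on {0..T} (\<lambda>t. f (t, u, x))"
  using f_deriv by (rule DERIV_continuous_on)

text \<open>Along a trajectory the chain rule gives \<open>a + b\<close> as the derivative of the
  test function. Integration over [0,T], then over \<open>\<nu>\<close>, and an exchange of the two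
  integrals turn this into the weak equation.\<close>

lemma flow_CE_solution: "CE_solution T \<nu> \<sigma>"
  unfolding CE_solution_def
proof (intro conjI allI impI \<sigma>_0)
  fix \<phi> :: "real \<times> real \<times> 'a \<Rightarrow> real" and \<phi>' assume \<phi>: "C1c_test T \<phi> \<phi>'"
  let ?S = "{0..T} \<times> (UNIV :: (real \<times> 'a) set)"
  have c': "continuous_on ?S \<phi>'" and d: "\<And>p. p \<in> ?S \<Longrightarrow> (\<phi> has_derivative blinfun_apply (\<phi>' p)) (at p within ?S)"
    using \<phi> by (auto simp: C1c_test_def)
  note facts = C1c_test_facts[OF T_pos \<phi>]
  note facts(1,2)[measurable] f_meas[measurable] flow_vel_measurable[measurable]
  obtain M where M: "\<And>p. p \<in> ?S \<Longrightarrow> \<bar>\<phi> p\<bar> \<le> M \<and> \<bar>blinfun_apply (\<phi>' p) (1, 0, 0)\<bar> \<le> M \<and> \<bar>blinfun_apply (\<phi>' p) (0, 1, 0)\<bar> \<le> M"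
    using facts(3) by blast
  have M0: "M \<ge> 0" using M[of "(0, 0, 0)"] T_pos by force
  obtain B where B: "B > 0" "\<And>t \<xi> x. t \<in> {0..T} \<Longrightarrow> \<bar>vel (\<sigma> t) t \<xi> x\<bar> \<le> B * (1 + \<bar>\<xi>\<bar>)"
    using flow_vel_bound by blast
  interpret N: prob_space \<nu> by (rule P2D[OF \<nu>])
  \<comment> \<open>Clamping makes a and b Borel in all variables; on [0,T] they are the two terms
    of the chain rule.\<close>
  define a where "a p = blinfun_apply (\<phi>' (clamp T (fst p), f p, snd (snd p))) (1, 0, 0)" for p
  define b where "b p = blinfun_apply (\<phi>' (clamp T (fst p), f p, snd (snd p))) (0, 1, 0) * vel (\<sigma> (fst p)) (fst p) (f p) (snd (snd p))" for p
  have meas_comp: "(\<lambda>p. h (fst p, f p, snd (snd p))) \<in> borel_measurable borel" if "h \<in> borel_measurable borel" for h :: "real \<times> real \<times> 'a \<Rightarrow> real"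
    by (rule measurable_compose[of "\<lambda>p. (fst p, f p, snd (snd p))" borel borel h borel]) (use that in \<open>auto intro!: borel_measurable_Pair f_meas\<close>)
  have am: "a \<in> borel_measurable borel"
    using meas_comp[OF facts(2)[of "(1, 0, 0)"]] by (simp add: a_def[abs_def])
  have bm: "b \<in> borel_measurable borel"
    using borel_measurable_times[OF meas_comp[OF facts(2)[of "(0, 1, 0)"]] meas_comp[OF flow_vel_measurable]] by (simp add: b_def[abs_def])
  have ab: "\<bar>a (t, q)\<bar> \<le> M" if "t \<in> {0..T}" for t q
    using M[of "(t, f (t, q), snd q)"] that by (simp add: a_def clamp(2))
  have bb: "\<bar>b (t, q)\<bar> \<le> M * (B * (1 + K * (1 + \<bar>fst q\<bar>)))" if "t \<in> {0..T}" for t q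
  proof -
    have "\<bar>vel (\<sigma> t) t (f (t, q)) (snd q)\<bar> \<le> B * (1 + K * (1 + \<bar>fst q\<bar>))"
      using B(2)[OF that, of "f (t, q)" "snd q"] f_bound[OF that, of q] B(1) by (auto elim!: order_trans intro!: mult_left_mono)
    then show ?thesis
      using M[of "(t, f (t, q), snd q)"] that M0 by (auto simp: b_def clamp(2) abs_mult intro!: mult_mono)
  qed
  have ib: "integrable \<nu> (\<lambda>q. M * (B * (1 + K * (1 + \<bar>fst q\<bar>))))" using P2D(6)[OF \<nu>] by auto
  have ia: "integrable \<nu> (\<lambda>_. M)" by simp
  note Fa = Fubini_Icc[OF P2D(1,2)[OF \<nu>] am ia ab] and Fb = Fubini_Icc[OF P2D(1,2)[OF \<nu>] bm ib bb]
  have ftc: "(LINT t:{0..T}|lborel. a (t, q)) + (LINT t:{0..T}|lborel. b (t, q)) = \<phi> (T, f (T, q), snd q) - \<phi> (0, q)" for q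
  proof -
    obtain u x where [simp]: "q = (u, x)" by (cases q)
    let ?c = "\<lambda>t. (t, f (t, u, x), x)"
    let ?v = "\<lambda>t. vel (\<sigma> t) t (f (t, u, x)) x"
    have cc: "continuous_on {0..T} ?c" by (intro continuous_intros flow_continuous)
    have ci: "?c ` {0..T} \<subseteq> ?S" by auto
    have cv: "continuous_on {0..T} ?v" by (rule vel_continuous[OF \<sigma>_cont flow_continuous])
    have ca: "continuous_on {0..T} (\<lambda>t. blinfun_apply (\<phi>' (?c t)) w)" for w
      by (intro continuous_intros continuous_on_compose2[OF c' cc ci])
    have "continuous_on {0..T} (\<lambda>t. a (t, q))" "continuous_on {0..T} (\<lambda>t. b (t, q))"
    proof -
      have "continuous_on {0..T} (\<lambda>t. blinfun_apply (\<phi>' (?c t)) (1, 0, 0))" by (rule ca)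
      then show "continuous_on {0..T} (\<lambda>t. a (t, q))" by (rule continuous_on_eq) (simp add: a_def clamp(2))
      have "continuous_on {0..T} (\<lambda>t. blinfun_apply (\<phi>' (?c t)) (0, 1, 0) * ?v t)" by (intro continuous_intros ca cv)
      then show "continuous_on {0..T} (\<lambda>t. b (t, q))" by (rule continuous_on_eq) (simp add: b_def clamp(2))
    qed
    then have ci2: "continuous_on {0..T} (\<lambda>t. a (t, q) + b (t, q))" and sa: "set_integrable lborel {0..T} (\<lambda>t. a (t, q))"
      and sb: "set_integrable lborel {0..T} (\<lambda>t. b (t, q))"
      by (auto intro!: continuous_intros borel_integrable_atLeastAtMost')
    have der: "((\<lambda>t. \<phi> (?c t)) has_vector_derivative a (t, q) + b (t, q)) (at t within {0..T})" if t: "t \<in> {0..T}" for t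
    proof -
      have "((\<lambda>t. f (t, u, x)) has_derivative (\<lambda>h. ?v t * h)) (at t within {0..T})"
        using f_deriv[OF t] by (simp add: has_field_derivative_def)
      then have "(?c has_derivative (\<lambda>h. (h, ?v t * h, 0))) (at t within {0..T})"
        by (intro has_derivative_Pair has_derivative_ident has_derivative_const)
      from has_derivative_in_compose2[of ?S \<phi> "\<lambda>p. blinfun_apply (\<phi>' p)", OF d ci t this]
      have "((\<lambda>t. \<phi> (?c t)) has_derivative (\<lambda>h. blinfun_apply (\<phi>' (?c t)) (h, ?v t * h, 0))) (at t within {0..T})"
        by auto
      moreover have "blinfun_apply (\<phi>' (?c t)) (h, ?v t * h, 0) = h *\<^sub>R (a (t, q) + b (t, q))" for h
      proof -
        have "(h, ?v t * h, 0::'a) = h *\<^sub>R (1, 0, 0) + (h * ?v t) *\<^sub>R (0, 1, 0)" by simp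
        then show ?thesis using t by (simp only: blinfun.add_right blinfun.scaleR_right) (simp add: a_def b_def clamp(2) algebra_simps)
      qed
      ultimately show ?thesis by (simp add: has_vector_derivative_def)
    qed
    have "(LINT t:{0..T}|lborel. a (t, q) + b (t, q)) = \<phi> (?c T) - \<phi> (?c 0)"
      unfolding set_lebesgue_integral_def by (rule integral_FTC_Icc[OF _ _ ci2]) (use T_pos der in auto)
    then show ?thesis using set_integral_add(2)[OF sa sb] f_0[of q] by simp
  qed
  have \<phi>T: "(LINT p|\<sigma> T. \<phi> (T, p)) = (\<integral>q. \<phi> (T, f (T, q), snd q) \<partial>\<nu>)"
  proof -
    have "(\<lambda>p. \<phi> (T, p)) \<in> borel_measurable borel"
      using measurable_compose[of "\<lambda>p. (T, p)" borel borel _ borel, OF _ facts(1)] T_pos by (simp add: clamp(2))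
    then show ?thesis by (rule integral_\<sigma>)
  qed
  have i0: "integrable \<nu> (\<lambda>q. \<phi> (t, f (t, q), snd q))" if "t \<in> {0..T}" for t
  proof (rule N.integrable_const_bound[where B=M])
    show "AE q in \<nu>. norm (\<phi> (t, f (t, q), snd q)) \<le> M" using M that by auto
    have "(\<lambda>q. \<phi> (t, f (t, q), snd q)) \<in> borel_measurable borel"
      using measurable_compose[of "\<lambda>q. (t, q)" borel borel _ borel, OF _ meas_comp[OF facts(1)]] that by (simp add: clamp(2))
    then show "(\<lambda>q. \<phi> (t, f (t, q), snd q)) \<in> borel_measurable \<nu>" by (rule P2D(9)[OF \<nu>])
  qed
  have ea: "(LINT p|\<sigma> t. blinfun_apply (\<phi>' (t, p)) (1, 0, 0)) = (\<integral>q. a (t, q) \<partial>\<nu>)" if "t \<in> {0..T}" for t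
  proof -
    have "(\<lambda>p. blinfun_apply (\<phi>' (t, p)) (1, 0, 0)) \<in> borel_measurable borel"
      using measurable_compose[of "\<lambda>q. (t, q)" borel borel _ borel, OF _ facts(2)[of "(1, 0, 0)"]] that by (simp add: clamp(2))
    then show ?thesis using that by (simp add: integral_\<sigma> a_def clamp(2))
  qed
  have eb: "(LINT p|\<sigma> t. blinfun_apply (\<phi>' (t, p)) (0, 1, 0) * vel (\<sigma> t) t (fst p) (snd p)) = (\<integral>q. b (t, q) \<partial>\<nu>)" if "t \<in> {0..T}" for t
  proof -
    have "(\<lambda>p. blinfun_apply (\<phi>' (t, p)) (0, 1, 0)) \<in> borel_measurable borel"
      using measurable_compose[of "\<lambda>q. (t, q)" borel borel _ borel, OF _ facts(2)[of "(0, 1, 0)"]] that by (simp add: clamp(2))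
    moreover have "(\<lambda>p. vel (\<sigma> t) t (fst p) (snd p)) \<in> borel_measurable borel"
      using measurable_compose[of "\<lambda>q. (t, q)" borel borel _ borel, OF _ flow_vel_measurable] by simp
    ultimately have "(\<lambda>p. blinfun_apply (\<phi>' (t, p)) (0, 1, 0) * vel (\<sigma> t) t (fst p) (snd p)) \<in> borel_measurable borel" by measurable
    then show ?thesis using that by (simp add: integral_\<sigma> b_def clamp(2))
  qed
  have A: "(LINT t:{0..T}|lborel. LINT p|\<sigma> t. blinfun_apply (\<phi>' (t, p)) (1, 0, 0)) = (\<integral>q. (LINT t:{0..T}|lborel. a (t, q)) \<partial>\<nu>)"
    by (rule trans[OF set_lebesgue_integral_cong Fa(1)]) (auto simp: ea)
  have B': "(LINT t:{0..T}|lborel. LINT p|\<sigma> t. blinfun_apply (\<phi>' (t, p)) (0, 1, 0) * vel (\<sigma> t) t (fst p) (snd p)) = (\<integral>q. (LINT t:{0..T}|lborel. b (t, q)) \<partial>\<nu>)"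
    by (rule trans[OF set_lebesgue_integral_cong Fb(1)]) (auto simp: eb)
  have "(\<integral>q. (LINT t:{0..T}|lborel. a (t, q)) \<partial>\<nu>) + (\<integral>q. (LINT t:{0..T}|lborel. b (t, q)) \<partial>\<nu>)
     = (\<integral>q. \<phi> (T, f (T, q), snd q) - \<phi> (0, q) \<partial>\<nu>)"
    using Fa(3) Fb(3) by (simp add: ftc flip: Bochner_Integration.integral_add)
  also have "\<dots> = (\<integral>q. \<phi> (T, f (T, q), snd q) \<partial>\<nu>) - (\<integral>q. \<phi> (0, q) \<partial>\<nu>)"
    using i0[of T] i0[of 0] T_pos by (subst Bochner_Integration.integral_diff) (auto simp: f_0)
  finally show "(LINT t:{0..T}|lborel. LINT p|\<sigma> t. blinfun_apply (\<phi>' (t, p)) (1, 0, 0))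
       + (LINT p|\<nu>. \<phi> (0, p)) - (LINT p|\<sigma> T. \<phi> (T, p))
     = - (LINT t:{0..T}|lborel. LINT p|\<sigma> t. blinfun_apply (\<phi>' (t, p)) (0, 1, 0) * vel (\<sigma> t) t (fst p) (snd p))"
    unfolding A B' \<phi>T by simp
qed

end

text \<open>Compactness of the interval. P stands for an upper bound known at t and near t by metric
  continuity of a curve, where the bounded quantity itself may be a supremum over \<xi> and
  x.\<close>

lemma locally_bounded_Icc:
  fixes P :: "real \<Rightarrow> real \<Rightarrow> bool"
  assumes mono: "\<And>s A B. P s A \<Longrightarrow> A \<le> B \<Longrightarrow> P s B"
    and pt: "\<And>t. t \<in> {0..T} \<Longrightarrow> \<exists>B. P t B"
    and loc: "\<And>t. t \<in> {0..T} \<Longrightarrow> \<exists>B. eventually (\<lambda>s. P s B) (at t within {0..T})"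
  shows "\<exists>B. \<forall>t\<in>{0..T}. P t B"
proof -
  have "\<exists>B d. d > 0 \<and> (\<forall>s\<in>{0..T}. dist s t < d \<longrightarrow> P s B)" if t: "t \<in> {0..T}" for t
  proof -
    obtain B d where B: "d > 0" "\<And>s. s \<in> {0..T} \<Longrightarrow> s \<noteq> t \<Longrightarrow> dist s t < d \<Longrightarrow> P s B"
      using loc[OF t] unfolding eventually_at by blast
    obtain B' where B': "P t B'" using pt[OF t] by blast
    have "P s (max B B')" if "s \<in> {0..T}" "dist s t < d" for s
    proof (cases "s = t")
      case True then show ?thesis using mono[OF B', of "max B B'"] by simp
    next
      case False then show ?thesis using mono[OF B(2)[OF that(1) False that(2)], of "max B B'"] by simp
    qed
    then show ?thesis using B(1) by blast
  qed
  then obtain B d where Bd: "\<And>t. t \<in> {0..T} \<Longrightarrow> d t > 0" "\<And>t s. t \<in> {0..T} \<Longrightarrow> s \<in> {0..T} \<Longrightarrow> dist s t < d t \<Longrightarrow> P s (B t)"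
    by metis
  have "compact {0..T}" by simp
  then obtain D where D: "D \<subseteq> {0..T}" "finite D" "{0..T} \<subseteq> (\<Union>t\<in>D. ball t (d t))"
    by (rule compactE_image[where C="{0..T}" and f="\<lambda>t. ball t (d t)"]) (use Bd(1) in auto)
  show ?thesis
  proof (intro exI[of _ "Max (insert 0 (B ` D))"] ballI)
    fix s assume s: "s \<in> {0..T}"
    then obtain t where t: "t \<in> D" "dist s t < d t" using D(3) by (auto simp: dist_commute)
    have "P s (B t)" using Bd(2)[of t s] t D(1) s by blast
    then show "P s (Max (insert 0 (B ` D)))" by (rule mono) (use D(2) t in auto)
  qed
qed

section \<open>Smooth cut-offs and product test functions\<close>

lemma max_square_deriv: "((\<lambda>t::real. (max 0 t)\<^sup>2) has_real_derivative 2 * max 0 t) (at t)"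
proof (cases t "0::real" rule: linorder_cases)
  case less
  have "((\<lambda>t. 0) has_real_derivative 0) (at t)" by simp
  moreover have "eventually (\<lambda>s. 0 = (max 0 s)\<^sup>2) (nhds t)"
    using eventually_nhds_in_open[of "{..<0}" t] less by (auto elim!: eventually_mono)
  ultimately show ?thesis using less by (subst (asm) DERIV_cong_ev[OF refl _ refl]) auto
next
  case greater
  have "((\<lambda>t. t\<^sup>2) has_real_derivative 2 * t) (at t)" by (auto intro!: derivative_eq_intros)
  moreover have "eventually (\<lambda>s. s\<^sup>2 = (max 0 s)\<^sup>2) (nhds t)"
    using eventually_nhds_in_open[of "{0<..}" t] greater by (auto elim!: eventually_mono)
  ultimately show ?thesis using greater by (subst (asm) DERIV_cong_ev[OF refl _ refl]) auto
next
  case equal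
  have "((\<lambda>h::real. (max 0 h)\<^sup>2 / h) \<longlongrightarrow> 0) (at 0)"
  proof (rule Lim_null_comparison)
    show "eventually (\<lambda>h. norm ((max 0 h)\<^sup>2 / h) \<le> \<bar>h\<bar>) (at (0::real))"
      by (rule always_eventually) (auto simp: max_def power2_eq_square)
    have "((\<lambda>h::real. \<bar>h\<bar>) \<longlongrightarrow> \<bar>0\<bar>) (at 0)" by (intro tendsto_intros)
    then show "((\<lambda>h::real. \<bar>h\<bar>) \<longlongrightarrow> 0) (at 0)" by simp
  qed
  then show ?thesis using equal by (simp add: DERIV_def)
qed

text \<open>A continuously differentiable substitute for the Heaviside function; dilating its
  argument sharpens it.\<close>

definition ramp :: "real \<Rightarrow> real" where
  "ramp t = (max 0 t)\<^sup>2 / (1 + (max 0 t)\<^sup>2)"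

lemma ramp_bounds: "0 \<le> ramp t" "ramp t \<le> 1" "t \<le> 0 \<Longrightarrow> ramp t = 0"
  by (auto simp: ramp_def divide_le_eq_1 add_pos_nonneg)

lemma ramp_deriv: "(ramp has_real_derivative 2 * max 0 t / (1 + (max 0 t)\<^sup>2)\<^sup>2) (at t)"
proof -
  have nz: "1 + (max 0 t)\<^sup>2 \<noteq> 0" using zero_le_power2[of "max 0 t"] by linarith
  show ?thesis
    unfolding ramp_def[abs_def]
    by (rule derivative_eq_intros max_square_deriv refl nz)+ (use nz in \<open>simp add: field_simps power2_eq_square\<close>)
qed

lemma ramp_limit:
  assumes "t > 0" shows "(\<lambda>n. ramp (real n * t)) \<longlonglongrightarrow> 1"
proof -
  have "(\<lambda>n. 1 - 1 / (1 + (real n * t)\<^sup>2)) \<longlonglongrightarrow> 1 - 0"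
  proof (intro tendsto_diff tendsto_const tendsto_divide_0[OF tendsto_const])
    have "filterlim (\<lambda>n. real n * t) at_top sequentially"
      using assms filterlim_real_sequentially by (subst mult.commute) (rule filterlim_tendsto_pos_mult_at_top[OF tendsto_const])
    then have "filterlim (\<lambda>n. (real n * t)\<^sup>2) at_top sequentially" by (intro filterlim_pow_at_top) auto
    then show "filterlim (\<lambda>n. 1 + (real n * t)\<^sup>2) at_infinity sequentially"
      by (intro filterlim_at_top_imp_at_infinity filterlim_tendsto_add_at_top[OF tendsto_const])
  qed
  moreover have "ramp (real n * t) = 1 - 1 / (1 + (real n * t)\<^sup>2)" for n
  proof -
    have "1 + (real n * t)\<^sup>2 \<noteq> 0" using zero_le_power2[of "real n * t"] by linarith
    then show ?thesis using assms by (simp add: ramp_def field_simps)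
  qed
  ultimately show ?thesis by simp
qed

definition C1_function :: "('a::euclidean_space \<Rightarrow> real) \<Rightarrow> bool" where
  "C1_function \<beta> \<longleftrightarrow> (\<exists>\<beta>' :: 'a \<Rightarrow> 'a \<Rightarrow>\<^sub>L real. (\<forall>x. (\<beta> has_derivative blinfun_apply (\<beta>' x)) (at x)) \<and> continuous_on UNIV \<beta>')"

lemma C1_function_continuous: "C1_function \<beta> \<Longrightarrow> continuous_on UNIV \<beta>"
  unfolding C1_function_def by (meson continuous_at_imp_continuous_on has_derivative_continuous)

lemma C1_function_const: "C1_function (\<lambda>_. c)"
  unfolding C1_function_def by (intro exI[of _ "\<lambda>_. 0"]) (auto simp: zero_blinfun.rep_eq)

lemma C1_function_mult:
  assumes "C1_function \<beta>1" "C1_function \<beta>2" shows "C1_function (\<lambda>x. \<beta>1 x * \<beta>2 x)"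
proof -
  obtain d1 d2 where d: "\<And>x. (\<beta>1 has_derivative blinfun_apply (d1 x)) (at x)" "continuous_on UNIV d1"
    "\<And>x. (\<beta>2 has_derivative blinfun_apply (d2 x)) (at x)" "continuous_on UNIV d2"
    using assms unfolding C1_function_def by blast
  show ?thesis
    unfolding C1_function_def
  proof (intro exI[of _ "\<lambda>x. \<beta>1 x *\<^sub>R d2 x + \<beta>2 x *\<^sub>R d1 x"] conjI allI)
    show "continuous_on UNIV (\<lambda>x. \<beta>1 x *\<^sub>R d2 x + \<beta>2 x *\<^sub>R d1 x)"
      using assms[THEN C1_function_continuous] d by (intro continuous_intros) auto
    show "((\<lambda>x. \<beta>1 x * \<beta>2 x) has_derivative blinfun_apply (\<beta>1 x *\<^sub>R d2 x + \<beta>2 x *\<^sub>R d1 x)) (at x)" for x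
      using has_derivative_mult[OF d(1)[of x] d(3)[of x]]
      by (rule has_derivative_eq_rhs) (auto simp: fun_eq_iff blinfun.add_left blinfun.scaleR_left)
  qed
qed

lemma C1_function_prod:
  assumes "finite I" "\<And>i. i \<in> I \<Longrightarrow> C1_function (\<beta> i)" shows "C1_function (\<lambda>x. \<Prod>i\<in>I. \<beta> i x)"
  using assms by (induction I) (simp_all add: C1_function_const C1_function_mult)

lemma C1_function_ramp: "C1_function (\<lambda>x. ramp (c * (x \<bullet> i) + d))"
proof -
  define r where "r t = 2 * max 0 t / (1 + (max 0 t)\<^sup>2)\<^sup>2" for t :: real
  have rc: "continuous_on UNIV r"
    unfolding r_def by (intro continuous_intros) (use zero_le_power2 in \<open>auto simp: add_nonneg_eq_0_iff\<close>)
  show ?thesis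
    unfolding C1_function_def
  proof (intro exI[of _ "\<lambda>x. (r (c * (x \<bullet> i) + d) * c) *\<^sub>R blinfun_inner_left i"] conjI allI)
    show "continuous_on UNIV (\<lambda>x. (r (c * (x \<bullet> i) + d) * c) *\<^sub>R blinfun_inner_left i)"
      by (intro continuous_intros continuous_on_compose2[OF rc]) auto
    fix x
    have "(ramp has_derivative (\<lambda>h. r (c * (x \<bullet> i) + d) * h)) (at (c * (x \<bullet> i) + d))"
      using ramp_deriv[of "c * (x \<bullet> i) + d"] unfolding has_field_derivative_def r_def .
    moreover have "((\<lambda>x. c * (x \<bullet> i) + d) has_derivative (\<lambda>h. c * (h \<bullet> i))) (at x)"
      by (auto intro!: derivative_eq_intros)
    ultimately have "((\<lambda>x. ramp (c * (x \<bullet> i) + d)) has_derivative (\<lambda>h. r (c * (x \<bullet> i) + d) * (c * (h \<bullet> i)))) (at x)"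
      by (rule has_derivative_compose[rotated])
    then show "((\<lambda>x. ramp (c * (x \<bullet> i) + d)) has_derivative blinfun_apply ((r (c * (x \<bullet> i) + d) * c) *\<^sub>R blinfun_inner_left i)) (at x)"
      by (rule has_derivative_eq_rhs) (auto simp: fun_eq_iff blinfun.scaleR_left inner_commute)
  qed
qed

text \<open>Each face of the box contributes one dilated ramp that vanishes on the wrong side of the
  face, so the product vanishes off the open box and tends to 1 inside.\<close>

lemma box_indicator_approx:
  fixes lo hi :: "'a::euclidean_space"
  obtains \<beta> :: "nat \<Rightarrow> 'a \<Rightarrow> real" where "\<And>n. C1_function (\<beta> n)" "\<And>n x. 0 \<le> \<beta> n x" "\<And>n x. \<beta> n x \<le> 1"
    "\<And>n x. x \<notin> box lo hi \<Longrightarrow> \<beta> n x = 0" "\<And>x. (\<lambda>n. \<beta> n x) \<longlonglongrightarrow> indicator (box lo hi) x"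
proof
  define \<beta> where "\<beta> n x = (\<Prod>i\<in>Basis. ramp (real n * (x \<bullet> i) + - (real n * (lo \<bullet> i))) * ramp (- real n * (x \<bullet> i) + real n * (hi \<bullet> i)))" for n :: nat and x :: 'a
  show "C1_function (\<beta> n)" for n
    unfolding \<beta>_def by (intro C1_function_prod C1_function_mult C1_function_ramp) simp
  show "0 \<le> \<beta> n x" for n x unfolding \<beta>_def by (intro prod_nonneg mult_nonneg_nonneg ramp_bounds ballI)
  show "\<beta> n x \<le> 1" for n x unfolding \<beta>_def by (intro prod_le_1 conjI mult_nonneg_nonneg mult_le_one ramp_bounds)
  show z: "\<beta> n x = 0" if x: "x \<notin> box lo hi" for n x
  proof -
    obtain i where i: "i \<in> Basis" "x \<bullet> i \<le> lo \<bullet> i \<or> hi \<bullet> i \<le> x \<bullet> i" using x unfolding mem_box by (meson not_less)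
    then have "real n * (x \<bullet> i) \<le> real n * (lo \<bullet> i) \<or> real n * (hi \<bullet> i) \<le> real n * (x \<bullet> i)" by (auto intro: mult_left_mono)
    then have "ramp (real n * (x \<bullet> i) + - (real n * (lo \<bullet> i))) * ramp (- real n * (x \<bullet> i) + real n * (hi \<bullet> i)) = 0"
      using ramp_bounds(3) by auto
    then show ?thesis unfolding \<beta>_def using i(1) by (intro prod_zero) auto
  qed
  show "(\<lambda>n. \<beta> n x) \<longlonglongrightarrow> indicator (box lo hi) x" for x
  proof (cases "x \<in> box lo hi")
    case True
    have "(\<lambda>n. \<beta> n x) \<longlonglongrightarrow> (\<Prod>i\<in>(Basis :: 'a set). 1 * 1)"
      unfolding \<beta>_def
    proof (intro tendsto_prod tendsto_mult)
      fix i :: 'a assume i: "i \<in> Basis"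
      show "(\<lambda>n. ramp (real n * (x \<bullet> i) + - (real n * (lo \<bullet> i)))) \<longlonglongrightarrow> 1"
        using ramp_limit[of "x \<bullet> i - lo \<bullet> i"] True i by (simp add: mem_box algebra_simps)
      show "(\<lambda>n. ramp (- real n * (x \<bullet> i) + real n * (hi \<bullet> i))) \<longlonglongrightarrow> 1"
        using ramp_limit[of "hi \<bullet> i - x \<bullet> i"] True i by (simp add: mem_box algebra_simps)
    qed
    then show ?thesis using True by simp
  qed (simp add: z)
qed

text \<open>The time factor may be nonzero at the end points; its value at T is the boundary term on
  which \<open>product_test\<close> relies.\<close>

lemma C1c_test_product:
  fixes \<beta> :: "'a::euclidean_space \<Rightarrow> real"
  assumes \<theta>: "\<And>t. t \<in> {0..T} \<Longrightarrow> (\<theta> has_real_derivative \<theta>' t) (at t within {0..T})" "continuous_on {0..T} \<theta>'"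
    and \<alpha>: "\<And>\<xi>. (\<alpha> has_real_derivative a \<xi>) (at \<xi>)" "continuous_on UNIV a" "\<And>\<xi>. \<bar>\<xi>\<bar> > R \<Longrightarrow> \<alpha> \<xi> = 0"
    and \<beta>: "C1_function \<beta>" "bounded S" "\<And>x. x \<notin> S \<Longrightarrow> \<beta> x = 0"
  obtains \<phi>' where "C1c_test T (\<lambda>(t, \<xi>, x). \<theta> t * \<alpha> \<xi> * \<beta> x) \<phi>'"
    "\<And>t \<xi> x. blinfun_apply (\<phi>' (t, \<xi>, x)) (1, 0, 0) = \<theta>' t * \<alpha> \<xi> * \<beta> x"
    "\<And>t \<xi> x. blinfun_apply (\<phi>' (t, \<xi>, x)) (0, 1, 0) = \<theta> t * a \<xi> * \<beta> x"
proof -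
  obtain \<beta>' where \<beta>': "\<And>x. (\<beta> has_derivative blinfun_apply (\<beta>' x)) (at x)" "continuous_on UNIV \<beta>'"
    using \<beta>(1) unfolding C1_function_def by blast
  have c: "continuous_on {0..T} \<theta>" "continuous_on UNIV \<alpha>" "continuous_on UNIV \<beta>"
    using DERIV_continuous_on[OF \<theta>(1)] DERIV_continuous_on[of UNIV \<alpha> a] \<alpha>(1) C1_function_continuous[OF \<beta>(1)]
    by auto
  let ?S = "{0..T} \<times> (UNIV :: (real \<times> 'a) set)"
  define e1 :: "(real \<times> real \<times> 'a) \<Rightarrow>\<^sub>L real" where "e1 = blinfun_inner_left (1, 0, 0)"
  define e2 :: "(real \<times> real \<times> 'a) \<Rightarrow>\<^sub>L real" where "e2 = blinfun_inner_left (0, 1, 0)"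
  define e3 :: "(real \<times> real \<times> 'a) \<Rightarrow>\<^sub>L 'a" where "e3 = Blinfun (\<lambda>p. snd (snd p))"
  have e3: "blinfun_apply e3 p = snd (snd p)" for p
    unfolding e3_def by (subst bounded_linear_Blinfun_apply) (auto intro!: bounded_linear_snd_comp bounded_linear_snd)
  have e12: "blinfun_apply e1 (h, y, z) = h" "blinfun_apply e2 (h, y, z) = y" for h y z
    by (simp_all add: e1_def e2_def)
  define \<phi>' where "\<phi>' p = (\<theta>' (fst p) * \<alpha> (fst (snd p)) * \<beta> (snd (snd p))) *\<^sub>R e1 + (\<theta> (fst p) * a (fst (snd p)) * \<beta> (snd (snd p))) *\<^sub>R e2
     + (\<theta> (fst p) * \<alpha> (fst (snd p))) *\<^sub>R (\<beta>' (snd (snd p)) o\<^sub>L e3)" for p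
  show ?thesis
  proof (rule that)
    show "blinfun_apply (\<phi>' (t, \<xi>, x)) (1, 0, 0) = \<theta>' t * \<alpha> \<xi> * \<beta> x" for t \<xi> x
      by (simp add: \<phi>'_def blinfun.add_left blinfun.scaleR_left e12 e3)
    show "blinfun_apply (\<phi>' (t, \<xi>, x)) (0, 1, 0) = \<theta> t * a \<xi> * \<beta> x" for t \<xi> x
      by (simp add: \<phi>'_def blinfun.add_left blinfun.scaleR_left e12 e3)
    show "C1c_test T (\<lambda>(t, \<xi>, x). \<theta> t * \<alpha> \<xi> * \<beta> x) \<phi>'"
      unfolding C1c_test_def
    proof (intro conjI ballI)
      have "bounded ({0..T} \<times> {- R..R} \<times> S)" using \<beta>(2) by (intro bounded_Times) auto
      then have "bounded {p \<in> ?S. (case p of (t, \<xi>, x) \<Rightarrow> \<theta> t * \<alpha> \<xi> * \<beta> x) \<noteq> 0}"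
      proof (rule bounded_subset, safe)
        fix t \<xi> and x :: 'a assume "\<theta> t * \<alpha> \<xi> * \<beta> x \<noteq> 0"
        then have "\<alpha> \<xi> \<noteq> 0" "\<beta> x \<noteq> 0" by auto
        then have "\<not> R < \<bar>\<xi>\<bar>" "x \<in> S" using \<alpha>(3)[of \<xi>] \<beta>(3)[of x] by auto
        then show "\<xi> \<in> {- R..R}" "x \<in> S" by (auto simp: abs_le_iff not_less)
      qed
      then show "compact (closure {p \<in> ?S. (case p of (t, \<xi>, x) \<Rightarrow> \<theta> t * \<alpha> \<xi> * \<beta> x) \<noteq> 0})" by simp
      have "continuous_on ?S (\<lambda>p. \<theta> (fst p))" "continuous_on ?S (\<lambda>p. \<theta>' (fst p))"
        "continuous_on ?S (\<lambda>p. \<alpha> (fst (snd p)))" "continuous_on ?S (\<lambda>p. a (fst (snd p)))"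
        "continuous_on ?S (\<lambda>p. \<beta> (snd (snd p)))" "continuous_on ?S (\<lambda>p. \<beta>' (snd (snd p)))"
        by (auto intro!: continuous_intros continuous_on_compose2[OF c(1)] continuous_on_compose2[OF \<theta>(2)] continuous_on_compose2[OF c(2)]
             continuous_on_compose2[OF c(3)] continuous_on_compose2[OF \<alpha>(2)] continuous_on_compose2[OF \<beta>'(2)])
      then show "continuous_on ?S \<phi>'"
        unfolding \<phi>'_def by (intro continuous_intros)
      fix p assume p: "p \<in> ?S"
      obtain t \<xi> x where [simp]: "p = (t, \<xi>, x)" by (cases p) auto
      have t: "t \<in> {0..T}" using p by simp
      have im: "fst ` ?S \<subseteq> {0..T}" by auto
      have "((\<lambda>p. \<theta> (fst p)) has_derivative (\<lambda>h. \<theta>' t * fst h)) (at p within ?S)"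
      proof -
        have "(fst has_derivative fst) (at p within ?S)" by (intro bounded_linear_imp_has_derivative bounded_linear_fst)
        then show ?thesis
          using has_derivative_in_compose2[of "{0..T}" \<theta> "\<lambda>t h. \<theta>' t * h" fst ?S p fst] \<theta>(1) im p
          by (simp add: has_field_derivative_def)
      qed
      moreover have "((\<lambda>p. \<alpha> (fst (snd p))) has_derivative (\<lambda>h. a \<xi> * fst (snd h))) (at p within ?S)"
      proof -
        have "((\<lambda>p. fst (snd p)) has_derivative (\<lambda>h. fst (snd h))) (at p within ?S)" by (auto intro!: derivative_intros)
        from has_derivative_compose[OF this, of \<alpha> "\<lambda>h. a \<xi> * h"] show ?thesis
          using \<alpha>(1)[of \<xi>] by (simp add: has_field_derivative_def)
      qed
      moreover have "((\<lambda>p. \<beta> (snd (snd p))) has_derivative (\<lambda>h. blinfun_apply (\<beta>' x) (snd (snd h)))) (at p within ?S)"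
      proof -
        have "((\<lambda>p. snd (snd p)) has_derivative (\<lambda>h. snd (snd h))) (at p within ?S)" by (auto intro!: derivative_intros)
        from has_derivative_compose[OF this, of \<beta> "blinfun_apply (\<beta>' x)"] show ?thesis
          using \<beta>'(1)[of x] by simp
      qed
      ultimately have "((\<lambda>p. \<theta> (fst p) * \<alpha> (fst (snd p)) * \<beta> (snd (snd p))) has_derivative
         (\<lambda>h. \<theta> (fst p) * \<alpha> (fst (snd p)) * blinfun_apply (\<beta>' x) (snd (snd h)) +
            (\<theta> (fst p) * (a \<xi> * fst (snd h)) + \<theta>' t * fst h * \<alpha> (fst (snd p))) * \<beta> (snd (snd p)))) (at p within ?S)"
        by (intro has_derivative_mult)
      then show "((\<lambda>(t, \<xi>, x). \<theta> t * \<alpha> \<xi> * \<beta> x) has_derivative blinfun_apply (\<phi>' p)) (at p within ?S)"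
        unfolding case_prod_beta'
        by (rule has_derivative_eq_rhs) (auto simp: fun_eq_iff \<phi>'_def blinfun.add_left blinfun.scaleR_left e12 e3 algebra_simps)
    qed
  qed
qed

section \<open>The weak equation for bounded Borel test functions\<close>

lemma antiderivative_const:
  fixes F a :: "real \<Rightarrow> real"
  assumes F: "\<And>\<xi>. (F has_real_derivative a \<xi>) (at \<xi>)" and z: "\<And>\<xi>. \<bar>\<xi>\<bar> > R \<Longrightarrow> a \<xi> = 0" and R: "R \<ge> 0"
  shows "\<xi> \<ge> R \<Longrightarrow> F \<xi> = F R" "\<xi> \<le> - R \<Longrightarrow> F \<xi> = F (- R)"
proof -
  show "F \<xi> = F R" if "\<xi> \<ge> R"
  proof (cases "\<xi> = R")
    case False
    then have "R < \<xi>" using that by simp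
    from MVT2[OF this, of F a] F obtain z where "z > R" "F \<xi> - F R = (\<xi> - R) * a z" by blast
    then show ?thesis using z[of z] R by simp
  qed simp
  show "F \<xi> = F (- R)" if "\<xi> \<le> - R"
  proof (cases "\<xi> = - R")
    case False
    then have "\<xi> < - R" using that by simp
    from MVT2[OF this, of F a] F obtain z where "z < - R" "F (- R) - F \<xi> = (- R - \<xi>) * a z" by blast
    then show ?thesis using z[of z] R by simp
  qed simp
qed

lemma exists_antiderivative:
  fixes a :: "real \<Rightarrow> real"
  assumes "continuous_on UNIV a"
  obtains F where "\<And>\<xi>. (F has_real_derivative a \<xi>) (at \<xi>)"
proof -
  have "\<exists>F. \<forall>x::real. - \<infinity> < ereal x \<longrightarrow> ereal x < \<infinity> \<longrightarrow> (F has_vector_derivative a x) (at x)"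
    by (rule einterval_antiderivative) (use assms in \<open>auto simp: continuous_on_eq_continuous_at\<close>)
  then show ?thesis using that by (auto simp: has_real_derivative_iff_has_vector_derivative)
qed

lemma antiderivative_lipschitz:
  fixes F a :: "real \<Rightarrow> real"
  assumes F: "\<And>\<xi>. (F has_real_derivative a \<xi>) (at \<xi>)" and a: "\<And>\<xi>. \<bar>a \<xi>\<bar> \<le> M"
  shows "\<bar>F \<xi> - F \<zeta>\<bar> \<le> M * \<bar>\<xi> - \<zeta>\<bar>"
proof -
  have *: "\<bar>F \<xi> - F \<zeta>\<bar> \<le> M * \<bar>\<xi> - \<zeta>\<bar>" if "\<zeta> < \<xi>" for \<xi> \<zeta>
  proof -
    from MVT2[OF that, of F a] F obtain z where "F \<xi> - F \<zeta> = (\<xi> - \<zeta>) * a z" by blast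
    then show ?thesis using that mult_left_mono[OF a[of z], of "\<xi> - \<zeta>"] by (simp add: abs_mult mult.commute)
  qed
  show ?thesis using *[of \<zeta> \<xi>] *[of \<xi> \<zeta>] by (cases \<xi> \<zeta> rule: linorder_cases) (auto simp: abs_minus_commute)
qed

text \<open>Lipschitz bump whose dilations serve as spread-out mass in
  \<open>evolves_product\<close>.\<close>

definition tent :: "real \<Rightarrow> real" where
  "tent y = max 0 (1 - \<bar>y\<bar>)"

lemma tent: "0 \<le> tent y" "tent y \<le> 1" "\<bar>y\<bar> > 1 \<Longrightarrow> tent y = 0" "\<bar>tent y - tent z\<bar> \<le> \<bar>y - z\<bar>"
  "continuous_on S tent"
  by (auto simp: tent_def[abs_def] intro!: continuous_intros)

lemma tent_total:
  assumes H: "\<And>y. (H has_real_derivative tent y) (at y)" shows "H (- 1) < H 1"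
proof -
  have "H (-1) \<le> H (-1/2)" "H (1/2) \<le> H 1"
    by (rule DERIV_nonneg_imp_nondecreasing; use H tent(1) in force)+
  moreover have "H (-1/2) < H (1/2)"
    by (rule DERIV_pos_imp_increasing) (use H in \<open>auto simp: tent_def intro!: exI conjI\<close>)
  ultimately show ?thesis by linarith
qed

text \<open>A Lipschitz approximation suffices in \<xi>: the weak equation is tested with a
  primitive of it, which is then continuously differentiable.\<close>

lemma interval_indicator_approx:
  fixes c d :: real
  obtains a :: "nat \<Rightarrow> real \<Rightarrow> real" where "\<And>n \<xi>. 0 \<le> a n \<xi>" "\<And>n \<xi>. a n \<xi> \<le> 1"
    "\<And>n \<xi> \<zeta>. \<bar>a n \<xi> - a n \<zeta>\<bar> \<le> real n * \<bar>\<xi> - \<zeta>\<bar>" "\<And>n \<xi>. \<xi> \<notin> {c<..<d} \<Longrightarrow> a n \<xi> = 0"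
    "\<And>\<xi>. (\<lambda>n. a n \<xi>) \<longlonglongrightarrow> indicator {c<..<d} \<xi>"
proof
  define a where "a n \<xi> = max 0 (min 1 (real n * min (\<xi> - c) (d - \<xi>)))" for n \<xi>
  show "0 \<le> a n \<xi>" "a n \<xi> \<le> 1" for n \<xi> by (auto simp: a_def)
  show "\<bar>a n \<xi> - a n \<zeta>\<bar> \<le> real n * \<bar>\<xi> - \<zeta>\<bar>" for n \<xi> \<zeta>
  proof -
    have "\<bar>a n \<xi> - a n \<zeta>\<bar> \<le> \<bar>real n * min (\<xi> - c) (d - \<xi>) - real n * min (\<zeta> - c) (d - \<zeta>)\<bar>"
      unfolding a_def by linarith
    also have "\<dots> = real n * \<bar>min (\<xi> - c) (d - \<xi>) - min (\<zeta> - c) (d - \<zeta>)\<bar>"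
      by (simp add: abs_mult flip: right_diff_distrib)
    also have "\<dots> \<le> real n * \<bar>\<xi> - \<zeta>\<bar>" by (rule mult_left_mono) auto
    finally show ?thesis .
  qed
  show z: "a n \<xi> = 0" if "\<xi> \<notin> {c<..<d}" for n \<xi>
  proof -
    have "min (\<xi> - c) (d - \<xi>) \<le> 0" using that by auto
    then have "real n * min (\<xi> - c) (d - \<xi>) \<le> 0" by (simp add: mult_nonneg_nonpos)
    then show ?thesis by (simp add: a_def)
  qed
  show "(\<lambda>n. a n \<xi>) \<longlonglongrightarrow> indicator {c<..<d} \<xi>" for \<xi>
  proof (cases "\<xi> \<in> {c<..<d}")
    case True
    then have p: "min (\<xi> - c) (d - \<xi>) > 0" by auto
    then obtain k where k: "1 < real k * min (\<xi> - c) (d - \<xi>)" using reals_Archimedean3 by blast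
    have "eventually (\<lambda>n. a n \<xi> = 1) sequentially"
      using eventually_ge_at_top[of k]
    proof eventually_elim
      case (elim n)
      have "real k * min (\<xi> - c) (d - \<xi>) \<le> real n * min (\<xi> - c) (d - \<xi>)" using elim p by (intro mult_right_mono) auto
      then show ?case using k by (simp add: a_def)
    qed
    then show ?thesis using True by (simp add: tendsto_eventually)
  qed (simp add: z)
qed

lemma set_integrable_bounded:
  fixes h :: "real \<Rightarrow> real"
  assumes "(\<lambda>s. indicator {a..b} s * h s) \<in> borel_measurable borel" "\<And>s. s \<in> {a..b} \<Longrightarrow> \<bar>h s\<bar> \<le> B"
  shows "set_integrable lborel {a..b} h"
  unfolding set_integrable_def
proof (rule Bochner_Integration.integrable_bound)
  show "integrable lborel (\<lambda>s. indicator {a..b} s *\<^sub>R B)"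
    using borel_integrable_atLeastAtMost'[of a b "\<lambda>_. B"] by (simp add: set_integrable_def)
  show "(\<lambda>s. indicator {a..b} s *\<^sub>R h s) \<in> borel_measurable lborel" using assms(1) by simp
  show "AE s in lborel. norm (indicator {a..b} s *\<^sub>R h s) \<le> norm (indicator {a..b} s *\<^sub>R B)"
    using assms(2) by (intro AE_I2) (fastforce split: split_indicator)
qed

text \<open>The primitive of p in \<xi> that vanishes at \<xi> = 0, after the substitution \<zeta> =
  \<xi> z. The fixed interval [0,1] treats both signs of \<xi> alike and makes joint measurability a
  matter of parameter integrals.\<close>

definition prim :: "(real \<times> 'a \<Rightarrow> real) \<Rightarrow> real \<times> 'a \<Rightarrow> real" where
  "prim p q = fst q * (LINT z:{0..1}|lborel. p (fst q * z, snd q))"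

lemma prim_measurable:
  fixes p :: "real \<times> 'a::euclidean_space \<Rightarrow> real"
  assumes [measurable]: "p \<in> borel_measurable borel" shows "prim p \<in> borel_measurable borel"
proof -
  have "(\<lambda>q. \<integral>z. indicator {0..1} z *\<^sub>R p (fst q * z, snd q) \<partial>lborel) \<in> borel_measurable borel"
    by (rule measurable_integral_parameter) (auto intro: lborel.sigma_finite_measure_axioms)
  then show ?thesis unfolding prim_def[abs_def] set_lebesgue_integral_def by measurable
qed

lemma prim_integrable:
  fixes p :: "real \<times> 'a::euclidean_space \<Rightarrow> real"
  assumes [measurable]: "p \<in> borel_measurable borel" and "\<And>q. \<bar>p q\<bar> \<le> K"
  shows "set_integrable lborel {0..1} (\<lambda>z. p (\<xi> * z, x))"
  by (rule set_integrable_bounded[where B=K]) (use assms in auto)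

lemma prim_bound:
  fixes p :: "real \<times> 'a::euclidean_space \<Rightarrow> real"
  assumes "p \<in> borel_measurable borel" "\<And>q. \<bar>p q\<bar> \<le> K" shows "\<bar>prim p q\<bar> \<le> K * \<bar>fst q\<bar>"
  using set_integral_Icc_bound[OF prim_integrable[OF assms], of "fst q" "snd q" K] assms(2)
    mult_left_mono[of "\<bar>LINT z:{0..1}|lborel. p (fst q * z, snd q)\<bar>" K "\<bar>fst q\<bar>"]
  by (simp add: prim_def abs_mult mult.commute)

lemma prim_antiderivative:
  assumes F: "\<And>\<xi>. (F has_real_derivative p (\<xi>, x)) (at \<xi>)" and c: "continuous_on UNIV (\<lambda>\<xi>. p (\<xi>, x))"
  shows "prim p (\<xi>, x) = F \<xi> - F 0"
proof -
  have "(\<integral>z. indicator {0..1} z *\<^sub>R (\<xi> * p (\<xi> * z, x)) \<partial>lborel) = F (\<xi> * 1) - F (\<xi> * 0)"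
  proof (rule integral_FTC_Icc)
    fix z :: real
    have "((\<lambda>z. F (\<xi> * z)) has_real_derivative p (\<xi> * z, x) * \<xi>) (at z within {0..1})"
      by (rule DERIV_chain2[OF F]) (auto intro!: derivative_eq_intros)
    then show "((\<lambda>z. F (\<xi> * z)) has_vector_derivative \<xi> * p (\<xi> * z, x)) (at z within {0..1})"
      by (simp add: has_real_derivative_iff_has_vector_derivative mult.commute)
    show "continuous_on {0..1} (\<lambda>z. \<xi> * p (\<xi> * z, x))"
      by (intro continuous_intros continuous_on_compose2[OF c]) auto
  qed simp
  then show ?thesis
    by (simp add: prim_def set_lebesgue_integral_def mult.left_commute)
qed

section \<open>A priori bounds for an arbitrary solution curve\<close>

locale mean_field_solution = mean_field +
  fixes T :: real and \<nu> :: "(real \<times> 'a) measure" and \<rho> :: "real \<Rightarrow> (real \<times> 'a) measure"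
  assumes T_pos: "T > 0" and \<rho>_cont: "cont_curve T (P2 \<mu>) (L2d2 \<mu>) \<rho>" and \<rho>_CE: "CE_solution T \<nu> \<rho>"
begin

lemma \<rho>_P2: "t \<in> {0..T} \<Longrightarrow> \<rho> t \<in> P2 \<mu>"
  using \<rho>_cont by (simp add: cont_curve_def)

lemma \<rho>_section_measurable: "t \<in> {0..T} \<Longrightarrow> (\<lambda>q. vel (\<rho> t) t (fst q) (snd q)) \<in> borel_measurable borel"
  using measurable_compose[of "\<lambda>q. (t, q)" borel borel _ borel, OF _ vel_measurable[OF \<rho>_P2]] by simp

lemma dual_lipschitz:
  assumes N: "N1 \<in> P2 \<mu>" "N2 \<in> P2 \<mu>" and g: "g \<in> borel_measurable borel" and L: "L \<ge> 0"
    and lip: "\<And>\<xi> \<zeta> x. \<bar>g (\<xi>, x) - g (\<zeta>, x)\<bar> \<le> L * \<bar>\<xi> - \<zeta>\<bar>" and i: "integrable N1 g" "integrable N2 g"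
  shows "\<bar>(\<integral>q. g q \<partial>N1) - (\<integral>q. g q \<partial>N2)\<bar> \<le> L * L2d2 \<mu> N1 N2"
proof (rule L2d2_dual[OF N sets_\<mu> g _ _ lip i])
  interpret prob_space \<mu> by (rule prob_\<mu>)
  show "(\<integral>\<^sup>+x. ennreal (L\<^sup>2) \<partial>\<mu>) \<le> ennreal (L\<^sup>2)" by (simp add: emeasure_space_1)
qed (use L in auto)

text \<open>Within \<open>L2d2\<close> distance 1 of \<open>\<rho> t\<close> the velocity changes by
  at most C and the first moment by at most 1; compactness makes these local bounds uniform.\<close>

lemma curve_bounds:
  "\<exists>B>0. \<forall>t\<in>{0..T}. (\<forall>\<xi> x. \<bar>vel (\<rho> t) t \<xi> x\<bar> \<le> B * (1 + \<bar>\<xi>\<bar>)) \<and> (\<integral>q. \<bar>fst q\<bar> \<partial>\<rho> t) \<le> B"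
proof -
  have "\<exists>B. \<forall>t\<in>{0..T}. (\<forall>\<xi> x. \<bar>vel (\<rho> t) t \<xi> x\<bar> \<le> B * (1 + \<bar>\<xi>\<bar>)) \<and> (\<integral>q. \<bar>fst q\<bar> \<partial>\<rho> t) \<le> B"
  proof (rule locally_bounded_Icc)
    fix s A B assume *: "(\<forall>\<xi> x. \<bar>vel (\<rho> s) s \<xi> x\<bar> \<le> A * (1 + \<bar>\<xi>\<bar>)) \<and> (\<integral>q. \<bar>fst q\<bar> \<partial>\<rho> s) \<le> A" "A \<le> B"
    have "A * (1 + \<bar>\<xi>\<bar>) \<le> B * (1 + \<bar>\<xi>\<bar>)" for \<xi> :: real using *(2) by (rule mult_right_mono) simp
    with * show "(\<forall>\<xi> x. \<bar>vel (\<rho> s) s \<xi> x\<bar> \<le> B * (1 + \<bar>\<xi>\<bar>)) \<and> (\<integral>q. \<bar>fst q\<bar> \<partial>\<rho> s) \<le> B"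
      by (meson order_trans)
  next
    fix t assume t: "t \<in> {0..T}"
    define m where "m = sqrt (\<integral>q. (fst q)\<^sup>2 \<partial>\<rho> t)"
    define I where "I = (\<integral>q. \<bar>fst q\<bar> \<partial>\<rho> t)"
    have m: "m \<ge> 0" "I \<ge> 0" by (auto simp: m_def I_def intro!: integral_nonneg_AE)
    \<comment> \<open>One constant has to serve for the velocity and the first moment; the extra C
      and 1 are the margins that nearby times use up.\<close>
    have arith: "C * (a + m) + C \<le> (C * (2 + m) + I + 1) * (1 + a)" if a: "a \<ge> 0" for a
    proof -
      have "0 \<le> (C * m + C + I + 1) * a" using a m C_pos by simp
      moreover have "0 \<le> C" "0 \<le> I" using C_pos m by auto
      ultimately show ?thesis by (simp add: algebra_simps)
    qed
    have v: "\<bar>vel (\<rho> t) s \<xi> x\<bar> + C \<le> (C * (2 + m) + I + 1) * (1 + \<bar>\<xi>\<bar>)" for s \<xi> x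
      using vel_bound[OF \<rho>_P2[OF t], of s \<xi> x] arith[of "\<bar>\<xi>\<bar>"] unfolding m_def[symmetric] by linarith
    have I1: "I + 1 \<le> C * (2 + m) + I + 1" using C_pos m by simp
    show "\<exists>B. (\<forall>\<xi> x. \<bar>vel (\<rho> t) t \<xi> x\<bar> \<le> B * (1 + \<bar>\<xi>\<bar>)) \<and> (\<integral>q. \<bar>fst q\<bar> \<partial>\<rho> t) \<le> B"
    proof (intro exI conjI allI)
      show "\<bar>vel (\<rho> t) t \<xi> x\<bar> \<le> (C * (2 + m) + I + 1) * (1 + \<bar>\<xi>\<bar>)" for \<xi> x using v[of t \<xi> x] C_pos by linarith
      show "(\<integral>q. \<bar>fst q\<bar> \<partial>\<rho> t) \<le> C * (2 + m) + I + 1" using I1 unfolding I_def by linarith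
    qed
    have "((\<lambda>s. L2d2 \<mu> (\<rho> s) (\<rho> t)) \<longlongrightarrow> 0) (at t within {0..T})" using \<rho>_cont t by (simp add: cont_curve_def)
    then have "eventually (\<lambda>s. L2d2 \<mu> (\<rho> s) (\<rho> t) < 1) (at t within {0..T})" by (rule order_tendstoD) simp
    moreover have "eventually (\<lambda>s. s \<in> {0..T}) (at t within {0..T})" by (simp add: eventually_at_filter)
    ultimately have "eventually (\<lambda>s. (\<forall>\<xi> x. \<bar>vel (\<rho> s) s \<xi> x\<bar> \<le> (C * (2 + m) + I + 1) * (1 + \<bar>\<xi>\<bar>)) \<and> (\<integral>q. \<bar>fst q\<bar> \<partial>\<rho> s) \<le> C * (2 + m) + I + 1) (at t within {0..T})"
    proof eventually_elim
      case (elim s)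
      have "C * L2d2 \<mu> (\<rho> s) (\<rho> t) \<le> C * 1" using elim C_pos by (intro mult_left_mono) auto
      then have "\<bar>vel (\<rho> s) s \<xi> x\<bar> \<le> (C * (2 + m) + I + 1) * (1 + \<bar>\<xi>\<bar>)" for \<xi> x
        using vel_diff_L2d2[OF \<rho>_P2[OF elim(2)] \<rho>_P2[OF t], of s \<xi> x] v[of s \<xi> x] by linarith
      moreover have "\<bar>(\<integral>q. \<bar>fst q\<bar> \<partial>\<rho> s) - (\<integral>q. \<bar>fst q\<bar> \<partial>\<rho> t)\<bar> \<le> 1 * L2d2 \<mu> (\<rho> s) (\<rho> t)"
        by (rule dual_lipschitz[OF \<rho>_P2[OF elim(2)] \<rho>_P2[OF t]])
          (use P2D(6)[OF \<rho>_P2[OF elim(2)]] P2D(6)[OF \<rho>_P2[OF t]] in auto)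
      ultimately show ?case using elim(1) I1 unfolding I_def[symmetric] by auto
    qed
    then show "\<exists>B. eventually (\<lambda>s. (\<forall>\<xi> x. \<bar>vel (\<rho> s) s \<xi> x\<bar> \<le> B * (1 + \<bar>\<xi>\<bar>)) \<and> (\<integral>q. \<bar>fst q\<bar> \<partial>\<rho> s) \<le> B) (at t within {0..T})"
      by blast
  qed
  then obtain B where B: "\<forall>t\<in>{0..T}. (\<forall>\<xi> x. \<bar>vel (\<rho> t) t \<xi> x\<bar> \<le> B * (1 + \<bar>\<xi>\<bar>)) \<and> (\<integral>q. \<bar>fst q\<bar> \<partial>\<rho> t) \<le> B" by blast
  have "B * (1 + \<bar>\<xi>\<bar>) \<le> max B 1 * (1 + \<bar>\<xi>\<bar>)" for \<xi> :: real by (rule mult_right_mono) auto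
  then have "\<bar>vel (\<rho> t) t \<xi> x\<bar> \<le> max B 1 * (1 + \<bar>\<xi>\<bar>)" if "t \<in> {0..T}" for t \<xi> x
    using B that by (meson order_trans)
  with B show ?thesis by (intro exI[of _ "max B 1"]) (auto intro: max.coboundedI1)
qed

text \<open>The moving measure is handled by the Lipschitz bound through
  \<open>dual_lipschitz\<close>, the moving integrand by dominated convergence at the fixed
  measure.\<close>

lemma integral_curve_continuous:
  assumes g: "\<And>t. t \<in> {0..T} \<Longrightarrow> g t \<in> borel_measurable borel" and L: "L \<ge> 0"
    and lip: "\<And>t \<xi> \<zeta> x. t \<in> {0..T} \<Longrightarrow> \<bar>g t (\<xi>, x) - g t (\<zeta>, x)\<bar> \<le> L * \<bar>\<xi> - \<zeta>\<bar>"
    and b: "\<And>t q. t \<in> {0..T} \<Longrightarrow> \<bar>g t q\<bar> \<le> M" and c: "\<And>q. continuous_on {0..T} (\<lambda>t. g t q)"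
  shows "continuous_on {0..T} (\<lambda>t. \<integral>q. g t q \<partial>\<rho> t)"
  unfolding continuous_on_def
proof
  fix t assume t: "t \<in> {0..T}"
  have gi: "integrable (\<rho> s') (g s)" if "s \<in> {0..T}" "s' \<in> {0..T}" for s s'
  proof -
    interpret prob_space "\<rho> s'" by (rule P2D[OF \<rho>_P2[OF that(2)]])
    show ?thesis by (rule integrable_const_bound[where B=M]) (use b[OF that(1)] P2D(9)[OF \<rho>_P2[OF that(2)] g[OF that(1)]] in auto)
  qed
  interpret prob_space "\<rho> t" by (rule P2D[OF \<rho>_P2[OF t]])
  have L0: "((\<lambda>s. L2d2 \<mu> (\<rho> s) (\<rho> t)) \<longlongrightarrow> 0) (at t within {0..T})" using \<rho>_cont t by (simp add: cont_curve_def)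
  show "((\<lambda>t. \<integral>q. g t q \<partial>\<rho> t) \<longlongrightarrow> (\<integral>q. g t q \<partial>\<rho> t)) (at t within {0..T})"
    unfolding tendsto_at_iff_sequentially comp_def
  proof (intro allI impI)
    fix s assume s': "\<forall>n. s n \<in> {0..T} - {t}" and st: "s \<longlonglongrightarrow> t"
    then have s: "s n \<in> {0..T}" for n by blast
    have Ls: "(\<lambda>n. L2d2 \<mu> (\<rho> (s n)) (\<rho> t)) \<longlonglongrightarrow> 0"
      using L0 s' st unfolding tendsto_at_iff_sequentially comp_def by blast
    have 1: "(\<lambda>n. \<integral>q. g (s n) q \<partial>\<rho> t) \<longlonglongrightarrow> (\<integral>q. g t q \<partial>\<rho> t)"
    proof (rule integral_dominated_convergence[where w="\<lambda>_. M"])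
      show "g t \<in> borel_measurable (\<rho> t)" "\<And>n. g (s n) \<in> borel_measurable (\<rho> t)"
        by (intro P2D(9)[OF \<rho>_P2[OF t]] g s t)+
      show "AE q in \<rho> t. (\<lambda>n. g (s n) q) \<longlonglongrightarrow> g t q"
        using c t s st by (intro AE_I2) (auto simp: continuous_on_sequentially comp_def)
      show "AE q in \<rho> t. norm (g (s n) q) \<le> M" for n using b[OF s] by simp
    qed simp
    have "(\<lambda>n. L * L2d2 \<mu> (\<rho> (s n)) (\<rho> t)) \<longlonglongrightarrow> L * 0" by (intro tendsto_intros Ls)
    then have z: "(\<lambda>n. L * L2d2 \<mu> (\<rho> (s n)) (\<rho> t)) \<longlonglongrightarrow> 0" by simp
    have "(\<lambda>n. (\<integral>q. g (s n) q \<partial>\<rho> (s n)) - (\<integral>q. g (s n) q \<partial>\<rho> t)) \<longlonglongrightarrow> 0"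
      by (rule Lim_null_comparison[OF always_eventually z])
        (use dual_lipschitz[OF \<rho>_P2[OF s] \<rho>_P2[OF t] g[OF s] L lip[OF s] gi[OF s s] gi[OF s t]] in simp)
    from tendsto_add[OF this 1] show "(\<lambda>n. \<integral>q. g (s n) q \<partial>\<rho> (s n)) \<longlonglongrightarrow> (\<integral>q. g t q \<partial>\<rho> t)" by simp
  qed
qed

end

text \<open>The velocity grows linearly, so the product is bounded and Lipschitz only because p
  vanishes beyond R. The product difference is split with v evaluated at a point inside [-R, R]; if
  both points lie outside, the difference is 0.\<close>

lemma cutoff_product:
  fixes p v :: "real \<Rightarrow> real"
  assumes v: "\<And>\<xi> \<zeta>. \<bar>v \<xi> - v \<zeta>\<bar> \<le> c * \<bar>\<xi> - \<zeta>\<bar>" "c \<ge> 0" "\<And>\<xi>. \<bar>v \<xi>\<bar> \<le> B * (1 + \<bar>\<xi>\<bar>)" "B \<ge> 0"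
    and p: "\<And>\<xi> \<zeta>. \<bar>p \<xi> - p \<zeta>\<bar> \<le> L * \<bar>\<xi> - \<zeta>\<bar>" "L \<ge> 0" "\<And>\<xi>. \<bar>p \<xi>\<bar> \<le> K" "\<And>\<xi>. \<bar>\<xi>\<bar> > R \<Longrightarrow> p \<xi> = 0" "R \<ge> 0"
  shows "\<bar>p \<xi> * v \<xi>\<bar> \<le> K * (B * (1 + R))"
    and "\<bar>p \<xi> * v \<xi> - p \<zeta> * v \<zeta>\<bar> \<le> (L * (B * (1 + R)) + K * c) * \<bar>\<xi> - \<zeta>\<bar>"
proof -
  have K: "K \<ge> 0" using p(3)[of 0] by linarith
  have vb: "\<bar>v \<xi>\<bar> \<le> B * (1 + R)" if "\<bar>\<xi>\<bar> \<le> R" for \<xi>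
  proof -
    have "B * (1 + \<bar>\<xi>\<bar>) \<le> B * (1 + R)" using that v(4) by (intro mult_left_mono) auto
    then show ?thesis using v(3)[of \<xi>] by linarith
  qed
  show "\<bar>p \<xi> * v \<xi>\<bar> \<le> K * (B * (1 + R))"
  proof (cases "\<bar>\<xi>\<bar> > R")
    case True
    then show ?thesis using p(4,5) K v(4) by simp
  next
    case False
    then show ?thesis unfolding abs_mult using p(3) K vb by (intro mult_mono) auto
  qed
  have *: "\<bar>p \<xi> * v \<xi> - p \<zeta> * v \<zeta>\<bar> \<le> (L * (B * (1 + R)) + K * c) * \<bar>\<xi> - \<zeta>\<bar>" if "\<bar>\<xi>\<bar> \<le> R" for \<xi> \<zeta>
  proof -
    have "p \<xi> * v \<xi> - p \<zeta> * v \<zeta> = (p \<xi> - p \<zeta>) * v \<xi> + p \<zeta> * (v \<xi> - v \<zeta>)"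
      by (simp add: algebra_simps)
    also have "\<bar>\<dots>\<bar> \<le> \<bar>p \<xi> - p \<zeta>\<bar> * \<bar>v \<xi>\<bar> + \<bar>p \<zeta>\<bar> * \<bar>v \<xi> - v \<zeta>\<bar>"
      unfolding abs_mult[symmetric] by (rule abs_triangle_ineq)
    also have "\<dots> \<le> (L * \<bar>\<xi> - \<zeta>\<bar>) * (B * (1 + R)) + K * (c * \<bar>\<xi> - \<zeta>\<bar>)"
      by (intro add_mono mult_mono p v vb that) (use p(2) K in auto)
    finally show ?thesis by (simp add: algebra_simps)
  qed
  show "\<bar>p \<xi> * v \<xi> - p \<zeta> * v \<zeta>\<bar> \<le> (L * (B * (1 + R)) + K * c) * \<bar>\<xi> - \<zeta>\<bar>"
  proof (cases "\<bar>\<xi>\<bar> \<le> R")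
    case False
    show ?thesis
    proof (cases "\<bar>\<zeta>\<bar> \<le> R")
      case True
      then show ?thesis using *[of \<zeta> \<xi>] by (simp add: abs_minus_commute)
    next
      case F2: False
      have "0 \<le> (L * (B * (1 + R)) + K * c) * \<bar>\<xi> - \<zeta>\<bar>" using p(2,5) v(2,4) K by simp
      then show ?thesis using False F2 p(4) by simp
    qed
  qed (rule *)
qed

section \<open>Integrands for which the time-integrated equation holds\<close>

context mean_field_solution begin

definition bound :: real where
  "bound = (SOME B. B > 0 \<and> (\<forall>t\<in>{0..T}. (\<forall>\<xi> x. \<bar>vel (\<rho> t) t \<xi> x\<bar> \<le> B * (1 + \<bar>\<xi>\<bar>)) \<and> (\<integral>q. \<bar>fst q\<bar> \<partial>\<rho> t) \<le> B))"

lemma bound: "bound > 0" "t \<in> {0..T} \<Longrightarrow> \<bar>vel (\<rho> t) t \<xi> x\<bar> \<le> bound * (1 + \<bar>\<xi>\<bar>)" "t \<in> {0..T} \<Longrightarrow> (\<integral>q. \<bar>fst q\<bar> \<partial>\<rho> t) \<le> bound"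
  using someI_ex[OF curve_bounds] unfolding bound_def[symmetric] by auto

text \<open>Formally the time derivative of the integral of \<open>prim p\<close> against
  \<open>\<rho>\<close>, with p as the \<xi>-derivative of the test function.\<close>

definition flux :: "(real \<times> 'a \<Rightarrow> real) \<Rightarrow> real \<Rightarrow> real" where
  "flux p s = (\<integral>q. p q * vel (\<rho> s) s (fst q) (snd q) \<partial>\<rho> s)"

lemma flux_integrable:
  assumes p: "p \<in> borel_measurable borel" "\<And>q. \<bar>p q\<bar> \<le> K" and s: "s \<in> {0..T}"
  shows "integrable (\<rho> s) (\<lambda>q. p q * vel (\<rho> s) s (fst q) (snd q))" "\<bar>flux p s\<bar> \<le> K * (bound * (1 + bound))"
proof -
  interpret prob_space "\<rho> s" by (rule P2D[OF \<rho>_P2[OF s]])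
  have K: "K \<ge> 0" using p(2)[of undefined] by linarith
  have m: "(\<lambda>q. p q * vel (\<rho> s) s (fst q) (snd q)) \<in> borel_measurable (\<rho> s)"
    by (rule P2D(9)[OF \<rho>_P2[OF s]]) (intro borel_measurable_times p \<rho>_section_measurable s)
  have i: "integrable (\<rho> s) (\<lambda>q. K * (bound * (1 + \<bar>fst q\<bar>)))"
    using P2D(6)[OF \<rho>_P2[OF s]] by auto
  have le: "\<bar>p q * vel (\<rho> s) s (fst q) (snd q)\<bar> \<le> K * (bound * (1 + \<bar>fst q\<bar>))" for q
    unfolding abs_mult using p(2) bound(2)[OF s] K by (intro mult_mono) auto
  show i2: "integrable (\<rho> s) (\<lambda>q. p q * vel (\<rho> s) s (fst q) (snd q))"
    by (rule Bochner_Integration.integrable_bound[OF i m]) (use le in \<open>auto intro!: AE_I2 order_trans[OF le]\<close>)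
  have "\<bar>flux p s\<bar> \<le> (\<integral>q. \<bar>p q * vel (\<rho> s) s (fst q) (snd q)\<bar> \<partial>\<rho> s)"
    unfolding flux_def by (rule integral_abs_bound)
  also have "\<dots> \<le> (\<integral>q. K * (bound * (1 + \<bar>fst q\<bar>)) \<partial>\<rho> s)"
    by (rule integral_mono[OF integrable_abs[OF i2] i le])
  also have "\<dots> = K * (bound * (1 + (\<integral>q. \<bar>fst q\<bar> \<partial>\<rho> s)))"
    using P2D(6)[OF \<rho>_P2[OF s]] by (simp add: prob_space)
  also have "\<dots> \<le> K * (bound * (1 + bound))"
    using K bound(1) bound(3)[OF s] by (intro mult_left_mono add_left_mono) auto
  finally show "\<bar>flux p s\<bar> \<le> K * (bound * (1 + bound))" .
qed

lemma prim_\<rho>_integrable: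
  assumes "p \<in> borel_measurable borel" "\<And>q. \<bar>p q\<bar> \<le> K" "t \<in> {0..T}"
  shows "integrable (\<rho> t) (prim p)"
proof (rule Bochner_Integration.integrable_bound)
  show "integrable (\<rho> t) (\<lambda>q. K * \<bar>fst q\<bar>)" using P2D(6)[OF \<rho>_P2[OF assms(3)]] by auto
  show "prim p \<in> borel_measurable (\<rho> t)" by (rule P2D(9)[OF \<rho>_P2[OF assms(3)] prim_measurable[OF assms(1)]])
  show "AE q in \<rho> t. norm (prim p q) \<le> norm (K * \<bar>fst q\<bar>)"
    unfolding real_norm_def by (intro AE_I2 order_trans[OF prim_bound[OF assms(1,2)] abs_ge_self])
qed

text \<open>Functions of x alone are conserved because all \<open>\<rho> t\<close> share one
  marginal. This frees the primitives in \<xi> from their constants of integration, even from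
  constants that depend on x.\<close>

lemma marginal_integral_const:
  "h \<in> borel_measurable borel \<Longrightarrow> t \<in> {0..T} \<Longrightarrow> (\<integral>q. h (snd q) \<partial>\<rho> t) = (\<integral>q. h (snd q) \<partial>\<rho> 0)" for h :: "'a \<Rightarrow> real"
  using P2_integral_snd(1)[OF \<rho>_P2, of _ h] T_pos by simp

text \<open>Time-integrated weak equation for the test function \<open>prim p\<close>. Measurability
  of the flux in time is part of the property because for a Borel integrand it is obtained only as a
  limit, together with the equation.\<close>

definition evolves :: "(real \<times> 'a \<Rightarrow> real) \<Rightarrow> bool" where
  "evolves p \<longleftrightarrow> (\<lambda>s. indicator {0..T} s * flux p s) \<in> borel_measurable borel \<and>
     (\<forall>t\<in>{0..T}. (\<integral>q. prim p q \<partial>\<rho> t) - (\<integral>q. prim p q \<partial>\<rho> 0) = (LINT s:{0..t}|lborel. flux p s))"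

lemma flux_set_integrable:
  assumes p: "p \<in> borel_measurable borel" "\<And>q. \<bar>p q\<bar> \<le> K"
    and m: "(\<lambda>s. indicator {0..T} s * flux p s) \<in> borel_measurable borel" and st: "s \<in> {0..T}" "t \<in> {0..T}"
  shows "set_integrable lborel {s..t} (flux p)"
proof (rule set_integrable_bounded)
  have "(\<lambda>\<tau>. indicator {s..t} \<tau> * (indicator {0..T} \<tau> * flux p \<tau>)) \<in> borel_measurable borel" using m by measurable
  also have "(\<lambda>\<tau>. indicator {s..t} \<tau> * (indicator {0..T} \<tau> * flux p \<tau>)) = (\<lambda>\<tau>. indicator {s..t} \<tau> * flux p \<tau>)"
    using st by (auto simp: fun_eq_iff split: split_indicator)
  finally show "(\<lambda>\<tau>. indicator {s..t} \<tau> * flux p \<tau>) \<in> borel_measurable borel" .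
  show "\<bar>flux p \<tau>\<bar> \<le> K * (bound * (1 + bound))" if "\<tau> \<in> {s..t}" for \<tau>
    by (rule flux_integrable(2)[OF p]) (use that st in auto)
qed

lemma evolves_lin:
  assumes p: "p \<in> borel_measurable borel" "\<And>q. \<bar>p q\<bar> \<le> K" "evolves p"
    and p': "p' \<in> borel_measurable borel" "\<And>q. \<bar>p' q\<bar> \<le> K'" "evolves p'"
  shows "evolves (\<lambda>q. p q + c * p' q)"
proof -
  have f: "flux (\<lambda>q. p q + c * p' q) s = flux p s + c * flux p' s" if "s \<in> {0..T}" for s
    using flux_integrable(1)[OF p(1,2) that] flux_integrable(1)[OF p'(1,2) that]
    by (simp add: flux_def distrib_right mult.assoc)
  have pr: "prim (\<lambda>q. p q + c * p' q) q = prim p q + c * prim p' q" for q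
    using prim_integrable[OF p(1,2), of "fst q" "snd q"] prim_integrable[OF p'(1,2), of "fst q" "snd q"]
    by (simp add: prim_def algebra_simps)
  show ?thesis
    unfolding evolves_def
  proof (intro conjI ballI)
    have "(\<lambda>s. indicator {0..T} s * flux p s + c * (indicator {0..T} s * flux p' s)) \<in> borel_measurable borel"
      using p(3) p'(3) by (auto simp: evolves_def)
    also have "(\<lambda>s. indicator {0..T} s * flux p s + c * (indicator {0..T} s * flux p' s)) = (\<lambda>s. indicator {0..T} s * flux (\<lambda>q. p q + c * p' q) s)"
      using f by (auto simp: fun_eq_iff split: split_indicator)
    finally show "(\<lambda>s. indicator {0..T} s * flux (\<lambda>q. p q + c * p' q) s) \<in> borel_measurable borel" .
    fix t assume t: "t \<in> {0..T}"
    have 0: "0 \<in> {0..T}" using T_pos by simp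
    have "(LINT s:{0..t}|lborel. flux (\<lambda>q. p q + c * p' q) s) = (LINT s:{0..t}|lborel. flux p s + c * flux p' s)"
      by (rule set_lebesgue_integral_cong) (use f t in auto)
    also have "\<dots> = (LINT s:{0..t}|lborel. flux p s) + c * (LINT s:{0..t}|lborel. flux p' s)"
    proof -
      have i: "set_integrable lborel {0..t} (flux p)" "set_integrable lborel {0..t} (flux p')"
        using flux_set_integrable[OF p(1,2) _ 0 t] flux_set_integrable[OF p'(1,2) _ 0 t] p(3) p'(3)
        unfolding evolves_def by blast+
      show ?thesis using set_integral_add(2)[OF i(1) set_integrable_mult_right[OF i(2)]] by simp
    qed
    finally have I: "(LINT s:{0..t}|lborel. flux (\<lambda>q. p q + c * p' q) s) =
      (LINT s:{0..t}|lborel. flux p s) + c * (LINT s:{0..t}|lborel. flux p' s)" .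
    have J: "(\<integral>q. prim (\<lambda>q. p q + c * p' q) q \<partial>\<rho> s) = (\<integral>q. prim p q \<partial>\<rho> s) + c * (\<integral>q. prim p' q \<partial>\<rho> s)" if "s \<in> {0..T}" for s
      using prim_\<rho>_integrable[OF p(1,2) that] prim_\<rho>_integrable[OF p'(1,2) that] by (simp add: pr)
    have "(\<integral>q. prim p q \<partial>\<rho> t) - (\<integral>q. prim p q \<partial>\<rho> 0) = (LINT s:{0..t}|lborel. flux p s)"
      "(\<integral>q. prim p' q \<partial>\<rho> t) - (\<integral>q. prim p' q \<partial>\<rho> 0) = (LINT s:{0..t}|lborel. flux p' s)"
      using p(3) p'(3) t unfolding evolves_def by blast+
    then show "(\<integral>q. prim (\<lambda>q. p q + c * p' q) q \<partial>\<rho> t) - (\<integral>q. prim (\<lambda>q. p q + c * p' q) q \<partial>\<rho> 0) = (LINT s:{0..t}|lborel. flux (\<lambda>q. p q + c * p' q) s)"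
      unfolding I J[OF t] J[OF 0] by (simp add: algebra_simps)
  qed
qed

lemma evolves_zero: "evolves (\<lambda>_. 0)"
  by (simp add: evolves_def flux_def prim_def)

text \<open>Dominated convergence at three levels: in the flux, in the primitive, and in time. First
  moments, bounded uniformly in time, dominate the linear growth of velocity and primitive.\<close>

lemma evolves_lim:
  assumes p: "\<And>n. p n \<in> borel_measurable borel" "\<And>n q. \<bar>p n q\<bar> \<le> K" "\<And>n. evolves (p n)"
    and lim: "\<And>q. (\<lambda>n. p n q) \<longlonglongrightarrow> p' q"
  shows "evolves p'"
proof -
  have K: "K \<ge> 0" using p(2)[of 0 undefined] by linarith
  have p'm: "p' \<in> borel_measurable borel" by (rule borel_measurable_LIMSEQ_real[OF lim p(1)])
  have p'b: "\<bar>p' q\<bar> \<le> K" for q by (rule LIMSEQ_le_const2[OF tendsto_rabs[OF lim]]) (use p(2) in auto)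
  have f: "(\<lambda>n. flux (p n) s) \<longlonglongrightarrow> flux p' s" if s: "s \<in> {0..T}" for s
    unfolding flux_def
  proof (rule integral_dominated_convergence[where w="\<lambda>q. K * (bound * (1 + \<bar>fst q\<bar>))"])
    interpret prob_space "\<rho> s" by (rule P2D[OF \<rho>_P2[OF s]])
    show "integrable (\<rho> s) (\<lambda>q. K * (bound * (1 + \<bar>fst q\<bar>)))" using P2D(6)[OF \<rho>_P2[OF s]] by auto
    show "(\<lambda>q. p' q * vel (\<rho> s) s (fst q) (snd q)) \<in> borel_measurable (\<rho> s)"
      "\<And>n. (\<lambda>q. p n q * vel (\<rho> s) s (fst q) (snd q)) \<in> borel_measurable (\<rho> s)"
      by (rule P2D(9)[OF \<rho>_P2[OF s]], intro borel_measurable_times p p'm \<rho>_section_measurable s)+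
    show "AE q in \<rho> s. (\<lambda>n. p n q * vel (\<rho> s) s (fst q) (snd q)) \<longlonglongrightarrow> p' q * vel (\<rho> s) s (fst q) (snd q)"
      by (intro AE_I2 tendsto_intros lim)
    show "AE q in \<rho> s. norm (p n q * vel (\<rho> s) s (fst q) (snd q)) \<le> K * (bound * (1 + \<bar>fst q\<bar>))" for n
      unfolding real_norm_def abs_mult using p(2) bound(2)[OF s] K by (intro AE_I2 mult_mono) auto
  qed
  have pr: "(\<lambda>n. prim (p n) q) \<longlonglongrightarrow> prim p' q" for q
    unfolding prim_def set_lebesgue_integral_def
  proof (intro tendsto_intros integral_dominated_convergence[where w="\<lambda>z. indicator {0..1} z *\<^sub>R K"])
    show "integrable lborel (\<lambda>z::real. indicator {0..1} z *\<^sub>R K)"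
      using borel_integrable_atLeastAtMost'[of 0 1 "\<lambda>_. K"] by (simp add: set_integrable_def)
    note p(1)[measurable] p'm[measurable]
    show "(\<lambda>z. indicator {0..1} z *\<^sub>R p' (fst q * z, snd q)) \<in> borel_measurable lborel"
      "(\<lambda>z. indicator {0..1} z *\<^sub>R p n (fst q * z, snd q)) \<in> borel_measurable lborel" for n by measurable
    show "AE z in lborel. (\<lambda>n. indicator {0..1} z *\<^sub>R p n (fst q * z, snd q)) \<longlonglongrightarrow> indicator {0..1} z *\<^sub>R p' (fst q * z, snd q)"
      by (intro AE_I2 tendsto_intros lim)
    show "AE z in lborel. norm (indicator {0..1} z *\<^sub>R p n (fst q * z, snd q)) \<le> indicator {0..1} z *\<^sub>R K" for n
      using p(2) by (intro AE_I2) (auto split: split_indicator)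
  qed
  have pri: "(\<lambda>n. \<integral>q. prim (p n) q \<partial>\<rho> t) \<longlonglongrightarrow> (\<integral>q. prim p' q \<partial>\<rho> t)" if t: "t \<in> {0..T}" for t
  proof (rule integral_dominated_convergence[where w="\<lambda>q. K * \<bar>fst q\<bar>"])
    show "prim p' \<in> borel_measurable (\<rho> t)" "\<And>n. prim (p n) \<in> borel_measurable (\<rho> t)"
      by (intro P2D(9)[OF \<rho>_P2[OF t]] prim_measurable p p'm)+
    show "integrable (\<rho> t) (\<lambda>q. K * \<bar>fst q\<bar>)" using P2D(6)[OF \<rho>_P2[OF t]] by auto
    show "AE q in \<rho> t. norm (prim (p n) q) \<le> K * \<bar>fst q\<bar>" for n using prim_bound[OF p(1,2)] by simp
  qed (use pr in simp)
  have fm: "(\<lambda>s. indicator {0..T} s * flux (p n) s) \<in> borel_measurable borel" for n using p(3) by (simp add: evolves_def)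
  show ?thesis
    unfolding evolves_def
  proof (intro conjI ballI)
    show m': "(\<lambda>s. indicator {0..T} s * flux p' s) \<in> borel_measurable borel"
    proof (rule borel_measurable_LIMSEQ_real[OF _ fm])
      show "(\<lambda>n. indicator {0..T} s * flux (p n) s) \<longlonglongrightarrow> indicator {0..T} s * flux p' s" for s
        using f[of s] by (cases "s \<in> {0..T}") (auto intro: tendsto_intros)
    qed
    fix t assume t: "t \<in> {0..T}"
    have 0: "0 \<in> {0..T}" using T_pos by simp
    have "(\<lambda>n. LINT s:{0..t}|lborel. flux (p n) s) \<longlonglongrightarrow> (LINT s:{0..t}|lborel. flux p' s)"
      unfolding set_lebesgue_integral_def
    proof (rule integral_dominated_convergence[where w="\<lambda>s. indicator {0..t} s *\<^sub>R (K * (bound * (1 + bound)))"])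
      show "integrable lborel (\<lambda>s. indicator {0..t} s *\<^sub>R (K * (bound * (1 + bound))))"
        using borel_integrable_atLeastAtMost'[of 0 t "\<lambda>_. K * (bound * (1 + bound))"] by (simp add: set_integrable_def)
      show "(\<lambda>s. indicator {0..t} s *\<^sub>R flux p' s) \<in> borel_measurable lborel"
        using flux_set_integrable[OF p'm p'b m' 0 t] by (auto simp: set_integrable_def)
      show "(\<lambda>s. indicator {0..t} s *\<^sub>R flux (p n) s) \<in> borel_measurable lborel" for n
        using flux_set_integrable[OF p(1,2) fm 0 t] by (auto simp: set_integrable_def)
      show "AE s in lborel. (\<lambda>n. indicator {0..t} s *\<^sub>R flux (p n) s) \<longlonglongrightarrow> indicator {0..t} s *\<^sub>R flux p' s"
        using f t by (intro AE_I2) (auto split: split_indicator)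
      show "AE s in lborel. norm (indicator {0..t} s *\<^sub>R flux (p n) s) \<le> indicator {0..t} s *\<^sub>R (K * (bound * (1 + bound)))" for n
        using flux_integrable(2)[OF p(1,2)] t by (intro AE_I2) (auto split: split_indicator)
    qed
    moreover have "(\<lambda>n. (\<integral>q. prim (p n) q \<partial>\<rho> t) - (\<integral>q. prim (p n) q \<partial>\<rho> 0)) \<longlonglongrightarrow> (\<integral>q. prim p' q \<partial>\<rho> t) - (\<integral>q. prim p' q \<partial>\<rho> 0)"
      by (intro tendsto_intros pri t 0)
    moreover have "(\<integral>q. prim (p n) q \<partial>\<rho> t) - (\<integral>q. prim (p n) q \<partial>\<rho> 0) = (LINT s:{0..t}|lborel. flux (p n) s)" for n
      using p(3) t by (simp add: evolves_def)
    ultimately show "(\<integral>q. prim p' q \<partial>\<rho> t) - (\<integral>q. prim p' q \<partial>\<rho> 0) = (LINT s:{0..t}|lborel. flux p' s)"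
      by (simp add: LIMSEQ_unique)
  qed
qed

text \<open>Lipschitz integrands with bounded support in \<xi> turn the linearly growing velocity
  into a bounded Lipschitz function, to which continuity of the curve applies.\<close>

lemma flux_continuous:
  assumes p: "p \<in> borel_measurable borel" "\<And>q. \<bar>p q\<bar> \<le> K" and L: "L \<ge> 0" "\<And>\<xi> \<zeta> x. \<bar>p (\<xi>, x) - p (\<zeta>, x)\<bar> \<le> L * \<bar>\<xi> - \<zeta>\<bar>"
    and R: "R \<ge> 0" "\<And>\<xi> x. \<bar>\<xi>\<bar> > R \<Longrightarrow> p (\<xi>, x) = 0"
  shows "continuous_on {0..T} (flux p)"
  unfolding flux_def[abs_def]
proof (rule integral_curve_continuous)
  have K: "K \<ge> 0" using p(2)[of undefined] by linarith
  let ?g = "\<lambda>t q. p q * vel (\<rho> t) t (fst q) (snd q)"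
  let ?L = "L * (bound * (1 + R)) + K * C"
  show "?L \<ge> 0" using L(1) bound(1) R(1) K C_pos by simp
  show "?g t \<in> borel_measurable borel" if "t \<in> {0..T}" for t
    by (intro borel_measurable_times p \<rho>_section_measurable that)
  show "continuous_on {0..T} (\<lambda>t. ?g t q)" for q
    by (intro continuous_intros vel_continuous[OF \<rho>_cont])
  fix t assume t: "t \<in> {0..T}"
  note cl = cutoff_product[where v="\<lambda>\<xi>. vel (\<rho> t) t \<xi> x" and p="\<lambda>\<xi>. p (\<xi>, x)" for x,
      OF vel_lip[OF \<rho>_P2[OF t]] less_imp_le[OF C_pos] bound(2)[OF t] less_imp_le[OF bound(1)] L(2) L(1) p(2) R(2) R(1)]
  show "\<bar>?g t q\<bar> \<le> K * (bound * (1 + R))" for q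
    using cl(1)[of "fst q" "snd q"] by simp
  show "\<bar>?g t (\<xi>, x) - ?g t (\<zeta>, x)\<bar> \<le> ?L * \<bar>\<xi> - \<zeta>\<bar>" for \<xi> \<zeta> x
    using cl(2)[of \<xi> x \<zeta>] by simp
qed

end

section \<open>Product test functions\<close>

context mean_field_solution begin

text \<open>The weak formulation tested with \<open>\<theta>(t) \<alpha>(\<xi>) \<beta>(x)\<close> says that \<open>P t = \<integral> \<alpha> \<beta> d\<rho>\<^sub>t - \<integral>\<^sub>0\<^sup>t flux\<close> is orthogonal to
  every \<open>\<theta>'\<close> up to a boundary term at \<open>T\<close>; the choice \<open>\<theta>' = P - P T\<close> shows that \<open>P\<close> is constant.\<close>

lemma product_test:
  assumes a: "continuous_on UNIV a" "\<And>\<xi>. \<bar>a \<xi>\<bar> \<le> K" "L \<ge> 0" "\<And>\<xi> \<zeta>. \<bar>a \<xi> - a \<zeta>\<bar> \<le> L * \<bar>\<xi> - \<zeta>\<bar>"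
    and \<alpha>: "\<And>\<xi>. (\<alpha> has_real_derivative a \<xi>) (at \<xi>)" "\<And>\<xi>. \<bar>\<xi>\<bar> > R \<Longrightarrow> \<alpha> \<xi> = 0" "\<And>\<xi>. \<bar>\<xi>\<bar> > R \<Longrightarrow> a \<xi> = 0" "R \<ge> 0"
    and \<beta>: "C1_function \<beta>" "bounded S" "\<And>x. x \<notin> S \<Longrightarrow> \<beta> x = 0" "\<And>x. \<bar>\<beta> x\<bar> \<le> 1"
    and t: "t \<in> {0..T}"
  shows "(\<integral>q. \<alpha> (fst q) * \<beta> (snd q) \<partial>\<rho> t) - (\<integral>q. \<alpha> (fst q) * \<beta> (snd q) \<partial>\<rho> 0) =
    (LINT s:{0..t}|lborel. flux (\<lambda>q. a (fst q) * \<beta> (snd q)) s)"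
proof -
  have K: "K \<ge> 0" using a(2)[of 0] by linarith
  have \<alpha>c: "continuous_on UNIV \<alpha>" using DERIV_continuous_on[of UNIV \<alpha> a] \<alpha>(1) by auto
  have \<beta>c: "continuous_on UNIV \<beta>" by (rule C1_function_continuous[OF \<beta>(1)])
  have [measurable]: "\<alpha> \<in> borel_measurable borel" "a \<in> borel_measurable borel" "\<beta> \<in> borel_measurable borel"
    by (intro borel_measurable_continuous_onI \<alpha>c a(1) \<beta>c)+
  have \<alpha>L: "\<bar>\<alpha> \<xi> - \<alpha> \<zeta>\<bar> \<le> K * \<bar>\<xi> - \<zeta>\<bar>" for \<xi> \<zeta>
    by (rule antiderivative_lipschitz[OF \<alpha>(1) a(2)])
  \<comment> \<open>\<open>\<alpha>\<close> vanishes at R + 1, which is within 2 R + 1 of every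
    point of [-R, R].\<close>
  have \<alpha>b: "\<bar>\<alpha> \<xi>\<bar> \<le> K * (2 * R + 1)" for \<xi>
  proof (cases "\<bar>\<xi>\<bar> > R")
    case False
    have "\<bar>\<alpha> \<xi>\<bar> \<le> K * \<bar>\<xi> - (R + 1)\<bar>" using \<alpha>L[of \<xi> "R + 1"] \<alpha>(2)[of "R + 1"] \<alpha>(4) by simp
    also have "\<dots> \<le> K * (2 * R + 1)" using False K by (intro mult_left_mono) auto
    finally show ?thesis .
  qed (use \<alpha>(2,4) K in auto)
  define A where "A t = (\<integral>q. \<alpha> (fst q) * \<beta> (snd q) \<partial>\<rho> t)" for t
  define V where "V = flux (\<lambda>q. a (fst q) * \<beta> (snd q))"
  have prod_le: "\<bar>y * \<beta> x\<bar> \<le> M" if "\<bar>y\<bar> \<le> M" for y M x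
    using mult_mono[OF that \<beta>(4)[of x]] abs_ge_zero[of y] that unfolding abs_mult by linarith
  have Ac: "continuous_on {0..T} A"
    unfolding A_def[abs_def]
  proof (rule integral_curve_continuous[where g="\<lambda>_ q. \<alpha> (fst q) * \<beta> (snd q)" and L=K])
    show "\<bar>\<alpha> (fst (\<xi>, x)) * \<beta> (snd (\<xi>, x)) - \<alpha> (fst (\<zeta>, x)) * \<beta> (snd (\<zeta>, x))\<bar> \<le> K * \<bar>\<xi> - \<zeta>\<bar>" for \<xi> \<zeta> x
      using prod_le[OF \<alpha>L[of \<xi> \<zeta>], of x] by (simp add: left_diff_distrib)
    show "\<bar>\<alpha> (fst q) * \<beta> (snd q)\<bar> \<le> K * (2 * R + 1)" for q by (rule prod_le[OF \<alpha>b])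
  qed (use K in auto)
  have Vc: "continuous_on {0..T} V"
    unfolding V_def
  proof (rule flux_continuous[OF _ _ a(3) _ \<alpha>(4)])
    show "\<bar>a (fst q) * \<beta> (snd q)\<bar> \<le> K" for q by (rule prod_le[OF a(2)])
    show "\<bar>a (fst (\<xi>, x)) * \<beta> (snd (\<xi>, x)) - a (fst (\<zeta>, x)) * \<beta> (snd (\<zeta>, x))\<bar> \<le> L * \<bar>\<xi> - \<zeta>\<bar>" for \<xi> \<zeta> x
      using prod_le[OF a(4)[of \<xi> \<zeta>], of x] by (simp add: left_diff_distrib)
  qed (use \<alpha>(3) in auto)
  define IV where "IV t = integral {0..t} V" for t
  define P where "P t = A t - IV t" for t
  define g where "g t = P t - P T" for t
  define \<theta> where "\<theta> t = integral {0..t} g" for t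
  have IVd: "(IV has_real_derivative V t) (at t within {0..T})" if "t \<in> {0..T}" for t
    unfolding IV_def[abs_def] by (rule integral_has_real_derivative[OF Vc that])
  have IVc: "continuous_on {0..T} IV" by (rule DERIV_continuous_on[OF IVd])
  have gc: "continuous_on {0..T} g" unfolding g_def P_def by (intro continuous_intros Ac IVc)
  have \<theta>d: "(\<theta> has_real_derivative g t) (at t within {0..T})" if "t \<in> {0..T}" for t
    unfolding \<theta>_def[abs_def] by (rule integral_has_real_derivative[OF gc that])
  have \<theta>c: "continuous_on {0..T} \<theta>" by (rule DERIV_continuous_on[OF \<theta>d])
  obtain \<phi>' where \<phi>: "C1c_test T (\<lambda>(t, \<xi>, x). \<theta> t * \<alpha> \<xi> * \<beta> x) \<phi>'"
    "\<And>t \<xi> x. blinfun_apply (\<phi>' (t, \<xi>, x)) (1, 0, 0) = g t * \<alpha> \<xi> * \<beta> x"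
    "\<And>t \<xi> x. blinfun_apply (\<phi>' (t, \<xi>, x)) (0, 1, 0) = \<theta> t * a \<xi> * \<beta> x"
    by (rule C1c_test_product[OF \<theta>d gc \<alpha>(1) a(1) \<alpha>(2) \<beta>(1-3)]) auto
  have L2I: "(LINT t:{0..T}|lborel. h t) = integral {0..T} h" if "continuous_on {0..T} h" for h :: "real \<Rightarrow> real"
    by (rule set_borel_integral_eq_integral(2)[OF borel_integrable_atLeastAtMost'[OF that]])
  have \<theta>0: "\<theta> 0 = 0" by (simp add: \<theta>_def)
  have e1: "(LINT p|\<rho> t. blinfun_apply (\<phi>' (t, p)) (1, 0, 0)) = g t * A t" for t
  proof -
    have "(\<lambda>p. blinfun_apply (\<phi>' (t, p)) (1, 0, 0)) = (\<lambda>q. g t * (\<alpha> (fst q) * \<beta> (snd q)))"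
      using \<phi>(2) by (auto simp: fun_eq_iff)
    then show ?thesis by (simp add: A_def)
  qed
  have e2: "(LINT p|\<rho> t. blinfun_apply (\<phi>' (t, p)) (0, 1, 0) * vel (\<rho> t) t (fst p) (snd p)) = \<theta> t * V t" for t
  proof -
    have "(\<lambda>p. blinfun_apply (\<phi>' (t, p)) (0, 1, 0) * vel (\<rho> t) t (fst p) (snd p)) = (\<lambda>q. \<theta> t * (a (fst q) * \<beta> (snd q) * vel (\<rho> t) t (fst q) (snd q)))"
      using \<phi>(3) by (auto simp: fun_eq_iff)
    then show ?thesis by (simp add: V_def flux_def)
  qed
  have e3: "(LINT p|\<rho> T. (\<lambda>(t, \<xi>, x). \<theta> t * \<alpha> \<xi> * \<beta> x) (T, p)) = \<theta> T * A T"
  proof -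
    have "(\<lambda>p. (\<lambda>(t, \<xi>, x). \<theta> t * \<alpha> \<xi> * \<beta> x) (T, p)) = (\<lambda>q. \<theta> T * (\<alpha> (fst q) * \<beta> (snd q)))" by auto
    then show ?thesis by (simp add: A_def)
  qed
  have e4: "(LINT p|\<nu>. (\<lambda>(t, \<xi>, x). \<theta> t * \<alpha> \<xi> * \<beta> x) (0, p)) = 0"
    by (simp add: \<theta>0 case_prod_beta')
  have "(LINT t:{0..T}|lborel. g t * A t) - \<theta> T * A T = - (LINT t:{0..T}|lborel. \<theta> t * V t)"
    using \<rho>_CE \<phi>(1) e1 e2 e3 e4 unfolding CE_solution_def by fastforce
  moreover have c: "continuous_on {0..T} (\<lambda>t. g t * A t)" "continuous_on {0..T} (\<lambda>t. \<theta> t * V t)" "continuous_on {0..T} (\<lambda>t. g t * IV t)"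
    by (intro continuous_intros gc Ac \<theta>c Vc IVc)+
  ultimately have CE: "integral {0..T} (\<lambda>t. g t * A t) - \<theta> T * A T = - integral {0..T} (\<lambda>t. \<theta> t * V t)"
    by (simp add: L2I)
  have "((\<lambda>t. g t * IV t + \<theta> t * V t) has_integral (\<theta> T * IV T - \<theta> 0 * IV 0)) {0..T}"
  proof (rule fundamental_theorem_of_calculus)
    fix t assume "t \<in> {0..T}"
    from DERIV_mult[OF \<theta>d[OF this] IVd[OF this]]
    show "((\<lambda>t. \<theta> t * IV t) has_vector_derivative g t * IV t + \<theta> t * V t) (at t within {0..T})"
      by (simp add: has_real_derivative_iff_has_vector_derivative mult.commute)
  qed (use T_pos in simp)
  then have parts: "integral {0..T} (\<lambda>t. g t * IV t) + integral {0..T} (\<lambda>t. \<theta> t * V t) = \<theta> T * IV T"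
    using integral_add[of "\<lambda>t. g t * IV t" "{0..T}" "\<lambda>t. \<theta> t * V t"] c by (auto simp: \<theta>0 integrable_continuous_real integral_unique)
  have i: "(\<lambda>t. g t * A t) integrable_on {0..T}" "(\<lambda>t. g t * IV t) integrable_on {0..T}" "(\<lambda>t. g t * P T) integrable_on {0..T}"
    using c gc by (auto intro!: integrable_continuous_real continuous_intros)
  \<comment> \<open>The weak equation and integration by parts evaluate the integral of g P as the
    boundary term \<open>\<theta> T * P T\<close>; the constant \<open>P T\<close> subtracted in g
    contributes exactly the same term.\<close>
  have "integral {0..T} (\<lambda>t. g t * g t) = integral {0..T} (\<lambda>t. (g t * A t - g t * IV t) - g t * P T)"
    by (rule arg_cong[where f="integral {0..T}"]) (auto simp: g_def P_def algebra_simps)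
  also have "\<dots> = integral {0..T} (\<lambda>t. g t * A t) - integral {0..T} (\<lambda>t. g t * IV t) - integral {0..T} (\<lambda>t. g t * P T)"
    using i by (simp add: integral_diff integrable_diff)
  also have "integral {0..T} (\<lambda>t. g t * P T) = \<theta> T * P T" by (simp add: \<theta>_def)
  finally have "integral {0..T} (\<lambda>t. g t * g t) = 0" using CE parts by (simp add: P_def algebra_simps)
  then have "g t * g t = 0" if "t \<in> {0..T}" for t
  proof -
    have "continuous_on {0..T} (\<lambda>t. g t * g t)" by (intro continuous_intros gc)
    from integral_eq_0_iff[OF this T_pos zero_le_square] \<open>integral {0..T} (\<lambda>t. g t * g t) = 0\<close> that show ?thesis by blast
  qed
  then have Pc: "P t = P T" if t: "t \<in> {0..T}" for t
  proof -
    from \<open>\<And>t. t \<in> {0..T} \<Longrightarrow> g t * g t = 0\<close>[OF t] have "g t = 0" by simp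
    then show ?thesis unfolding g_def by linarith
  qed
  have "A t - A 0 = IV t"
  proof -
    have "P t = P 0" using Pc[OF t] Pc[of 0] T_pos by simp
    moreover have "IV 0 = 0" by (simp add: IV_def)
    ultimately show ?thesis unfolding P_def by linarith
  qed
  also have "IV t = (LINT s:{0..t}|lborel. V s)"
    unfolding IV_def by (rule set_borel_integral_eq_integral(2)[symmetric, OF borel_integrable_atLeastAtMost'[OF continuous_on_subset[OF Vc]]]) (use t in auto)
  finally show ?thesis by (simp add: A_def V_def)
qed

text \<open>Unless the integral of a is 0, its primitive has different constant values at the two
  ends, and no choice of constant makes it compactly supported. Subtracting \<kappa> e, where e is a
  tent of half-width M and height 1 / M, equalises the masses. Since e is at most 1 / M and its
  primitive at most |\<xi>| / M, the correction disappears against the bounded first moments as M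
  grows.\<close>

lemma evolves_product:
  assumes a: "\<And>\<xi>. \<bar>a \<xi>\<bar> \<le> 1" "L \<ge> 0" "\<And>\<xi> \<zeta>. \<bar>a \<xi> - a \<zeta>\<bar> \<le> L * \<bar>\<xi> - \<zeta>\<bar>" "\<And>\<xi>. \<bar>\<xi>\<bar> > R \<Longrightarrow> a \<xi> = 0" "R \<ge> 0"
    and \<beta>: "C1_function \<beta>" "bounded S" "\<And>x. x \<notin> S \<Longrightarrow> \<beta> x = 0" "\<And>x. \<bar>\<beta> x\<bar> \<le> 1"
  shows "evolves (\<lambda>q. a (fst q) * \<beta> (snd q))"
proof -
  have ac: "continuous_on UNIV a"
    by (rule lipschitz_on_continuous_on[OF lipschitz_onI[where L=L]]) (use a in \<open>auto simp: dist_real_def\<close>)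
  have \<beta>c: "continuous_on UNIV \<beta>" by (rule C1_function_continuous[OF \<beta>(1)])
  have [measurable]: "a \<in> borel_measurable borel" "\<beta> \<in> borel_measurable borel" "tent \<in> borel_measurable borel"
    by (intro borel_measurable_continuous_onI ac \<beta>c tent)+
  obtain F where F: "\<And>\<xi>. (F has_real_derivative a \<xi>) (at \<xi>)" using exists_antiderivative[OF ac] by blast
  obtain H where H: "\<And>\<xi>. (H has_real_derivative tent \<xi>) (at \<xi>)" using exists_antiderivative[OF tent(5)] by blast
  have H1: "H (- 1) < H 1" by (rule tent_total[OF H])
  \<comment> \<open>The mass of a divided by the mass of the tent, which every dilation
    preserves.\<close>
  define \<kappa> where "\<kappa> = (F R - F (- R)) / (H 1 - H (- 1))"
  let ?p = "\<lambda>q. a (fst q) * \<beta> (snd q)"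
  have prod_le: "\<bar>y * \<beta> x\<bar> \<le> M" if "\<bar>y\<bar> \<le> M" for y M x
    using mult_mono[OF that \<beta>(4)[of x]] abs_ge_zero[of y] that unfolding abs_mult by linarith
  have pm: "?p \<in> borel_measurable borel" by measurable
  have pb: "\<bar>?p q\<bar> \<le> 1" for q by (rule prod_le[OF a(1)])
  have fc: "continuous_on {0..T} (flux ?p)"
  proof (rule flux_continuous[OF pm pb a(2) _ a(5)])
    show "\<bar>a (fst (\<xi>, x)) * \<beta> (snd (\<xi>, x)) - a (fst (\<zeta>, x)) * \<beta> (snd (\<zeta>, x))\<bar> \<le> L * \<bar>\<xi> - \<zeta>\<bar>" for \<xi> \<zeta> x
      using prod_le[OF a(3)[of \<xi> \<zeta>], of x] by (simp add: left_diff_distrib)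
  qed (use a(4) in auto)
  have 0: "0 \<in> {0..T}" using T_pos by simp
  have F_diff: "(\<integral>q. prim ?p q \<partial>\<rho> t) - (\<integral>q. prim ?p q \<partial>\<rho> 0) = (LINT s:{0..t}|lborel. flux ?p s)" if t: "t \<in> {0..T}" for t
  proof -
    \<comment> \<open>The defect of the equation; it is free of M and is shown to be of order 1 /
      M.\<close>
    define D where "D = (\<integral>q. prim ?p q \<partial>\<rho> t) - (\<integral>q. prim ?p q \<partial>\<rho> 0) - (LINT s:{0..t}|lborel. flux ?p s)"
    have pa: "prim ?p q = (F (fst q) - F 0) * \<beta> (snd q)" for q
    proof (cases q)
      case (Pair \<xi> x)
      have "prim ?p (\<xi>, x) = F \<xi> * \<beta> x - F 0 * \<beta> x"
        by (rule prim_antiderivative[where F="\<lambda>\<xi>. F \<xi> * \<beta> x"]) (auto intro!: DERIV_cmult_right F continuous_intros ac)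
      then show ?thesis using Pair by (simp add: algebra_simps)
    qed
    have "\<bar>D\<bar> \<le> (\<bar>\<kappa>\<bar> * (2 * bound + T * (bound * (1 + bound)))) / real (Suc n)" for n
    proof -
      define M where "M = real (Suc n)"
      have M: "M \<ge> 1" by (simp add: M_def)
      define e where "e \<xi> = tent (\<xi> / M) / M" for \<xi>
      define N where "N \<xi> = H (\<xi> / M) - H 0" for \<xi>
      have em[measurable]: "e \<in> borel_measurable borel" unfolding e_def by measurable
      have ec: "continuous_on UNIV e" unfolding e_def using M
        by (intro continuous_intros continuous_on_compose2[OF tent(5)[of UNIV]]) auto
      have eb: "\<bar>e \<xi>\<bar> \<le> 1 / M" for \<xi> using tent(1,2)[of "\<xi> / M"] M by (simp add: e_def divide_right_mono)
      have Nd: "(N has_real_derivative e \<xi>) (at \<xi>)" for \<xi>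
        unfolding N_def[abs_def] e_def
        by (rule derivative_eq_intros DERIV_chain2[OF H] refl | use M in simp)+
      have NL: "\<bar>N \<xi>\<bar> \<le> 1 / M * \<bar>\<xi>\<bar>" for \<xi>
        using antiderivative_lipschitz[OF Nd eb, of \<xi> 0] by (simp add: N_def)
      have eL: "\<bar>e \<xi> - e \<zeta>\<bar> \<le> 1 * \<bar>\<xi> - \<zeta>\<bar>" for \<xi> \<zeta>
      proof -
        have "\<bar>e \<xi> - e \<zeta>\<bar> = \<bar>tent (\<xi> / M) - tent (\<zeta> / M)\<bar> / M" using M by (simp add: e_def flip: diff_divide_distrib)
        also have "\<dots> \<le> \<bar>\<xi> / M - \<zeta> / M\<bar> / M" using M by (intro divide_right_mono tent) auto
        also have "\<dots> = \<bar>\<xi> - \<zeta>\<bar> / (M * M)" using M by (simp flip: diff_divide_distrib)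
        also have "\<dots> \<le> \<bar>\<xi> - \<zeta>\<bar> / 1" using M mult_mono[of 1 M 1 M] by (intro divide_left_mono) auto
        finally show ?thesis by simp
      qed
      define R' where "R' = max R M"
      define a' where "a' \<xi> = a \<xi> - \<kappa> * e \<xi>" for \<xi>
      define \<alpha> where "\<alpha> \<xi> = (F \<xi> - F (- R)) - \<kappa> * (N \<xi> - N (- M))" for \<xi>
      have ez: "e \<xi> = 0" if "\<bar>\<xi>\<bar> > M" for \<xi> using that M tent(3)[of "\<xi> / M"] by (simp add: e_def)
      have \<alpha>d: "(\<alpha> has_real_derivative a' \<xi>) (at \<xi>)" for \<xi>
        unfolding \<alpha>_def[abs_def] a'_def by (rule derivative_eq_intros F Nd refl)+ simp
      have "N M - N (- M) = H 1 - H (- 1)" using M by (simp add: N_def)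
      then have kN: "\<kappa> * (N M - N (- M)) = F R - F (- R)" using H1 by (simp add: \<kappa>_def)
      have \<alpha>z: "\<alpha> \<xi> = 0" if "\<bar>\<xi>\<bar> > R'" for \<xi>
      proof (cases "\<xi> > 0")
        case True
        then have "\<xi> \<ge> R" "\<xi> \<ge> M" "M \<ge> 0" using that M by (auto simp: R'_def)
        then have "F \<xi> = F R" "N \<xi> = N M"
          using antiderivative_const(1)[OF F a(4,5)] antiderivative_const(1)[OF Nd ez] by blast+
        then show ?thesis using kN by (simp add: \<alpha>_def)
      next
        case False
        then have "\<xi> \<le> - R" "\<xi> \<le> - M" "M \<ge> 0" using that M by (auto simp: R'_def)
        then have "F \<xi> = F (- R)" "N \<xi> = N (- M)"
          using antiderivative_const(2)[OF F a(4,5)] antiderivative_const(2)[OF Nd ez] by blast+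
        then show ?thesis by (simp add: \<alpha>_def)
      qed
      let ?e = "\<lambda>q. e (fst q) * \<beta> (snd q)"
      have pe: "\<bar>?e q\<bar> \<le> 1 / M" for q by (rule prod_le[OF eb])
      have pem: "?e \<in> borel_measurable borel" by measurable
      have main: "(\<integral>q. \<alpha> (fst q) * \<beta> (snd q) \<partial>\<rho> t) - (\<integral>q. \<alpha> (fst q) * \<beta> (snd q) \<partial>\<rho> 0) = (LINT s:{0..t}|lborel. flux (\<lambda>q. a' (fst q) * \<beta> (snd q)) s)"
      proof (rule product_test[where K="1 + \<bar>\<kappa>\<bar> * (1 / M)" and L="L + \<bar>\<kappa>\<bar> * 1" and R=R', OF _ _ _ _ \<alpha>d \<alpha>z _ _ \<beta> t])
        show "continuous_on UNIV a'" unfolding a'_def by (intro continuous_intros ac ec)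
        show "\<bar>a' \<xi>\<bar> \<le> 1 + \<bar>\<kappa>\<bar> * (1 / M)" for \<xi>
          using a(1)[of \<xi>] mult_left_mono[OF eb[of \<xi>], of "\<bar>\<kappa>\<bar>"] abs_triangle_ineq4[of "a \<xi>" "\<kappa> * e \<xi>"] unfolding a'_def abs_mult by linarith
        show "\<bar>a' \<xi> - a' \<zeta>\<bar> \<le> (L + \<bar>\<kappa>\<bar> * 1) * \<bar>\<xi> - \<zeta>\<bar>" for \<xi> \<zeta>
        proof -
          have "a' \<xi> - a' \<zeta> = (a \<xi> - a \<zeta>) - \<kappa> * (e \<xi> - e \<zeta>)" by (simp add: a'_def algebra_simps)
          also have "\<bar>\<dots>\<bar> \<le> \<bar>a \<xi> - a \<zeta>\<bar> + \<bar>\<kappa>\<bar> * \<bar>e \<xi> - e \<zeta>\<bar>" unfolding abs_mult[symmetric] by (rule abs_triangle_ineq4)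
          also have "\<dots> \<le> L * \<bar>\<xi> - \<zeta>\<bar> + \<bar>\<kappa>\<bar> * (1 * \<bar>\<xi> - \<zeta>\<bar>)" by (intro add_mono a mult_left_mono eL) auto
          finally show ?thesis by (simp add: algebra_simps)
        qed
        show "a' \<xi> = 0" if "\<bar>\<xi>\<bar> > R'" for \<xi> using that a(4) ez by (simp add: a'_def R'_def)
        show "0 \<le> L + \<bar>\<kappa>\<bar> * 1" "R' \<ge> 0" using a(2,5) by (auto simp: R'_def)
      qed
      have fe: "flux (\<lambda>q. a' (fst q) * \<beta> (snd q)) s = flux ?p s - \<kappa> * flux ?e s" if "s \<in> {0..T}" for s
        using flux_integrable(1)[OF pm pb that] flux_integrable(1)[OF pem pe that]
        by (simp add: flux_def a'_def left_diff_distrib mult.assoc)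
      have ec2: "continuous_on {0..T} (flux ?e)"
      proof (rule flux_continuous[OF pem pe, where L=1 and R=M])
        show "\<bar>e (fst (\<xi>, x)) * \<beta> (snd (\<xi>, x)) - e (fst (\<zeta>, x)) * \<beta> (snd (\<zeta>, x))\<bar> \<le> 1 * \<bar>\<xi> - \<zeta>\<bar>" for \<xi> \<zeta> x
          using prod_le[OF eL[of \<xi> \<zeta>], of x] by (simp add: left_diff_distrib)
      qed (use ez M in auto)
      have si: "set_integrable lborel {0..t} (flux ?p)" "set_integrable lborel {0..t} (flux ?e)"
        by (rule borel_integrable_atLeastAtMost', rule continuous_on_subset[OF fc] continuous_on_subset[OF ec2], use t in auto)+
      have "(LINT s:{0..t}|lborel. flux (\<lambda>q. a' (fst q) * \<beta> (snd q)) s) = (LINT s:{0..t}|lborel. flux ?p s - \<kappa> * flux ?e s)"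
        by (rule set_lebesgue_integral_cong) (use fe t in auto)
      also have "\<dots> = (LINT s:{0..t}|lborel. flux ?p s) - \<kappa> * (LINT s:{0..t}|lborel. flux ?e s)"
        using set_integral_diff(2)[OF si(1) set_integrable_mult_right[OF si(2)]] by simp
      finally have R1: "(LINT s:{0..t}|lborel. flux (\<lambda>q. a' (fst q) * \<beta> (snd q)) s) = (LINT s:{0..t}|lborel. flux ?p s) - \<kappa> * (LINT s:{0..t}|lborel. flux ?e s)" .
      \<comment> \<open>Collects the constants of integration of F and N. Multiplied by
        \<open>\<beta>\<close> it is a function of x alone and cancels between the times t and
        0.\<close>
      define c where "c = F 0 - F (- R) + \<kappa> * N (- M)"
      have Nm[measurable]: "N \<in> borel_measurable borel"
        using DERIV_continuous_on[of UNIV N e] Nd by (intro borel_measurable_continuous_onI) auto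
      have NI: "integrable (\<rho> s) (\<lambda>q. N (fst q) * \<beta> (snd q))" "\<bar>\<integral>q. N (fst q) * \<beta> (snd q) \<partial>\<rho> s\<bar> \<le> 1 / M * bound" if s: "s \<in> {0..T}" for s
      proof -
        have i: "integrable (\<rho> s) (\<lambda>q. 1 / M * \<bar>fst q\<bar>)" using P2D(6)[OF \<rho>_P2[OF s]] by auto
        have le: "\<bar>N (fst q) * \<beta> (snd q)\<bar> \<le> 1 / M * \<bar>fst q\<bar>" for q by (rule prod_le[OF NL])
        show i2: "integrable (\<rho> s) (\<lambda>q. N (fst q) * \<beta> (snd q))"
        proof (rule Bochner_Integration.integrable_bound[OF i])
          show "(\<lambda>q. N (fst q) * \<beta> (snd q)) \<in> borel_measurable (\<rho> s)" by (rule P2D(9)[OF \<rho>_P2[OF s]]) measurable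
          show "AE q in \<rho> s. norm (N (fst q) * \<beta> (snd q)) \<le> norm (1 / M * \<bar>fst q\<bar>)"
            unfolding real_norm_def by (intro AE_I2 order_trans[OF le abs_ge_self])
        qed
        have "\<bar>\<integral>q. N (fst q) * \<beta> (snd q) \<partial>\<rho> s\<bar> \<le> (\<integral>q. \<bar>N (fst q) * \<beta> (snd q)\<bar> \<partial>\<rho> s)" by (rule integral_abs_bound)
        also have "\<dots> \<le> (\<integral>q. 1 / M * \<bar>fst q\<bar> \<partial>\<rho> s)" by (rule integral_mono[OF integrable_abs[OF i2] i le])
        also have "\<dots> \<le> 1 / M * bound" unfolding integral_mult_right_zero using bound(3)[OF s] M by (intro mult_left_mono) auto
        finally show "\<bar>\<integral>q. N (fst q) * \<beta> (snd q) \<partial>\<rho> s\<bar> \<le> 1 / M * bound" .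
      qed
      have \<beta>i: "integrable (\<rho> s) (\<lambda>q. \<beta> (snd q))" if s: "s \<in> {0..T}" for s
      proof -
        interpret prob_space "\<rho> s" by (rule P2D[OF \<rho>_P2[OF s]])
        show ?thesis by (rule integrable_const_bound[where B=1]) (use \<beta>(4) in \<open>auto intro!: P2D(9)[OF \<rho>_P2[OF s]]\<close>)
      qed
      have R2: "(\<integral>q. \<alpha> (fst q) * \<beta> (snd q) \<partial>\<rho> s) = (\<integral>q. prim ?p q \<partial>\<rho> s) - \<kappa> * (\<integral>q. N (fst q) * \<beta> (snd q) \<partial>\<rho> s) + c * (\<integral>q. \<beta> (snd q) \<partial>\<rho> s)"
        if s: "s \<in> {0..T}" for s
      proof -
        have "\<alpha> (fst q) * \<beta> (snd q) = prim ?p q - \<kappa> * (N (fst q) * \<beta> (snd q)) + c * \<beta> (snd q)" for q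
          unfolding pa by (simp add: \<alpha>_def c_def algebra_simps)
        then show ?thesis
          using prim_\<rho>_integrable[OF pm pb s] NI(1)[OF s] \<beta>i[OF s] by simp
      qed
      define E where "E = (\<integral>q. N (fst q) * \<beta> (snd q) \<partial>\<rho> t) - (\<integral>q. N (fst q) * \<beta> (snd q) \<partial>\<rho> 0) - (LINT s:{0..t}|lborel. flux ?e s)"
      have DE: "D = \<kappa> * E"
        using main[unfolded R1 R2[OF t] R2[OF 0]] marginal_integral_const[of \<beta> t] t by (simp add: D_def E_def algebra_simps)
      have "\<bar>E\<bar> \<le> 1 / M * bound + 1 / M * bound + 1 / M * (bound * (1 + bound)) * T"
      proof -
        have "\<bar>LINT s:{0..t}|lborel. flux ?e s\<bar> \<le> 1 / M * (bound * (1 + bound)) * (t - 0)"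
          by (rule set_integral_Icc_bound[OF si(2)]) (use flux_integrable(2)[OF pem pe] t in auto)
        also have "\<dots> \<le> 1 / M * (bound * (1 + bound)) * T" using t M bound(1) by (intro mult_left_mono) auto
        finally have fl: "\<bar>LINT s:{0..t}|lborel. flux ?e s\<bar> \<le> 1 / M * (bound * (1 + bound)) * T" .
        show ?thesis unfolding E_def using fl NI(2)[OF t] NI(2)[OF 0] by linarith
      qed
      then have "\<bar>D\<bar> \<le> \<bar>\<kappa>\<bar> * (1 / M * bound + 1 / M * bound + 1 / M * (bound * (1 + bound)) * T)"
        unfolding DE abs_mult by (rule mult_left_mono) simp
      also have "\<dots> = (\<bar>\<kappa>\<bar> * (2 * bound + T * (bound * (1 + bound)))) / M" using M by (simp add: field_simps)
      finally show ?thesis by (simp only: M_def)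
    qed
    moreover have "(\<lambda>n. (\<bar>\<kappa>\<bar> * (2 * bound + T * (bound * (1 + bound)))) / real (Suc n)) \<longlonglongrightarrow> 0"
      using LIMSEQ_Suc[OF lim_const_over_n] .
    ultimately have "\<bar>D\<bar> \<le> 0" by (intro LIMSEQ_le_const) auto
    then show ?thesis by (simp add: D_def)
  qed
  have "(\<lambda>s. indicator {0..T} s *\<^sub>R flux ?p s) \<in> borel_measurable borel"
    by (rule borel_measurable_continuous_on_indicator[OF _ fc]) simp
  then show ?thesis unfolding evolves_def using F_diff by simp
qed

end

section \<open>From boxes to bounded Borel integrands\<close>

lemma box_prod: "box (a :: 'a::euclidean_space \<times> 'b::euclidean_space) b = box (fst a) (fst b) \<times> box (snd a) (snd b)"
proof -
  have "x \<in> box a b \<longleftrightarrow> fst x \<in> box (fst a) (fst b) \<and> snd x \<in> box (snd a) (snd b)" for x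
    unfolding mem_box Basis_prod_def ball_Un ball_simps by (simp add: inner_prod_def)
  then show ?thesis by (auto simp: mem_Times_iff)
qed

context mean_field_solution begin

text \<open>The Lipschitz constants of the approximants blow up, but the approximants stay between 0
  and 1, and \<open>evolves_lim\<close> asks only for a common bound.\<close>

lemma evolves_box: "evolves (indicator (box a b))"
proof -
  obtain \<alpha> :: "nat \<Rightarrow> real \<Rightarrow> real" where \<alpha>: "\<And>n \<xi>. 0 \<le> \<alpha> n \<xi>" "\<And>n \<xi>. \<alpha> n \<xi> \<le> 1"
    "\<And>n \<xi> \<zeta>. \<bar>\<alpha> n \<xi> - \<alpha> n \<zeta>\<bar> \<le> real n * \<bar>\<xi> - \<zeta>\<bar>" "\<And>n \<xi>. \<xi> \<notin> {fst a<..<fst b} \<Longrightarrow> \<alpha> n \<xi> = 0"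
    "\<And>\<xi>. (\<lambda>n. \<alpha> n \<xi>) \<longlonglongrightarrow> indicator {fst a<..<fst b} \<xi>"
    using interval_indicator_approx[of "fst a" "fst b"] by metis
  obtain \<beta> :: "nat \<Rightarrow> 'a \<Rightarrow> real" where \<beta>: "\<And>n. C1_function (\<beta> n)" "\<And>n x. 0 \<le> \<beta> n x" "\<And>n x. \<beta> n x \<le> 1"
    "\<And>n x. x \<notin> box (snd a) (snd b) \<Longrightarrow> \<beta> n x = 0" "\<And>x. (\<lambda>n. \<beta> n x) \<longlonglongrightarrow> indicator (box (snd a) (snd b)) x"
    using box_indicator_approx[of "snd a" "snd b"] by metis
  have [measurable]: "\<alpha> n \<in> borel_measurable borel" "\<beta> n \<in> borel_measurable borel" for n
  proof -
    have "continuous_on UNIV (\<alpha> n)"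
      by (rule lipschitz_on_continuous_on[OF lipschitz_onI[where L="real n"]]) (use \<alpha>(3) in \<open>auto simp: dist_real_def\<close>)
    then show "\<alpha> n \<in> borel_measurable borel" by (rule borel_measurable_continuous_onI)
    show "\<beta> n \<in> borel_measurable borel" by (intro borel_measurable_continuous_onI C1_function_continuous \<beta>)
  qed
  show ?thesis
  proof (rule evolves_lim)
    show "(\<lambda>q. \<alpha> n (fst q) * \<beta> n (snd q)) \<in> borel_measurable borel" for n by measurable
    show "\<bar>\<alpha> n (fst q) * \<beta> n (snd q)\<bar> \<le> 1" for n q
      unfolding abs_mult using \<alpha>(1,2) \<beta>(2,3) by (intro mult_le_one) (auto simp: abs_le_iff intro: order_trans[of _ 0])
    show "evolves (\<lambda>q. \<alpha> n (fst q) * \<beta> n (snd q))" for n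
    proof (rule evolves_product[where L="real n" and R="max \<bar>fst a\<bar> \<bar>fst b\<bar>" and S="box (snd a) (snd b)"])
      show "\<alpha> n \<xi> = 0" if "max \<bar>fst a\<bar> \<bar>fst b\<bar> < \<bar>\<xi>\<bar>" for \<xi> using that by (intro \<alpha>(4)) auto
      show "\<bar>\<alpha> n \<xi>\<bar> \<le> 1" for \<xi> using \<alpha>(1,2)[of n \<xi>] by simp
      show "\<bar>\<beta> n x\<bar> \<le> 1" for x using \<beta>(2,3)[of n x] by simp
    qed (use \<alpha>(3) \<beta> in auto)
    show "(\<lambda>n. \<alpha> n (fst q) * \<beta> n (snd q)) \<longlonglongrightarrow> indicator (box a b) q" for q
    proof -
      have "(\<lambda>n. \<alpha> n (fst q) * \<beta> n (snd q)) \<longlonglongrightarrow> indicator {fst a<..<fst b} (fst q) * indicator (box (snd a) (snd b)) (snd q)"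
        by (intro tendsto_mult \<alpha> \<beta>)
      also have "indicator {fst a<..<fst b} (fst q) * indicator (box (snd a) (snd b)) (snd q) = (indicator (box a b) q :: real)"
        by (auto simp: box_prod box_real mem_Times_iff split: split_indicator)
      finally show ?thesis .
    qed
  qed
qed

text \<open>Dynkin class argument with open boxes as generator; countable disjoint unions are
  bounded limits of finite sums.\<close>

lemma evolves_indicator:
  assumes "A \<in> sets borel" shows "evolves (indicator A)"
proof -
  let ?G = "range (\<lambda>(a, b). box a b :: (real \<times> 'a) set)"
  have s: "sets borel = sigma_sets (UNIV :: (real \<times> 'a) set) ?G"
    by (subst borel_eq_box) simp
  have I: "Int_stable ?G"
    unfolding Int_stable_def
  proof safe
    fix a b c d :: "real \<times> 'a"
    show "box a b \<inter> box c d \<in> ?G" unfolding box_Int_box by (metis (mono_tags, lifting) case_prod_conv rangeI)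
  qed
  have im[measurable]: "(indicator A :: real \<times> 'a \<Rightarrow> real) \<in> borel_measurable borel" if "A \<in> sigma_sets UNIV ?G" for A
    using that s by (intro borel_measurable_indicator) simp
  \<comment> \<open>Complements require the constant 1, which is reached as a limit of growing
    boxes.\<close>
  have one: "evolves (\<lambda>_. 1)"
  proof (rule evolves_lim)
    show "evolves (indicator (box (- real n *\<^sub>R One) (real n *\<^sub>R One)))" for n by (rule evolves_box)
    show "(\<lambda>n. indicator (box (- real n *\<^sub>R One) (real n *\<^sub>R One)) q :: real) \<longlonglongrightarrow> 1" for q
    proof -
      obtain N where N: "\<And>i. i \<in> Basis \<Longrightarrow> \<bar>q \<bullet> i\<bar> < real N"
        using reals_Archimedean2[of "norm q"] Basis_le_norm[of _ q] by (metis le_less_trans)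
      have "eventually (\<lambda>n. indicator (box (- real n *\<^sub>R One) (real n *\<^sub>R One)) q = (1::real)) sequentially"
        using eventually_ge_at_top[of N]
      proof eventually_elim
        case (elim n)
        have "- real n < q \<bullet> i \<and> q \<bullet> i < real n" if "i \<in> Basis" for i using N[OF that] elim by auto
        then show ?case by (auto simp: mem_box indicator_def)
      qed
      then show ?thesis by (rule tendsto_eventually)
    qed
    show "\<bar>indicator (box (- real n *\<^sub>R One) (real n *\<^sub>R One)) q\<bar> \<le> (1::real)" for n and q :: "real \<times> 'a" by (simp split: split_indicator)
  qed measurable
  have "A \<in> sigma_sets UNIV ?G" using assms s by simp
  have G: "?G \<subseteq> Pow UNIV" by simp
  note A = \<open>A \<in> sigma_sets UNIV ?G\<close>
  from A show ?thesis
  proof (induction rule: sigma_sets_induct_disjoint[OF I G, consumes 1, case_names basic empty compl union])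
    case (basic A) then show ?case using evolves_box by auto
  next
    case empty then show ?case using evolves_zero by simp
  next
    case (compl A)
    have "evolves (\<lambda>q. 1 + (- 1) * indicator A q)"
      by (rule evolves_lin[OF _ _ one im[OF compl(1)] _ compl(2), where K=1 and K'=1]) auto
    moreover have "(\<lambda>q. 1 + (- 1) * indicator A q) = (indicator (UNIV - A) :: real \<times> 'a \<Rightarrow> real)"
      by (auto simp: fun_eq_iff split: split_indicator)
    ultimately show ?case by simp
  next
    case (union A)
    have d: "(\<Sum>i<n. indicator (A i) q) = (indicator (\<Union>i<n. A i) q :: real)" for n q
      by (subst indicator_UN_disjoint) (use union(1) in \<open>auto simp: disjoint_family_on_def\<close>)
    have m: "(indicator (\<Union>i<n. A i) :: real \<times> 'a \<Rightarrow> real) \<in> borel_measurable borel" for n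
      using union(2) s by (auto intro!: borel_measurable_indicator sets.finite_UN)
    show ?case
    proof (rule evolves_lim[OF m])
      show "evolves (indicator (\<Union>i<n. A i))" for n
      proof (induction n)
        case (Suc n)
        have "evolves (\<lambda>q. indicator (\<Union>i<n. A i) q + 1 * indicator (A n) q)"
          by (rule evolves_lin[OF m _ Suc im _ union(3), where K=1 and K'=1]) (use union(2) in auto)
        moreover have "(\<lambda>q. indicator (\<Union>i<n. A i) q + 1 * indicator (A n) q) = (indicator (\<Union>i<Suc n. A i) :: real \<times> 'a \<Rightarrow> real)"
          using d[where n=n] d[where n="Suc n"] by (auto simp: fun_eq_iff)
        ultimately show ?case by simp
      qed (simp add: evolves_zero)
      show "\<bar>indicator (\<Union>i<n. A i) q\<bar> \<le> (1::real)" for n q by (simp split: split_indicator)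
      show "(\<lambda>n. indicator (\<Union>i<n. A i) q) \<longlonglongrightarrow> (indicator (\<Union>i. A i) q :: real)" for q by (rule LIMSEQ_indicator_UN)
    qed
  qed
qed

text \<open>Induction over nonnegative Borel functions. Boundedness is carried as a premise inside
  the induction because limits require a common bound; nonnegativity and monotonicity let every
  construction step pass an upper bound down to its parts.\<close>

lemma evolves_bounded:
  assumes p: "p \<in> borel_measurable borel" "\<And>q. \<bar>p q\<bar> \<le> K" shows "evolves p"
proof -
  have nn: "evolves u" if u: "u \<in> borel_measurable borel" "\<And>q. 0 \<le> u q" "\<And>q. u q \<le> M" for u M
  proof -
    have "(\<exists>M. \<forall>q. u q \<le> M) \<longrightarrow> evolves u"
      using u(1,2)
    proof (induction u rule: borel_measurable_induct_real)
      case (set A) then show ?case using evolves_indicator by blast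
    next
      case (mult u c)
      show ?case
      proof (cases "c = 0")
        case True then show ?thesis using evolves_zero by simp
      next
        case False
        show ?thesis
        proof
          assume "\<exists>M. \<forall>q. c * u q \<le> M"
          then obtain M where "\<And>q. c * u q \<le> M" by blast
          then have M: "u q \<le> M / c" for q using False mult(1) by (simp add: field_simps)
          then have "evolves u" using mult by blast
          then have "evolves (\<lambda>q. 0 + c * u q)"
            by (intro evolves_lin[OF _ _ evolves_zero mult(2), where K=0 and K'="M / c"]) (use M mult(3) in auto)
          then show "evolves (\<lambda>q. c * u q)" by simp
        qed
      qed
    next
      case (add u v)
      show ?case
      proof
        assume "\<exists>M. \<forall>q. v q + u q \<le> M"
        then obtain M where vu: "\<And>q. v q + u q \<le> M" by blast
        have M: "u q \<le> M" "v q \<le> M" for q using add(2)[of q] add(4)[of q] vu[of q] by linarith+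
        then have "evolves u" "evolves v" using add.IH by blast+
        then have "evolves (\<lambda>q. v q + 1 * u q)"
          by (intro evolves_lin[OF add(3) _ _ add(1), where K=M and K'=M]) (use M add(2,4) in auto)
        then show "evolves (\<lambda>q. v q + u q)" by simp
      qed
    next
      case (seq U)
      show ?case
      proof
        assume "\<exists>M. \<forall>q. u q \<le> M"
        then obtain M where M: "\<And>q. u q \<le> M" by blast
        have le: "U i q \<le> M" for i q
        proof -
          have "incseq (\<lambda>i. U i q)" using seq(3) by (auto simp: incseq_def le_fun_def simp del: split_paired_All)
          from incseq_le[OF this seq(4), of i] M[of q] show ?thesis by simp
        qed
        show "evolves u"
        proof (rule evolves_lim[where p=U and K=M])
          show "evolves (U i)" for i using seq.IH[of i] le by blast
        qed (use seq(1,2,4) le in auto)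
      qed
    qed
    then show ?thesis using u(3) by blast
  qed
  have K: "0 \<le> K" using p(2)[of undefined] by linarith
  have m: "(\<lambda>q. max 0 (p q)) \<in> borel_measurable borel" "(\<lambda>q. max 0 (- p q)) \<in> borel_measurable borel"
    using p(1) by measurable
  have le: "max 0 (p q) \<le> K" "max 0 (- p q) \<le> K" for q using p(2)[of q] K by (auto simp: abs_le_iff)
  have e: "evolves (\<lambda>q. max 0 (p q))" "evolves (\<lambda>q. max 0 (- p q))"
    by (rule nn[OF m(1) _ le(1)], simp) (rule nn[OF m(2) _ le(2)], simp)
  have "evolves (\<lambda>q. max 0 (p q) + (- 1) * max 0 (- p q))"
    by (rule evolves_lin[OF m(1) _ e(1) m(2) _ e(2), where K=K and K'=K]) (use le in auto)
  moreover have "(\<lambda>q. max 0 (p q) + (- 1) * max 0 (- p q)) = p" by (auto simp: fun_eq_iff max_def)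
  ultimately show ?thesis by simp
qed

lemma evolution_increment:
  assumes p: "p \<in> borel_measurable borel" "\<And>q. \<bar>p q\<bar> \<le> K" and st: "0 \<le> s" "s \<le> t" "t \<le> T"
  shows "set_integrable lborel {s..t} (flux p)"
    and "(\<integral>q. prim p q \<partial>\<rho> t) - (\<integral>q. prim p q \<partial>\<rho> s) = (LINT \<tau>:{s..t}|lborel. flux p \<tau>)"
proof -
  have e: "evolves p" by (rule evolves_bounded[OF p])
  then have m: "(\<lambda>s. indicator {0..T} s * flux p s) \<in> borel_measurable borel" by (simp add: evolves_def)
  show "set_integrable lborel {s..t} (flux p)" by (rule flux_set_integrable[OF p m]) (use st in auto)
  have i: "set_integrable lborel {0..t} (flux p)" by (rule flux_set_integrable[OF p m]) (use st in auto)
  have "(\<integral>q. prim p q \<partial>\<rho> t) - (\<integral>q. prim p q \<partial>\<rho> 0) = (LINT \<tau>:{0..t}|lborel. flux p \<tau>)"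
    "(\<integral>q. prim p q \<partial>\<rho> s) - (\<integral>q. prim p q \<partial>\<rho> 0) = (LINT \<tau>:{0..s}|lborel. flux p \<tau>)"
    using e st unfolding evolves_def by auto
  with set_integral_increment[OF i st(1,2)] show "(\<integral>q. prim p q \<partial>\<rho> t) - (\<integral>q. prim p q \<partial>\<rho> s) = (LINT \<tau>:{s..t}|lborel. flux p \<tau>)"
    by linarith
qed

end

section \<open>Mollification and bi-Lipschitz flows\<close>

lemma C1_taylor:
  fixes F p :: "real \<Rightarrow> real"
  assumes F: "\<And>\<xi>. (F has_real_derivative p \<xi>) (at \<xi>)" and L: "\<And>\<xi> \<zeta>. \<bar>p \<xi> - p \<zeta>\<bar> \<le> L * \<bar>\<xi> - \<zeta>\<bar>" "L \<ge> 0"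
  shows "\<bar>F (\<xi> + \<delta>) - F \<xi> - \<delta> * p \<xi>\<bar> \<le> L * \<delta>\<^sup>2"
proof -
  define G where "G y = F y - y * p \<xi>" for y
  have Gd: "(G has_real_derivative (p y - p \<xi>)) (at y)" for y
    unfolding G_def[abs_def] by (rule derivative_eq_intros F refl)+ simp
  have "\<exists>z. \<bar>z - \<xi>\<bar> \<le> \<bar>\<delta>\<bar> \<and> G (\<xi> + \<delta>) - G \<xi> = \<delta> * (p z - p \<xi>)"
  proof (cases \<delta> "0::real" rule: linorder_cases)
    case less
    from MVT2[of "\<xi> + \<delta>" \<xi> G "\<lambda>y. p y - p \<xi>"] Gd less obtain z where "\<xi> + \<delta> < z" "z < \<xi>" "G \<xi> - G (\<xi> + \<delta>) = (\<xi> - (\<xi> + \<delta>)) * (p z - p \<xi>)" by auto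
    then show ?thesis by (intro exI[of _ z]) (auto simp: algebra_simps)
  next
    case greater
    from MVT2[of \<xi> "\<xi> + \<delta>" G "\<lambda>y. p y - p \<xi>"] Gd greater obtain z where "\<xi> < z" "z < \<xi> + \<delta>" "G (\<xi> + \<delta>) - G \<xi> = (\<xi> + \<delta> - \<xi>) * (p z - p \<xi>)" by auto
    then show ?thesis by (intro exI[of _ z]) (auto simp: algebra_simps)
  qed (auto intro!: exI[of _ \<xi>])
  then obtain z where z: "\<bar>z - \<xi>\<bar> \<le> \<bar>\<delta>\<bar>" "G (\<xi> + \<delta>) - G \<xi> = \<delta> * (p z - p \<xi>)" by blast
  have "\<bar>p z - p \<xi>\<bar> \<le> L * \<bar>\<delta>\<bar>" using L(1)[of z \<xi>] mult_left_mono[OF z(1) L(2)] by linarith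
  then have "\<bar>\<delta>\<bar> * \<bar>p z - p \<xi>\<bar> \<le> \<bar>\<delta>\<bar> * (L * \<bar>\<delta>\<bar>)" by (intro mult_left_mono) auto
  moreover have "F (\<xi> + \<delta>) - F \<xi> - \<delta> * p \<xi> = \<delta> * (p z - p \<xi>)" using z(2) by (simp add: G_def algebra_simps)
  ultimately show ?thesis by (simp add: abs_mult power2_eq_square mult_ac)
qed

text \<open>\<open>w\<^sup>2 exp (2 c t)\<close> is nondecreasing and \<open>w\<^sup>2 exp (- 2 c t)\<close> is nonincreasing, which gives the bound
  in both time directions.\<close>

lemma two_sided_gronwall:
  fixes w w' :: "real \<Rightarrow> real"
  assumes wd: "\<And>t. t \<in> {0..T} \<Longrightarrow> (w has_real_derivative w' t) (at t within {0..T})"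
    and w'b: "\<And>t. t \<in> {0..T} \<Longrightarrow> \<bar>w' t\<bar> \<le> C * \<bar>w t\<bar>" and C_pos: "C > 0"
    and s: "s \<in> {0..T}" and t: "t \<in> {0..T}"
  shows "\<bar>w t\<bar> \<le> exp (C * T) * \<bar>w s\<bar>"
proof -
  \<comment> \<open>c = 1 and c = -1 select the two weights; the trailing factor c turns the
    nonincreasing case into a nondecreasing one.\<close>
  have mono: "(w a)\<^sup>2 * exp (2 * C * a * c) * c \<le> (w b)\<^sup>2 * exp (2 * C * b * c) * c"
    if ab: "0 \<le> a" "a \<le> b" "b \<le> T" and c: "c = 1 \<or> c = - 1" for a b c
  proof (cases "a = b")
    case False
    have in0: "{a..b} \<subseteq> {0..T}" using ab by auto
    have d: "((\<lambda>t. (w t)\<^sup>2 * exp (2 * C * t * c) * c) has_real_derivative (2 * w t * w' t + 2 * C * c * (w t)\<^sup>2) * exp (2 * C * t * c) * c) (at t within {0..T})" if "t \<in> {0..T}" for t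
      by (rule derivative_eq_intros wd[OF that] refl)+ (simp add: algebra_simps power2_eq_square)
    show ?thesis
    proof (rule DERIV_nonneg_imp_increasing_open[OF ab(2)])
      fix t assume t: "a < t" "t < b"
      then have t0: "t \<in> {0..T}" "t \<in> interior {0..T}" using ab by auto
      have "\<bar>w t * w' t\<bar> \<le> \<bar>w t\<bar> * (C * \<bar>w t\<bar>)" unfolding abs_mult by (intro mult_left_mono w'b t0) auto
      also have "\<dots> = C * (w t)\<^sup>2" by (simp add: power2_eq_square mult_ac)
      finally have "0 \<le> (2 * w t * w' t + 2 * C * c * (w t)\<^sup>2) * c" using c by (auto simp: abs_le_iff)
      then have "0 \<le> ((2 * w t * w' t + 2 * C * c * (w t)\<^sup>2) * c) * exp (2 * C * t * c)" by (rule mult_nonneg_nonneg) simp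
      then have nn: "0 \<le> (2 * w t * w' t + 2 * C * c * (w t)\<^sup>2) * exp (2 * C * t * c) * c" by (simp only: mult_ac)
      show "\<exists>y. ((\<lambda>t. (w t)\<^sup>2 * exp (2 * C * t * c) * c) has_real_derivative y) (at t) \<and> 0 \<le> y"
        using d[OF t0(1)] nn unfolding at_within_interior[OF t0(2)] by blast
    next
      show "continuous_on {a..b} (\<lambda>t. (w t)\<^sup>2 * exp (2 * C * t * c) * c)"
        using continuous_on_subset[OF DERIV_continuous_on[OF d] in0] .
    qed
  qed simp
  have sq: "(w t)\<^sup>2 \<le> (w s)\<^sup>2 * exp (2 * C * T)"
  proof (cases "s \<le> t")
    case True
    from mono[of s t "- 1"] s t True have "(w t)\<^sup>2 * exp (- (2 * C * t)) \<le> (w s)\<^sup>2 * exp (- (2 * C * s))" by simp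
    then have "(w t)\<^sup>2 * exp (- (2 * C * t)) * exp (2 * C * t) \<le> (w s)\<^sup>2 * exp (- (2 * C * s)) * exp (2 * C * t)"
      by (rule mult_right_mono) simp
    then have "(w t)\<^sup>2 \<le> (w s)\<^sup>2 * exp (2 * C * (t - s))" by (simp add: mult.assoc right_diff_distrib flip: exp_add)
    also have "\<dots> \<le> (w s)\<^sup>2 * exp (2 * C * T)" using s t C_pos by (intro mult_left_mono) auto
    finally show ?thesis .
  next
    case False
    from mono[of t s 1] s t False have "(w t)\<^sup>2 * exp (2 * C * t) \<le> (w s)\<^sup>2 * exp (2 * C * s)" by simp
    then have "(w t)\<^sup>2 * exp (2 * C * t) * exp (- (2 * C * t)) \<le> (w s)\<^sup>2 * exp (2 * C * s) * exp (- (2 * C * t))"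
      by (rule mult_right_mono) simp
    then have "(w t)\<^sup>2 \<le> (w s)\<^sup>2 * exp (2 * C * (s - t))" by (simp add: mult.assoc right_diff_distrib flip: exp_add)
    also have "\<dots> \<le> (w s)\<^sup>2 * exp (2 * C * T)" using s t C_pos by (intro mult_left_mono) auto
    finally show ?thesis .
  qed
  have "(exp (C * T))\<^sup>2 = exp (2 * C * T)" by (simp add: exp_double[symmetric] mult_ac)
  with sq have "\<bar>w t\<bar>\<^sup>2 \<le> (exp (C * T) * \<bar>w s\<bar>)\<^sup>2" by (simp add: power_mult_distrib mult_ac)
  then show ?thesis by (intro power2_le_imp_le[of "\<bar>_\<bar>"]) auto
qed

text \<open>One-sided average over [\<xi>, \<xi> + \<epsilon>]. Its \<xi>-derivative is exactly
  \<open>quotient\<close>, so a function that is merely Lipschitz acquires a Lipschitz derivative,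
  and bounds on the derivative are read off from increments.\<close>

definition mollify :: "real \<Rightarrow> (real \<times> 'a \<Rightarrow> real) \<Rightarrow> real \<times> 'a \<Rightarrow> real" where
  "mollify \<epsilon> \<phi> q = (LINT z:{0..1}|lborel. \<phi> (fst q + \<epsilon> * z, snd q))"

definition quotient :: "real \<Rightarrow> (real \<times> 'a \<Rightarrow> real) \<Rightarrow> real \<times> 'a \<Rightarrow> real" where
  "quotient \<epsilon> \<phi> q = (\<phi> (fst q + \<epsilon>, snd q) - \<phi> q) / \<epsilon>"

context
  fixes \<phi> :: "real \<times> 'a::euclidean_space \<Rightarrow> real" and \<epsilon> :: real and l :: "'a \<Rightarrow> real" and M :: real
  assumes \<phi>: "\<phi> \<in> borel_measurable borel" "\<And>\<xi> \<zeta> x. \<bar>\<phi> (\<xi>, x) - \<phi> (\<zeta>, x)\<bar> \<le> l x * \<bar>\<xi> - \<zeta>\<bar>" "\<And>q. \<bar>\<phi> q\<bar> \<le> M"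
    and \<epsilon>: "\<epsilon> > 0"
begin

lemma mollify_l_nonneg: "l x \<ge> 0"
  using \<phi>(2)[of 1 x 0] by simp

lemma mollify_integrable: "set_integrable lborel {0..1} (\<lambda>z. \<phi> (\<xi> + \<epsilon> * z, x))"
  using \<phi> by (intro set_integrable_bounded[where B=M]) auto

lemma mollify_measurable: "mollify \<epsilon> \<phi> \<in> borel_measurable borel"
proof -
  note \<phi>(1)[measurable]
  have "(\<lambda>q. \<integral>z. indicator {0..1} z *\<^sub>R \<phi> (fst q + \<epsilon> * z, snd q) \<partial>lborel) \<in> borel_measurable borel"
    by (rule measurable_integral_parameter) (auto intro: lborel.sigma_finite_measure_axioms)
  then show ?thesis unfolding mollify_def[abs_def] set_lebesgue_integral_def .
qed

lemma quotient_measurable: "quotient \<epsilon> \<phi> \<in> borel_measurable borel"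
  unfolding quotient_def[abs_def] using \<phi>(1) by measurable

lemma quotient_bound: "\<bar>quotient \<epsilon> \<phi> (\<xi>, x)\<bar> \<le> l x"
  using \<phi>(2)[of "\<xi> + \<epsilon>" x \<xi>] \<epsilon> by (simp add: quotient_def field_simps)

lemma quotient_lipschitz: "\<bar>quotient \<epsilon> \<phi> (\<xi>, x) - quotient \<epsilon> \<phi> (\<zeta>, x)\<bar> \<le> 2 * l x / \<epsilon> * \<bar>\<xi> - \<zeta>\<bar>"
proof -
  have "\<bar>(\<phi> (\<xi> + \<epsilon>, x) - \<phi> (\<xi>, x)) - (\<phi> (\<zeta> + \<epsilon>, x) - \<phi> (\<zeta>, x))\<bar> \<le> 2 * l x * \<bar>\<xi> - \<zeta>\<bar>"
    using \<phi>(2)[of "\<xi> + \<epsilon>" x "\<zeta> + \<epsilon>"] \<phi>(2)[of \<xi> x \<zeta>] by simp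
  then show ?thesis using \<epsilon> by (simp add: quotient_def divide_right_mono flip: diff_divide_distrib)
qed

lemma mollify_close: "\<bar>mollify \<epsilon> \<phi> (\<xi>, x) - \<phi> (\<xi>, x)\<bar> \<le> l x * \<epsilon>"
proof -
  have c: "set_integrable lborel {0..1::real} (\<lambda>_. \<phi> (\<xi>, x))" by (rule borel_integrable_atLeastAtMost') simp
  have "mollify \<epsilon> \<phi> (\<xi>, x) - \<phi> (\<xi>, x) = (LINT z:{0..1}|lborel. \<phi> (\<xi> + \<epsilon> * z, x) - \<phi> (\<xi>, x))"
    using set_integral_diff(2)[OF mollify_integrable[of \<xi> x] c] by (simp add: mollify_def set_lebesgue_integral_def)
  also have "\<bar>\<dots>\<bar> \<le> (l x * \<epsilon>) * (1 - 0)"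
  proof (rule set_integral_Icc_bound)
    fix z :: real assume z: "z \<in> {0..1}"
    have "\<bar>\<phi> (\<xi> + \<epsilon> * z, x) - \<phi> (\<xi>, x)\<bar> \<le> l x * \<bar>\<epsilon> * z\<bar>" using \<phi>(2)[of "\<xi> + \<epsilon> * z" x \<xi>] by simp
    also have "\<dots> \<le> l x * \<epsilon>" using z \<epsilon> mollify_l_nonneg by (intro mult_left_mono) (auto simp: abs_mult mult_le_cancel_left1)
    finally show "\<bar>\<phi> (\<xi> + \<epsilon> * z, x) - \<phi> (\<xi>, x)\<bar> \<le> l x * \<epsilon>" .
  qed (auto intro!: set_integral_diff(1) mollify_integrable c)
  finally show ?thesis by simp
qed

lemma mollify_bound: "\<bar>mollify \<epsilon> \<phi> q\<bar> \<le> M"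
  using set_integral_Icc_bound[OF mollify_integrable[of "fst q" "snd q"], of M] \<phi>(3) by (simp add: mollify_def)

lemma mollify_deriv: "((\<lambda>\<xi>. mollify \<epsilon> \<phi> (\<xi>, x)) has_real_derivative quotient \<epsilon> \<phi> (\<xi>, x)) (at \<xi>)"
proof -
  have c: "continuous_on UNIV (\<lambda>\<xi>. \<phi> (\<xi>, x))"
    by (rule lipschitz_on_continuous_on[OF lipschitz_onI[where L="l x"]]) (use \<phi>(2) mollify_l_nonneg in \<open>auto simp: dist_real_def\<close>)
  obtain A where A: "\<And>\<xi>. (A has_real_derivative \<phi> (\<xi>, x)) (at \<xi>)" using exists_antiderivative[OF c] by blast
  have e: "mollify \<epsilon> \<phi> (\<xi>, x) = (A (\<xi> + \<epsilon>) - A \<xi>) / \<epsilon>" for \<xi>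
  proof -
    have "(\<integral>z. indicator {0..1} z *\<^sub>R \<phi> (\<xi> + \<epsilon> * z, x) \<partial>lborel) = A (\<xi> + \<epsilon> * 1) / \<epsilon> - A (\<xi> + \<epsilon> * 0) / \<epsilon>"
    proof (rule integral_FTC_Icc)
      fix z :: real
      have "((\<lambda>z. A (\<xi> + \<epsilon> * z)) has_real_derivative \<phi> (\<xi> + \<epsilon> * z, x) * \<epsilon>) (at z within {0..1})"
        by (rule DERIV_chain2[OF A]) (auto intro!: derivative_eq_intros)
      from DERIV_cdivide[OF this, of \<epsilon>] show "((\<lambda>z. A (\<xi> + \<epsilon> * z) / \<epsilon>) has_vector_derivative \<phi> (\<xi> + \<epsilon> * z, x)) (at z within {0..1})"
        using \<epsilon> by (simp add: has_real_derivative_iff_has_vector_derivative)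
      show "continuous_on {0..1} (\<lambda>z. \<phi> (\<xi> + \<epsilon> * z, x))"
        by (intro continuous_on_compose2[OF c] continuous_intros) auto
    qed simp
    then show ?thesis by (simp add: mollify_def set_lebesgue_integral_def diff_divide_distrib)
  qed
  have "((\<lambda>\<xi>. (A (\<xi> + \<epsilon>) - A \<xi>) / \<epsilon>) has_real_derivative (\<phi> (\<xi> + \<epsilon>, x) - \<phi> (\<xi>, x)) / \<epsilon>) (at \<xi>)"
    by (intro DERIV_cdivide DERIV_diff A) (use A[of "\<xi> + \<epsilon>"] in \<open>simp add: DERIV_shift\<close>)
  then show ?thesis unfolding e by (simp add: quotient_def)
qed

lemma mollify_prim: "prim (quotient \<epsilon> \<phi>) (\<xi>, x) = mollify \<epsilon> \<phi> (\<xi>, x) - mollify \<epsilon> \<phi> (0, x)"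
proof (rule prim_antiderivative[OF mollify_deriv])
  show "continuous_on UNIV (\<lambda>\<xi>. quotient \<epsilon> \<phi> (\<xi>, x))"
    by (rule lipschitz_on_continuous_on[OF lipschitz_onI[where L="2 * l x / \<epsilon>"]])
      (use quotient_lipschitz mollify_l_nonneg \<epsilon> in \<open>auto simp: dist_real_def\<close>)
qed

end

section \<open>Solutions tested with mollified functions\<close>

context mean_field_solution begin

lemma bounded_\<rho>_integrable:
  fixes h :: "real \<times> 'a \<Rightarrow> real"
  assumes "h \<in> borel_measurable borel" "\<And>q. \<bar>h q\<bar> \<le> M" "t \<in> {0..T}"
  shows "integrable (\<rho> t) h"
proof -
  interpret prob_space "\<rho> t" by (rule P2D[OF \<rho>_P2[OF assms(3)]])
  show ?thesis
  proof (rule integrable_const_bound[where B=M])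
    show "AE q in \<rho> t. norm (h q) \<le> M" using assms(2) by simp
    show "h \<in> borel_measurable (\<rho> t)" by (rule P2D(9)[OF \<rho>_P2[OF assms(3)] assms(1)])
  qed
qed

text \<open>By \<open>mollify_prim\<close> the mollification differs from the primitive of its
  difference quotient by a function of x alone, whose integral is constant in time.\<close>

lemma mollified_increment:
  assumes \<phi>: "\<phi> \<in> borel_measurable borel" "\<And>\<xi> \<zeta> x. \<bar>\<phi> (\<xi>, x) - \<phi> (\<zeta>, x)\<bar> \<le> l x * \<bar>\<xi> - \<zeta>\<bar>" "\<And>q. \<bar>\<phi> q\<bar> \<le> M" and \<epsilon>: "\<epsilon> > 0"
    and l: "\<And>x. l x \<le> Lb" and st: "0 \<le> s" "s \<le> t" "t \<le> T"
  shows "set_integrable lborel {s..t} (flux (quotient \<epsilon> \<phi>))"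
    and "(\<integral>q. mollify \<epsilon> \<phi> q \<partial>\<rho> t) - (\<integral>q. mollify \<epsilon> \<phi> q \<partial>\<rho> s) = (LINT \<tau>:{s..t}|lborel. flux (quotient \<epsilon> \<phi>) \<tau>)"
proof -
  note mo = mollify_measurable[OF \<phi> \<epsilon>] mollify_bound[OF \<phi> \<epsilon>]
  have qb: "\<bar>quotient \<epsilon> \<phi> q\<bar> \<le> Lb" for q
    using quotient_bound[OF \<phi> \<epsilon>, of "fst q" "snd q"] l[of "snd q"] by simp
  note inc = evolution_increment[OF quotient_measurable[OF \<phi> \<epsilon>] qb st]
  show "set_integrable lborel {s..t} (flux (quotient \<epsilon> \<phi>))" by (rule inc)
  have s0: "(\<lambda>x. mollify \<epsilon> \<phi> (0, x)) \<in> borel_measurable borel"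
    by (rule measurable_compose[OF _ mo(1)]) simp
  have "(\<integral>q. prim (quotient \<epsilon> \<phi>) q \<partial>\<rho> \<tau>) = (\<integral>q. mollify \<epsilon> \<phi> q \<partial>\<rho> \<tau>) - (\<integral>q. mollify \<epsilon> \<phi> (0, snd q) \<partial>\<rho> 0)" if \<tau>: "\<tau> \<in> {0..T}" for \<tau>
  proof -
    have "prim (quotient \<epsilon> \<phi>) = (\<lambda>q. mollify \<epsilon> \<phi> q - mollify \<epsilon> \<phi> (0, snd q))"
      using mollify_prim[OF \<phi> \<epsilon>] by (auto simp: fun_eq_iff)
    moreover have "integrable (\<rho> \<tau>) (mollify \<epsilon> \<phi>)" by (rule bounded_\<rho>_integrable[OF mo \<tau>])
    moreover have "integrable (\<rho> \<tau>) (\<lambda>q. mollify \<epsilon> \<phi> (0, snd q))"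
      by (rule bounded_\<rho>_integrable[OF _ mo(2) \<tau>]) (rule measurable_compose[OF snd_borel s0])
    ultimately show ?thesis using marginal_integral_const[OF s0 \<tau>] by simp
  qed
  then show "(\<integral>q. mollify \<epsilon> \<phi> q \<partial>\<rho> t) - (\<integral>q. mollify \<epsilon> \<phi> q \<partial>\<rho> s) = (LINT \<tau>:{s..t}|lborel. flux (quotient \<epsilon> \<phi>) \<tau>)"
    using inc(2) st by simp
qed

text \<open>The velocity bound gives the estimate for the mollified function, with a constant free
  of \<epsilon>. In \<open>transport_energy_step\<close> it replaces the measure at time \<tau> by
  the one at time s at a cost of second order in the step.\<close>

lemma lipschitz_in_time:
  assumes g: "g \<in> borel_measurable borel" "\<And>\<xi> \<zeta> x. \<bar>g (\<xi>, x) - g (\<zeta>, x)\<bar> \<le> L * \<bar>\<xi> - \<zeta>\<bar>" "\<And>q. \<bar>g q\<bar> \<le> M" and st: "0 \<le> s" "s \<le> t" "t \<le> T"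
  shows "\<bar>(\<integral>q. g q \<partial>\<rho> t) - (\<integral>q. g q \<partial>\<rho> s)\<bar> \<le> L * (bound * (1 + bound)) * (t - s)"
proof -
  have b: "\<bar>(\<integral>q. g q \<partial>\<rho> t) - (\<integral>q. g q \<partial>\<rho> s)\<bar> \<le> L * (bound * (1 + bound)) * (t - s) + (2 * L) * \<epsilon>" if \<epsilon>: "\<epsilon> > 0" for \<epsilon>
  proof -
    note inc = mollified_increment[OF g \<epsilon> order_refl st]
    have "\<bar>LINT \<tau>:{s..t}|lborel. flux (quotient \<epsilon> g) \<tau>\<bar> \<le> (L * (bound * (1 + bound))) * (t - s)"
    proof (rule set_integral_Icc_bound[OF inc(1) _ st(2)])
      fix \<tau> assume "\<tau> \<in> {s..t}"
      then have "\<tau> \<in> {0..T}" using st by auto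
      moreover have "\<bar>quotient \<epsilon> g q\<bar> \<le> L" for q using quotient_bound[OF g \<epsilon>, of "fst q" "snd q"] by simp
      ultimately show "\<bar>flux (quotient \<epsilon> g) \<tau>\<bar> \<le> L * (bound * (1 + bound))"
        by (intro flux_integrable(2)[OF quotient_measurable[OF g \<epsilon>]])
    qed
    moreover have "\<bar>(\<integral>q. mollify \<epsilon> g q \<partial>\<rho> \<tau>) - (\<integral>q. g q \<partial>\<rho> \<tau>)\<bar> \<le> L * \<epsilon>" if \<tau>: "\<tau> \<in> {0..T}" for \<tau>
    proof -
      interpret prob_space "\<rho> \<tau>" by (rule P2D[OF \<rho>_P2[OF \<tau>]])
      have i: "integrable (\<rho> \<tau>) (mollify \<epsilon> g)" "integrable (\<rho> \<tau>) g"
        by (rule bounded_\<rho>_integrable[OF _ _ \<tau>] mollify_measurable[OF g \<epsilon>] mollify_bound[OF g \<epsilon>] g)+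
      then have "\<bar>(\<integral>q. mollify \<epsilon> g q \<partial>\<rho> \<tau>) - (\<integral>q. g q \<partial>\<rho> \<tau>)\<bar> = \<bar>\<integral>q. mollify \<epsilon> g q - g q \<partial>\<rho> \<tau>\<bar>" by simp
      also have "\<dots> \<le> (\<integral>q. \<bar>mollify \<epsilon> g q - g q\<bar> \<partial>\<rho> \<tau>)" by (rule integral_abs_bound)
      also have "\<dots> \<le> (\<integral>q. L * \<epsilon> \<partial>\<rho> \<tau>)"
      proof (rule integral_mono)
        show "\<bar>mollify \<epsilon> g q - g q\<bar> \<le> L * \<epsilon>" for q using mollify_close[OF g \<epsilon>, of "fst q" "snd q"] by simp
      qed (use i in auto)
      finally show ?thesis by (simp add: prob_space)
    qed
    from this[of t] this[of s] st have "\<bar>(\<integral>q. mollify \<epsilon> g q \<partial>\<rho> t) - (\<integral>q. g q \<partial>\<rho> t)\<bar> \<le> L * \<epsilon>" "\<bar>(\<integral>q. mollify \<epsilon> g q \<partial>\<rho> s) - (\<integral>q. g q \<partial>\<rho> s)\<bar> \<le> L * \<epsilon>" by auto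
    ultimately show ?thesis using inc(2) by linarith
  qed
  show ?thesis
  proof (rule field_le_epsilon)
    fix e :: real assume e: "e > 0"
    have L: "L \<ge> 0" using g(2)[of 1 undefined 0] by simp
    have "(2 * L) * (e / (2 * L + 1)) \<le> e" using e L by (simp add: field_simps)
    then show "\<bar>(\<integral>q. g q \<partial>\<rho> t) - (\<integral>q. g q \<partial>\<rho> s)\<bar> \<le> L * (bound * (1 + bound)) * (t - s) + e"
      using b[of "e / (2 * L + 1)"] e L by (simp add: add_nonneg_pos)
  qed
qed

end

section \<open>Order, expansion and inverse of the flow\<close>

context mean_field_flow begin

definition \<Gamma> :: real where "\<Gamma> = exp (C * T)"

lemma \<Gamma>_ge1: "\<Gamma> \<ge> 1"
  using C_pos T_pos by (simp add: \<Gamma>_def)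

lemma flow_bilipschitz:
  assumes s: "s \<in> {0..T}" and t: "t \<in> {0..T}"
  shows "\<bar>f (t, u, x) - f (t, v, x)\<bar> \<le> \<Gamma> * \<bar>f (s, u, x) - f (s, v, x)\<bar>"
  unfolding \<Gamma>_def
proof (rule two_sided_gronwall[OF _ _ C_pos s t])
  fix t assume t: "t \<in> {0..T}"
  show "((\<lambda>t. f (t, u, x) - f (t, v, x)) has_real_derivative vel (\<sigma> t) t (f (t, u, x)) x - vel (\<sigma> t) t (f (t, v, x)) x) (at t within {0..T})"
    by (intro DERIV_diff f_deriv t)
  show "\<bar>vel (\<sigma> t) t (f (t, u, x)) x - vel (\<sigma> t) t (f (t, v, x)) x\<bar> \<le> C * \<bar>f (t, u, x) - f (t, v, x)\<bar>"
    by (rule vel_lip[OF \<sigma>_P2[OF t]])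
qed

lemma flow_unique:
  assumes g: "g 0 = u" "\<And>t. t \<in> {0..T} \<Longrightarrow> (g has_real_derivative vel (\<sigma> t) t (g t) x) (at t within {0..T})" and t: "t \<in> {0..T}"
  shows "g t = f (t, u, x)"
proof -
  have "\<bar>g t - f (t, u, x)\<bar> \<le> exp (C * T) * \<bar>g 0 - f (0, u, x)\<bar>"
  proof (rule two_sided_gronwall[OF _ _ C_pos _ t])
    fix t assume t: "t \<in> {0..T}"
    show "((\<lambda>t. g t - f (t, u, x)) has_real_derivative vel (\<sigma> t) t (g t) x - vel (\<sigma> t) t (f (t, u, x)) x) (at t within {0..T})"
      by (intro DERIV_diff f_deriv g t)
    show "\<bar>vel (\<sigma> t) t (g t) x - vel (\<sigma> t) t (f (t, u, x)) x\<bar> \<le> C * \<bar>g t - f (t, u, x)\<bar>"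
      by (rule vel_lip[OF \<sigma>_P2[OF t]])
  qed (use T_pos in simp)
  then show ?thesis using g(1) f_0 by simp
qed

text \<open>Trajectories of one fibre cannot cross: if the order were lost, the intermediate value
  theorem would produce a meeting time, and the Lipschitz bound back to time 0 would make the
  starting points equal.\<close>

lemma flow_strict_mono:
  assumes t: "t \<in> {0..T}" and uv: "u < v" shows "f (t, u, x) < f (t, v, x)"
proof (rule ccontr)
  assume n: "\<not> f (t, u, x) < f (t, v, x)"
  have c: "continuous_on {0..t} (\<lambda>s. f (s, v, x) - f (s, u, x))"
    by (rule continuous_on_subset[of "{0..T}"]) (use t in \<open>auto intro!: continuous_intros flow_continuous\<close>)
  have "\<exists>s\<ge>0. s \<le> t \<and> f (s, v, x) - f (s, u, x) = 0"
    by (rule IVT2'[OF _ _ _ c]) (use n uv t f_0 in auto)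
  then obtain s where "s \<ge> 0" "s \<le> t" and s2: "f (s, v, x) - f (s, u, x) = 0" by blast
  then have s: "s \<in> {0..T}" "f (s, v, x) = f (s, u, x)" using t by auto
  have "\<bar>f (0, u, x) - f (0, v, x)\<bar> \<le> \<Gamma> * \<bar>f (s, u, x) - f (s, v, x)\<bar>"
    by (rule flow_bilipschitz) (use s T_pos in auto)
  then show False using s uv f_0 by simp
qed

lemma flow_bound_0: "t \<in> {0..T} \<Longrightarrow> \<bar>f (t, 0, x)\<bar> \<le> K"
  using f_bound[of t "(0, x)"] by simp

lemma flow_expanding:
  assumes s: "s \<in> {0..T}" and t: "t \<in> {0..T}" and uv: "u \<le> v"
  shows "f (s, v, x) - f (s, u, x) \<le> \<Gamma> * (f (t, v, x) - f (t, u, x))"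
proof (cases "u = v")
  case False
  then have "u < v" using uv by simp
  then show ?thesis using flow_bilipschitz[OF t s, of v x u] flow_strict_mono[OF s, of u v x] flow_strict_mono[OF t, of u v x] by simp
qed simp

lemma flow_surj:
  assumes t: "t \<in> {0..T}" shows "\<exists>u. f (t, u, x) = \<xi>"
proof -
  have 0: "0 \<in> {0..T}" using T_pos by simp
  \<comment> \<open>A particle started at distance U from 0 is at least |\<xi>| + K away from the
    trajectory of 0, which itself stays within K of 0.\<close>
  define U where "U = \<Gamma> * (\<bar>\<xi>\<bar> + K)"
  have U: "U \<ge> 0" using \<Gamma>_ge1 K_pos by (simp add: U_def)
  have up: "\<bar>\<xi>\<bar> \<le> f (t, U, x)"
  proof -
    have "U \<le> \<Gamma> * (f (t, U, x) - f (t, 0, x))" using flow_expanding[OF 0 t U, of x] f_0 by simp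
    then have "\<bar>\<xi>\<bar> + K \<le> f (t, U, x) - f (t, 0, x)" using \<Gamma>_ge1 by (simp add: U_def)
    then show ?thesis using flow_bound_0[OF t, of x] by simp
  qed
  have dn: "f (t, - U, x) \<le> - \<bar>\<xi>\<bar>"
  proof -
    have "U \<le> \<Gamma> * (f (t, 0, x) - f (t, - U, x))" using flow_expanding[OF 0 t, of "- U" 0 x] U f_0 by simp
    then have "\<bar>\<xi>\<bar> + K \<le> f (t, 0, x) - f (t, - U, x)" using \<Gamma>_ge1 by (simp add: U_def)
    then show ?thesis using flow_bound_0[OF t, of x] by simp
  qed
  have c: "continuous_on {- U..U} (\<lambda>u. f (t, u, x))"
    by (rule lipschitz_on_continuous_on[OF lipschitz_onI[where L=\<Gamma>]])
      (use flow_bilipschitz[OF 0 t] f_0 \<Gamma>_ge1 in \<open>auto simp: dist_real_def\<close>)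
  have "\<exists>u. - U \<le> u \<and> u \<le> U \<and> f (t, u, x) = \<xi>"
    by (rule IVT'[OF _ _ _ c]) (use up dn U in auto)
  then show ?thesis by blast
qed

definition inv_flow :: "real \<Rightarrow> real \<times> 'a \<Rightarrow> real" where
  "inv_flow t q = (SOME u. f (t, u, snd q) = fst q)"

lemma inv_flow: "t \<in> {0..T} \<Longrightarrow> f (t, inv_flow t (\<xi>, x), x) = \<xi>"
  using someI_ex[OF flow_surj] by (simp add: inv_flow_def)

lemma inv_flow_eq: "t \<in> {0..T} \<Longrightarrow> inv_flow t (f (t, u, x), x) = u"
  using inv_flow[of t "f (t, u, x)" x] flow_strict_mono[of t] by (metis linorder_neqE less_irrefl)

text \<open>Monotonicity turns sublevel sets of the inverse into inequalities for the flow, so that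
  joint measurability in \<xi> and x follows from that of f.\<close>

lemma inv_flow_le_iff: "t \<in> {0..T} \<Longrightarrow> inv_flow t (\<xi>, x) \<le> c \<longleftrightarrow> \<xi> \<le> f (t, c, x)"
  using inv_flow[of t \<xi> x] flow_strict_mono[of t] by (metis linorder_not_less order_le_less)

lemma inv_flow_measurable:
  assumes t: "t \<in> {0..T}" shows "inv_flow t \<in> borel_measurable borel"
proof (rule borel_measurable_iff_le[THEN iffD2], rule allI)
  fix c
  have "(\<lambda>q::real \<times> 'a. f (t, c, snd q)) \<in> borel_measurable borel"
    by (rule measurable_compose[OF _ f_meas]) simp
  then have "{q \<in> space borel. fst q \<le> f (t, c, snd q)} \<in> sets borel" by measurable
  moreover have "inv_flow t q \<le> c \<longleftrightarrow> fst q \<le> f (t, c, snd q)" for q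
    using inv_flow_le_iff[OF t, of "fst q" "snd q" c] by simp
  ultimately show "{w \<in> space borel. inv_flow t w \<le> c} \<in> sets borel" by simp
qed

lemma flow_increment:
  assumes st: "0 \<le> s" "s \<le> t" "t \<le> T"
  shows "set_integrable lborel {s..t} (\<lambda>\<tau>. vel (\<sigma> \<tau>) \<tau> (f (\<tau>, u, x)) x)"
    and "f (t, u, x) - f (s, u, x) = (LINT \<tau>:{s..t}|lborel. vel (\<sigma> \<tau>) \<tau> (f (\<tau>, u, x)) x)"
proof -
  have sub: "{s..t} \<subseteq> {0..T}" using st by auto
  have c: "continuous_on {s..t} (\<lambda>\<tau>. vel (\<sigma> \<tau>) \<tau> (f (\<tau>, u, x)) x)"
    by (rule continuous_on_subset[OF vel_continuous[OF \<sigma>_cont flow_continuous] sub])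
  show "set_integrable lborel {s..t} (\<lambda>\<tau>. vel (\<sigma> \<tau>) \<tau> (f (\<tau>, u, x)) x)"
    by (rule borel_integrable_atLeastAtMost'[OF c])
  have "(\<integral>\<tau>. indicator {s..t} \<tau> *\<^sub>R vel (\<sigma> \<tau>) \<tau> (f (\<tau>, u, x)) x \<partial>lborel) = f (t, u, x) - f (s, u, x)"
  proof (rule integral_FTC_Icc[OF st(2) _ c])
    fix \<tau> assume "s \<le> \<tau>" "\<tau> \<le> t"
    then have "\<tau> \<in> {0..T}" using st by auto
    from f_deriv[OF this] show "((\<lambda>\<tau>. f (\<tau>, u, x)) has_vector_derivative vel (\<sigma> \<tau>) \<tau> (f (\<tau>, u, x)) x) (at \<tau> within {s..t})"
      unfolding has_real_derivative_iff_has_vector_derivative by (rule has_vector_derivative_within_subset[OF _ sub])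
  qed
  then show "f (t, u, x) - f (s, u, x) = (LINT \<tau>:{s..t}|lborel. vel (\<sigma> \<tau>) \<tau> (f (\<tau>, u, x)) x)"
    by (simp add: set_lebesgue_integral_def)
qed

end

section \<open>Uniqueness by duality\<close>

text \<open>With n + 1 equal steps the quadratic errors add up to c t^2 / (n + 1), which vanishes.
  This replaces differentiating E in time.\<close>

lemma sum_increments:
  fixes E b :: "real \<Rightarrow> real"
  assumes t: "t \<ge> 0" and b: "set_integrable lborel {0..t} b"
    and step: "\<And>s s'. 0 \<le> s \<Longrightarrow> s \<le> s' \<Longrightarrow> s' \<le> t \<Longrightarrow> \<bar>E s' - E s\<bar> \<le> (LINT \<tau>:{s..s'}|lborel. b \<tau>) + a * (s' - s) + c * (s' - s)\<^sup>2"
  shows "\<bar>E t - E 0\<bar> \<le> (LINT \<tau>:{0..t}|lborel. b \<tau>) + a * t"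
proof -
  have n: "\<bar>E t - E 0\<bar> \<le> (LINT \<tau>:{0..t}|lborel. b \<tau>) + a * t + (c * t\<^sup>2) / real (Suc n)" for n
  proof -
    define h where "h = t / real (Suc n)"
    have h: "h \<ge> 0" "real (Suc n) * h = t" using t by (auto simp: h_def)
    have "\<bar>E (real i * h) - E 0\<bar> \<le> (LINT \<tau>:{0..real i * h}|lborel. b \<tau>) + a * (real i * h) + real i * (c * h\<^sup>2)" if "i \<le> Suc n" for i
      using that
    proof (induction i)
      case 0
      have "(LINT \<tau>:{0..0}|lborel. b \<tau>) = 0"
        using set_integral_increment[OF b order_refl t] by simp
      then show ?case by simp
    next
      case (Suc i)
      have le: "real i * h \<le> real (Suc i) * h" "real (Suc i) * h \<le> t"
        using h Suc.prems mult_right_mono[of "real (Suc i)" "real (Suc n)" h] by (auto intro: mult_right_mono)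
      have bi: "set_integrable lborel {0..real (Suc i) * h} b" by (rule set_integrable_subset[OF b]) (use le in auto)
      have d: "real (Suc i) * h - real i * h = h" by (simp add: algebra_simps)
      have i0: "0 \<le> real i * h" using h by simp
      have "\<bar>E (real (Suc i) * h) - E (real i * h)\<bar> \<le> (LINT \<tau>:{real i * h..real (Suc i) * h}|lborel. b \<tau>) + a * h + c * h\<^sup>2"
        using step[OF i0 le] unfolding d .
      moreover have "(LINT \<tau>:{0..real (Suc i) * h}|lborel. b \<tau>) - (LINT \<tau>:{0..real i * h}|lborel. b \<tau>) = (LINT \<tau>:{real i * h..real (Suc i) * h}|lborel. b \<tau>)"
        by (rule set_integral_increment[OF bi i0 le(1)])
      moreover have "a * (real (Suc i) * h) = a * (real i * h) + a * h" "real (Suc i) * (c * h\<^sup>2) = real i * (c * h\<^sup>2) + c * h\<^sup>2"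
        by (simp_all add: algebra_simps)
      moreover have "\<bar>E (real i * h) - E 0\<bar> \<le> (LINT \<tau>:{0..real i * h}|lborel. b \<tau>) + a * (real i * h) + real i * (c * h\<^sup>2)"
        using Suc by simp
      ultimately show ?case by linarith
    qed
    from this[of "Suc n"] have "\<bar>E t - E 0\<bar> \<le> (LINT \<tau>:{0..t}|lborel. b \<tau>) + a * t + real (Suc n) * (c * h\<^sup>2)" unfolding h(2) by simp
    moreover have "real (Suc n) * (c * h\<^sup>2) = (c * t\<^sup>2) / real (Suc n)"
    proof -
      have "real (Suc n) * (c * h\<^sup>2) = c * h * (real (Suc n) * h)" by (simp add: power2_eq_square)
      also have "\<dots> = c * h * t" unfolding h(2) ..
      also have "\<dots> = (c * t\<^sup>2) / real (Suc n)" by (simp add: h_def power2_eq_square)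
      finally show ?thesis .
    qed
    ultimately show ?thesis by simp
  qed
  have "(\<lambda>n. (LINT \<tau>:{0..t}|lborel. b \<tau>) + a * t + (c * t\<^sup>2) / real (Suc n)) \<longlonglongrightarrow> (LINT \<tau>:{0..t}|lborel. b \<tau>) + a * t + 0"
    by (intro tendsto_add tendsto_const LIMSEQ_Suc[OF lim_const_over_n])
  then show ?thesis using n by (intro LIMSEQ_le_const) auto
qed

text \<open>A function that is Lipschitz in the clipped position is constant in \<xi> beyond n in
  each direction, which is how compact support of difference quotients is encoded.\<close>

definition clip :: "real \<Rightarrow> real \<Rightarrow> real" where
  "clip n \<xi> = max (- n) (min n \<xi>)"

lemma clip_lip: "\<bar>clip n \<xi> - clip n \<zeta>\<bar> \<le> \<bar>\<xi> - \<zeta>\<bar>"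
  by (auto simp: clip_def)

locale mean_field_uniqueness = mean_field_flow \<mu> \<Psi> k C T \<nu> \<sigma> f K + S: mean_field_solution \<mu> \<Psi> k C T \<nu> \<rho>
  for \<mu> :: "'a::euclidean_space measure" and \<Psi> k C T \<nu> \<sigma> f K \<rho>
begin

lemma S_0: "\<rho> 0 = \<nu>"
  using S.\<rho>_CE by (simp add: CE_solution_def)

definition rate :: real where
  "rate = (SOME B. B > 0 \<and> (\<forall>t\<in>{0..T}. \<forall>\<xi> x. \<bar>vel (\<sigma> t) t \<xi> x\<bar> \<le> B * (1 + \<bar>\<xi>\<bar>)))"

lemma rate: "rate > 0" "t \<in> {0..T} \<Longrightarrow> \<bar>vel (\<sigma> t) t \<xi> x\<bar> \<le> rate * (1 + \<bar>\<xi>\<bar>)"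
  using someI_ex[OF flow_vel_bound] unfolding rate_def[symmetric] by auto

end

text \<open>The test function is bounded, has fibre constants at most N, and does not vary in \<xi>
  outside [-n, n]. This makes the difference quotients of its transport bounded and compactly
  supported in \<xi>. The final estimate contains none of n, N and M, only the integral of l, so the
  truncations can be removed afterwards.\<close>

locale transport_test = mean_field_uniqueness \<mu> \<Psi> k C T \<nu> \<sigma> f K \<rho>
  for \<mu> :: "'a::euclidean_space measure" and \<Psi> k C T \<nu> \<sigma> f K \<rho> +
  fixes t :: real and \<psi> :: "real \<times> 'a \<Rightarrow> real" and l :: "'a \<Rightarrow> real" and n N M :: real
  assumes t: "t \<in> {0..T}" and \<psi>: "\<psi> \<in> borel_measurable borel" and \<psi>_bound: "\<And>q. \<bar>\<psi> q\<bar> \<le> M"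
    and \<psi>_lip: "\<And>\<xi> \<zeta> x. \<bar>\<psi> (\<xi>, x) - \<psi> (\<zeta>, x)\<bar> \<le> l x * \<bar>clip n \<xi> - clip n \<zeta>\<bar>"
    and l: "l \<in> borel_measurable borel" "\<And>x. 0 \<le> l x" "\<And>x. l x \<le> N" and n: "n \<ge> 0"
begin

text \<open>Solution of the backward transport equation along \<open>\<sigma>\<close> with value
  \<open>\<psi>\<close> at time t: the particle that sits at q at time s is followed to time
  t.\<close>

definition transport :: "real \<Rightarrow> real \<times> 'a \<Rightarrow> real" where
  "transport s q = \<psi> (f (t, inv_flow s q, snd q), snd q)"

lemma transport_measurable:
  assumes "s \<in> {0..T}" shows "transport s \<in> borel_measurable borel"
proof -
  note inv_flow_measurable[OF assms, measurable] f_meas[measurable] \<psi>[measurable]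
  show ?thesis unfolding transport_def[abs_def] by measurable
qed

lemma transport_bound: "\<bar>transport s q\<bar> \<le> M"
  unfolding transport_def by (rule \<psi>_bound)

lemma transport_lip:
  assumes s: "s \<in> {0..T}" shows "\<bar>transport s (\<xi>, x) - transport s (\<zeta>, x)\<bar> \<le> \<Gamma> * l x * \<bar>\<xi> - \<zeta>\<bar>"
proof -
  have "\<bar>f (t, inv_flow s (\<xi>, x), x) - f (t, inv_flow s (\<zeta>, x), x)\<bar> \<le> \<Gamma> * \<bar>\<xi> - \<zeta>\<bar>"
    using flow_bilipschitz[OF s t, of "inv_flow s (\<xi>, x)" x "inv_flow s (\<zeta>, x)"] inv_flow[OF s] by simp
  then have "\<bar>clip n (f (t, inv_flow s (\<xi>, x), x)) - clip n (f (t, inv_flow s (\<zeta>, x), x))\<bar> \<le> \<Gamma> * \<bar>\<xi> - \<zeta>\<bar>"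
    using clip_lip order_trans by blast
  from mult_left_mono[OF this l(2)[of x]] \<psi>_lip[of "f (t, inv_flow s (\<xi>, x), x)" x "f (t, inv_flow s (\<zeta>, x), x)"]
  show ?thesis by (simp add: transport_def mult_ac)
qed

lemma transport_flow: "s \<in> {0..T} \<Longrightarrow> transport s (f (s, u, x), x) = \<psi> (f (t, u, x), x)"
  by (simp add: transport_def inv_flow_eq)

lemma transport_end: "transport t (\<xi>, x) = \<psi> (\<xi>, x)"
  by (simp add: transport_def inv_flow[OF t])

text \<open>A particle outside [-R, R] at time s has modulus at least n at time t, where
  \<open>\<psi>\<close> no longer varies. The two K bound the trajectory of 0 at the times s and t,
  and \<Gamma> bounds how much the flow can contract.\<close>

definition R :: real where "R = K + \<Gamma> * (n + K)"

lemma R_nonneg: "R \<ge> 0"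
  using K_pos n \<Gamma>_ge1 by (simp add: R_def)

lemma transport_high:
  assumes s: "s \<in> {0..T}" and \<xi>: "\<xi> \<ge> R" shows "transport s (\<xi>, x) = \<psi> (n, x)"
proof -
  define u where "u = inv_flow s (\<xi>, x)"
  have fu: "f (s, u, x) = \<xi>" by (simp add: u_def inv_flow[OF s])
  have "K \<le> R" using \<Gamma>_ge1 n K_pos by (simp add: R_def)
  then have "f (s, 0, x) \<le> f (s, u, x)" using flow_bound_0[OF s, of x] \<xi> fu by simp
  then have u: "0 \<le> u" using flow_strict_mono[OF s, of u 0 x] by force
  have "\<xi> - K \<le> \<Gamma> * (f (t, u, x) + K)"
  proof -
    have "\<xi> - f (s, 0, x) \<le> \<Gamma> * (f (t, u, x) - f (t, 0, x))" using flow_expanding[OF s t u, of x] fu by simp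
    also have "\<dots> \<le> \<Gamma> * (f (t, u, x) + K)" using flow_bound_0[OF t, of x] \<Gamma>_ge1 by (intro mult_left_mono) auto
    finally show ?thesis using flow_bound_0[OF s, of x] by simp
  qed
  then have "\<Gamma> * (n + K) \<le> \<Gamma> * (f (t, u, x) + K)" using \<xi> by (simp add: R_def)
  then have "n \<le> f (t, u, x)" using \<Gamma>_ge1 by simp
  then have "clip n (f (t, u, x)) = clip n n" using n by (simp add: clip_def)
  then have "\<psi> (f (t, u, x), x) = \<psi> (n, x)" using \<psi>_lip[of "f (t, u, x)" x n] by simp
  then show ?thesis by (simp add: transport_def u_def)
qed

lemma transport_low:
  assumes s: "s \<in> {0..T}" and \<xi>: "\<xi> \<le> - R" shows "transport s (\<xi>, x) = \<psi> (- n, x)"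
proof -
  define u where "u = inv_flow s (\<xi>, x)"
  have fu: "f (s, u, x) = \<xi>" by (simp add: u_def inv_flow[OF s])
  have "K \<le> R" using \<Gamma>_ge1 n K_pos by (simp add: R_def)
  then have "f (s, u, x) \<le> f (s, 0, x)" using flow_bound_0[OF s, of x] \<xi> fu by simp
  then have u: "u \<le> 0" using flow_strict_mono[OF s, of 0 u x] by force
  have "- \<xi> - K \<le> \<Gamma> * (K - f (t, u, x))"
  proof -
    have "f (s, 0, x) - \<xi> \<le> \<Gamma> * (f (t, 0, x) - f (t, u, x))" using flow_expanding[OF s t u, of x] fu by simp
    also have "\<dots> \<le> \<Gamma> * (K - f (t, u, x))" using flow_bound_0[OF t, of x] \<Gamma>_ge1 by (intro mult_left_mono) auto
    finally show ?thesis using flow_bound_0[OF s, of x] by simp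
  qed
  then have "\<Gamma> * (n + K) \<le> \<Gamma> * (K - f (t, u, x))" using \<xi> by (simp add: R_def)
  then have "f (t, u, x) \<le> - n" using \<Gamma>_ge1 by simp
  then have "clip n (f (t, u, x)) = clip n (- n)" using n by (simp add: clip_def)
  then have "\<psi> (f (t, u, x), x) = \<psi> (- n, x)" using \<psi>_lip[of "f (t, u, x)" x "- n"] by simp
  then show ?thesis by (simp add: transport_def u_def)
qed

definition L :: real where "L = \<Gamma> * N"
text \<open>Speed bound for a particle that is within R + 1 of 0 at some time: it then stays within
  \<open>\<Gamma> * (R + 1 + K) + K\<close> on all of [0,T].\<close>

definition D :: real where "D = rate * (1 + (\<Gamma> * (R + 1 + K) + K))"

lemma L_nonneg: "L \<ge> 0"
  using \<Gamma>_ge1 l(2)[of undefined] l(3)[of undefined] by (simp add: L_def)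

lemma l_le_L: "\<Gamma> * l x \<le> L"
  unfolding L_def using l(3) \<Gamma>_ge1 by (intro mult_left_mono) auto

lemma transport_L: "s \<in> {0..T} \<Longrightarrow> \<bar>transport s (\<xi>, x) - transport s (\<zeta>, x)\<bar> \<le> L * \<bar>\<xi> - \<zeta>\<bar>"
  using transport_lip[of s \<xi> x \<zeta>] mult_right_mono[OF l_le_L[of x], of "\<bar>\<xi> - \<zeta>\<bar>"] by simp

lemma D_pos: "D > 0"
  using rate(1) \<Gamma>_ge1 R_nonneg K_pos unfolding D_def by (intro mult_pos_pos add_pos_nonneg) auto

lemma quotient_vanishes:
  assumes s: "s \<in> {0..T}" and \<epsilon>: "0 < \<epsilon>" "\<epsilon> \<le> 1" and \<xi>: "\<bar>\<xi>\<bar> > R + 1"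
  shows "quotient \<epsilon> (transport s) (\<xi>, x) = 0"
proof (cases "\<xi> > 0")
  case True
  then have "\<xi> \<ge> R" "\<xi> + \<epsilon> \<ge> R" using \<xi> \<epsilon> by auto
  then show ?thesis using transport_high[OF s] by (simp add: quotient_def)
next
  case False
  then have "\<xi> \<le> - R" "\<xi> + \<epsilon> \<le> - R" using \<xi> \<epsilon> by auto
  then show ?thesis using transport_low[OF s] by (simp add: quotient_def)
qed

text \<open>\<open>transport\<close> is constant along the flow, so up to a commutator of size \<open>\<epsilon>\<close> its mollification solves the
  transport equation.\<close>

lemma mollified_transport_step:
  assumes s: "0 \<le> s" "s \<le> s'" "s' \<le> T" and \<epsilon>: "0 < \<epsilon>" "\<epsilon> \<le> 1"
  shows "\<bar>mollify \<epsilon> (transport s') (\<xi>, x) - mollify \<epsilon> (transport s) (\<xi>, x) +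
      quotient \<epsilon> (transport s') (\<xi>, x) * (LINT \<tau>:{s..s'}|lborel. vel (\<sigma> \<tau>) \<tau> \<xi> x)\<bar>
    \<le> L * C * \<Gamma> * \<epsilon> * (s' - s) + (2 * L * D\<^sup>2 + L * C * D) / \<epsilon> * (s' - s)\<^sup>2"
proof -
  have s0: "s \<in> {0..T}" and s'0: "s' \<in> {0..T}" using s by auto
  define h where "h = s' - s"
  have h: "h \<ge> 0" using s by (simp add: h_def)
  let ?v = "LINT \<tau>:{s..s'}|lborel. vel (\<sigma> \<tau>) \<tau> \<xi> x" and ?p = "quotient \<epsilon> (transport s') (\<xi>, x)"
  note tr = transport_measurable[OF s0] transport_lip[OF s0] transport_bound[of s]
  note tr' = transport_measurable[OF s'0] transport_lip[OF s'0] transport_bound[of s']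
  have rhs: "0 \<le> L * C * \<Gamma> * \<epsilon> * h" "0 \<le> (2 * L * D\<^sup>2 + L * C * D) / \<epsilon> * h\<^sup>2"
    using L_nonneg C_pos \<Gamma>_ge1 \<epsilon> h D_pos by auto
  show ?thesis
  \<comment> \<open>Beyond R + 1 the averaging interval, of length at most 1, stays where
    \<open>transport\<close> depends neither on \<xi> nor on time, and the left side is 0.\<close>
  proof (cases "\<bar>\<xi>\<bar> > R + 1")
    case True
    have e: "transport s' (\<xi> + \<epsilon> * z, x) = transport s (\<xi> + \<epsilon> * z, x)" if "z \<in> {0..1}" for z
    proof -
      have ez: "0 \<le> \<epsilon> * z" "\<epsilon> * z \<le> 1" using that \<epsilon> mult_le_one[of \<epsilon> z] by auto
      show ?thesis
      proof (cases "\<xi> > 0")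
        case pos: True
        then have "\<xi> + \<epsilon> * z \<ge> R" using True ez by auto
        then show ?thesis using transport_high[OF s0] transport_high[OF s'0] by simp
      next
        case False
        then have "\<xi> + \<epsilon> * z \<le> - R" using True ez by auto
        then show ?thesis using transport_low[OF s0] transport_low[OF s'0] by simp
      qed
    qed
    have "mollify \<epsilon> (transport s') (\<xi>, x) = mollify \<epsilon> (transport s) (\<xi>, x)"
      unfolding mollify_def by (rule set_lebesgue_integral_cong) (use e in auto)
    then show ?thesis using quotient_vanishes[OF s'0 \<epsilon> True] rhs by (simp add: h_def)
  next
    case False
    then have \<xi>: "\<bar>\<xi>\<bar> \<le> R + 1" by simp
    \<comment> \<open>Displacement of the particle with label u during [s, s'].\<close>
    define \<delta> where "\<delta> u = f (s', u, x) - f (s, u, x)" for u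
    define u where "u = inv_flow s (\<xi>, x)"
    have fu: "f (s, u, x) = \<xi>" by (simp add: u_def inv_flow[OF s0])
    have vi: "set_integrable lborel {s..s'} (\<lambda>\<tau>. vel (\<sigma> \<tau>) \<tau> \<zeta> x)" for \<zeta>
      by (rule borel_integrable_atLeastAtMost', rule continuous_on_subset[OF vel_continuous[OF \<sigma>_cont, of "\<lambda>_. \<zeta>"]]) (use s in auto)
    have \<delta>d: "\<bar>\<delta> u1 - \<delta> u2\<bar> \<le> C * \<Gamma> * \<bar>f (s, u1, x) - f (s, u2, x)\<bar> * h" for u1 u2
    proof -
      note i1 = flow_increment[OF s, of u1 x] and i2 = flow_increment[OF s, of u2 x]
      have "\<delta> u1 - \<delta> u2 = (LINT \<tau>:{s..s'}|lborel. vel (\<sigma> \<tau>) \<tau> (f (\<tau>, u1, x)) x - vel (\<sigma> \<tau>) \<tau> (f (\<tau>, u2, x)) x)"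
        using set_integral_diff(2)[OF i1(1) i2(1)] by (simp add: \<delta>_def i1(2) i2(2))
      also have "\<bar>\<dots>\<bar> \<le> C * \<Gamma> * \<bar>f (s, u1, x) - f (s, u2, x)\<bar> * (s' - s)"
      proof (rule set_integral_Icc_bound[OF set_integral_diff(1)[OF i1(1) i2(1)] _ s(2)])
        fix \<tau> assume "\<tau> \<in> {s..s'}"
        then have \<tau>: "\<tau> \<in> {0..T}" using s by auto
        have "\<bar>vel (\<sigma> \<tau>) \<tau> (f (\<tau>, u1, x)) x - vel (\<sigma> \<tau>) \<tau> (f (\<tau>, u2, x)) x\<bar> \<le> C * \<bar>f (\<tau>, u1, x) - f (\<tau>, u2, x)\<bar>"
          by (rule vel_lip[OF \<sigma>_P2[OF \<tau>]])
        also have "\<dots> \<le> C * (\<Gamma> * \<bar>f (s, u1, x) - f (s, u2, x)\<bar>)"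
          using flow_bilipschitz[OF s0 \<tau>] C_pos by (intro mult_left_mono) auto
        finally show "\<bar>vel (\<sigma> \<tau>) \<tau> (f (\<tau>, u1, x)) x - vel (\<sigma> \<tau>) \<tau> (f (\<tau>, u2, x)) x\<bar> \<le> C * \<Gamma> * \<bar>f (s, u1, x) - f (s, u2, x)\<bar>"
          by (simp add: mult.assoc)
      qed
      finally show ?thesis by (simp add: h_def)
    qed
    have vD: "\<bar>vel (\<sigma> \<tau>) \<tau> (f (\<tau>, u, x)) x\<bar> \<le> D" if \<tau>: "\<tau> \<in> {0..T}" for \<tau>
    proof -
      have "\<bar>f (\<tau>, u, x) - f (\<tau>, 0, x)\<bar> \<le> \<Gamma> * \<bar>f (s, u, x) - f (s, 0, x)\<bar>" by (rule flow_bilipschitz[OF s0 \<tau>])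
      also have "\<dots> \<le> \<Gamma> * (R + 1 + K)" using \<xi> fu flow_bound_0[OF s0, of x] \<Gamma>_ge1 by (intro mult_left_mono) auto
      finally have "\<bar>f (\<tau>, u, x)\<bar> \<le> \<Gamma> * (R + 1 + K) + K" using flow_bound_0[OF \<tau>, of x] by linarith
      then have "rate * (1 + \<bar>f (\<tau>, u, x)\<bar>) \<le> D" unfolding D_def using rate(1) by (intro mult_left_mono) auto
      then show ?thesis using rate(2)[OF \<tau>] order_trans by blast
    qed
    have inc: "\<bar>f (\<tau>, u, x) - \<xi>\<bar> \<le> D * h" if \<tau>: "\<tau> \<in> {s..s'}" for \<tau>
    proof -
      have st: "0 \<le> s" "s \<le> \<tau>" "\<tau> \<le> T" using \<tau> s by auto
      have "\<bar>LINT \<tau>:{s..\<tau>}|lborel. vel (\<sigma> \<tau>) \<tau> (f (\<tau>, u, x)) x\<bar> \<le> D * (\<tau> - s)"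
        by (rule set_integral_Icc_bound[OF flow_increment(1)[OF st] _ st(2)]) (use vD st in auto)
      also have "\<dots> \<le> D * h" using \<tau> D_pos by (intro mult_left_mono) (auto simp: h_def)
      finally show ?thesis using flow_increment(2)[OF st, of u x] fu by simp
    qed
    have \<delta>u: "\<bar>\<delta> u\<bar> \<le> D * h" using inc[of s'] s fu by (simp add: \<delta>_def)
    \<comment> \<open>The shift by the displacement of the particle at \<xi> is exact only at \<xi>.
      At \<xi> + \<epsilon> z the true displacement differs from it by at most C \<Gamma> \<epsilon>
      h, and this is the commutator.\<close>
    have a1: "\<bar>mollify \<epsilon> (transport s') (\<xi> + \<delta> u, x) - mollify \<epsilon> (transport s) (\<xi>, x)\<bar> \<le> L * C * \<Gamma> * \<epsilon> * h"
    proof -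
      note m1 = mollify_integrable[OF tr' \<epsilon>(1), of "\<xi> + \<delta> u" x] and m2 = mollify_integrable[OF tr \<epsilon>(1), of \<xi> x]
      have "mollify \<epsilon> (transport s') (\<xi> + \<delta> u, x) - mollify \<epsilon> (transport s) (\<xi>, x) =
         (LINT z:{0..1}|lborel. transport s' (\<xi> + \<delta> u + \<epsilon> * z, x) - transport s (\<xi> + \<epsilon> * z, x))"
        using set_integral_diff(2)[OF m1 m2] by (simp add: mollify_def)
      also have "\<bar>\<dots>\<bar> \<le> L * C * \<Gamma> * \<epsilon> * h * (1 - 0)"
      proof (rule set_integral_Icc_bound[OF set_integral_diff(1)[OF m1 m2]])
        fix z :: real assume z: "z \<in> {0..1}"
        define uz where "uz = inv_flow s (\<xi> + \<epsilon> * z, x)"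
        have fuz: "f (s, uz, x) = \<xi> + \<epsilon> * z" by (simp add: uz_def inv_flow[OF s0])
        have "transport s (\<xi> + \<epsilon> * z, x) = transport s' (\<xi> + \<epsilon> * z + \<delta> uz, x)"
          using transport_flow[OF s0, of uz x] transport_flow[OF s'0, of uz x] fuz by (simp add: \<delta>_def)
        then have "\<bar>transport s' (\<xi> + \<delta> u + \<epsilon> * z, x) - transport s (\<xi> + \<epsilon> * z, x)\<bar> \<le> L * \<bar>\<delta> u - \<delta> uz\<bar>"
          using transport_L[OF s'0, of "\<xi> + \<delta> u + \<epsilon> * z" x "\<xi> + \<epsilon> * z + \<delta> uz"] by simp
        also have "\<dots> \<le> L * (C * \<Gamma> * \<bar>f (s, u, x) - f (s, uz, x)\<bar> * h)" by (intro mult_left_mono \<delta>d L_nonneg)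
        also have "\<dots> \<le> L * (C * \<Gamma> * \<epsilon> * h)"
        proof (intro mult_left_mono mult_right_mono)
          show "\<bar>f (s, u, x) - f (s, uz, x)\<bar> \<le> \<epsilon>" using z \<epsilon> by (simp add: fu fuz abs_mult mult_le_cancel_left1)
        qed (use L_nonneg C_pos \<Gamma>_ge1 h in auto)
        finally show "\<bar>transport s' (\<xi> + \<delta> u + \<epsilon> * z, x) - transport s (\<xi> + \<epsilon> * z, x)\<bar> \<le> L * C * \<Gamma> * \<epsilon> * h"
          by (simp add: mult_ac)
      qed simp
      finally show ?thesis by simp
    qed
    have lip_q: "\<bar>quotient \<epsilon> (transport s') (\<xi>, x) - quotient \<epsilon> (transport s') (\<zeta>, x)\<bar> \<le> 2 * L / \<epsilon> * \<bar>\<xi> - \<zeta>\<bar>" for \<xi> \<zeta>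
    proof -
      have "2 * (\<Gamma> * l x) / \<epsilon> * \<bar>\<xi> - \<zeta>\<bar> \<le> 2 * L / \<epsilon> * \<bar>\<xi> - \<zeta>\<bar>"
        using l_le_L[of x] \<epsilon> by (intro mult_right_mono divide_right_mono) auto
      with quotient_lipschitz[OF tr' \<epsilon>(1), of \<xi> x \<zeta>] show ?thesis by linarith
    qed
    have a2: "\<bar>mollify \<epsilon> (transport s') (\<xi> + \<delta> u, x) - mollify \<epsilon> (transport s') (\<xi>, x) - \<delta> u * ?p\<bar> \<le> 2 * L / \<epsilon> * (D * h)\<^sup>2"
    proof -
      have "\<bar>mollify \<epsilon> (transport s') (\<xi> + \<delta> u, x) - mollify \<epsilon> (transport s') (\<xi>, x) - \<delta> u * ?p\<bar> \<le> 2 * L / \<epsilon> * (\<delta> u)\<^sup>2"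
        by (rule C1_taylor[where F="\<lambda>\<xi>. mollify \<epsilon> (transport s') (\<xi>, x)" and p="\<lambda>\<xi>. quotient \<epsilon> (transport s') (\<xi>, x)", OF mollify_deriv[OF tr' \<epsilon>(1)] lip_q])
          (use L_nonneg \<epsilon> in simp)
      also have "\<dots> \<le> 2 * L / \<epsilon> * (D * h)\<^sup>2"
        using power_mono[OF \<delta>u abs_ge_zero, of 2] L_nonneg \<epsilon> by (intro mult_left_mono) auto
      finally show ?thesis .
    qed
    \<comment> \<open>The actual displacement is compared with the time integral of the velocity
      frozen at \<xi>; the particle moves by at most D h, so the difference is of second
      order.\<close>
    have a3: "\<bar>\<delta> u - ?v\<bar> \<le> C * (D * h) * h"
    proof -
      note i1 = flow_increment[OF s, of u x]
      have "\<delta> u - ?v = (LINT \<tau>:{s..s'}|lborel. vel (\<sigma> \<tau>) \<tau> (f (\<tau>, u, x)) x - vel (\<sigma> \<tau>) \<tau> \<xi> x)"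
        using set_integral_diff(2)[OF i1(1) vi] by (simp add: \<delta>_def i1(2))
      also have "\<bar>\<dots>\<bar> \<le> C * (D * h) * (s' - s)"
      proof (rule set_integral_Icc_bound[OF set_integral_diff(1)[OF i1(1) vi] _ s(2)])
        fix \<tau> assume \<tau>: "\<tau> \<in> {s..s'}"
        then have \<tau>0: "\<tau> \<in> {0..T}" using s by auto
        have "\<bar>vel (\<sigma> \<tau>) \<tau> (f (\<tau>, u, x)) x - vel (\<sigma> \<tau>) \<tau> \<xi> x\<bar> \<le> C * \<bar>f (\<tau>, u, x) - \<xi>\<bar>" by (rule vel_lip[OF \<sigma>_P2[OF \<tau>0]])
        also have "\<dots> \<le> C * (D * h)" using inc[OF \<tau>] C_pos by (intro mult_left_mono) auto
        finally show "\<bar>vel (\<sigma> \<tau>) \<tau> (f (\<tau>, u, x)) x - vel (\<sigma> \<tau>) \<tau> \<xi> x\<bar> \<le> C * (D * h)" .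
      qed
      finally show ?thesis by (simp add: h_def)
    qed
    have pL: "\<bar>?p\<bar> \<le> L" using quotient_bound[OF tr' \<epsilon>(1), of \<xi> x] l_le_L[of x] by simp
    have a4: "\<bar>\<delta> u * ?p - ?p * ?v\<bar> \<le> L * (C * (D * h) * h)"
    proof -
      have "\<delta> u * ?p - ?p * ?v = ?p * (\<delta> u - ?v)" by (simp add: algebra_simps)
      then show ?thesis using mult_mono[OF pL a3 L_nonneg abs_ge_zero] by (simp add: abs_mult)
    qed
    have "\<bar>mollify \<epsilon> (transport s') (\<xi>, x) - mollify \<epsilon> (transport s) (\<xi>, x) + ?p * ?v\<bar> \<le>
       L * C * \<Gamma> * \<epsilon> * h + 2 * L / \<epsilon> * (D * h)\<^sup>2 + L * (C * (D * h) * h)"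
      using a1 a2 a4 by linarith
    \<comment> \<open>Since \<epsilon> is at most 1, dividing the last term by \<epsilon> only
      enlarges it and lets the quadratic terms share one factor.\<close>
    also have "\<dots> \<le> L * C * \<Gamma> * \<epsilon> * h + 2 * L / \<epsilon> * (D * h)\<^sup>2 + L * (C * (D * h) * h) / \<epsilon>"
    proof -
      have "0 \<le> L * (C * (D * h) * h)" using L_nonneg C_pos D_pos h by simp
      then have "L * (C * (D * h) * h) / 1 \<le> L * (C * (D * h) * h) / \<epsilon>" using \<epsilon> by (intro divide_left_mono) auto
      then show ?thesis by simp
    qed
    also have "\<dots> = L * C * \<Gamma> * \<epsilon> * h + (2 * L * D\<^sup>2 + L * C * D) / \<epsilon> * h\<^sup>2"
      using \<epsilon> by (simp add: field_simps power2_eq_square)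
    finally show ?thesis by (simp add: h_def)
  qed
qed

end

section \<open>Estimate of the transported test function along the other solution\<close>

context transport_test begin

lemma transport_energy_step:
  assumes \<beta>: "continuous_on {0..T} \<beta>" and vd: "\<And>\<tau> \<xi> x. \<tau> \<in> {0..T} \<Longrightarrow> \<bar>vel (\<rho> \<tau>) \<tau> \<xi> x - vel (\<sigma> \<tau>) \<tau> \<xi> x\<bar> \<le> \<beta> \<tau>"
    and s: "0 \<le> s" "s \<le> s'" "s' \<le> T" and \<epsilon>: "0 < \<epsilon>" "\<epsilon> \<le> 1"
  shows "\<bar>(\<integral>q. mollify \<epsilon> (transport s') q \<partial>\<rho> s') - (\<integral>q. mollify \<epsilon> (transport s) q \<partial>\<rho> s)\<bar> \<le>
    (LINT \<tau>:{s..s'}|lborel. \<Gamma> * (\<integral>x. l x \<partial>\<mu>) * \<beta> \<tau>) + L * C * \<Gamma> * \<epsilon> * (s' - s) +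
    (2 * L * D\<^sup>2 + L * C * D + (2 * L * (rate * (2 + R)) + L * C) * (S.bound * (1 + S.bound))) / \<epsilon> * (s' - s)\<^sup>2"
proof -
  have s0: "s \<in> {0..T}" and s'0: "s' \<in> {0..T}" using s by auto
  have sub: "{s..s'} \<subseteq> {0..T}" using s by auto
  define h where "h = s' - s"
  have h: "h \<ge> 0" using s by (simp add: h_def)
  define p where "p = quotient \<epsilon> (transport s')"
  define m where "m = mollify \<epsilon> (transport s)"
  define m' where "m' = mollify \<epsilon> (transport s')"
  note tr = transport_measurable[OF s0] transport_lip[OF s0] transport_bound[of s]
  note tr' = transport_measurable[OF s'0] transport_lip[OF s'0] transport_bound[of s']
  have pm: "p \<in> borel_measurable borel" unfolding p_def by (rule quotient_measurable[OF tr' \<epsilon>(1)])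
  have pl: "\<bar>p (\<xi>, x)\<bar> \<le> \<Gamma> * l x" for \<xi> x unfolding p_def by (rule quotient_bound[OF tr' \<epsilon>(1)])
  have pb: "\<bar>p q\<bar> \<le> L" for q using pl[of "fst q" "snd q"] l_le_L[of "snd q"] by simp
  have plip: "\<bar>p (\<xi>, x) - p (\<zeta>, x)\<bar> \<le> 2 * L / \<epsilon> * \<bar>\<xi> - \<zeta>\<bar>" for \<xi> \<zeta> x
  proof -
    have "2 * (\<Gamma> * l x) / \<epsilon> * \<bar>\<xi> - \<zeta>\<bar> \<le> 2 * L / \<epsilon> * \<bar>\<xi> - \<zeta>\<bar>"
      using l_le_L[of x] \<epsilon> by (intro mult_right_mono divide_right_mono) auto
    with quotient_lipschitz[OF tr' \<epsilon>(1), of \<xi> x \<zeta>] show ?thesis unfolding p_def by linarith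
  qed
  have pz: "p (\<xi>, x) = 0" if "\<bar>\<xi>\<bar> > R + 1" for \<xi> x
    unfolding p_def by (rule quotient_vanishes[OF s'0 \<epsilon> that])
  \<comment> \<open>Constants delivered by \<open>cutoff_product\<close> for p, which vanishes
    beyond R + 1 and has Lipschitz constant \<open>2 * L / \<epsilon>\<close>.\<close>
  define Lg where "Lg = 2 * L / \<epsilon> * (rate * (1 + (R + 1))) + L * C"
  define Mg where "Mg = L * (rate * (1 + (R + 1)))"
  define G where "G = (\<lambda>w. p (snd w) * vel (\<sigma> (fst w)) (fst w) (fst (snd w)) (snd (snd w)))"
  have L2: "0 \<le> 2 * L / \<epsilon>" using L_nonneg \<epsilon> by simp
  have R1: "0 \<le> R + 1" using R_nonneg by simp
  have G: "\<bar>G (\<tau>, q)\<bar> \<le> Mg" "\<bar>G (\<tau>, \<xi>, x) - G (\<tau>, \<zeta>, x)\<bar> \<le> Lg * \<bar>\<xi> - \<zeta>\<bar>" if \<tau>: "\<tau> \<in> {0..T}" for \<tau> q \<xi> \<zeta> x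
  proof -
    note cl = cutoff_product[where v="\<lambda>\<xi>. vel (\<sigma> \<tau>) \<tau> \<xi> x" and p="\<lambda>\<xi>. p (\<xi>, x)" for x,
      OF vel_lip[OF \<sigma>_P2[OF \<tau>]] less_imp_le[OF C_pos] rate(2)[OF \<tau>] less_imp_le[OF rate(1)] plip L2 pb pz R1]
    show "\<bar>G (\<tau>, q)\<bar> \<le> Mg" using cl(1)[of "fst q" "snd q"] by (simp add: G_def Mg_def)
    show "\<bar>G (\<tau>, \<xi>, x) - G (\<tau>, \<zeta>, x)\<bar> \<le> Lg * \<bar>\<xi> - \<zeta>\<bar>" using cl(2)[of \<xi> x \<zeta>] by (simp add: G_def Lg_def)
  qed
  have Gm: "G \<in> borel_measurable borel"
    unfolding G_def by (intro borel_measurable_times flow_vel_measurable measurable_compose[OF snd_borel pm])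
  have Gsm: "(\<lambda>q. G (\<tau>, q)) \<in> borel_measurable borel" for \<tau>
    by (rule measurable_compose[OF _ Gm]) simp
  interpret Ns: prob_space "\<rho> s" by (rule P2D[OF S.\<rho>_P2[OF s0]])
  note Fub = Fubini_Icc[OF P2D(1,2)[OF S.\<rho>_P2[OF s0]] Gm, of "\<lambda>_. Mg" s s']
  have Fub1: "(LINT \<tau>:{s..s'}|lborel. \<integral>q. G (\<tau>, q) \<partial>\<rho> s) = (\<integral>q. (LINT \<tau>:{s..s'}|lborel. G (\<tau>, q)) \<partial>\<rho> s)"
    and Fub2: "set_integrable lborel {s..s'} (\<lambda>\<tau>. \<integral>q. G (\<tau>, q) \<partial>\<rho> s)"
    and Fub3: "integrable (\<rho> s) (\<lambda>q. LINT \<tau>:{s..s'}|lborel. G (\<tau>, q))"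
    using Fub G(1) sub by auto
  have GI: "(LINT \<tau>:{s..s'}|lborel. G (\<tau>, q)) = p q * (LINT \<tau>:{s..s'}|lborel. vel (\<sigma> \<tau>) \<tau> (fst q) (snd q))" for q
    by (simp add: G_def)
  note inc = S.mollified_increment[OF tr' \<epsilon>(1) l_le_L s, folded p_def m'_def]
  have mi: "integrable (\<rho> s) m" "integrable (\<rho> s) m'"
    unfolding m_def m'_def
    by (rule S.bounded_\<rho>_integrable[OF _ _ s0] mollify_measurable[OF tr \<epsilon>(1)] mollify_bound[OF tr \<epsilon>(1)]
        mollify_measurable[OF tr' \<epsilon>(1)] mollify_bound[OF tr' \<epsilon>(1)])+
  define err where "err = L * C * \<Gamma> * \<epsilon> * (s' - s) + (2 * L * D\<^sup>2 + L * C * D) / \<epsilon> * (s' - s)\<^sup>2"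
  have e1: "\<bar>(\<integral>q. m' q \<partial>\<rho> s) - (\<integral>q. m q \<partial>\<rho> s) + (LINT \<tau>:{s..s'}|lborel. \<integral>q. G (\<tau>, q) \<partial>\<rho> s)\<bar> \<le> err"
  proof -
    have i: "integrable (\<rho> s) (\<lambda>q. m' q - m q + (LINT \<tau>:{s..s'}|lborel. G (\<tau>, q)))" using mi Fub3 by auto
    have "(\<integral>q. m' q \<partial>\<rho> s) - (\<integral>q. m q \<partial>\<rho> s) + (LINT \<tau>:{s..s'}|lborel. \<integral>q. G (\<tau>, q) \<partial>\<rho> s) =
       (\<integral>q. m' q - m q + (LINT \<tau>:{s..s'}|lborel. G (\<tau>, q)) \<partial>\<rho> s)"
      using mi Fub3 by (simp add: Fub1)
    also have "\<bar>\<dots>\<bar> \<le> (\<integral>q. \<bar>m' q - m q + (LINT \<tau>:{s..s'}|lborel. G (\<tau>, q))\<bar> \<partial>\<rho> s)" by (rule integral_abs_bound)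
    also have "\<dots> \<le> (\<integral>q. err \<partial>\<rho> s)"
    proof (rule integral_mono)
      show "\<bar>m' q - m q + (LINT \<tau>:{s..s'}|lborel. G (\<tau>, q))\<bar> \<le> err" for q
        using mollified_transport_step[OF s \<epsilon>, of "fst q" "snd q"] by (simp add: GI err_def m_def m'_def p_def)
    qed (use i in auto)
    finally show ?thesis by (simp add: Ns.prob_space)
  qed
  define J where "J = (\<integral>x. l x \<partial>\<mu>)"
  have li: "integrable \<mu> l"
  proof -
    interpret prob_space \<mu> by (rule prob_\<mu>)
    show ?thesis by (rule integrable_const_bound[where B=N]) (use l sets_\<mu> in \<open>auto cong: measurable_cong_sets\<close>)
  qed
  \<comment> \<open>The two velocities are first compared under the same measure
    \<open>\<rho> \<tau>\<close>, which gives the term with \<open>\<beta>\<close>; only then is the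
    measure moved back from \<tau> to s.\<close>
  have e2: "\<bar>S.flux p \<tau> - (\<integral>q. G (\<tau>, q) \<partial>\<rho> s)\<bar> \<le> \<Gamma> * J * \<beta> \<tau> + Lg * (S.bound * (1 + S.bound)) * h" if \<tau>: "\<tau> \<in> {s..s'}" for \<tau>
  proof -
    have \<tau>0: "\<tau> \<in> {0..T}" using \<tau> sub by auto
    note n\<tau> = P2D[OF S.\<rho>_P2[OF \<tau>0]]
    have Gi: "integrable (\<rho> \<tau>) (\<lambda>q. G (\<tau>, q))" by (rule S.bounded_\<rho>_integrable[OF Gsm G(1)[OF \<tau>0] \<tau>0])
    have fi: "integrable (\<rho> \<tau>) (\<lambda>q. p q * vel (\<rho> \<tau>) \<tau> (fst q) (snd q))" by (rule S.flux_integrable(1)[OF pm pb \<tau>0])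
    have lsi: "integrable (\<rho> \<tau>) (\<lambda>q. l (snd q))" "(\<integral>q. l (snd q) \<partial>\<rho> \<tau>) = J"
      using P2_integral_snd[OF S.\<rho>_P2[OF \<tau>0] l(1)] li by (auto simp: J_def)
    have "S.flux p \<tau> - (\<integral>q. G (\<tau>, q) \<partial>\<rho> \<tau>) = (\<integral>q. p q * vel (\<rho> \<tau>) \<tau> (fst q) (snd q) - G (\<tau>, q) \<partial>\<rho> \<tau>)"
      using fi Gi by (simp add: S.flux_def)
    also have "\<bar>\<dots>\<bar> \<le> (\<integral>q. \<bar>p q * vel (\<rho> \<tau>) \<tau> (fst q) (snd q) - G (\<tau>, q)\<bar> \<partial>\<rho> \<tau>)" by (rule integral_abs_bound)
    also have "\<dots> \<le> (\<integral>q. \<Gamma> * \<beta> \<tau> * l (snd q) \<partial>\<rho> \<tau>)"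
    proof (rule integral_mono)
      fix q
      have "p q * vel (\<rho> \<tau>) \<tau> (fst q) (snd q) - G (\<tau>, q) = p q * (vel (\<rho> \<tau>) \<tau> (fst q) (snd q) - vel (\<sigma> \<tau>) \<tau> (fst q) (snd q))"
        by (simp add: G_def algebra_simps)
      also have "\<bar>\<dots>\<bar> \<le> (\<Gamma> * l (snd q)) * \<beta> \<tau>"
        unfolding abs_mult using pl[of "fst q" "snd q"] vd[OF \<tau>0] l(2) \<Gamma>_ge1 by (intro mult_mono) auto
      finally show "\<bar>p q * vel (\<rho> \<tau>) \<tau> (fst q) (snd q) - G (\<tau>, q)\<bar> \<le> \<Gamma> * \<beta> \<tau> * l (snd q)" by (simp add: mult_ac)
    qed (use fi Gi lsi in auto)
    finally have 1: "\<bar>S.flux p \<tau> - (\<integral>q. G (\<tau>, q) \<partial>\<rho> \<tau>)\<bar> \<le> \<Gamma> * J * \<beta> \<tau>" using lsi by (simp add: mult_ac)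
    have st: "0 \<le> s" "s \<le> \<tau>" "\<tau> \<le> T" using \<tau> s by auto
    have "\<bar>(\<integral>q. G (\<tau>, q) \<partial>\<rho> \<tau>) - (\<integral>q. G (\<tau>, q) \<partial>\<rho> s)\<bar> \<le> Lg * (S.bound * (1 + S.bound)) * (\<tau> - s)"
      by (rule S.lipschitz_in_time[OF Gsm G(2)[OF \<tau>0] G(1)[OF \<tau>0] st])
    also have "\<dots> \<le> Lg * (S.bound * (1 + S.bound)) * h"
      using \<tau> S.bound(1) L_nonneg \<epsilon> rate(1) R_nonneg C_pos by (intro mult_left_mono) (auto simp: h_def Lg_def)
    finally show ?thesis using 1 by linarith
  qed
  have bi: "set_integrable lborel {s..s'} (\<lambda>\<tau>. \<Gamma> * J * \<beta> \<tau>)"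
    by (rule borel_integrable_atLeastAtMost') (intro continuous_intros continuous_on_subset[OF \<beta> sub])
  have ci: "set_integrable lborel {s..s'} (\<lambda>\<tau>. Lg * (S.bound * (1 + S.bound)) * h)"
    by (rule borel_integrable_atLeastAtMost') (intro continuous_intros)
  note di = set_integral_diff[OF inc(1) Fub2]
  have "\<bar>(LINT \<tau>:{s..s'}|lborel. S.flux p \<tau>) - (LINT \<tau>:{s..s'}|lborel. \<integral>q. G (\<tau>, q) \<partial>\<rho> s)\<bar> =
     \<bar>LINT \<tau>:{s..s'}|lborel. S.flux p \<tau> - (\<integral>q. G (\<tau>, q) \<partial>\<rho> s)\<bar>"
    using di(2) by simp
  also have "\<dots> \<le> (LINT \<tau>:{s..s'}|lborel. \<bar>S.flux p \<tau> - (\<integral>q. G (\<tau>, q) \<partial>\<rho> s)\<bar>)"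
    using set_integral_norm_bound[OF di(1)] by simp
  also have "\<dots> \<le> (LINT \<tau>:{s..s'}|lborel. \<Gamma> * J * \<beta> \<tau> + Lg * (S.bound * (1 + S.bound)) * h)"
    by (rule set_integral_mono[OF set_integrable_abs[OF di(1)] set_integral_add(1)[OF bi ci] e2])
  also have "\<dots> = (LINT \<tau>:{s..s'}|lborel. \<Gamma> * J * \<beta> \<tau>) + Lg * (S.bound * (1 + S.bound)) * h * (s' - s)"
    using set_integral_add(2)[OF bi ci] s by (simp add: set_lebesgue_integral_def)
  finally have e3: "\<bar>(LINT \<tau>:{s..s'}|lborel. S.flux p \<tau>) - (LINT \<tau>:{s..s'}|lborel. \<integral>q. G (\<tau>, q) \<partial>\<rho> s)\<bar> \<le>
     (LINT \<tau>:{s..s'}|lborel. \<Gamma> * J * \<beta> \<tau>) + Lg * (S.bound * (1 + S.bound)) * h * (s' - s)" .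
  \<comment> \<open>Moving the measure costs at most a multiple of Lg h on an interval of length h,
    hence a quadratic term; Lg itself is of order 1 / \<epsilon>.\<close>
  have e4: "Lg * (S.bound * (1 + S.bound)) * h * (s' - s) \<le> (2 * L * (rate * (2 + R)) + L * C) * (S.bound * (1 + S.bound)) / \<epsilon> * (s' - s)\<^sup>2"
  proof -
    have "L * C / 1 \<le> L * C / \<epsilon>" using \<epsilon> L_nonneg C_pos by (intro divide_left_mono) auto
    then have "Lg \<le> (2 * L * (rate * (2 + R)) + L * C) / \<epsilon>" by (simp add: Lg_def add_divide_distrib)
    then have "Lg * ((S.bound * (1 + S.bound)) * (h * h)) \<le> (2 * L * (rate * (2 + R)) + L * C) / \<epsilon> * ((S.bound * (1 + S.bound)) * (h * h))"
      using S.bound(1) by (intro mult_right_mono) auto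
    then show ?thesis by (simp add: h_def power2_eq_square mult_ac)
  qed
  have "(2 * L * D\<^sup>2 + L * C * D + (2 * L * (rate * (2 + R)) + L * C) * (S.bound * (1 + S.bound))) / \<epsilon> * (s' - s)\<^sup>2 =
     (2 * L * D\<^sup>2 + L * C * D) / \<epsilon> * (s' - s)\<^sup>2 + (2 * L * (rate * (2 + R)) + L * C) * (S.bound * (1 + S.bound)) / \<epsilon> * (s' - s)\<^sup>2"
    by (simp add: add_divide_distrib distrib_right)
  then show ?thesis
    using e1 e3 e4 inc(2) unfolding err_def J_def[symmetric] m_def[symmetric] m'_def[symmetric] by linarith
qed

text \<open>The partition is refined at fixed \<epsilon>, since the quadratic error carries 1 /
  \<epsilon>; only then does \<epsilon> tend to 0. The end values give the claim:
  \<open>transport t\<close> is \<open>\<psi>\<close>, and \<open>transport 0\<close> against the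
  common initial datum is \<open>\<psi>\<close> against \<open>\<sigma> t\<close>.\<close>

lemma transport_estimate:
  assumes \<beta>: "continuous_on {0..T} \<beta>" and vd: "\<And>\<tau> \<xi> x. \<tau> \<in> {0..T} \<Longrightarrow> \<bar>vel (\<rho> \<tau>) \<tau> \<xi> x - vel (\<sigma> \<tau>) \<tau> \<xi> x\<bar> \<le> \<beta> \<tau>"
  shows "\<bar>(\<integral>q. \<psi> q \<partial>\<rho> t) - (\<integral>q. \<psi> q \<partial>\<sigma> t)\<bar> \<le> (LINT \<tau>:{0..t}|lborel. \<Gamma> * (\<integral>x. l x \<partial>\<mu>) * \<beta> \<tau>)"
proof -
  let ?I = "LINT \<tau>:{0..t}|lborel. \<Gamma> * (\<integral>x. l x \<partial>\<mu>) * \<beta> \<tau>"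
  have 0: "0 \<in> {0..T}" using T_pos by simp
  have bi: "set_integrable lborel {0..t} (\<lambda>\<tau>. \<Gamma> * (\<integral>x. l x \<partial>\<mu>) * \<beta> \<tau>)"
    by (rule borel_integrable_atLeastAtMost') (intro continuous_intros continuous_on_subset[OF \<beta>], use t in auto)
  have close: "\<bar>(\<integral>q. mollify \<epsilon> (transport s) q \<partial>\<rho> s) - (\<integral>q. transport s q \<partial>\<rho> s)\<bar> \<le> L * \<epsilon>" if s: "s \<in> {0..T}" and \<epsilon>: "\<epsilon> > 0" for s \<epsilon>
  proof -
    interpret prob_space "\<rho> s" by (rule P2D[OF S.\<rho>_P2[OF s]])
    note tr = transport_measurable[OF s] transport_L[OF s] transport_bound[of s]
    have i: "integrable (\<rho> s) (mollify \<epsilon> (transport s))" "integrable (\<rho> s) (transport s)"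
      by (rule S.bounded_\<rho>_integrable[OF _ _ s] mollify_measurable[OF tr \<epsilon>] mollify_bound[OF tr \<epsilon>] tr)+
    then have "\<bar>(\<integral>q. mollify \<epsilon> (transport s) q \<partial>\<rho> s) - (\<integral>q. transport s q \<partial>\<rho> s)\<bar> = \<bar>\<integral>q. mollify \<epsilon> (transport s) q - transport s q \<partial>\<rho> s\<bar>" by simp
    also have "\<dots> \<le> (\<integral>q. \<bar>mollify \<epsilon> (transport s) q - transport s q\<bar> \<partial>\<rho> s)" by (rule integral_abs_bound)
    also have "\<dots> \<le> (\<integral>q. L * \<epsilon> \<partial>\<rho> s)"
    proof (rule integral_mono)
      show "\<bar>mollify \<epsilon> (transport s) q - transport s q\<bar> \<le> L * \<epsilon>" for q using mollify_close[OF tr \<epsilon>, of "fst q" "snd q"] by simp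
    qed (use i in auto)
    finally show ?thesis by (simp add: prob_space)
  qed
  have tt: "(\<integral>q. transport t q \<partial>\<rho> t) = (\<integral>q. \<psi> q \<partial>\<rho> t)"
    using transport_end by (intro Bochner_Integration.integral_cong) auto
  have t0: "(\<integral>q. transport 0 q \<partial>\<rho> 0) = (\<integral>q. \<psi> q \<partial>\<sigma> t)"
  proof -
    have "transport 0 q = \<psi> (f (t, q), snd q)" for q
      using transport_flow[OF 0, of "fst q" "snd q"] by (simp add: f_0)
    then show ?thesis unfolding S_0 by (simp add: integral_\<sigma>[OF \<psi>])
  qed
  have e: "\<bar>(\<integral>q. \<psi> q \<partial>\<rho> t) - (\<integral>q. \<psi> q \<partial>\<sigma> t)\<bar> \<le> ?I + (L * C * \<Gamma> * t + 2 * L) * \<epsilon>" if \<epsilon>: "0 < \<epsilon>" "\<epsilon> \<le> 1" for \<epsilon>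
  proof -
    have "\<bar>(\<integral>q. mollify \<epsilon> (transport t) q \<partial>\<rho> t) - (\<integral>q. mollify \<epsilon> (transport 0) q \<partial>\<rho> 0)\<bar> \<le> ?I + L * C * \<Gamma> * \<epsilon> * t"
    proof (rule sum_increments[OF _ bi])
      show "\<bar>(\<integral>q. mollify \<epsilon> (transport s') q \<partial>\<rho> s') - (\<integral>q. mollify \<epsilon> (transport s) q \<partial>\<rho> s)\<bar> \<le>
        (LINT \<tau>:{s..s'}|lborel. \<Gamma> * (\<integral>x. l x \<partial>\<mu>) * \<beta> \<tau>) + L * C * \<Gamma> * \<epsilon> * (s' - s) +
        (2 * L * D\<^sup>2 + L * C * D + (2 * L * (rate * (2 + R)) + L * C) * (S.bound * (1 + S.bound))) / \<epsilon> * (s' - s)\<^sup>2"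
        if "0 \<le> s" "s \<le> s'" "s' \<le> t" for s s'
        by (rule transport_energy_step[OF \<beta> vd _ _ _ \<epsilon>]) (use that t in auto)
    qed (use t in auto)
    then have "\<bar>(\<integral>q. \<psi> q \<partial>\<rho> t) - (\<integral>q. \<psi> q \<partial>\<sigma> t)\<bar> \<le> ?I + L * C * \<Gamma> * \<epsilon> * t + 2 * (L * \<epsilon>)"
      using close[OF t \<epsilon>(1)] close[OF 0 \<epsilon>(1)] unfolding tt t0 by linarith
    then show ?thesis by (simp add: algebra_simps)
  qed
  show ?thesis
  proof (rule field_le_epsilon)
    fix d :: real assume d: "d > 0"
    let ?A = "L * C * \<Gamma> * t + 2 * L"
    have A: "?A \<ge> 0" using L_nonneg C_pos \<Gamma>_ge1 t by simp
    define \<epsilon> where "\<epsilon> = min 1 (d / (?A + 1))"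
    have \<epsilon>: "0 < \<epsilon>" "\<epsilon> \<le> 1" using d A by (auto simp: \<epsilon>_def)
    have "?A * \<epsilon> \<le> ?A * (d / (?A + 1))" using A by (intro mult_left_mono) (auto simp: \<epsilon>_def)
    also have "\<dots> \<le> d" using A d by (simp add: field_simps)
    finally show "\<bar>(\<integral>q. \<psi> q \<partial>\<rho> t) - (\<integral>q. \<psi> q \<partial>\<sigma> t)\<bar> \<le> ?I + d" using e[OF \<epsilon>] by linarith
  qed
qed

end

section \<open>Closing the estimate for the velocities\<close>

context mean_field_uniqueness begin

lemma clip_bounds: "n \<ge> 0 \<Longrightarrow> \<bar>clip n \<xi>\<bar> \<le> n" "\<bar>clip n \<xi>\<bar> \<le> \<bar>\<xi>\<bar>" if "n \<ge> 0" for n \<xi> :: real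
  using that by (auto simp: clip_def)

text \<open>The velocity is an integral of the kernel, which becomes an admissible
  \<open>\<psi>\<close> when it is set to 0 where k exceeds m and its second argument is clipped.
  The truncated Lipschitz constant has integral at most C for every m, so the bound survives the
  limit by dominated convergence.\<close>

lemma velocity_estimate:
  assumes \<beta>: "continuous_on {0..T} \<beta>" and vd: "\<And>\<tau> \<xi> x. \<tau> \<in> {0..T} \<Longrightarrow> \<bar>vel (\<rho> \<tau>) \<tau> \<xi> x - vel (\<sigma> \<tau>) \<tau> \<xi> x\<bar> \<le> \<beta> \<tau>"
    and t: "t \<in> {0..T}"
  shows "\<bar>vel (\<rho> t) t \<xi> x - vel (\<sigma> t) t \<xi> x\<bar> \<le> \<Gamma> * C * (LINT \<tau>:{0..t}|lborel. \<beta> \<tau>)"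
proof -
  define \<psi> where "\<psi> m q = (if k t x (snd q) \<le> real m then \<Psi> t \<xi> (clip (real m) (fst q)) x (snd q) else 0)" for m :: nat and q
  define l where "l m y = (if k t x y \<le> real m then k t x y else 0)" for m :: nat and y
  have clipm[measurable]: "clip n \<in> borel_measurable borel" for n unfolding clip_def[abs_def] by measurable
  have \<psi>m: "\<psi> m \<in> borel_measurable borel" for m unfolding \<psi>_def[abs_def] by measurable
  have lm: "l m \<in> borel_measurable borel" for m unfolding l_def[abs_def] by measurable
  have \<beta>0: "0 \<le> \<beta> \<tau>" if "\<tau> \<in> {0..T}" for \<tau> using vd[OF that, of 0 undefined] by linarith
  have est: "\<bar>(\<integral>q. \<psi> m q \<partial>\<rho> t) - (\<integral>q. \<psi> m q \<partial>\<sigma> t)\<bar> \<le> \<Gamma> * C * (LINT \<tau>:{0..t}|lborel. \<beta> \<tau>)" for m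
  proof -
    interpret tt: transport_test \<mu> \<Psi> k C T \<nu> \<sigma> f K \<rho> t "\<psi> m" "l m" "real m" "real m" "real m * (\<bar>\<xi>\<bar> + real m)"
    proof
      show "t \<in> {0..T}" "\<psi> m \<in> borel_measurable borel" "l m \<in> borel_measurable borel" by (rule t \<psi>m lm)+
      show "0 \<le> l m y" "l m y \<le> real m" for y using k_nonneg by (auto simp: l_def)
      show "\<bar>\<psi> m q\<bar> \<le> real m * (\<bar>\<xi>\<bar> + real m)" for q
      proof (cases "k t x (snd q) \<le> real m")
        case True
        have "\<bar>\<Psi> t \<xi> (clip (real m) (fst q)) x (snd q)\<bar> \<le> k t x (snd q) * (\<bar>\<xi>\<bar> + \<bar>clip (real m) (fst q)\<bar>)" by (rule \<Psi>_bound)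
        also have "\<dots> \<le> real m * (\<bar>\<xi>\<bar> + real m)" using True k_nonneg clip_bounds(1)[of "real m" "fst q"] by (intro mult_mono) auto
        finally show ?thesis using True by (simp add: \<psi>_def)
      qed (simp add: \<psi>_def)
      show "\<bar>\<psi> m (a, y) - \<psi> m (b, y)\<bar> \<le> l m y * \<bar>clip (real m) a - clip (real m) b\<bar>" for a b y
        using \<Psi>_lip[of t \<xi> "clip (real m) a" x y \<xi> "clip (real m) b"] by (simp add: \<psi>_def l_def)
    qed simp
    have lC: "(\<integral>y. l m y \<partial>\<mu>) \<le> C"
    proof -
      interpret prob_space \<mu> by (rule prob_\<mu>)
      have ki: "integrable \<mu> (\<lambda>y. k t x y)" "(\<integral>y. k t x y \<partial>\<mu>) \<le> C"
        using k_integrable[OF \<nu>, of t x] P2_integral_snd[OF \<nu>, of "k t x"] by auto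
      have "(\<integral>y. l m y \<partial>\<mu>) \<le> (\<integral>y. k t x y \<partial>\<mu>)"
      proof (rule integral_mono)
        show "integrable \<mu> (l m)"
          by (rule Bochner_Integration.integrable_bound[OF ki(1)]) (use lm[of m] sets_\<mu> k_nonneg in \<open>auto simp: l_def cong: measurable_cong_sets\<close>)
        show "integrable \<mu> (k t x)" by (rule ki)
        show "l m y \<le> k t x y" for y using k_nonneg by (simp add: l_def)
      qed
      then show ?thesis using ki by simp
    qed
    have "\<bar>(\<integral>q. \<psi> m q \<partial>\<rho> t) - (\<integral>q. \<psi> m q \<partial>\<sigma> t)\<bar> \<le> (LINT \<tau>:{0..t}|lborel. \<Gamma> * (\<integral>y. l m y \<partial>\<mu>) * \<beta> \<tau>)"
      by (rule tt.transport_estimate[OF \<beta> vd])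
    also have "\<dots> = \<Gamma> * (\<integral>y. l m y \<partial>\<mu>) * (LINT \<tau>:{0..t}|lborel. \<beta> \<tau>)" by simp
    also have "\<dots> \<le> \<Gamma> * C * (LINT \<tau>:{0..t}|lborel. \<beta> \<tau>)"
    proof (intro mult_right_mono mult_left_mono lC)
      show "0 \<le> (LINT \<tau>:{0..t}|lborel. \<beta> \<tau>)"
        unfolding set_lebesgue_integral_def using \<beta>0 t by (intro integral_nonneg_AE AE_I2) (auto split: split_indicator)
    qed (use \<Gamma>_ge1 in simp)
    finally show ?thesis .
  qed
  have lim: "(\<lambda>m. \<integral>q. \<psi> m q \<partial>N) \<longlonglongrightarrow> (\<integral>q. \<Psi> t \<xi> (fst q) x (snd q) \<partial>N)" if N: "N \<in> P2 \<mu>" for N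
  proof (rule integral_dominated_convergence[where w="\<lambda>q. \<bar>\<xi>\<bar> * k t x (snd q) + k t x (snd q) * \<bar>fst q\<bar>"])
    show "(\<lambda>q. \<Psi> t \<xi> (fst q) x (snd q)) \<in> borel_measurable N" by (rule P2D(9)[OF N]) measurable
    show "\<psi> m \<in> borel_measurable N" for m by (rule P2D(9)[OF N \<psi>m])
    show "integrable N (\<lambda>q. \<bar>\<xi>\<bar> * k t x (snd q) + k t x (snd q) * \<bar>fst q\<bar>)"
      by (intro Bochner_Integration.integrable_add integrable_mult_right k_integrable[OF N] k_weighted(1)[OF N fst_borel P2D(5)[OF N]])
    show "AE q in N. norm (\<psi> m q) \<le> \<bar>\<xi>\<bar> * k t x (snd q) + k t x (snd q) * \<bar>fst q\<bar>" for m
    proof (rule AE_I2)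
      fix q
      have "\<bar>\<Psi> t \<xi> (clip (real m) (fst q)) x (snd q)\<bar> \<le> k t x (snd q) * (\<bar>\<xi>\<bar> + \<bar>clip (real m) (fst q)\<bar>)" by (rule \<Psi>_bound)
      also have "\<dots> \<le> k t x (snd q) * (\<bar>\<xi>\<bar> + \<bar>fst q\<bar>)" using k_nonneg clip_bounds(2)[of "real m" "fst q"] by (intro mult_left_mono) auto
      finally show "norm (\<psi> m q) \<le> \<bar>\<xi>\<bar> * k t x (snd q) + k t x (snd q) * \<bar>fst q\<bar>"
        using k_nonneg[of t x "snd q"] by (auto simp: \<psi>_def algebra_simps)
    qed
    show "AE q in N. (\<lambda>m. \<psi> m q) \<longlonglongrightarrow> \<Psi> t \<xi> (fst q) x (snd q)"
    proof (rule AE_I2)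
      fix q
      obtain m0 :: nat where m0: "k t x (snd q) \<le> real m0" "\<bar>fst q\<bar> \<le> real m0"
        using real_arch_simple[of "max (k t x (snd q)) \<bar>fst q\<bar>"] by auto
      have "eventually (\<lambda>m. \<psi> m q = \<Psi> t \<xi> (fst q) x (snd q)) sequentially"
        using eventually_ge_at_top[of m0]
      proof eventually_elim
        case (elim m)
        then have "real m0 \<le> real m" by simp
        then have "k t x (snd q) \<le> real m" "clip (real m) (fst q) = fst q" using m0 by (auto simp: clip_def)
        then show ?case by (simp add: \<psi>_def)
      qed
      then show "(\<lambda>m. \<psi> m q) \<longlonglongrightarrow> \<Psi> t \<xi> (fst q) x (snd q)" by (rule tendsto_eventually)
    qed
  qed
  have "(\<lambda>m. \<bar>(\<integral>q. \<psi> m q \<partial>\<rho> t) - (\<integral>q. \<psi> m q \<partial>\<sigma> t)\<bar>) \<longlonglongrightarrow>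
     \<bar>(\<integral>q. \<Psi> t \<xi> (fst q) x (snd q) \<partial>\<rho> t) - (\<integral>q. \<Psi> t \<xi> (fst q) x (snd q) \<partial>\<sigma> t)\<bar>"
    by (intro tendsto_intros lim S.\<rho>_P2 \<sigma>_P2 t)
  then have "\<bar>(\<integral>q. \<Psi> t \<xi> (fst q) x (snd q) \<partial>\<rho> t) - (\<integral>q. \<Psi> t \<xi> (fst q) x (snd q) \<partial>\<sigma> t)\<bar> \<le> \<Gamma> * C * (LINT \<tau>:{0..t}|lborel. \<beta> \<tau>)"
    by (rule LIMSEQ_le_const2) (use est in auto)
  then show ?thesis by (simp add: vel_def abs_minus_commute)
qed

text \<open>First majorant of the iteration in \<open>velocities_agree\<close>; it is uniform in
  \<xi> and x because \<open>vel_diff_L2d2\<close> is.\<close>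

lemma velocity_bounded: "\<exists>B. \<forall>t\<in>{0..T}. \<forall>\<xi> x. \<bar>vel (\<rho> t) t \<xi> x - vel (\<sigma> t) t \<xi> x\<bar> \<le> B"
proof (rule locally_bounded_Icc)
  show "\<exists>B. \<forall>\<xi> x. \<bar>vel (\<rho> t) t \<xi> x - vel (\<sigma> t) t \<xi> x\<bar> \<le> B" if "t \<in> {0..T}" for t
    using vel_diff_L2d2[OF S.\<rho>_P2[OF that] \<sigma>_P2[OF that], of t] by blast
  fix t assume t: "t \<in> {0..T}"
  have "((\<lambda>s. L2d2 \<mu> (\<rho> s) (\<rho> t)) \<longlongrightarrow> 0) (at t within {0..T})" "((\<lambda>s. L2d2 \<mu> (\<sigma> s) (\<sigma> t)) \<longlongrightarrow> 0) (at t within {0..T})"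
    using S.\<rho>_cont \<sigma>_cont t by (simp_all add: cont_curve_def)
  then have "eventually (\<lambda>s. L2d2 \<mu> (\<rho> s) (\<rho> t) < 1) (at t within {0..T})" "eventually (\<lambda>s. L2d2 \<mu> (\<sigma> s) (\<sigma> t) < 1) (at t within {0..T})"
    by (auto dest: order_tendstoD(2)[of _ _ _ 1])
  moreover have "eventually (\<lambda>s. s \<in> {0..T}) (at t within {0..T})" by (simp add: eventually_at_filter)
  ultimately have "eventually (\<lambda>s. \<forall>\<xi> x. \<bar>vel (\<rho> s) s \<xi> x - vel (\<sigma> s) s \<xi> x\<bar> \<le> C * L2d2 \<mu> (\<rho> t) (\<sigma> t) + 2 * C) (at t within {0..T})"
  proof eventually_elim
    case (elim s)
    have "C * L2d2 \<mu> (\<rho> s) (\<rho> t) \<le> C * 1" "C * L2d2 \<mu> (\<sigma> s) (\<sigma> t) \<le> C * 1" using elim C_pos by (auto intro!: mult_left_mono)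
    then have "\<bar>vel (\<rho> s) s \<xi> x - vel (\<sigma> s) s \<xi> x\<bar> \<le> C * L2d2 \<mu> (\<rho> t) (\<sigma> t) + 2 * C" for \<xi> x
      using vel_diff_L2d2[OF S.\<rho>_P2[OF elim(3)] S.\<rho>_P2[OF t], of s \<xi> x] vel_diff_L2d2[OF S.\<rho>_P2[OF t] \<sigma>_P2[OF t], of s \<xi> x]
        vel_diff_L2d2[OF \<sigma>_P2[OF elim(3)] \<sigma>_P2[OF t], of s \<xi> x] by linarith
    then show ?case by blast
  qed
  then show "\<exists>B. eventually (\<lambda>s. \<forall>\<xi> x. \<bar>vel (\<rho> s) s \<xi> x - vel (\<sigma> s) s \<xi> x\<bar> \<le> B) (at t within {0..T})" by blast
qed (meson order_trans)

text \<open>Gronwall by iteration. The supremum of the velocity difference over \<xi> and x has no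
  established regularity in time, so each step feeds an explicit continuous majorant into
  \<open>velocity_estimate\<close>; the j-th one is B (A t)^j / j!, which tends to 0.\<close>

lemma velocities_agree:
  assumes t: "t \<in> {0..T}" shows "vel (\<rho> t) t \<xi> x = vel (\<sigma> t) t \<xi> x"
proof -
  obtain B where B: "\<And>t \<xi> x. t \<in> {0..T} \<Longrightarrow> \<bar>vel (\<rho> t) t \<xi> x - vel (\<sigma> t) t \<xi> x\<bar> \<le> B" using velocity_bounded by blast
  define A where "A = \<Gamma> * C"
  have j: "\<bar>vel (\<rho> t) t \<xi> x - vel (\<sigma> t) t \<xi> x\<bar> \<le> B * ((A * t) ^ j / fact j)" if "t \<in> {0..T}" for j t \<xi> x
    using that
  proof (induction j arbitrary: t \<xi> x)
    case (Suc j)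
    let ?b = "\<lambda>\<tau>. B * ((A * \<tau>) ^ j / fact j)"
    have c: "continuous_on S ?b" for S by (intro continuous_intros) auto
    have "\<bar>vel (\<rho> t) t \<xi> x - vel (\<sigma> t) t \<xi> x\<bar> \<le> \<Gamma> * C * (LINT \<tau>:{0..t}|lborel. ?b \<tau>)"
      by (rule velocity_estimate[OF c Suc.IH Suc.prems])
    also have "(LINT \<tau>:{0..t}|lborel. ?b \<tau>) = B * A ^ j * t ^ Suc j / fact (Suc j) - B * A ^ j * 0 ^ Suc j / fact (Suc j)"
      unfolding set_lebesgue_integral_def
    proof (rule integral_FTC_Icc[OF _ _ c])
      fix \<tau> :: real
      have d: "((\<lambda>\<tau>. B * A ^ j * \<tau> ^ Suc j / fact (Suc j)) has_real_derivative B * A ^ j * (real (Suc j) * \<tau> ^ j) / fact (Suc j)) (at \<tau> within {0..t})"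
        by (rule derivative_eq_intros refl | simp)+
      have e: "B * A ^ j * (real (Suc j) * \<tau> ^ j) / fact (Suc j) = ?b \<tau>"
        unfolding power_mult_distrib fact_Suc by (simp del: of_nat_Suc)
      show "((\<lambda>\<tau>. B * A ^ j * \<tau> ^ Suc j / fact (Suc j)) has_vector_derivative ?b \<tau>) (at \<tau> within {0..t})"
        using d unfolding e has_real_derivative_iff_has_vector_derivative .
    qed (use Suc.prems in simp)
    also have "\<Gamma> * C * (B * A ^ j * t ^ Suc j / fact (Suc j) - B * A ^ j * 0 ^ Suc j / fact (Suc j)) = B * ((A * t) ^ Suc j / fact (Suc j))"
    proof -
      have AC: "\<Gamma> * C = A" by (simp add: A_def)
      show ?thesis unfolding AC by (simp add: power_mult_distrib)
    qed
    finally show ?case .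
  qed (use B in simp)
  have "(\<lambda>j. B * ((A * t) ^ j / fact j)) \<longlonglongrightarrow> B * 0"
    using summable_LIMSEQ_zero[OF summable_exp[of "A * t"]] by (intro tendsto_mult tendsto_const) (simp add: divide_inverse mult.commute)
  then have "\<bar>vel (\<rho> t) t \<xi> x - vel (\<sigma> t) t \<xi> x\<bar> \<le> B * 0" by (rule LIMSEQ_le_const) (use j[OF t] in auto)
  then show ?thesis by simp
qed

text \<open>With equal velocities the transport estimate holds for \<beta> = 0. The indicator of a
  half-line times A is approached by functions piecewise linear in \<xi>, whose growing Lipschitz
  constants are multiplied by 0.\<close>

theorem curves_agree:
  assumes t: "t \<in> {0..T}" shows "\<rho> t = \<sigma> t"
proof (rule measure_eq_atMost_times[OF P2D(1,2)[OF S.\<rho>_P2[OF t]] P2D(2)[OF \<sigma>_P2[OF t]]])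
  fix c and A :: "'a set" assume A: "A \<in> sets borel"
  define \<psi> where "\<psi> m q = indicator A (snd q) * max 0 (min 1 (1 - real m * (fst q - c)))" for m :: nat and q
  have \<psi>m: "\<psi> m \<in> borel_measurable borel" for m unfolding \<psi>_def[abs_def] using A by measurable
  have e: "(\<integral>q. \<psi> m q \<partial>\<rho> t) = (\<integral>q. \<psi> m q \<partial>\<sigma> t)" for m
  proof -
    \<comment> \<open>For positive m the slope of \<open>\<psi> m\<close> lies over [c, c + 1],
      hence inside [-n, n], and clipping at n leaves the function unchanged.\<close>
    define n where "n = \<bar>c\<bar> + 1"
    have key: "\<bar>max 0 (min 1 (1 - real m * (a - c))) - max 0 (min 1 (1 - real m * (b - c)))\<bar> \<le> real m * \<bar>clip n a - clip n b\<bar>" for a b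
    proof -
      have cl: "max 0 (min 1 (1 - real m * (a - c))) = max 0 (min 1 (1 - real m * (clip n a - c)))" for a
      proof (cases "a \<le> - n \<or> a \<ge> n")
        case True
        show ?thesis
        proof (cases "m = 0")
          case False
          then have m: "real m \<ge> 1" by simp
          from True show ?thesis
          proof
            assume "a \<le> - n"
            then have "a - c \<le> 0" "clip n a - c \<le> 0" by (auto simp: n_def clip_def)
            then have "real m * (a - c) \<le> 0" "real m * (clip n a - c) \<le> 0" using m by (auto simp: mult_nonneg_nonpos)
            then show ?thesis by simp
          next
            assume "a \<ge> n"
            then have "a - c \<ge> 1" "clip n a - c \<ge> 1" by (auto simp: n_def clip_def)
            then have "real m * (a - c) \<ge> 1" "real m * (clip n a - c) \<ge> 1" using m mult_mono[of 1 "real m" 1] by auto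
            then show ?thesis by simp
          qed
        qed simp
      next
        case False
        then have "clip n a = a" by (auto simp: clip_def)
        then show ?thesis by simp
      qed
      have "\<bar>max 0 (min 1 (1 - real m * (a - c))) - max 0 (min 1 (1 - real m * (b - c)))\<bar> \<le> \<bar>real m * (clip n a - c) - real m * (clip n b - c)\<bar>"
      proof -
        have mm: "\<bar>max 0 (min 1 (1 - y)) - max 0 (min 1 (1 - z))\<bar> \<le> \<bar>y - z\<bar>" for y z :: real by (simp add: max_def min_def abs_minus_commute)
        show ?thesis by (subst cl, subst (2) cl, rule mm)
      qed
      also have "\<dots> = real m * \<bar>clip n a - clip n b\<bar>" by (simp add: abs_mult flip: right_diff_distrib)
      finally show ?thesis .
    qed
    interpret tt: transport_test \<mu> \<Psi> k C T \<nu> \<sigma> f K \<rho> t "\<psi> m" "\<lambda>_. real m" n "real m" 1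
    proof
      show "\<bar>\<psi> m (a, y) - \<psi> m (b, y)\<bar> \<le> real m * \<bar>clip n a - clip n b\<bar>" for a b y
      proof (cases "y \<in> A")
        case True
        then have "\<psi> m (a, y) - \<psi> m (b, y) = max 0 (min 1 (1 - real m * (a - c))) - max 0 (min 1 (1 - real m * (b - c)))"
          by (simp add: \<psi>_def)
        then show ?thesis using key[of a b] by (simp only:)
      qed (simp add: \<psi>_def)
      show "\<bar>\<psi> m q\<bar> \<le> 1" for q by (simp add: \<psi>_def split: split_indicator)
    qed (use t \<psi>m in \<open>auto simp: n_def\<close>)
    have "\<bar>(\<integral>q. \<psi> m q \<partial>\<rho> t) - (\<integral>q. \<psi> m q \<partial>\<sigma> t)\<bar> \<le> (LINT \<tau>:{0..t}|lborel. \<Gamma> * (\<integral>x. real m \<partial>\<mu>) * 0)"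
      by (rule tt.transport_estimate[where \<beta>="\<lambda>_. 0"]) (auto simp: velocities_agree)
    then show ?thesis by simp
  qed
  have lim: "(\<lambda>m. \<integral>q. \<psi> m q \<partial>N) \<longlonglongrightarrow> measure N ({..c} \<times> A)" if N: "N \<in> P2 \<mu>" for N
  proof -
    interpret prob_space N by (rule P2D[OF N])
    have S: "{..c} \<times> A \<in> sets N" using A P2D(2)[OF N] by (simp add: Times_in_borel)
    have "(\<lambda>m. \<integral>q. \<psi> m q \<partial>N) \<longlonglongrightarrow> (\<integral>q. indicator ({..c} \<times> A) q \<partial>N)"
    proof (rule integral_dominated_convergence[where w="\<lambda>_. 1"])
      show "AE q in N. (\<lambda>m. \<psi> m q) \<longlonglongrightarrow> indicator ({..c} \<times> A) q"
      proof (rule AE_I2)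
        fix q :: "real \<times> 'a"
        show "(\<lambda>m. \<psi> m q) \<longlonglongrightarrow> indicator ({..c} \<times> A) q"
        proof (cases "fst q \<le> c")
          case True
          then have "real m * (fst q - c) \<le> 0" for m by (simp add: mult_nonneg_nonpos)
          then have "\<psi> m q = indicator A (snd q)" for m by (simp add: \<psi>_def)
          then show ?thesis using True by (cases q) (simp add: indicator_def)
        next
          case False
          then obtain m0 where m0: "1 < real m0 * (fst q - c)" using reals_Archimedean3[of "fst q - c"] by auto
          have "eventually (\<lambda>m. \<psi> m q = 0) sequentially"
            using eventually_ge_at_top[of m0]
          proof eventually_elim
            case (elim m)
            have "real m0 * (fst q - c) \<le> real m * (fst q - c)" using elim False by (intro mult_right_mono) auto
            then show ?case using m0 by (simp add: \<psi>_def)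
          qed
          then show ?thesis using False by (cases q) (simp add: tendsto_eventually)
        qed
      qed
      show "AE q in N. norm (\<psi> m q) \<le> 1" for m by (intro AE_I2) (simp add: \<psi>_def split: split_indicator)
      show "\<psi> m \<in> borel_measurable N" for m by (rule P2D(9)[OF N \<psi>m])
    qed (use S in auto)
    then show ?thesis using S by simp
  qed
  have "measure (\<rho> t) ({..c} \<times> A) = measure (\<sigma> t) ({..c} \<times> A)"
    using lim[OF S.\<rho>_P2[OF t]] lim[OF \<sigma>_P2[OF t]] unfolding e by (rule LIMSEQ_unique)
  moreover have "prob_space (\<rho> t)" "prob_space (\<sigma> t)"
    by (rule P2D[OF S.\<rho>_P2[OF t]] P2D[OF \<sigma>_P2[OF t]])+
  ultimately show "emeasure (\<rho> t) ({..c} \<times> A) = emeasure (\<sigma> t) ({..c} \<times> A)"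
    by (simp add: finite_measure.emeasure_eq_measure prob_space.finite_measure)
qed

end

section \<open>The graph continuity equation\<close>

text \<open>The indefinite integral of the dominating function serves as a continuous real clock for
  the curve.\<close>

lemma ac_curve_modulus:
  assumes c: "ac_curve T X dst c" and sym: "\<And>s t. dst (c s) (c t) = dst (c t) (c s)"
  shows "\<exists>G :: real \<Rightarrow> real. continuous_on {0..T} G \<and> (\<forall>s\<in>{0..T}. \<forall>t\<in>{0..T}. dst (c s) (c t) \<le> \<bar>G s - G t\<bar>)"
proof -
  obtain m where m: "set_integrable lborel {0..T} m"
    and d: "\<And>s t. 0 \<le> s \<Longrightarrow> s \<le> t \<Longrightarrow> t \<le> T \<Longrightarrow> dst (c s) (c t) \<le> (LINT \<tau>:{s..t}|lborel. m \<tau>)"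
    using c unfolding ac_curve_def by blast
  define G where "G t = integral {0..t} m" for t
  have mi: "set_integrable lborel {0..t} m" if "t \<le> T" for t
    by (rule set_integrable_subset[OF m]) (use that in auto)
  have G: "G t = (LINT \<tau>:{0..t}|lborel. m \<tau>)" if "t \<le> T" for t
    using set_borel_integral_eq_integral(2)[OF mi[OF that]] by (simp add: G_def)
  have "continuous_on {0..T} G"
    unfolding G_def[abs_def] by (rule indefinite_integral_continuous_1[OF set_borel_integral_eq_integral(1)[OF m]])
  moreover have *: "dst (c s) (c t) \<le> \<bar>G s - G t\<bar>" if "0 \<le> s" "s \<le> t" "t \<le> T" for s t
    using d[OF that] set_integral_increment[OF mi[OF that(3)] that(1,2)] G[of s] G[of t] that by simp
  have "dst (c s) (c t) \<le> \<bar>G s - G t\<bar>" if "s \<in> {0..T}" "t \<in> {0..T}" for s t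
    using *[of s t] *[of t s] that sym[of s t] by (cases "s \<le> t") (auto simp: abs_minus_commute)
  ultimately show ?thesis by blast
qed

text \<open>A sequence bounded in mean square that tends to 0 pointwise tends to 0 weakly. Nothing
  dominates b, so w |b| is bounded by min (w |b|) (k w^2) + b^2 / k: the first part is dominated by
  k w^2, the second has integral at most c / k.\<close>

lemma weighted_convergence:
  fixes b :: "nat \<Rightarrow> 'b \<Rightarrow> real"
  assumes w: "w \<in> borel_measurable N" "integrable N (\<lambda>q. (w q)\<^sup>2)" "\<And>q. 0 \<le> w q"
    and b: "\<And>n. b n \<in> borel_measurable N" "\<And>n. integrable N (\<lambda>q. (b n q)\<^sup>2)" "\<And>n. (\<integral>q. (b n q)\<^sup>2 \<partial>N) \<le> c"
    and lim: "\<And>q. (\<lambda>n. b n q) \<longlonglongrightarrow> 0"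
  shows "(\<lambda>n. \<integral>q. w q * \<bar>b n q\<bar> \<partial>N) \<longlonglongrightarrow> 0"
proof (rule LIMSEQ_I)
  fix e :: real assume e: "e > 0"
  have c: "c \<ge> 0" using b(3)[of 0] by (meson Bochner_Integration.integral_nonneg order_trans zero_le_power2)
  \<comment> \<open>Makes the remainder c / k at most e / 2.\<close>
  define k where "k = (2 * c + 1) / e"
  have k: "k > 0" "c / k \<le> e / 2" using e c by (auto simp: k_def field_simps)
  note w(1)[measurable] b(1)[measurable]
  define m where "m n q = min (w q * \<bar>b n q\<bar>) (k * (w q)\<^sup>2)" for n q
  have mi: "integrable N (m n)" for n
    unfolding m_def
    by (rule Bochner_Integration.integrable_bound[OF integrable_mult_right[OF w(2), of k]]) (use w(3) k in \<open>auto simp: abs_mult\<close>)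
  have "(\<lambda>n. \<integral>q. m n q \<partial>N) \<longlonglongrightarrow> (\<integral>q. 0 \<partial>N)"
  proof (rule integral_dominated_convergence[where w="\<lambda>q. k * (w q)\<^sup>2"])
    show "integrable N (\<lambda>q. k * (w q)\<^sup>2)" using w(2) by simp
    show "AE q in N. norm (m n q) \<le> k * (w q)\<^sup>2" for n using w(3) k by (auto simp: m_def)
    show "AE q in N. (\<lambda>n. m n q) \<longlonglongrightarrow> 0"
    proof (rule AE_I2)
      fix q
      have "(\<lambda>n. min (w q * \<bar>b n q\<bar>) (k * (w q)\<^sup>2)) \<longlonglongrightarrow> min (w q * \<bar>0\<bar>) (k * (w q)\<^sup>2)" by (intro tendsto_intros lim)
      then show "(\<lambda>n. m n q) \<longlonglongrightarrow> 0" using k by (simp add: m_def min_def)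
    qed
  qed (use mi in auto)
  then have "(\<lambda>n. \<integral>q. m n q \<partial>N) \<longlonglongrightarrow> 0" by simp
  from LIMSEQ_D[OF this, of "e / 2"] e obtain n0 where n0: "\<And>n. n \<ge> n0 \<Longrightarrow> \<bar>\<integral>q. m n q \<partial>N\<bar> < e / 2" by auto
  show "\<exists>n0. \<forall>n\<ge>n0. norm ((\<integral>q. w q * \<bar>b n q\<bar> \<partial>N) - 0) < e"
  proof (intro exI allI impI)
    fix n assume n: "n \<ge> n0"
    have le: "w q * \<bar>b n q\<bar> \<le> m n q + (b n q)\<^sup>2 / k" for q
    proof (cases "\<bar>b n q\<bar> \<le> k * w q")
      case True
      have "w q * \<bar>b n q\<bar> \<le> w q * (k * w q)" using True w(3) by (rule mult_left_mono)
      then have "m n q = w q * \<bar>b n q\<bar>" by (simp add: m_def power2_eq_square mult_ac)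
      then show ?thesis using k by simp
    next
      case False
      then have "w q \<le> \<bar>b n q\<bar> / k" using k by (simp add: field_simps)
      then have "w q * \<bar>b n q\<bar> \<le> \<bar>b n q\<bar> / k * \<bar>b n q\<bar>" by (rule mult_right_mono) simp
      moreover have "0 \<le> m n q" using w(3) k by (simp add: m_def)
      ultimately show ?thesis by (simp add: power2_eq_square flip: abs_mult)
    qed
    have i: "integrable N (\<lambda>q. w q * \<bar>b n q\<bar>)"
      using Cauchy_Schwarz_integral(1)[of w N "\<lambda>q. \<bar>b n q\<bar>"] w b by simp
    have "(\<integral>q. w q * \<bar>b n q\<bar> \<partial>N) \<le> (\<integral>q. m n q + (b n q)\<^sup>2 / k \<partial>N)"
      by (rule integral_mono[OF i _ le]) (use mi b in auto)
    also have "\<dots> = (\<integral>q. m n q \<partial>N) + (\<integral>q. (b n q)\<^sup>2 \<partial>N) / k" using mi b by simp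
    also have "\<dots> < e / 2 + e / 2"
    proof -
      have "(\<integral>q. (b n q)\<^sup>2 \<partial>N) / k \<le> c / k" using b(3) k by (intro divide_right_mono) auto
      then show ?thesis using n0[OF n] k(2) by linarith
    qed
    finally have "(\<integral>q. w q * \<bar>b n q\<bar> \<partial>N) < e" by simp
    moreover have "0 \<le> (\<integral>q. w q * \<bar>b n q\<bar> \<partial>N)" using w(3) by (intro integral_nonneg_AE) auto
    ultimately show "norm ((\<integral>q. w q * \<bar>b n q\<bar> \<partial>N) - 0) < e" by simp
  qed
qed

section \<open>The kernel of the graph equation\<close>

locale graph_setting =
  fixes T :: real and \<mu> :: "'a::euclidean_space measure" and \<Phi> :: "real \<Rightarrow> real \<Rightarrow> real \<Rightarrow> real"
    and V :: "real \<Rightarrow> ('a \<Rightarrow> real) \<Rightarrow> 'a \<times> 'a \<Rightarrow> real"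
    and r :: "real \<Rightarrow> 'a \<Rightarrow> real" and \<eta> :: "real \<Rightarrow> 'a \<times> 'a \<Rightarrow> real" and C\<^sub>V L\<^sub>V :: real
  assumes T_pos: "T > 0"
    and prob_\<mu>: "prob_space \<mu>" and sets_\<mu>: "sets \<mu> = sets borel" and moment_\<mu>: "integrable \<mu> (\<lambda>x. (norm x)\<^sup>2)"
    and flux: "admissible_flux \<Phi>" and velocity: "velocity_field T \<mu> V"
    and V_cont: "\<forall>g\<in>L2 \<mu>. \<forall>p\<in>offdiag. continuous_on {0..T} (\<lambda>t. V t g p)"
    and C\<^sub>V_pos: "C\<^sub>V > 0" and L\<^sub>V_pos: "L\<^sub>V > 0"
    and V_bound: "(SUP t\<in>{0..T}. SUP g\<in>L2 \<mu>. SUP x. \<integral>\<^sup>+x'\<in>- {x}. ennreal (\<bar>V t g (x, x')\<bar>\<^sup>2) \<partial>\<mu>) \<le> ennreal C\<^sub>V"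
    and V_lip: "\<forall>t\<in>{0..T}. \<forall>g\<in>L2 \<mu>. \<forall>h\<in>L2 \<mu>.
           (SUP x. \<integral>\<^sup>+x'\<in>- {x}. ennreal (\<bar>V t g (x, x') - V t h (x, x')\<bar>\<^sup>2) \<partial>\<mu>)
             \<le> ennreal (L\<^sub>V * (L2_dist \<mu> g h)\<^sup>2)"
    and r_ac: "ac_curve T (L2 \<mu>) (L2_dist \<mu>) r" and \<eta>_ac: "ac_curve T Cb_offdiag Cb_dist \<eta>"
begin

lemma offdiag_borel: "(offdiag :: ('a \<times> 'a) set) \<in> sets borel"
proof -
  have "closed {p :: 'a \<times> 'a. fst p = snd p}" by (intro closed_Collect_eq continuous_intros)
  then have "open (- {p :: 'a \<times> 'a. fst p = snd p})" by (rule open_Compl)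
  moreover have "- {p :: 'a \<times> 'a. fst p = snd p} = offdiag" by (auto simp: offdiag_def)
  ultimately show ?thesis by (simp add: borel_open)
qed

lemma r_L2: "t \<in> {0..T} \<Longrightarrow> r t \<in> L2 \<mu>"
  using r_ac by (simp add: ac_curve_def)

lemma L2_dist_sym: "L2_dist \<mu> g h = L2_dist \<mu> h g"
  by (simp add: L2_dist_def power2_commute)

lemma L2_dist_nonneg: "0 \<le> L2_dist \<mu> g h"
  by (simp add: L2_dist_def)

lemma r_cont: "cont_curve T (L2 \<mu>) (L2_dist \<mu>) r"
proof -
  obtain G :: "real \<Rightarrow> real" where G: "continuous_on {0..T} G" "\<And>s t. s \<in> {0..T} \<Longrightarrow> t \<in> {0..T} \<Longrightarrow> L2_dist \<mu> (r s) (r t) \<le> \<bar>G s - G t\<bar>"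
    using ac_curve_modulus[OF r_ac L2_dist_sym] by blast
  show ?thesis
    unfolding cont_curve_def
  proof (intro conjI ballI r_L2)
    fix t assume t: "t \<in> {0..T}"
    have "((\<lambda>s. \<bar>G s - G t\<bar>) \<longlongrightarrow> \<bar>G t - G t\<bar>) (at t within {0..T})"
      using G(1) t by (intro tendsto_intros) (auto simp: continuous_on_def)
    then have z: "((\<lambda>s. \<bar>G s - G t\<bar>) \<longlongrightarrow> 0) (at t within {0..T})" by simp
    show "((\<lambda>s. L2_dist \<mu> (r s) (r t)) \<longlongrightarrow> 0) (at t within {0..T})"
      by (rule Lim_null_comparison[OF _ z]) (use G(2)[OF _ t] L2_dist_nonneg in \<open>auto simp: eventually_at_filter\<close>)
  qed
qed

lemma const_cont: "g \<in> L2 \<mu> \<Longrightarrow> cont_curve T (L2 \<mu>) (L2_dist \<mu>) (\<lambda>_. g)"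
  by (simp add: cont_curve_def L2_dist_def)

text \<open>The value 0 on the diagonal encodes the point removed from the integrals. The curve is a
  parameter because \<open>kernel_time_continuous\<close> compares r with a constant curve.\<close>

definition along :: "(real \<Rightarrow> 'a \<Rightarrow> real) \<Rightarrow> real \<Rightarrow> 'a \<Rightarrow> 'a \<Rightarrow> real" where
  "along \<rho> s x y = (if x = y then 0 else V (clamp T s) (\<rho> (clamp T s)) (x, y))"

definition weight :: "real \<Rightarrow> 'a \<Rightarrow> 'a \<Rightarrow> real" where
  "weight s x y = (if x = y then 0 else \<eta> (clamp T s) (x, y))"

lemma clamp_T: "clamp T s \<in> {0..T}"
  using clamp(1) T_pos by simp

lemma restricted_measurable:
  fixes F :: "real \<times> 'a \<times> 'a \<Rightarrow> real"
  assumes F: "F \<in> borel_measurable (restrict_space borel ({0..T} \<times> offdiag))"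
  shows "(\<lambda>(s, x, y). if x = y then 0 else F (clamp T s, x, y)) \<in> borel_measurable borel"
proof -
  have S: "{0..T} \<times> (offdiag :: ('a \<times> 'a) set) \<in> sets borel" by (intro Times_in_borel offdiag_borel) auto
  have "(\<lambda>w. indicator ({0..T} \<times> offdiag) w *\<^sub>R F w) \<in> borel_measurable borel"
    using borel_measurable_restrict_space_iff[of "{0..T} \<times> offdiag" borel F] F S by simp
  moreover have "(\<lambda>w::real \<times> 'a \<times> 'a. (clamp T (fst w), snd w)) \<in> borel_measurable borel"
    unfolding clamp_def by measurable
  ultimately have "(\<lambda>w. indicator ({0..T} \<times> offdiag) (clamp T (fst w), snd w) *\<^sub>R F (clamp T (fst w), snd w)) \<in> borel_measurable borel"
    by (rule measurable_compose[rotated])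
  also have "(\<lambda>w. indicator ({0..T} \<times> offdiag) (clamp T (fst w), snd w) *\<^sub>R F (clamp T (fst w), snd w)) =
      (\<lambda>(s, x, y). if x = y then 0 else F (clamp T s, x, y))"
    using clamp_T by (auto simp: fun_eq_iff offdiag_def indicator_def)
  finally show ?thesis .
qed

lemma along_measurable:
  assumes "cont_curve T (L2 \<mu>) (L2_dist \<mu>) \<rho>"
  shows "(\<lambda>(s, x, y). along \<rho> s x y) \<in> borel_measurable borel"
proof -
  have "(\<lambda>(t, p). V t (\<rho> t) p) \<in> borel_measurable (restrict_space borel ({0..T} \<times> offdiag))"
    using velocity assms by (auto simp: velocity_field_def measurable_along_curves_def)
  from restricted_measurable[OF this] show ?thesis by (simp add: along_def cong: if_cong)
qed

lemma along_section_measurable: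
  assumes "cont_curve T (L2 \<mu>) (L2_dist \<mu>) \<rho>"
  shows "along \<rho> s x \<in> borel_measurable borel"
  using measurable_compose[of "\<lambda>y. (s, x, y)" borel borel _ borel, OF _ along_measurable[OF assms]] by simp

lemma \<eta>_Cb: "t \<in> {0..T} \<Longrightarrow> \<eta> t \<in> Cb_offdiag"
  using \<eta>_ac by (simp add: ac_curve_def)

lemma Cb_dist_upper:
  assumes h: "h \<in> Cb_offdiag" "g \<in> Cb_offdiag" and p: "p \<in> offdiag"
  shows "\<bar>h p - g p\<bar> \<le> Cb_dist h g"
  unfolding Cb_dist_def
proof (rule cSUP_upper[OF p])
  obtain A B where "\<And>p. p \<in> offdiag \<Longrightarrow> \<bar>h p\<bar> \<le> A" "\<And>p. p \<in> offdiag \<Longrightarrow> \<bar>g p\<bar> \<le> B"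
    using h unfolding Cb_offdiag_def bounded_iff by fastforce
  then show "bdd_above ((\<lambda>p. \<bar>h p - g p\<bar>) ` offdiag)"
    by (intro bdd_aboveI2[where M="A + B"]) (metis abs_triangle_ineq4 add_mono order_trans)
qed

lemma \<eta>_modulus: "\<exists>G :: real \<Rightarrow> real. continuous_on {0..T} G \<and> (\<forall>s\<in>{0..T}. \<forall>t\<in>{0..T}. \<forall>p\<in>offdiag. \<bar>\<eta> s p - \<eta> t p\<bar> \<le> \<bar>G s - G t\<bar>)"
proof -
  have "Cb_dist (\<eta> s) (\<eta> t) = Cb_dist (\<eta> t) (\<eta> s)" for s t by (simp add: Cb_dist_def abs_minus_commute)
  from ac_curve_modulus[where c=\<eta> and dst=Cb_dist, OF \<eta>_ac this] show ?thesis
    using Cb_dist_upper[OF \<eta>_Cb \<eta>_Cb] order_trans by meson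
qed

lemma \<eta>_bounded: "\<exists>M>0. \<forall>t\<in>{0..T}. \<forall>p\<in>offdiag. \<bar>\<eta> t p\<bar> \<le> M"
proof -
  obtain G :: "real \<Rightarrow> real" where G: "continuous_on {0..T} G" "\<And>s t p. s \<in> {0..T} \<Longrightarrow> t \<in> {0..T} \<Longrightarrow> p \<in> offdiag \<Longrightarrow> \<bar>\<eta> s p - \<eta> t p\<bar> \<le> \<bar>G s - G t\<bar>"
    using \<eta>_modulus by blast
  have "bounded (G ` {0..T})" by (intro compact_imp_bounded compact_continuous_image G) auto
  then obtain B where "\<forall>y\<in>G ` {0..T}. norm y \<le> B" unfolding bounded_iff by blast
  then have B: "\<bar>G t\<bar> \<le> B" if "t \<in> {0..T}" for t using that by auto
  have 0: "0 \<in> {0..T}" using T_pos by simp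
  obtain A where A: "\<And>p. p \<in> offdiag \<Longrightarrow> \<bar>\<eta> 0 p\<bar> \<le> A"
    using \<eta>_Cb[OF 0] unfolding Cb_offdiag_def bounded_iff by fastforce
  have "\<bar>\<eta> t p\<bar> \<le> \<bar>A + 2 * B\<bar> + 1" if "t \<in> {0..T}" "p \<in> offdiag" for t p
    using G(2)[OF that(1) 0 that(2)] B[OF that(1)] B[OF 0] A[OF that(2)] by linarith
  then show ?thesis by (intro exI[of _ "\<bar>A + 2 * B\<bar> + 1"]) auto
qed

text \<open>The time modulus of \<open>\<eta>\<close> is uniform over the off-diagonal set, so
  continuity in time and in space combine to joint continuity.\<close>

lemma weight_measurable: "(\<lambda>(s, x, y). weight s x y) \<in> borel_measurable borel"
proof -
  obtain G :: "real \<Rightarrow> real" where G: "continuous_on {0..T} G" "\<And>s t p. s \<in> {0..T} \<Longrightarrow> t \<in> {0..T} \<Longrightarrow> p \<in> offdiag \<Longrightarrow> \<bar>\<eta> s p - \<eta> t p\<bar> \<le> \<bar>G s - G t\<bar>"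
    using \<eta>_modulus by blast
  have "continuous_on ({0..T} \<times> offdiag) (\<lambda>w. \<eta> (fst w) (snd w))"
    unfolding continuous_on_def
  proof
    fix w :: "real \<times> 'a \<times> 'a" assume w: "w \<in> {0..T} \<times> offdiag"
    then have w1: "fst w \<in> {0..T}" and w2: "snd w \<in> offdiag" by auto
    let ?F = "at w within {0..T} \<times> offdiag"
    have a: "((\<lambda>v. G (fst v)) \<longlongrightarrow> G (fst w)) ?F"
    proof -
      have "continuous_on ({0..T} \<times> offdiag) (\<lambda>v::real \<times> 'a \<times> 'a. G (fst v))"
        by (rule continuous_on_compose2[OF G(1)]) (auto intro!: continuous_intros)
      then show ?thesis using w unfolding continuous_on_def by blast
    qed
    have b: "((\<lambda>v. \<eta> (fst w) (snd v)) \<longlongrightarrow> \<eta> (fst w) (snd w)) ?F"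
    proof -
      have "continuous_on offdiag (\<eta> (fst w))" using \<eta>_Cb[OF w1] by (simp add: Cb_offdiag_def)
      then have "continuous_on ({0..T} \<times> offdiag) (\<lambda>v::real \<times> 'a \<times> 'a. \<eta> (fst w) (snd v))"
        by (rule continuous_on_compose2) (auto intro!: continuous_intros)
      then show ?thesis using w unfolding continuous_on_def by blast
    qed
    have "((\<lambda>v. \<bar>G (fst v) - G (fst w)\<bar> + \<bar>\<eta> (fst w) (snd v) - \<eta> (fst w) (snd w)\<bar>) \<longlongrightarrow>
        \<bar>G (fst w) - G (fst w)\<bar> + \<bar>\<eta> (fst w) (snd w) - \<eta> (fst w) (snd w)\<bar>) ?F" by (intro tendsto_intros a b)
    then have z: "((\<lambda>v. \<bar>G (fst v) - G (fst w)\<bar> + \<bar>\<eta> (fst w) (snd v) - \<eta> (fst w) (snd w)\<bar>) \<longlongrightarrow> 0) ?F" by simp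
    have "((\<lambda>v. \<eta> (fst v) (snd v) - \<eta> (fst w) (snd w)) \<longlongrightarrow> 0) ?F"
    proof (rule Lim_null_comparison[OF _ z])
      have "norm (\<eta> (fst v) (snd v) - \<eta> (fst w) (snd w)) \<le> \<bar>G (fst v) - G (fst w)\<bar> + \<bar>\<eta> (fst w) (snd v) - \<eta> (fst w) (snd w)\<bar>"
        if "v \<in> {0..T} \<times> offdiag" for v
        using G(2)[of "fst v" "fst w" "snd v"] that w1 by auto
      then show "eventually (\<lambda>v. norm (\<eta> (fst v) (snd v) - \<eta> (fst w) (snd w)) \<le> \<bar>G (fst v) - G (fst w)\<bar> + \<bar>\<eta> (fst w) (snd v) - \<eta> (fst w) (snd w)\<bar>) ?F"
        by (auto simp: eventually_at_filter)
    qed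
    then show "((\<lambda>w. \<eta> (fst w) (snd w)) \<longlongrightarrow> \<eta> (fst w) (snd w)) ?F" by (simp add: LIM_zero_iff)
  qed
  then have "(\<lambda>w. \<eta> (fst w) (snd w)) \<in> borel_measurable (restrict_space borel ({0..T} \<times> offdiag))"
    by (rule borel_measurable_continuous_on_restrict)
  from restricted_measurable[OF this] show ?thesis by (simp add: weight_def cong: if_cong)
qed

lemma along_bound:
  assumes \<rho>: "cont_curve T (L2 \<mu>) (L2_dist \<mu>) \<rho>"
  shows "(\<integral>\<^sup>+y. ennreal ((along \<rho> s x y)\<^sup>2) \<partial>\<mu>) \<le> ennreal C\<^sub>V"
proof -
  have \<rho>L: "\<rho> (clamp T s) \<in> L2 \<mu>" using \<rho> clamp_T by (simp add: cont_curve_def)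
  have "(\<integral>\<^sup>+y. ennreal ((along \<rho> s x y)\<^sup>2) \<partial>\<mu>) = (\<integral>\<^sup>+x'\<in>- {x}. ennreal (\<bar>V (clamp T s) (\<rho> (clamp T s)) (x, x')\<bar>\<^sup>2) \<partial>\<mu>)"
    by (intro nn_integral_cong) (auto simp: along_def indicator_def)
  also have "\<dots> \<le> (SUP x. \<integral>\<^sup>+x'\<in>- {x}. ennreal (\<bar>V (clamp T s) (\<rho> (clamp T s)) (x, x')\<bar>\<^sup>2) \<partial>\<mu>)"
    by (rule SUP_upper) simp
  also have "\<dots> \<le> (SUP g\<in>L2 \<mu>. SUP x. \<integral>\<^sup>+x'\<in>- {x}. ennreal (\<bar>V (clamp T s) g (x, x')\<bar>\<^sup>2) \<partial>\<mu>)"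
    by (rule SUP_upper[OF \<rho>L])
  also have "\<dots> \<le> (SUP t\<in>{0..T}. SUP g\<in>L2 \<mu>. SUP x. \<integral>\<^sup>+x'\<in>- {x}. ennreal (\<bar>V t g (x, x')\<bar>\<^sup>2) \<partial>\<mu>)"
    by (rule SUP_upper[OF clamp_T])
  also note V_bound
  finally show ?thesis .
qed

lemma along_diff:
  assumes \<rho>: "cont_curve T (L2 \<mu>) (L2_dist \<mu>) \<rho>" "cont_curve T (L2 \<mu>) (L2_dist \<mu>) \<rho>'"
  shows "(\<integral>\<^sup>+y. ennreal ((along \<rho> s x y - along \<rho>' s x y)\<^sup>2) \<partial>\<mu>) \<le> ennreal (L\<^sub>V * (L2_dist \<mu> (\<rho> (clamp T s)) (\<rho>' (clamp T s)))\<^sup>2)"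
proof -
  have \<rho>L: "\<rho> (clamp T s) \<in> L2 \<mu>" "\<rho>' (clamp T s) \<in> L2 \<mu>" using \<rho> clamp_T by (auto simp: cont_curve_def)
  have "(\<integral>\<^sup>+y. ennreal ((along \<rho> s x y - along \<rho>' s x y)\<^sup>2) \<partial>\<mu>) =
      (\<integral>\<^sup>+x'\<in>- {x}. ennreal (\<bar>V (clamp T s) (\<rho> (clamp T s)) (x, x') - V (clamp T s) (\<rho>' (clamp T s)) (x, x')\<bar>\<^sup>2) \<partial>\<mu>)"
    by (intro nn_integral_cong) (auto simp: along_def indicator_def)
  also have "\<dots> \<le> (SUP x. \<integral>\<^sup>+x'\<in>- {x}. ennreal (\<bar>V (clamp T s) (\<rho> (clamp T s)) (x, x') - V (clamp T s) (\<rho>' (clamp T s)) (x, x')\<bar>\<^sup>2) \<partial>\<mu>)"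
    by (rule SUP_upper) simp
  also have "\<dots> \<le> ennreal (L\<^sub>V * (L2_dist \<mu> (\<rho> (clamp T s)) (\<rho>' (clamp T s)))\<^sup>2)"
    using V_lip clamp_T \<rho>L by blast
  finally show ?thesis .
qed

lemma nn_to_integral:
  fixes h :: "'a \<Rightarrow> real"
  assumes h: "h \<in> borel_measurable borel" and b: "(\<integral>\<^sup>+y. ennreal ((h y)\<^sup>2) \<partial>\<mu>) \<le> ennreal c" and c: "c \<ge> 0" and N: "N \<in> P2 \<mu>"
  shows "integrable N (\<lambda>q. (h (snd q))\<^sup>2)" "(\<integral>q. (h (snd q))\<^sup>2 \<partial>N) \<le> c"
proof -
  have hm: "(\<lambda>y. (h y)\<^sup>2) \<in> borel_measurable borel" using h by measurable
  have i: "integrable \<mu> (\<lambda>y. (h y)\<^sup>2)"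
    by (rule integrableI_bounded) (use hm sets_\<mu> b in \<open>auto cong: measurable_cong_sets intro: le_less_trans\<close>)
  then show "integrable N (\<lambda>q. (h (snd q))\<^sup>2)" using P2_integral_snd(2)[OF N hm] by simp
  have "(\<integral>y. (h y)\<^sup>2 \<partial>\<mu>) \<le> c" using b c i by (simp add: nn_integral_eq_integral)
  then show "(\<integral>q. (h (snd q))\<^sup>2 \<partial>N) \<le> c" using P2_integral_snd(1)[OF N hm] by simp
qed

definition flux_const :: real where
  "flux_const = (SOME L. L > 0 \<and> (\<forall>a b c d v w.
        \<bar>\<Phi> a b w - \<Phi> a b v\<bar> \<le> L * (\<bar>a\<bar> + \<bar>b\<bar>) * \<bar>w - v\<bar> \<and>
        \<bar>\<Phi> a b v - \<Phi> c d v\<bar> \<le> L * (\<bar>a - c\<bar> + \<bar>b - d\<bar>) * \<bar>v\<bar>))"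

lemma flux_facts:
  "flux_const > 0" "\<bar>\<Phi> a b w - \<Phi> a b v\<bar> \<le> flux_const * (\<bar>a\<bar> + \<bar>b\<bar>) * \<bar>w - v\<bar>"
  "\<bar>\<Phi> a b v - \<Phi> c d v\<bar> \<le> flux_const * (\<bar>a - c\<bar> + \<bar>b - d\<bar>) * \<bar>v\<bar>"
  "\<Phi> 0 0 v = 0" "\<Phi> a b 0 = 0" "(\<lambda>(a, b, v). \<Phi> a b v) \<in> borel_measurable borel"
proof -
  have ex: "\<exists>L. L > 0 \<and> (\<forall>a b c d v w.
        \<bar>\<Phi> a b w - \<Phi> a b v\<bar> \<le> L * (\<bar>a\<bar> + \<bar>b\<bar>) * \<bar>w - v\<bar> \<and>
        \<bar>\<Phi> a b v - \<Phi> c d v\<bar> \<le> L * (\<bar>a - c\<bar> + \<bar>b - d\<bar>) * \<bar>v\<bar>)"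
    using flux unfolding admissible_flux_def by blast
  note L = someI_ex[OF ex, folded flux_const_def]
  show "flux_const > 0" "\<bar>\<Phi> a b w - \<Phi> a b v\<bar> \<le> flux_const * (\<bar>a\<bar> + \<bar>b\<bar>) * \<bar>w - v\<bar>"
    "\<bar>\<Phi> a b v - \<Phi> c d v\<bar> \<le> flux_const * (\<bar>a - c\<bar> + \<bar>b - d\<bar>) * \<bar>v\<bar>" using L by blast+
  show "\<Phi> 0 0 v = 0" "\<Phi> a b 0 = 0" "(\<lambda>(a, b, v). \<Phi> a b v) \<in> borel_measurable borel"
    using flux unfolding admissible_flux_def by blast+
qed

definition weight_sup :: real where
  "weight_sup = (SOME M. M > 0 \<and> (\<forall>t\<in>{0..T}. \<forall>p\<in>offdiag. \<bar>\<eta> t p\<bar> \<le> M))"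

lemma weight_sup: "weight_sup > 0" "\<bar>weight s x y\<bar> \<le> weight_sup"
proof -
  note M = someI_ex[OF \<eta>_bounded, folded weight_sup_def]
  then show "weight_sup > 0" by blast
  show "\<bar>weight s x y\<bar> \<le> weight_sup"
    using M clamp_T[of s] by (auto simp: weight_def offdiag_def)
qed

definition kernel :: "real \<Rightarrow> real \<Rightarrow> real \<Rightarrow> 'a \<Rightarrow> 'a \<Rightarrow> real" where
  "kernel t a b x y = \<Phi> a b (along r t x y) * weight t x y"

definition kernel_lip :: "real \<Rightarrow> 'a \<Rightarrow> 'a \<Rightarrow> real" where
  "kernel_lip t x y = flux_const * weight_sup * \<bar>along r t x y\<bar>"

lemma kernel_section_measurable:
  assumes N: "N \<in> P2 \<mu>" shows "(\<lambda>q. kernel t \<xi> (fst q) x (snd q)) \<in> borel_measurable N"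
proof -
  have "(\<lambda>q. (\<xi>, fst q, along r t x (snd q))) \<in> borel_measurable (borel :: (real \<times> 'a) measure)"
    by (intro borel_measurable_Pair borel_measurable_const fst_borel measurable_compose[OF snd_borel along_section_measurable[OF r_cont]])
  from measurable_compose[OF this flux_facts(6)] have "(\<lambda>q. \<Phi> \<xi> (fst q) (along r t x (snd q))) \<in> borel_measurable (borel :: (real \<times> 'a) measure)" by simp
  moreover have "(\<lambda>q. weight t x (snd q)) \<in> borel_measurable (borel :: (real \<times> 'a) measure)"
  proof -
    have "(\<lambda>q. (t, x, snd q)) \<in> borel_measurable (borel :: (real \<times> 'a) measure)"
      by (intro borel_measurable_Pair borel_measurable_const snd_borel)
    from measurable_compose[OF this weight_measurable] show ?thesis by simp
  qed
  ultimately show ?thesis unfolding kernel_def by (intro P2D(9)[OF N] borel_measurable_times)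
qed

lemma kernel_time_continuous:
  assumes N: "N \<in> P2 \<mu>"
  shows "continuous_on UNIV (\<lambda>t. \<integral>q. kernel t \<xi> (fst q) x (snd q) \<partial>N)"
proof -
  interpret N: prob_space N by (rule P2D[OF N])
  obtain G :: "real \<Rightarrow> real" where G: "continuous_on {0..T} G" "\<And>s t p. s \<in> {0..T} \<Longrightarrow> t \<in> {0..T} \<Longrightarrow> p \<in> offdiag \<Longrightarrow> \<bar>\<eta> s p - \<eta> t p\<bar> \<le> \<bar>G s - G t\<bar>"
    using \<eta>_modulus by blast
  define w where "w q = \<bar>\<xi>\<bar> + \<bar>fst q\<bar>" for q :: "real \<times> 'a"
  have wm: "w \<in> borel_measurable N" unfolding w_def[abs_def] by (rule P2D(9)[OF N]) measurable
  have wi: "integrable N (\<lambda>q. (w q)\<^sup>2)"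
  proof -
    have "integrable N (\<lambda>q. \<xi>\<^sup>2 + (fst q)\<^sup>2 + 2 * \<bar>\<xi>\<bar> * \<bar>fst q\<bar>)" using P2D[OF N] by auto
    then show ?thesis by (simp add: w_def power2_sum)
  qed
  have w0: "0 \<le> w q" for q by (simp add: w_def)
  have um: "(\<lambda>q. along \<rho> s x (snd q)) \<in> borel_measurable N" if "cont_curve T (L2 \<mu>) (L2_dist \<mu>) \<rho>" for \<rho> s
    by (rule P2D(9)[OF N measurable_compose[OF snd_borel along_section_measurable[OF that]]])
  have ui: "integrable N (\<lambda>q. (along \<rho> s x (snd q))\<^sup>2)" "(\<integral>q. (along \<rho> s x (snd q))\<^sup>2 \<partial>N) \<le> C\<^sub>V" if "cont_curve T (L2 \<mu>) (L2_dist \<mu>) \<rho>" for \<rho> s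
    using nn_to_integral[OF along_section_measurable[OF that] along_bound[OF that] _ N] C\<^sub>V_pos by auto
  have ki: "integrable N (\<lambda>q. kernel t \<xi> (fst q) x (snd q))" for t
  proof (rule Bochner_Integration.integrable_bound[OF _ kernel_section_measurable[OF N]])
    show "integrable N (\<lambda>q. flux_const * weight_sup * (w q * along r t x (snd q)))"
      using Cauchy_Schwarz_integral(1)[OF wm um[OF r_cont] wi ui(1)[OF r_cont]] by auto
    have "\<bar>kernel t \<xi> (fst q) x (snd q)\<bar> \<le> (flux_const * w q * \<bar>along r t x (snd q)\<bar>) * weight_sup" for q
      unfolding kernel_def abs_mult
      using flux_facts(3)[of \<xi> "fst q" "along r t x (snd q)" 0 0] flux_facts(1,4) weight_sup
      by (intro mult_mono) (auto simp: w_def)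
    then show "AE q in N. norm (kernel t \<xi> (fst q) x (snd q)) \<le> norm (flux_const * weight_sup * (w q * along r t x (snd q)))"
      using w0 flux_facts(1) weight_sup(1) by (auto simp: abs_mult mult_ac)
  qed
  have c: "continuous_on {0..T} (\<lambda>t. \<integral>q. kernel t \<xi> (fst q) x (snd q) \<partial>N)"
    unfolding continuous_on_sequentially comp_def
  proof (intro allI ballI impI, elim conjE)
    fix s :: "nat \<Rightarrow> real" and t assume t: "t \<in> {0..T}" and "\<forall>n. s n \<in> {0..T}" and st: "s \<longlonglongrightarrow> t"
    then have s: "s n \<in> {0..T}" for n by blast
    \<comment> \<open>The constant curve frozen at \<open>r t\<close>, along which V varies through
      explicit time alone.\<close>
    define g where "g = (\<lambda>_::real. r t)"
    have gc: "cont_curve T (L2 \<mu>) (L2_dist \<mu>) g" unfolding g_def by (rule const_cont[OF r_L2[OF t]])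
    have gt: "along g t x y = along r t x y" for y by (simp add: along_def g_def clamp(2)[OF t])
    define a where "a n q = along r (s n) x (snd q) - along g (s n) x (snd q)" for n and q :: "real \<times> 'a"
    define b where "b n q = along g (s n) x (snd q) - along g t x (snd q)" for n and q :: "real \<times> 'a"
    have am: "a n \<in> borel_measurable N" and bm: "b n \<in> borel_measurable N" for n
      unfolding a_def[abs_def] b_def[abs_def] using um[OF r_cont] um[OF gc] by auto
    have aI: "integrable N (\<lambda>q. (a n q)\<^sup>2)" "(\<integral>q. (a n q)\<^sup>2 \<partial>N) \<le> L\<^sub>V * (L2_dist \<mu> (r (s n)) (r t))\<^sup>2" for n
    proof -
      have m: "(\<lambda>y. along r (s n) x y - along g (s n) x y) \<in> borel_measurable borel"
        using along_section_measurable[OF r_cont] along_section_measurable[OF gc] by measurable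
      have "(\<integral>\<^sup>+y. ennreal ((along r (s n) x y - along g (s n) x y)\<^sup>2) \<partial>\<mu>) \<le> ennreal (L\<^sub>V * (L2_dist \<mu> (r (s n)) (r t))\<^sup>2)"
        using along_diff[OF r_cont gc, of "s n" x] clamp(2)[OF s] by (simp add: g_def)
      from nn_to_integral[OF m this _ N] show "integrable N (\<lambda>q. (a n q)\<^sup>2)" "(\<integral>q. (a n q)\<^sup>2 \<partial>N) \<le> L\<^sub>V * (L2_dist \<mu> (r (s n)) (r t))\<^sup>2"
        using L\<^sub>V_pos by (auto simp: a_def)
    qed
    have bI: "integrable N (\<lambda>q. (b n q)\<^sup>2)" "(\<integral>q. (b n q)\<^sup>2 \<partial>N) \<le> 4 * C\<^sub>V" for n
    proof -
      have le: "(b n q)\<^sup>2 \<le> 2 * (along g (s n) x (snd q))\<^sup>2 + 2 * (along g t x (snd q))\<^sup>2" for q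
        using zero_le_power2[of "along g (s n) x (snd q) + along g t x (snd q)"]
        by (simp add: b_def power2_eq_square algebra_simps)
      have i: "integrable N (\<lambda>q. 2 * (along g (s n) x (snd q))\<^sup>2 + 2 * (along g t x (snd q))\<^sup>2)" using ui(1)[OF gc] by auto
      show i2: "integrable N (\<lambda>q. (b n q)\<^sup>2)"
      proof (rule Bochner_Integration.integrable_bound[OF i])
        show "(\<lambda>q. (b n q)\<^sup>2) \<in> borel_measurable N" using bm by measurable
        show "AE q in N. norm ((b n q)\<^sup>2) \<le> norm (2 * (along g (s n) x (snd q))\<^sup>2 + 2 * (along g t x (snd q))\<^sup>2)"
          using le by (intro AE_I2) (simp add: abs_of_nonneg)
      qed
      have "(\<integral>q. (b n q)\<^sup>2 \<partial>N) \<le> (\<integral>q. 2 * (along g (s n) x (snd q))\<^sup>2 + 2 * (along g t x (snd q))\<^sup>2 \<partial>N)"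
        by (rule integral_mono[OF i2 i le])
      also have "\<dots> \<le> 4 * C\<^sub>V" using ui[OF gc, of "s n"] ui[OF gc, of t] by simp
      finally show "(\<integral>q. (b n q)\<^sup>2 \<partial>N) \<le> 4 * C\<^sub>V" .
    qed
    have L0: "(\<lambda>n. L2_dist \<mu> (r (s n)) (r t)) \<longlonglongrightarrow> 0"
    proof -
      obtain Gr :: "real \<Rightarrow> real" where Gr: "continuous_on {0..T} Gr" "\<And>s t. s \<in> {0..T} \<Longrightarrow> t \<in> {0..T} \<Longrightarrow> L2_dist \<mu> (r s) (r t) \<le> \<bar>Gr s - Gr t\<bar>"
        using ac_curve_modulus[OF r_ac L2_dist_sym] by blast
      have "(\<lambda>n. Gr (s n)) \<longlonglongrightarrow> Gr t"
        using Gr(1) s t st unfolding continuous_on_sequentially comp_def by blast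
      then have "(\<lambda>n. \<bar>Gr (s n) - Gr t\<bar>) \<longlonglongrightarrow> \<bar>Gr t - Gr t\<bar>" by (intro tendsto_intros)
      then have z: "(\<lambda>n. \<bar>Gr (s n) - Gr t\<bar>) \<longlonglongrightarrow> 0" by simp
      show ?thesis by (rule Lim_null_comparison[OF _ z]) (use Gr(2)[OF s t] L2_dist_nonneg in auto)
    qed
    have e0: "(\<lambda>n. \<bar>G (s n) - G t\<bar>) \<longlonglongrightarrow> 0"
    proof -
      have "(\<lambda>n. G (s n)) \<longlonglongrightarrow> G t"
        using G(1) s t st unfolding continuous_on_sequentially comp_def by blast
      then have "(\<lambda>n. \<bar>G (s n) - G t\<bar>) \<longlonglongrightarrow> \<bar>G t - G t\<bar>" by (intro tendsto_intros)
      then show ?thesis by simp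
    qed
    have A0: "(\<lambda>n. \<integral>q. w q * \<bar>a n q\<bar> \<partial>N) \<longlonglongrightarrow> 0"
    proof (rule Lim_null_comparison)
      have "norm (\<integral>q. w q * \<bar>a n q\<bar> \<partial>N) \<le> sqrt (\<integral>q. (w q)\<^sup>2 \<partial>N) * (sqrt L\<^sub>V * L2_dist \<mu> (r (s n)) (r t))" for n
      proof -
        have "(\<integral>q. w q * \<bar>a n q\<bar> \<partial>N) = (\<integral>q. \<bar>w q * a n q\<bar> \<partial>N)" using w0 by (simp add: abs_mult)
        also have "\<dots> \<le> sqrt (\<integral>q. (w q)\<^sup>2 \<partial>N) * sqrt (\<integral>q. (a n q)\<^sup>2 \<partial>N)"
          by (rule Cauchy_Schwarz_integral(2)[OF wm am wi aI(1)])
        also have "\<dots> \<le> sqrt (\<integral>q. (w q)\<^sup>2 \<partial>N) * sqrt (L\<^sub>V * (L2_dist \<mu> (r (s n)) (r t))\<^sup>2)"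
          using aI(2) by (intro mult_left_mono) (auto intro!: integral_nonneg_AE)
        also have "sqrt (L\<^sub>V * (L2_dist \<mu> (r (s n)) (r t))\<^sup>2) = sqrt L\<^sub>V * L2_dist \<mu> (r (s n)) (r t)"
          using L2_dist_nonneg by (simp add: real_sqrt_mult)
        moreover have "0 \<le> (\<integral>q. w q * \<bar>a n q\<bar> \<partial>N)" using w0 by (intro integral_nonneg_AE) auto
        ultimately show ?thesis by simp
      qed
      then show "eventually (\<lambda>n. norm (\<integral>q. w q * \<bar>a n q\<bar> \<partial>N) \<le> sqrt (\<integral>q. (w q)\<^sup>2 \<partial>N) * (sqrt L\<^sub>V * L2_dist \<mu> (r (s n)) (r t))) sequentially" by simp
      have "(\<lambda>n. sqrt (\<integral>q. (w q)\<^sup>2 \<partial>N) * (sqrt L\<^sub>V * L2_dist \<mu> (r (s n)) (r t))) \<longlonglongrightarrow> sqrt (\<integral>q. (w q)\<^sup>2 \<partial>N) * (sqrt L\<^sub>V * 0)" by (intro tendsto_intros L0)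
      then show "(\<lambda>n. sqrt (\<integral>q. (w q)\<^sup>2 \<partial>N) * (sqrt L\<^sub>V * L2_dist \<mu> (r (s n)) (r t))) \<longlonglongrightarrow> 0" by simp
    qed
    have B0: "(\<lambda>n. \<integral>q. w q * \<bar>b n q\<bar> \<partial>N) \<longlonglongrightarrow> 0"
    proof (rule weighted_convergence[OF wm wi w0 bm bI])
      fix q :: "real \<times> 'a"
      show "(\<lambda>n. b n q) \<longlonglongrightarrow> 0"
      proof (cases "x = snd q")
        case False
        then have "continuous_on {0..T} (\<lambda>t'. V t' (r t) (x, snd q))" using V_cont r_L2[OF t] by (auto simp: offdiag_def)
        then have "(\<lambda>n. V (s n) (r t) (x, snd q)) \<longlonglongrightarrow> V t (r t) (x, snd q)"
          using s t st unfolding continuous_on_sequentially comp_def by blast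
        then show ?thesis using False clamp(2)[OF s] clamp(2)[OF t] by (simp add: b_def along_def g_def LIM_zero_iff)
      qed (simp add: b_def along_def)
    qed
    define c where "c = (\<integral>q. w q * \<bar>along r t x (snd q)\<bar> \<partial>N)"
    have ci: "integrable N (\<lambda>q. w q * \<bar>along r t x (snd q)\<bar>)"
      using Cauchy_Schwarz_integral(1)[of w N "\<lambda>q. \<bar>along r t x (snd q)\<bar>"] wm wi um[OF r_cont] ui(1)[OF r_cont] by simp
    have wa: "integrable N (\<lambda>q. w q * \<bar>a n q\<bar>)" and wb: "integrable N (\<lambda>q. w q * \<bar>b n q\<bar>)" for n
      using Cauchy_Schwarz_integral(1)[of w N "\<lambda>q. \<bar>a n q\<bar>"] Cauchy_Schwarz_integral(1)[of w N "\<lambda>q. \<bar>b n q\<bar>"] wm wi am bm aI(1) bI(1) by simp_all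
    have est: "\<bar>(\<integral>q. kernel (s n) \<xi> (fst q) x (snd q) \<partial>N) - (\<integral>q. kernel t \<xi> (fst q) x (snd q) \<partial>N)\<bar> \<le>
       flux_const * weight_sup * ((\<integral>q. w q * \<bar>a n q\<bar> \<partial>N) + (\<integral>q. w q * \<bar>b n q\<bar> \<partial>N)) + flux_const * c * \<bar>G (s n) - G t\<bar>" for n
    proof -
      let ?B = "\<lambda>q. flux_const * weight_sup * (w q * \<bar>a n q\<bar> + w q * \<bar>b n q\<bar>) + flux_const * \<bar>G (s n) - G t\<bar> * (w q * \<bar>along r t x (snd q)\<bar>)"
      have pw: "\<bar>kernel (s n) \<xi> (fst q) x (snd q) - kernel t \<xi> (fst q) x (snd q)\<bar> \<le> ?B q" for q
      proof -
        let ?u = "along r (s n) x (snd q)" and ?v = "along r t x (snd q)"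
        have tri: "\<bar>a * w - b * z\<bar> \<le> \<bar>a - b\<bar> * \<bar>w\<bar> + \<bar>b\<bar> * \<bar>w - z\<bar>" for a b w z :: real
        proof -
          have "a * w - b * z = (a - b) * w + b * (w - z)" by algebra
          then show ?thesis using abs_triangle_ineq[of "(a - b) * w" "b * (w - z)"] by (simp add: abs_mult)
        qed
        have "\<bar>kernel (s n) \<xi> (fst q) x (snd q) - kernel t \<xi> (fst q) x (snd q)\<bar> \<le>
            \<bar>\<Phi> \<xi> (fst q) ?u - \<Phi> \<xi> (fst q) ?v\<bar> * \<bar>weight (s n) x (snd q)\<bar> + \<bar>\<Phi> \<xi> (fst q) ?v\<bar> * \<bar>weight (s n) x (snd q) - weight t x (snd q)\<bar>"
          unfolding kernel_def by (rule tri)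
        also have "\<dots> \<le> (flux_const * w q * (\<bar>a n q\<bar> + \<bar>b n q\<bar>)) * weight_sup + (flux_const * w q * \<bar>?v\<bar>) * \<bar>G (s n) - G t\<bar>"
        proof (intro add_mono mult_mono)
          have "?u - ?v = a n q + b n q" by (simp add: a_def b_def gt)
          then have "\<bar>?u - ?v\<bar> \<le> \<bar>a n q\<bar> + \<bar>b n q\<bar>" by simp
          then have "flux_const * w q * \<bar>?u - ?v\<bar> \<le> flux_const * w q * (\<bar>a n q\<bar> + \<bar>b n q\<bar>)"
            using flux_facts(1) w0 by (intro mult_left_mono) auto
          then show "\<bar>\<Phi> \<xi> (fst q) ?u - \<Phi> \<xi> (fst q) ?v\<bar> \<le> flux_const * w q * (\<bar>a n q\<bar> + \<bar>b n q\<bar>)"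
            using flux_facts(2)[of \<xi> "fst q" ?u ?v] by (simp add: w_def)
          show "\<bar>weight (s n) x (snd q)\<bar> \<le> weight_sup" by (rule weight_sup)
          show "\<bar>\<Phi> \<xi> (fst q) ?v\<bar> \<le> flux_const * w q * \<bar>?v\<bar>"
            using flux_facts(3)[of \<xi> "fst q" ?v 0 0] flux_facts(4) by (simp add: w_def)
          show "\<bar>weight (s n) x (snd q) - weight t x (snd q)\<bar> \<le> \<bar>G (s n) - G t\<bar>"
            using G(2)[OF s t, of "(x, snd q)"] clamp(2)[OF s] clamp(2)[OF t] by (simp add: weight_def offdiag_def)
        qed (use flux_facts(1) w0 in auto)
        finally show ?thesis by (simp add: algebra_simps)
      qed
      have Bi: "integrable N ?B" using wa wb ci by auto
      have "\<bar>(\<integral>q. kernel (s n) \<xi> (fst q) x (snd q) \<partial>N) - (\<integral>q. kernel t \<xi> (fst q) x (snd q) \<partial>N)\<bar> =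
         \<bar>\<integral>q. kernel (s n) \<xi> (fst q) x (snd q) - kernel t \<xi> (fst q) x (snd q) \<partial>N\<bar>" using ki by simp
      also have "\<dots> \<le> (\<integral>q. \<bar>kernel (s n) \<xi> (fst q) x (snd q) - kernel t \<xi> (fst q) x (snd q)\<bar> \<partial>N)" by (rule integral_abs_bound)
      also have "\<dots> \<le> (\<integral>q. ?B q \<partial>N)" by (rule integral_mono[OF _ Bi pw]) (use ki in auto)
      also have "\<dots> = flux_const * weight_sup * ((\<integral>q. w q * \<bar>a n q\<bar> \<partial>N) + (\<integral>q. w q * \<bar>b n q\<bar> \<partial>N)) + flux_const * \<bar>G (s n) - G t\<bar> * c"
        using wa wb ci by (simp add: c_def)
      finally show ?thesis by (simp add: mult_ac)
    qed
    have "(\<lambda>n. flux_const * weight_sup * ((\<integral>q. w q * \<bar>a n q\<bar> \<partial>N) + (\<integral>q. w q * \<bar>b n q\<bar> \<partial>N)) + flux_const * c * \<bar>G (s n) - G t\<bar>)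
       \<longlonglongrightarrow> flux_const * weight_sup * (0 + 0) + flux_const * c * 0"
      by (intro tendsto_intros A0 B0 e0)
    then have z: "(\<lambda>n. flux_const * weight_sup * ((\<integral>q. w q * \<bar>a n q\<bar> \<partial>N) + (\<integral>q. w q * \<bar>b n q\<bar> \<partial>N)) + flux_const * c * \<bar>G (s n) - G t\<bar>) \<longlonglongrightarrow> 0" by simp
    have "(\<lambda>n. (\<integral>q. kernel (s n) \<xi> (fst q) x (snd q) \<partial>N) - (\<integral>q. kernel t \<xi> (fst q) x (snd q) \<partial>N)) \<longlonglongrightarrow> 0"
      by (rule Lim_null_comparison[OF _ z]) (use est in auto)
    then show "(\<lambda>n. \<integral>q. kernel (s n) \<xi> (fst q) x (snd q) \<partial>N) \<longlonglongrightarrow> (\<integral>q. kernel t \<xi> (fst q) x (snd q) \<partial>N)"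
      by (simp add: LIM_zero_iff)
  qed
  \<comment> \<open>The kernel sees time only through \<open>clamp\<close>, which extends continuity
    from [0,T] to the line.\<close>
  have "continuous_on UNIV (\<lambda>t. \<integral>q. kernel (clamp T t) \<xi> (fst q) x (snd q) \<partial>N)"
    by (rule continuous_on_compose2[OF c]) (use clamp_T in \<open>auto intro!: continuous_intros\<close>)
  moreover have "kernel (clamp T t) a b x y = kernel t a b x y" for t a b y
    using clamp(2)[OF clamp_T] by (simp add: kernel_def along_def weight_def)
  ultimately show ?thesis by simp
qed

text \<open>The flux is Lipschitz in its first two arguments with a constant proportional to |V|, so
  the bound \<open>C\<^sub>V\<close> on the square integral of V enters through its square
  root.\<close>

lemma kernel_mean_field: "mean_field \<mu> kernel kernel_lip (flux_const * weight_sup * sqrt C\<^sub>V)"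
proof (rule mean_field.intro)
  have U: "(\<lambda>w. along r (fst w) (fst (snd w)) (snd (snd w))) \<in> borel_measurable borel"
    using along_measurable[OF r_cont] by (simp add: case_prod_beta')
  have W: "(\<lambda>w. weight (fst w) (fst (snd w)) (snd (snd w))) \<in> borel_measurable borel"
    using weight_measurable by (simp add: case_prod_beta')
  have pr: "(\<lambda>w::real \<times> real \<times> real \<times> 'a \<times> 'a. (fst w, fst (snd (snd (snd w))), snd (snd (snd (snd w))))) \<in> borel_measurable borel"
    by measurable
  have "(\<lambda>w::real \<times> real \<times> real \<times> 'a \<times> 'a. (fst (snd w), fst (snd (snd w)), along r (fst w) (fst (snd (snd (snd w)))) (snd (snd (snd (snd w)))))) \<in> borel_measurable borel"
    using measurable_compose[OF pr U] by (intro borel_measurable_Pair) auto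
  from measurable_compose[OF this flux_facts(6)] measurable_compose[OF pr W]
  show "(\<lambda>(t, \<xi>, \<zeta>, x, y). kernel t \<xi> \<zeta> x y) \<in> borel_measurable borel"
    by (simp add: kernel_def case_prod_beta')
  show "(\<lambda>(t, x, y). kernel_lip t x y) \<in> borel_measurable borel"
    using U by (simp add: kernel_lip_def case_prod_beta')
  show "kernel_lip t x y \<ge> 0" for t x y using flux_facts(1) weight_sup(1) by (simp add: kernel_lip_def)
  show "flux_const * weight_sup * sqrt C\<^sub>V > 0" using flux_facts(1) weight_sup(1) C\<^sub>V_pos by simp
  show "(\<integral>\<^sup>+y. ennreal ((kernel_lip t x y)\<^sup>2) \<partial>\<mu>) \<le> ennreal ((flux_const * weight_sup * sqrt C\<^sub>V)\<^sup>2)" for t x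
  proof -
    let ?c = "(flux_const * weight_sup)\<^sup>2"
    have "(\<integral>\<^sup>+y. ennreal ((kernel_lip t x y)\<^sup>2) \<partial>\<mu>) = (\<integral>\<^sup>+y. ennreal ?c * ennreal ((along r t x y)\<^sup>2) \<partial>\<mu>)"
      by (intro nn_integral_cong) (simp add: kernel_lip_def power_mult_distrib flip: ennreal_mult)
    also have "\<dots> = ennreal ?c * (\<integral>\<^sup>+y. ennreal ((along r t x y)\<^sup>2) \<partial>\<mu>)"
      using along_section_measurable[OF r_cont, of t x] sets_\<mu> by (intro nn_integral_cmult) (simp cong: measurable_cong_sets)
    also have "\<dots> \<le> ennreal ?c * ennreal C\<^sub>V" by (intro mult_left_mono along_bound r_cont) simp
    also have "\<dots> = ennreal ((flux_const * weight_sup * sqrt C\<^sub>V)\<^sup>2)"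
      using C\<^sub>V_pos by (simp add: power_mult_distrib flip: ennreal_mult)
    finally show ?thesis .
  qed
  show "\<bar>kernel t a b x y - kernel t c d x y\<bar> \<le> kernel_lip t x y * (\<bar>a - c\<bar> + \<bar>b - d\<bar>)" for t a b c d x y
  proof -
    have "kernel t a b x y - kernel t c d x y = (\<Phi> a b (along r t x y) - \<Phi> c d (along r t x y)) * weight t x y"
      by (simp add: kernel_def left_diff_distrib)
    also have "\<bar>\<dots>\<bar> \<le> (flux_const * (\<bar>a - c\<bar> + \<bar>b - d\<bar>) * \<bar>along r t x y\<bar>) * weight_sup"
      unfolding abs_mult using flux_facts(1,3) weight_sup by (intro mult_mono) auto
    finally show ?thesis by (simp add: kernel_lip_def mult_ac)
  qed
  show "kernel t 0 0 x y = 0" for t x y by (simp add: kernel_def flux_facts(4))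
qed (fact prob_\<mu> sets_\<mu> moment_\<mu> | rule kernel_time_continuous, assumption)+

sublocale mean_field \<mu> kernel kernel_lip "flux_const * weight_sup * sqrt C\<^sub>V"
  by (rule kernel_mean_field)

lemma kernel_eq:
  assumes t: "t \<in> {0..T}"
  shows "indicator (UNIV \<times> - {x}) q *\<^sub>R (\<Phi> \<xi> (fst q) (V t (r t) (x, snd q)) * \<eta> t (x, snd q)) = kernel t \<xi> (fst q) x (snd q)"
  using clamp(2)[OF t] by (cases q) (auto simp: kernel_def along_def weight_def indicator_def)

lemma graph_velocity_eq:
  assumes t: "t \<in> {0..T}" shows "graph_velocity \<Phi> V \<sigma> r \<eta> t \<xi> x = vel (\<sigma> t) t \<xi> x"
  unfolding graph_velocity_def vel_def set_lebesgue_integral_def kernel_eq[OF t] ..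

text \<open>The \<xi>-derivative of the test function does not depend on the inner variable, so the
  inner integral is this factor times the velocity with reversed sign.\<close>

lemma graph_CE_eq: "graph_CE_solution T \<Phi> V r \<eta> \<nu> \<sigma> \<longleftrightarrow> CE_solution T \<nu> \<sigma>"
proof -
  have e: "(LINT q:UNIV \<times> - {snd p}|\<sigma> t. d * \<Phi> (fst p) (fst q) (V t (r t) (snd p, snd q)) * \<eta> t (snd p, snd q)) = - (d * vel (\<sigma> t) t (fst p) (snd p))"
    if t: "t \<in> {0..T}" for t p d
  proof -
    have "(LINT q:UNIV \<times> - {snd p}|\<sigma> t. d * \<Phi> (fst p) (fst q) (V t (r t) (snd p, snd q)) * \<eta> t (snd p, snd q)) =
       (\<integral>q. d * (indicator (UNIV \<times> - {snd p}) q *\<^sub>R (\<Phi> (fst p) (fst q) (V t (r t) (snd p, snd q)) * \<eta> t (snd p, snd q))) \<partial>\<sigma> t)"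
      unfolding set_lebesgue_integral_def by (intro Bochner_Integration.integral_cong) (auto simp: mult_ac)
    then show ?thesis unfolding kernel_eq[OF t] vel_def by simp
  qed
  have "(LINT t:{0..T}|lborel. LINT p|\<sigma> t. (LINT q:UNIV \<times> - {snd p}|\<sigma> t.
             blinfun_apply (\<phi>' (t, p)) (0, 1, 0) *
             \<Phi> (fst p) (fst q) (V t (r t) (snd p, snd q)) * \<eta> t (snd p, snd q))) =
     - (LINT t:{0..T}|lborel. LINT p|\<sigma> t. blinfun_apply (\<phi>' (t, p)) (0, 1, 0) * vel (\<sigma> t) t (fst p) (snd p))"
    for \<phi>' :: "real \<times> real \<times> 'a \<Rightarrow> (real \<times> real \<times> 'a) \<Rightarrow>\<^sub>L real"
  proof -
    have "(LINT t:{0..T}|lborel. LINT p|\<sigma> t. (LINT q:UNIV \<times> - {snd p}|\<sigma> t.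
             blinfun_apply (\<phi>' (t, p)) (0, 1, 0) *
             \<Phi> (fst p) (fst q) (V t (r t) (snd p, snd q)) * \<eta> t (snd p, snd q))) =
       (LINT t:{0..T}|lborel. - (LINT p|\<sigma> t. blinfun_apply (\<phi>' (t, p)) (0, 1, 0) * vel (\<sigma> t) t (fst p) (snd p)))"
      by (rule set_lebesgue_integral_cong) (auto simp: e)
    then show ?thesis by (simp add: set_lebesgue_integral_def)
  qed
  then show ?thesis unfolding graph_CE_solution_def CE_solution_def by simp
qed

theorem graph_CE_well_posed:
  assumes \<nu>: "\<nu> \<in> P2 \<mu>" and \<nu>x: "is_disintegration \<mu> \<nu> \<nu>x"
  shows "\<exists>\<sigma>. cont_curve T (P2 \<mu>) (L2d2 \<mu>) \<sigma> \<and> graph_CE_solution T \<Phi> V r \<eta> \<nu> \<sigma> \<and>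
           (\<forall>\<sigma>'. cont_curve T (P2 \<mu>) (L2d2 \<mu>) \<sigma>' \<and> graph_CE_solution T \<Phi> V r \<eta> \<nu> \<sigma>' \<longrightarrow>
              (\<forall>t\<in>{0..T}. \<sigma>' t = \<sigma> t)) \<and>
           (\<exists>f \<sigma>x. (\<forall>t\<in>{0..T}. is_disintegration \<mu> (\<sigma> t) (\<sigma>x t)) \<and>
              (AE x in \<mu>. is_flow_map T (\<lambda>t \<xi>. graph_velocity \<Phi> V \<sigma> r \<eta> t \<xi> x) (f x) \<and>
                 (\<forall>t\<in>{0..T}. \<sigma>x t x = distr (\<nu>x x) borel (f x t))))"
proof -
  let ?C = "flux_const * weight_sup * sqrt C\<^sub>V"
  obtain \<sigma> f K where fl: "mean_field_flow \<mu> kernel kernel_lip ?C T \<nu> \<sigma> f K"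
    using exists_flow[OF \<nu> T_pos] by blast
  interpret F: mean_field_flow \<mu> kernel kernel_lip ?C T \<nu> \<sigma> f K by (rule fl)
  have uniq: "\<sigma>' t = \<sigma> t" if \<sigma>': "cont_curve T (P2 \<mu>) (L2d2 \<mu>) \<sigma>'" "graph_CE_solution T \<Phi> V r \<eta> \<nu> \<sigma>'" and t: "t \<in> {0..T}" for \<sigma>' t
  proof -
    interpret S: mean_field_solution \<mu> kernel kernel_lip ?C T \<nu> \<sigma>'
      by unfold_locales (use \<sigma>' T_pos in \<open>auto simp: graph_CE_eq\<close>)
    interpret U: mean_field_uniqueness \<mu> kernel kernel_lip ?C T \<nu> \<sigma> f K \<sigma>' ..
    show ?thesis by (rule U.curves_agree[OF t])
  qed
  have flow: "is_flow_map T (\<lambda>t \<xi>. graph_velocity \<Phi> V \<sigma> r \<eta> t \<xi> x) (\<lambda>t u. f (t, u, x))" for x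
    unfolding is_flow_map_def ode_solution_def
    using F.f_0 F.f_deriv F.flow_unique graph_velocity_eq by auto
  \<comment> \<open>The flow moves any disintegration of \<open>\<nu>\<close> to one of
    \<open>\<sigma> t\<close>, so the representation holds for the given \<open>\<nu>x\<close>,
    whichever version it is.\<close>
  have dis: "is_disintegration \<mu> (\<sigma> t) (\<lambda>x. distr (\<nu>x x) borel (\<lambda>u. f (t, u, x)))" for t
    unfolding F.\<sigma>_push by (rule disintegration_push[OF \<nu>x P2D(2)[OF \<nu>] F.f_section])
  show ?thesis
  proof (intro exI[of _ \<sigma>] conjI)
    show "cont_curve T (P2 \<mu>) (L2d2 \<mu>) \<sigma>" by (rule F.\<sigma>_cont)
    show "graph_CE_solution T \<Phi> V r \<eta> \<nu> \<sigma>" unfolding graph_CE_eq by (rule F.flow_CE_solution)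
    show "\<forall>\<sigma>'. cont_curve T (P2 \<mu>) (L2d2 \<mu>) \<sigma>' \<and> graph_CE_solution T \<Phi> V r \<eta> \<nu> \<sigma>' \<longrightarrow> (\<forall>t\<in>{0..T}. \<sigma>' t = \<sigma> t)"
      using uniq by blast
    show "\<exists>f \<sigma>x. (\<forall>t\<in>{0..T}. is_disintegration \<mu> (\<sigma> t) (\<sigma>x t)) \<and>
              (AE x in \<mu>. is_flow_map T (\<lambda>t \<xi>. graph_velocity \<Phi> V \<sigma> r \<eta> t \<xi> x) (f x) \<and>
                 (\<forall>t\<in>{0..T}. \<sigma>x t x = distr (\<nu>x x) borel (f x t)))"
      by (intro exI[of _ "\<lambda>x t u. f (t, u, x)"] exI[of _ "\<lambda>t x. distr (\<nu>x x) borel (\<lambda>u. f (t, u, x))"] conjI ballI dis AE_I2 flow refl)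
  qed
qed

end

theorem theorem4p1:
  fixes T :: real
    and \<mu> :: "(real ^ 'd) measure"
    and \<Phi> :: "real \<Rightarrow> real \<Rightarrow> real \<Rightarrow> real"
    and V \<omega> :: "real \<Rightarrow> (real ^ 'd \<Rightarrow> real) \<Rightarrow> (real ^ 'd) \<times> (real ^ 'd) \<Rightarrow> real"
    and r\<^sub>0 :: "real ^ 'd \<Rightarrow> real"
    and \<eta>\<^sub>0 :: "(real ^ 'd) \<times> (real ^ 'd) \<Rightarrow> real"
    and r :: "real \<Rightarrow> real ^ 'd \<Rightarrow> real"
    and \<eta> :: "real \<Rightarrow> (real ^ 'd) \<times> (real ^ 'd) \<Rightarrow> real"
    and C\<^sub>V L\<^sub>V :: real
    and \<nu> :: "(real \<times> (real ^ 'd)) measure"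
    and \<nu>x :: "real ^ 'd \<Rightarrow> real measure"
  assumes "T > 0"
    and "prob_space \<mu>" "sets \<mu> = sets borel" "integrable \<mu> (\<lambda>x. (norm x)\<^sup>2)"
    and "admissible_flux \<Phi>" "jointly_antisymmetric \<Phi>"
    and "r\<^sub>0 \<in> L2 \<mu>" "\<eta>\<^sub>0 \<in> Cb_offdiag" "symmetric_offdiag \<eta>\<^sub>0"
    and "weight_source T \<mu> \<omega>"
    and "velocity_field T \<mu> V"
    and "\<forall>g\<in>L2 \<mu>. \<forall>p\<in>offdiag. continuous_on {0..T} (\<lambda>t. V t g p)"
    and "C\<^sub>V > 0" "L\<^sub>V > 0"
    and "(SUP t\<in>{0..T}. SUP g\<in>L2 \<mu>. SUP x. \<integral>\<^sup>+x'\<in>- {x}. ennreal (\<bar>V t g (x, x')\<bar>\<^sup>2) \<partial>\<mu>) \<le> ennreal C\<^sub>V"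
    and "\<forall>t\<in>{0..T}. \<forall>g\<in>L2 \<mu>. \<forall>h\<in>L2 \<mu>.
           (SUP x. \<integral>\<^sup>+x'\<in>- {x}. ennreal (\<bar>V t g (x, x') - V t h (x, x')\<bar>\<^sup>2) \<partial>\<mu>)
             \<le> ennreal (L\<^sub>V * (L2_dist \<mu> g h)\<^sup>2)"
    and "co_NCL_solution T \<mu> \<Phi> V \<omega> r\<^sub>0 \<eta>\<^sub>0 r \<eta>"
    and "\<nu> \<in> P2 \<mu>" "is_disintegration \<mu> \<nu> \<nu>x"
  shows "\<exists>\<sigma>. cont_curve T (P2 \<mu>) (L2d2 \<mu>) \<sigma> \<and> graph_CE_solution T \<Phi> V r \<eta> \<nu> \<sigma> \<and>
           (\<forall>\<sigma>'. cont_curve T (P2 \<mu>) (L2d2 \<mu>) \<sigma>' \<and> graph_CE_solution T \<Phi> V r \<eta> \<nu> \<sigma>' \<longrightarrow>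
              (\<forall>t\<in>{0..T}. \<sigma>' t = \<sigma> t)) \<and>
           (\<exists>f \<sigma>x. (\<forall>t\<in>{0..T}. is_disintegration \<mu> (\<sigma> t) (\<sigma>x t)) \<and>
              (AE x in \<mu>. is_flow_map T (\<lambda>t \<xi>. graph_velocity \<Phi> V \<sigma> r \<eta> t \<xi> x) (f x) \<and>
                 (\<forall>t\<in>{0..T}. \<sigma>x t x = distr (\<nu>x x) borel (f x t))))"
proof -
  interpret graph_setting T \<mu> \<Phi> V r \<eta> C\<^sub>V L\<^sub>V
  proof (rule graph_setting.intro)
    show "ac_curve T (L2 \<mu>) (L2_dist \<mu>) r" "ac_curve T Cb_offdiag Cb_dist \<eta>"
      using assms(17) unfolding co_NCL_solution_def by blast+
  qed (fact assms)+
  show ?thesis by (rule graph_CE_well_posed[OF assms(18,19)])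
qed

end
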